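(* Assume that $\min_{i\ne j}a_{i,j}>0$. Let $(\mathcal{T}_m,\mathcal{E}_m,(x_K)_{K\in\mathcal{T}_m})_{m\ge1}$ be a sequence of admissible meshes of $\Omega$, with time discretizations $0=t_{0,m}<\dots<t_{N_{T,m},m}=T$ of $(0,T)$, such that $h_{\mathcal{T}_m}\to0$ and $h_{T,m}\to0$ as $m\to\infty$ while $\zeta_{\mathcal{T}_m}\ge\zeta^\star$ for all $m$, for some constant $\zeta^\star>0$. Let $U^0\in L^\infty(\Omega;\mathcal{A})$ satisfy $\int_\Omega u_i^0\,dx>0$ for all $i$. For each $m$, let $\boldsymbol{U}_m=(u_{i,K}^n)_{1\le i\le N,K\in\mathcal{T}_m,1\le n\le N_{T,m}}$ be a solution, with $\boldsymbol{U}_m^n\in\mathcal{A}^{\mathcal{T}_m}$ for all $n$, of the finite volume scheme on this discretization with initial data given by the cell averages of $U^0$, and let $U_{\mathcal{T}_m,\boldsymbol{\Delta t}_m}:Q_T\to\mathcal{A}$ be the corresponding piecewise constant approximate solution. Then there exists at least one $U\in L^\infty(Q_T;\mathcal{A})\cap L^2((0,T);H^1(\Omega))^N$ such that, up to a subsequence, $$U_{\mathcal{T}_m,\boldsymbol{\Delta t}_m}\underset{m\to\infty}{\longrightarrow}U\quad\text{strongly in }L^p(Q_T)^N\text{ for any }1\le p<\infty.$$ Moreover, $U$ is a weak solution of the cross-diffusion system corresponding to the initial profile $U^0$.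
   Context: Data. $\Omega\subset\mathbb{R}^d$ is a nonempty connected bounded open set, $T>0$, $Q_T=(0,T)\times\Omega$, $N\ge2$ is the number of species, and $A=(a_{i,j})_{1\le i,j\le N}$ is a real symmetric matrix with $a_{i,j}\ge 0$. $\mathcal{A}=\{(u_1,\dots,u_N)\in\mathbb{R}_+^N : \sum_{i=1}^N u_i=1\}$ with $\mathbb{R}_+=[0,\infty)$; $L^\infty(X;\mathcal{A})$ denotes measurable functions on $X$ with values in $\mathcal{A}$. Weak solution. A weak solution of the system $\partial_tu_i-\operatorname{div}\big(\sum_{j=1}^Na_{i,j}(u_j\nabla u_i-u_i\nabla u_j)\big)=0$ in $Q_T$ with no-flux boundary conditions, corresponding to $U^0\in L^\infty(\Omega;\mathcal{A})$, is $U=(u_1,\dots,u_N)\in L^\infty(Q_T;\mathcal{A})\cap L^2([0,T];H^1(\Omega))^N$ such that for all $i\in\{1,\dots,N\}$ and all $\varphi\in C_c^\infty([0,T)\times\overline\Omega)$, $$-\iint_{Q_T}u_i\partial_t\varphi\,dx\,dt-\int_\Omega u_i^0\varphi(0,\cdot)\,dx+\iint_{Q_T}\sum_{j=1}^Na_{i,j}(u_j\nabla u_i-u_i\nabla u_j)\cdot\nabla\varphi\,dx\,dt=0.$$ Admissible mesh of $\Omega$. A triplet $(\mathcal{T},\mathcal{E},(x_K)_{K\in\mathcal{T}})$ with $\mathcal{T},\mathcal{E}$ finite such that: (i) each control volume (cell) $K\in\mathcal{T}$ is a non-empty, open, polyhedral, convex subset of $\Omega$, distinct cells are disjoint, and $\bigcup_{K}\overline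 K=\overline\Omega$; (ii) each face $\sigma\in\mathcal{E}$ is closed, contained in a hyperplane of $\mathbb{R}^d$, with $(d-1)$-dimensional Hausdorff measure $m_\sigma>0$; distinct faces intersect in a set of zero $(d-1)$-dimensional Hausdorff measure; for each $K$ there is $\mathcal{E}_K\subset\mathcal{E}$ with $\partial K=\bigcup_{\sigma\in\mathcal{E}_K}\sigma$, and $\bigcup_K\mathcal{E}_K=\mathcal{E}$; for distinct $K,L$, $\overline K\cap\overline L$ is either a single face of $\mathcal{E}$, denoted $K|L$, or has zero $(d-1)$-dimensional Hausdorff measure; (iii) $x_K\in K$, and if $K,L$ share a face $K|L$ then $x_L-x_K$ is orthogonal to $K|L$; (iv) for $\sigma\in\mathcal{E}_K$ with $\sigma\subset\partial\Omega$ there is $x_\sigma\in\sigma$ with $x_\sigma-x_K$ orthogonal to $\sigma$. $m_K$ is the Lebesgue measure of $K$; $\mathcal{E}_{\rm int}$ is the set of faces of the form $K|L$, $\mathcal{E}_{\rm ext}$ the set of faces contained in $\partial\Omega$. $d_\sigma=|x_K-x_L|$ if $\sigma=K|L\in\mathcal{E}_{\rm int}$, $d_\sigma=|x_K-x_\sigma|$ if $\sigma\in\mathcal{E}_{\rm ext}\cap\mathcal{E}_K$, and $\tau_\sigma=m_\sigma/d_\sigma$. Mesh size and regularity: $h_{\mathcal{T}}=\max_K\operatorname{diam}(K)$, $\zeta_{\mathcal{T}}=\min_{K\in\mathcal{T}}\min_{\sigma\in\mathcal{E}_K}\frac{d(x_K,\sigma)}{d_\sigma}$, where $d(x_K,\sigma)$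 is the distance from $x_K$ to $\sigma$. For a time discretization $0=t_0<\dots<t_{N_T}=T$: $\Delta t_n=t_n-t_{n-1}$, $\boldsymbol{\Delta t}=(\Delta t_n)_n$, $h_T=\max_n\Delta t_n$. Discrete notation. $\boldsymbol{U}=(u_{i,K})_{1\le i\le N,K\in\mathcal{T}}$, $\boldsymbol{u}_i=(u_{i,K})_{K}$; $\boldsymbol{U}\in\mathcal{A}^{\mathcal{T}}$ means $(u_{1,K},\dots,u_{N,K})\in\mathcal{A}$ for all $K$. For $\boldsymbol{c}\in\mathbb{R}^{\mathcal{T}}$ and $\sigma\in\mathcal{E}_K$: $c_{K\sigma}=c_L$ if $\sigma=K|L\in\mathcal{E}_{\rm int}$, $c_{K\sigma}=c_K$ if $\sigma\in\mathcal{E}_{\rm ext}$, and $D_{K\sigma}\boldsymbol{c}=c_{K\sigma}-c_K$. Scheme. Fix a parameter $a^\star$ (independent of $m$) with $a^\star>0$ and $a^\star\ge\min_{(i,j)}a_{i,j}$. Initialization: $u_{i,K}^0=\frac1{m_K}\int_Ku_i^0(x)\,dx$. For $n=1,\dots,N_T$, given $\boldsymbol{U}^{n-1}$, $\boldsymbol{U}^n$ solves, for all $K\in\mathcal{T}$ and $i\in\{1,\dots,N\}$, $$m_K\frac{u_{i,K}^n-u_{i,K}^{n-1}}{\Delta t_n}+\sum_{\sigma\in\mathcal{E}_K}F_{i,K\sigma}^n=0,$$ $$F_{i,K\sigma}^n=-a^\star\tau_\sigma D_{K\sigma}\boldsymbol{u}_i^n-\tau_\sigma\sum_{j=1}^N(a_{i,j}-a^\star)\left(u_{j,\sigma}^nD_{K\sigma}\boldsymbol{u}_i^n-u_{i,\sigma}^nD_{K\sigma}\boldsymbol{u}_j^n\right),$$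 where $u_{j,\sigma}^n=0$ if $\min(u_{j,K}^n,u_{j,K\sigma}^n)\le 0$; $u_{j,\sigma}^n=u_{j,K}^n$ if $u_{j,K}^n=u_{j,K\sigma}^n>0$; and $u_{j,\sigma}^n=\frac{u_{j,K}^n-u_{j,K\sigma}^n}{\ln u_{j,K}^n-\ln u_{j,K\sigma}^n}$ otherwise. Approximate solution. $U_{\mathcal{T},\boldsymbol{\Delta t}}(t,x)=(u_{1,K}^n,\dots,u_{N,K}^n)$ if $(t,x)\in(t_{n-1},t_n]\times K$. *)

theory Defs
  imports "HOL-Analysis.Analysis"
begin

section \<open>Smooth functions and test functions\<close>

definition partial_deriv :: "'a::euclidean_space \<Rightarrow> ('a \<Rightarrow> real) \<Rightarrow> 'a \<Rightarrow> real" where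
  "partial_deriv e f x = frechet_derivative f (at x) e"

definition gradient :: "('a::euclidean_space \<Rightarrow> real) \<Rightarrow> 'a \<Rightarrow> 'a" where
  "gradient f x = (\<Sum>e\<in>Basis. partial_deriv e f x *\<^sub>R e)"

primrec C_k :: "nat \<Rightarrow> ('a::euclidean_space \<Rightarrow> real) \<Rightarrow> bool" where
  "C_k 0 f \<longleftrightarrow> continuous_on UNIV f"
| "C_k (Suc k) f \<longleftrightarrow> (\<forall>x. f differentiable (at x)) \<and> (\<forall>e\<in>Basis. C_k k (partial_deriv e f))"

definition smooth :: "('a::euclidean_space \<Rightarrow> real) \<Rightarrow> bool" where
  "smooth f \<longleftrightarrow> (\<forall>k. C_k k f)"

text \<open>Elements of \<open>C\<^sub>c\<^sup>\<infinity>(S)\<close>, represented by smooth functions on the whole space of which only the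
  values on \<open>S\<close> matter: on \<open>S\<close> they vanish outside a compact subset of \<open>S\<close>. For
  \<open>S = [0,T) \<times> closure \<Omega>\<close> no condition is imposed at \<open>t = 0\<close> or on the boundary of \<open>\<Omega>\<close>, and for
  open \<open>S\<close> the restrictions to \<open>S\<close> are the usual test functions.\<close>

definition test_function :: "'a::euclidean_space set \<Rightarrow> ('a \<Rightarrow> real) \<Rightarrow> bool" where
  "test_function S \<phi> \<longleftrightarrow>
     smooth \<phi> \<and> (\<exists>C. compact C \<and> C \<subseteq> S \<and> (\<forall>x\<in>S - C. \<phi> x = 0))"


section \<open>Function spaces\<close>

text \<open>Elements of Lebesgue and Sobolev spaces are represented by functions on the whole type; only
  their values almost everywhere on the underlying set matter.\<close>

definition in_L2 :: "'a::euclidean_space set \<Rightarrow> ('a \<Rightarrow> 'b::euclidean_space) \<Rightarrow> bool" where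
  "in_L2 S f \<longleftrightarrow>
     f \<in> borel_measurable (lebesgue_on S) \<and> integrable (lebesgue_on S) (\<lambda>x. (norm (f x))\<^sup>2)"

definition tendsto_Lp ::
    "real \<Rightarrow> 'a::euclidean_space set \<Rightarrow> (nat \<Rightarrow> 'a \<Rightarrow> 'b::euclidean_space) \<Rightarrow> ('a \<Rightarrow> 'b) \<Rightarrow> bool" where
  "tendsto_Lp p S f g \<longleftrightarrow>
     g \<in> borel_measurable (lebesgue_on S) \<and>
     integrable (lebesgue_on S) (\<lambda>x. norm (g x) powr p) \<and>
     (\<forall>m. f m \<in> borel_measurable (lebesgue_on S) \<and>
          integrable (lebesgue_on S) (\<lambda>x. norm (f m x) powr p)) \<and>
     (\<lambda>m. (\<integral>x. norm (f m x - g x) powr p \<partial>lebesgue_on S) powr (1 / p)) \<longlonglongrightarrow> 0"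

text \<open>\<open>f \<in> H\<^sup>1(\<Omega>)\<close> with weak gradient \<open>g\<close>.\<close>

definition has_H1_gradient :: "'a::euclidean_space set \<Rightarrow> ('a \<Rightarrow> real) \<Rightarrow> ('a \<Rightarrow> 'a) \<Rightarrow> bool" where
  "has_H1_gradient \<Omega> f g \<longleftrightarrow>
     in_L2 \<Omega> f \<and> in_L2 \<Omega> g \<and>
     (\<forall>\<phi>. test_function \<Omega> \<phi> \<longrightarrow> (\<forall>e\<in>Basis.
        (\<integral>x. f x * partial_deriv e \<phi> x \<partial>lebesgue_on \<Omega>) = - (\<integral>x. (g x \<bullet> e) * \<phi> x \<partial>lebesgue_on \<Omega>)))"

text \<open>\<open>u \<in> L\<^sup>2(0,T;H\<^sup>1(\<Omega>))\<close> with spatial gradient \<open>G\<close>: for almost every \<open>t\<close> the slice \<open>u(t,\<cdot>)\<close> lies in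
  \<open>H\<^sup>1(\<Omega>)\<close> with gradient \<open>G(t,\<cdot>)\<close>, and \<open>t \<mapsto> \<parallel>u(t,\<cdot>)\<parallel>\<close> in \<open>H\<^sup>1(\<Omega>)\<close> is square integrable.
  Joint measurability of \<open>u\<close> and \<open>G\<close> expresses strong measurability of \<open>t \<mapsto> u(t,\<cdot>)\<close> in the
  separable space \<open>H\<^sup>1(\<Omega>)\<close>.\<close>

definition has_L2H1_gradient ::
    "real \<Rightarrow> 'a::euclidean_space set \<Rightarrow> (real \<times> 'a \<Rightarrow> real) \<Rightarrow> (real \<times> 'a \<Rightarrow> 'a) \<Rightarrow> bool" where
  "has_L2H1_gradient T \<Omega> u G \<longleftrightarrow>
     in_L2 ({0<..<T} \<times> \<Omega>) u \<and> in_L2 ({0<..<T} \<times> \<Omega>) G \<and>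
     (AE t in lebesgue_on {0<..<T}. has_H1_gradient \<Omega> (\<lambda>x. u (t, x)) (\<lambda>x. G (t, x)))"

definition in_L2H1 :: "real \<Rightarrow> 'a::euclidean_space set \<Rightarrow> (real \<times> 'a \<Rightarrow> real) \<Rightarrow> bool" where
  "in_L2H1 T \<Omega> u \<longleftrightarrow> (\<exists>G. has_L2H1_gradient T \<Omega> u G)"

definition unit_simplex :: "(real ^ 'n) set" where
  "unit_simplex = {u. (\<forall>i. 0 \<le> u $ i) \<and> (\<Sum>i\<in>UNIV. u $ i) = 1}"

text \<open>\<open>L\<^sup>\<infinity>(S;\<A>)\<close>, \<open>\<A>\<close> being the unit simplex (so that boundedness is automatic).\<close>

definition in_Linf_simplex :: "'a::euclidean_space set \<Rightarrow> ('a \<Rightarrow> real ^ 'n) \<Rightarrow> bool" where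
  "in_Linf_simplex S U \<longleftrightarrow>
     U \<in> borel_measurable (lebesgue_on S) \<and> (AE x in lebesgue_on S. U x \<in> unit_simplex)"


section \<open>Weak solutions of the cross-diffusion system\<close>

definition weak_solution ::
    "real \<Rightarrow> 'a::euclidean_space set \<Rightarrow> real ^ 'n ^ 'n \<Rightarrow> ('a \<Rightarrow> real ^ 'n) \<Rightarrow> (real \<times> 'a \<Rightarrow> real ^ 'n) \<Rightarrow> bool"
  where
  "weak_solution T \<Omega> A U0 U \<longleftrightarrow>
     in_Linf_simplex ({0<..<T} \<times> \<Omega>) U \<and>
     (\<exists>G :: 'n \<Rightarrow> real \<times> 'a \<Rightarrow> 'a.
        (\<forall>i. has_L2H1_gradient T \<Omega> (\<lambda>z. U z $ i) (G i)) \<and>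
        (\<forall>i \<phi>. test_function ({0..<T} \<times> closure \<Omega>) \<phi> \<longrightarrow>
           - (\<integral>(t, x). U (t, x) $ i * deriv (\<lambda>s. \<phi> (s, x)) t \<partial>lebesgue_on ({0<..<T} \<times> \<Omega>))
           - (\<integral>x. U0 x $ i * \<phi> (0, x) \<partial>lebesgue_on \<Omega>)
           + (\<integral>(t, x). (\<Sum>j\<in>UNIV. A $ i $ j *\<^sub>R
                  (U (t, x) $ j *\<^sub>R G i (t, x) - U (t, x) $ i *\<^sub>R G j (t, x)))
                \<bullet> gradient (\<lambda>y. \<phi> (t, y)) x \<partial>lebesgue_on ({0<..<T} \<times> \<Omega>)) = 0))"


section \<open>Hausdorff measure\<close>

text \<open>The normalisation is the one for which the \<open>s\<close>-dimensional Hausdorff measure agrees with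
  Lebesgue measure on \<open>s\<close>-dimensional affine subspaces; it is needed because the measures of
  faces and of cells occur together in the scheme. The empty set is treated separately since
  \<open>0 ^ 0 = 1\<close>; for \<open>s = 0\<close> this is counting measure.\<close>

definition hausdorff_content :: "nat \<Rightarrow> real \<Rightarrow> 'a::metric_space set \<Rightarrow> ennreal" where
  "hausdorff_content s \<delta> S =
     (INF C\<in>{C :: nat \<Rightarrow> 'a set. S \<subseteq> (\<Union>k. C k) \<and> (\<forall>k. bounded (C k) \<and> diameter (C k) \<le> \<delta>)}.
        \<Sum>k. if C k = {} then 0 else ennreal (unit_ball_vol (real s) * (diameter (C k) / 2) ^ s))"

definition hausdorff_measure :: "nat \<Rightarrow> 'a::metric_space set \<Rightarrow> ennreal" where
  "hausdorff_measure s S = (SUP \<delta>\<in>{0<..}. hausdorff_content s \<delta> S)"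

definition surface_measure :: "'a::euclidean_space set \<Rightarrow> ennreal" where
  "surface_measure S = hausdorff_measure (DIM('a) - 1) S"


section \<open>Admissible meshes\<close>

text \<open>The objects whose existence is required of an admissible triplet, namely the sets
  \<open>\<E>\<^sub>K\<close> (here \<open>cell_faces M K\<close>) and the points \<open>x\<^sub>\<sigma>\<close> (here \<open>face_point M \<sigma>\<close>), are carried along as
  components; for an admissible mesh they are determined by the triplet, \<open>x\<^sub>\<sigma>\<close> being the orthogonal
  projection of \<open>x\<^sub>K\<close> on the hyperplane containing \<open>\<sigma>\<close>.\<close>

record 'a mesh =
  cells :: "'a set set"
  faces :: "'a set set"
  center :: "'a set \<Rightarrow> 'a"
  cell_faces :: "'a set \<Rightarrow> 'a set set"
  face_point :: "'a set \<Rightarrow> 'a"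

definition orthogonal_to_face :: "'a::euclidean_space \<Rightarrow> 'a set \<Rightarrow> bool" where
  "orthogonal_to_face v \<sigma> \<longleftrightarrow> (\<forall>y\<in>\<sigma>. \<forall>z\<in>\<sigma>. orthogonal v (y - z))"

definition admissible_mesh :: "'a::euclidean_space set \<Rightarrow> 'a mesh \<Rightarrow> bool" where
  "admissible_mesh \<Omega> M \<longleftrightarrow>
     finite (cells M) \<and> finite (faces M) \<and>
     (\<forall>K\<in>cells M. K \<noteq> {} \<and> open K \<and> convex K \<and> polyhedron (closure K) \<and> K \<subseteq> \<Omega>) \<and>
     (\<forall>K\<in>cells M. \<forall>L\<in>cells M. K \<noteq> L \<longrightarrow> K \<inter> L = {}) \<and>
     (\<Union>K\<in>cells M. closure K) = closure \<Omega> \<and>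
     (\<forall>\<sigma>\<in>faces M. closed \<sigma> \<and> (\<exists>a b. a \<noteq> 0 \<and> \<sigma> \<subseteq> {x. a \<bullet> x = b}) \<and> surface_measure \<sigma> > 0) \<and>
     (\<forall>\<sigma>\<in>faces M. \<forall>\<tau>\<in>faces M. \<sigma> \<noteq> \<tau> \<longrightarrow> surface_measure (\<sigma> \<inter> \<tau>) = 0) \<and>
     (\<forall>K\<in>cells M. cell_faces M K \<subseteq> faces M \<and> frontier K = \<Union> (cell_faces M K)) \<and>
     (\<Union>K\<in>cells M. cell_faces M K) = faces M \<and>
     (\<forall>K\<in>cells M. \<forall>L\<in>cells M. K \<noteq> L \<longrightarrow>
        closure K \<inter> closure L \<in> faces M \<or> surface_measure (closure K \<inter> closure L) = 0) \<and>
     (\<forall>K\<in>cells M. center M K \<in> K) \<and>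
     (\<forall>K\<in>cells M. \<forall>L\<in>cells M. K \<noteq> L \<and> closure K \<inter> closure L \<in> faces M \<longrightarrow>
        orthogonal_to_face (center M L - center M K) (closure K \<inter> closure L)) \<and>
     (\<forall>K\<in>cells M. \<forall>\<sigma>\<in>cell_faces M K. \<sigma> \<subseteq> frontier \<Omega> \<longrightarrow>
        face_point M \<sigma> \<in> \<sigma> \<and> orthogonal_to_face (face_point M \<sigma> - center M K) \<sigma>)"

definition interior_faces :: "'a::euclidean_space mesh \<Rightarrow> 'a set set" where
  "interior_faces M =
     {\<sigma>\<in>faces M. \<exists>K\<in>cells M. \<exists>L\<in>cells M. K \<noteq> L \<and> \<sigma> = closure K \<inter> closure L}"

text \<open>The cell \<open>L\<close> with \<open>\<sigma> = K|L\<close>; only meaningful for interior faces \<open>\<sigma>\<close> of \<open>K\<close>.\<close>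

definition neighbour :: "'a::euclidean_space mesh \<Rightarrow> 'a set \<Rightarrow> 'a set \<Rightarrow> 'a set" where
  "neighbour M K \<sigma> = (THE L. L \<in> cells M \<and> L \<noteq> K \<and> closure K \<inter> closure L = \<sigma>)"

text \<open>\<open>d\<^sub>\<sigma>\<close>, for a face \<open>\<sigma>\<close> of the cell \<open>K\<close>. Faces that are not of the form \<open>K|L\<close> are the exterior
  ones. If a face \<open>K|L\<close> happens to be contained in the boundary of \<open>\<Omega>\<close> (possible when \<open>\<Omega>\<close> lies
  on both sides of its boundary), it is treated as an interior face.\<close>

definition face_dist :: "'a::euclidean_space mesh \<Rightarrow> 'a set \<Rightarrow> 'a set \<Rightarrow> real" where
  "face_dist M K \<sigma> =
     (if \<sigma> \<in> interior_faces M then dist (center M K) (center M (neighbour M K \<sigma>))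
      else dist (center M K) (face_point M \<sigma>))"

definition transmissivity :: "'a::euclidean_space mesh \<Rightarrow> 'a set \<Rightarrow> 'a set \<Rightarrow> real" where
  "transmissivity M K \<sigma> = enn2real (surface_measure \<sigma>) / face_dist M K \<sigma>"

definition mesh_size :: "'a::euclidean_space mesh \<Rightarrow> real" where
  "mesh_size M = Max (diameter ` cells M)"

definition mesh_regularity :: "'a::euclidean_space mesh \<Rightarrow> real" where
  "mesh_regularity M =
     Min ((\<lambda>K. Min ((\<lambda>\<sigma>. infdist (center M K) \<sigma> / face_dist M K \<sigma>) ` cell_faces M K)) ` cells M)"

definition time_discretization :: "real \<Rightarrow> nat \<Rightarrow> (nat \<Rightarrow> real) \<Rightarrow> bool" where
  "time_discretization T NT t \<longleftrightarrow> t 0 = 0 \<and> t NT = T \<and> (\<forall>n<NT. t n < t (Suc n))"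

definition time_step :: "nat \<Rightarrow> (nat \<Rightarrow> real) \<Rightarrow> real" where
  "time_step NT t = Max ((\<lambda>n. t n - t (n - 1)) ` {1..NT})"


section \<open>The finite volume scheme\<close>

text \<open>\<open>c\<^sub>K\<^sub>\<sigma>\<close> for a discrete function \<open>c\<close> on the cells.\<close>

definition mirror_value :: "'a::euclidean_space mesh \<Rightarrow> ('a set \<Rightarrow> real) \<Rightarrow> 'a set \<Rightarrow> 'a set \<Rightarrow> real" where
  "mirror_value M c K \<sigma> = (if \<sigma> \<in> interior_faces M then c (neighbour M K \<sigma>) else c K)"

definition face_jump :: "'a::euclidean_space mesh \<Rightarrow> ('a set \<Rightarrow> real) \<Rightarrow> 'a set \<Rightarrow> 'a set \<Rightarrow> real" where
  "face_jump M c K \<sigma> = mirror_value M c K \<sigma> - c K"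

definition log_mean :: "real \<Rightarrow> real \<Rightarrow> real" where
  "log_mean a b = (if min a b \<le> 0 then 0 else if a = b then a else (a - b) / (ln a - ln b))"

definition face_value :: "'a::euclidean_space mesh \<Rightarrow> ('a set \<Rightarrow> real) \<Rightarrow> 'a set \<Rightarrow> 'a set \<Rightarrow> real" where
  "face_value M c K \<sigma> = log_mean (c K) (mirror_value M c K \<sigma>)"

definition flux ::
    "'a::euclidean_space mesh \<Rightarrow> real ^ 'n ^ 'n \<Rightarrow> real \<Rightarrow> ('a set \<Rightarrow> real ^ 'n) \<Rightarrow> 'n \<Rightarrow> 'a set \<Rightarrow> 'a set \<Rightarrow> real"
  where
  "flux M A astar V i K \<sigma> =
     (let u = (\<lambda>j L. V L $ j) in
      - astar * transmissivity M K \<sigma> * face_jump M (u i) K \<sigma>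
      - transmissivity M K \<sigma> * (\<Sum>j\<in>UNIV. (A $ i $ j - astar) *
           (face_value M (u j) K \<sigma> * face_jump M (u i) K \<sigma>
            - face_value M (u i) K \<sigma> * face_jump M (u j) K \<sigma>)))"

text \<open>\<open>V n K $ i\<close> is the unknown \<open>u\<^sub>i\<^sub>,\<^sub>K\<close> at time step \<open>n\<close>; the values for \<open>n = 0\<close> are those of the
  initialization.\<close>

definition scheme_solution ::
    "'a::euclidean_space mesh \<Rightarrow> nat \<Rightarrow> (nat \<Rightarrow> real) \<Rightarrow> real ^ 'n ^ 'n \<Rightarrow> real \<Rightarrow> ('a \<Rightarrow> real ^ 'n)
      \<Rightarrow> (nat \<Rightarrow> 'a set \<Rightarrow> real ^ 'n) \<Rightarrow> bool" where
  "scheme_solution M NT t A astar U0 V \<longleftrightarrow>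
     (\<forall>K\<in>cells M. \<forall>i. V 0 K $ i = (1 / measure lebesgue K) * (\<integral>x. U0 x $ i \<partial>lebesgue_on K)) \<and>
     (\<forall>n\<in>{1..NT}. \<forall>K\<in>cells M. \<forall>i.
        measure lebesgue K * ((V n K $ i - V (n - 1) K $ i) / (t n - t (n - 1)))
        + (\<Sum>\<sigma>\<in>cell_faces M K. flux M A astar (V n) i K \<sigma>) = 0)"

text \<open>The piecewise constant function equal to \<open>V n K\<close> on \<open>(t\<^sub>n\<^sub>-\<^sub>1, t\<^sub>n] \<times> K\<close>, extended by zero to the
  null set of points lying in no cell.\<close>

definition approximate_solution ::
    "'a::euclidean_space mesh \<Rightarrow> nat \<Rightarrow> (nat \<Rightarrow> real) \<Rightarrow> (nat \<Rightarrow> 'a set \<Rightarrow> real ^ 'n) \<Rightarrow> real \<times> 'a \<Rightarrow> real ^ 'n"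
  where
  "approximate_solution M NT t V z =
     (\<Sum>n\<in>{1..NT}. \<Sum>K\<in>cells M. indicator ({t (n - 1)<..t n} \<times> K) z *\<^sub>R V n K)"

end

theory Submission
  imports Defs "HOL-Complex_Analysis.Great_Picard" "HOL-Library.Diagonal_Subsequence"
begin

text \<open>The logarithmic mean is chosen so that the discrete chain rule turns the scheme tested with
  \<open>ln u\<^sub>i\<close> into an entropy inequality, which controls the discrete \<open>L\<^sup>2(H\<^sup>1)\<close> norm of
  the approximate solutions; no positivity is needed, since a zero of \<open>u\<^sub>i\<close> in one cell propagates to the
  neighbouring cells and to the previous time, and \<open>ln 0 = 0\<close>. Cutting a translation into infinitesimal ones
  bounds space translates in \<open>L\<^sup>1\<close>, and the scheme bounds time translates, so Kolmogorov's criterion gives a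
  limit \<open>U\<close>. Discrete gradients, weighted in each cell by the distances of its centre to the faces, are bounded
  in \<open>L\<^sup>2\<close>; instead of weak limits, convex combinations of their tails converge strongly. Both the discrete
  gradients and the fluxes are consistent up to errors of the order of the mesh size and the time step, which
  identifies the limit as the gradient of \<open>U\<close> and gives the equation.

  The Hausdorff measure of a face enters through volumes: by the isodiametric inequality it is the Lebesgue
  measure of the face in its hyperplane, hence \<open>m\<^sub>\<sigma> |e \<bullet> \<nu>|\<close> is the volume of the
  prism over \<open>\<sigma>\<close> with edge \<open>e\<close>, that is, to first order in \<open>e\<close>, the volume of the points
  that leave the cell through \<open>\<sigma>\<close> under the translation by \<open>e\<close>.\<close>

text \<open>No divergence theorem for polyhedral cells is used. Integrals against derivatives of a
  test function are read as limits of difference quotients; the translation is moved onto the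
  piecewise constant function, and what remains is the volume of the points passing from one cell to
  another. The second geometric input is a volume too: the cones from the centre of a cell over its
  faces fit into the cell, which bounds jumps and gradients by the energy.

  The dissipation constant c is the minimum of \<open>astar\<close> and the off-diagonal
  coefficients. The logarithmic means of two states sum to some W <= 1, so the scheme interpolates:
  the weight 1 - W sees \<open>astar\<close>, the weight W sees the a_ij, and both are at least c.

  The flux is a product of u and gradients, and convex combinations of products are not products of
  convex combinations. Hence u is first replaced by its strong limit U, which leaves an expression
  linear in the gradients. It involves the gradients of several species, so one set of weights must
  serve them all.\<close>

notation scaleR (infixr "*R" 75) and LIMSEQ ("((_)/ ----> (_))" [60, 60] 60)

hide_fact (open) Henstock_Kurzweil_Integration.integrable_add Henstock_Kurzweil_Integration.integrable_diff
  Henstock_Kurzweil_Integration.integrable_bound Henstock_Kurzweil_Integration.integrable_sum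
  Henstock_Kurzweil_Integration.integral_add Henstock_Kurzweil_Integration.integral_cong
  Henstock_Kurzweil_Integration.integral_diff Henstock_Kurzweil_Integration.integral_nonneg
  Henstock_Kurzweil_Integration.integral_norm_bound_integral Henstock_Kurzweil_Integration.integral_sum
  Topology_Euclidean_Space.norm_nth_le

abbreviation nn_integral_lborel (binder "NBINT " 10) where "nn_integral_lborel f \<equiv> nn_integral lborel f"

abbreviation plane where "plane \<nu> b \<equiv> {x. \<nu> \<bullet> x = b}"

abbreviation below where "below \<nu> b \<equiv> {x. \<nu> \<bullet> x < b}"

abbreviation above where "above \<nu> b \<equiv> {x. \<nu> \<bullet> x > b}"

abbreviation face where "face K L \<equiv> closure K \<inter> closure L"

abbreviation sum_UNIV (binder "SU " 10) where "sum_UNIV f \<equiv> sum f UNIV"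

abbreviation vol :: "'a::euclidean_space set => real" where "vol \<equiv> measure lebesgue"

section \<open>Steiner symmetrization and the isodiametric inequality\<close>

text \<open>Fubini along an arbitrary direction i without a choice of coordinates: the average runs
  over the strip 0 <= x . i <= 1, which every line parallel to i meets in a segment of length one,
  so each line counts once.\<close>

lemma emeasure_lborel_slices:
  fixes S :: "'a::euclidean_space set"
  assumes i: "norm i = 1" and S: "S \<in> sets borel"
  shows "emeasure lborel S =
	(NBINT x. indicator {x. 0 \<le> x \<bullet> i \<and> x \<bullet> i \<le> 1} x * emeasure lborel {s. x + s *R i \<in> S})"
proof -
  have ii: "i \<bullet> i = 1" using i by (simp add: norm_eq_1)
  have [measurable]: "S \<in> sets borel" by fact
  let ?I = "\<lambda>x::'a. indicator {x. 0 \<le> x \<bullet> i \<and> x \<bullet> i \<le> 1} x :: ennreal"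
  let ?J = "\<lambda>x s. indicator S x * indicator {x \<bullet> i - 1..x \<bullet> i} s :: ennreal"
  have slice: "emeasure lborel {s. x + s *R i \<in> S} = (NBINT s. indicator S (x + s *R i))" for x
  proof -
	have "{s. x + s *R i \<in> S} \<in> sets lborel" by measurable
	hence "emeasure lborel {s. x + s *R i \<in> S} = (NBINT s. indicator {s. x + s *R i \<in> S} s)" by simp
	also have "... = (NBINT s. indicator S (x + s *R i))" by (intro nn_integral_cong) (auto simp: indicator_def)
	finally show ?thesis .
  qed
  have "(NBINT x. ?I x * emeasure lborel {s. x + s *R i \<in> S}) = (NBINT x s. ?I x * indicator S (x + s *R i))"
	unfolding slice by (intro nn_integral_cong nn_integral_cmult[symmetric]) measurable
  also have "... = (NBINT s x. ?I x * indicator S (x + s *R i))" by (rule lborel_pair.Fubini'[symmetric]) measurable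
  \<comment> \<open>For fixed s the translation of x by s i turns the strip condition into x . i - 1
    <= s <= x . i; integrated over s first, this interval contributes the factor 1.\<close>
  also have "... = (NBINT s x. ?J x s)"
  proof (rule nn_integral_cong)
	fix s :: real
	have "(NBINT x. ?J x s) = (\<integral>\<^sup>+x. ?J x s \<partial>distr lborel borel ((+) (s *R i)))" by (simp add: lborel_distr_plus)
	also have "... = (NBINT x. indicator S (s *R i + x) * indicator {(s *R i + x) \<bullet> i - 1..(s *R i + x) \<bullet> i} s)"
	proof (subst nn_integral_distr)
	  have "(\<lambda>x. indicator {x \<bullet> i - 1..x \<bullet> i} s :: ennreal)
		  = (\<lambda>x::'a. if x \<bullet> i - 1 \<le> s \<and> s \<le> x \<bullet> i then 1 else 0)" by (auto simp: indicator_def)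
	  also have "... \<in> borel_measurable borel" by measurable
	  finally have "(\<lambda>x. ?J x s) \<in> borel_measurable borel" by measurable
	  thus "(\<lambda>x. ?J x s)
		  \<in> borel_measurable (distr lborel borel ((+) (s *R i)))" by simp
	qed auto
	also have "... = (NBINT x. ?I x * indicator S (x + s *R i))"
	  by (intro nn_integral_cong) (auto simp: indicator_def inner_add_left ii add.commute)
	finally show "(NBINT x. ?I x * indicator S (x + s *R i)) = (NBINT x. ?J x s)" ..
  qed
  also have "... = (NBINT x s. ?J x s)"
  proof (rule lborel_pair.Fubini')
	have "(\<lambda>(x, s). ?J x s)
		= (\<lambda>(x::'a, s). indicator S x * (if x \<bullet> i - 1 \<le> s \<and> s \<le> x \<bullet> i then 1 else 0))"
	  by (auto simp: indicator_def)
	also have "... \<in> borel_measurable (lborel \<Otimes>\<^sub>M lborel)" by measurable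
	finally show "(\<lambda>(x, s). ?J x s) \<in> borel_measurable (lborel \<Otimes>\<^sub>M lborel)" .
  qed
  also have "... = (NBINT x. indicator S x)" by (intro nn_integral_cong) (simp add: nn_integral_cmult)
  also have "... = emeasure lborel S" by simp
  finally show ?thesis ..
qed

text \<open>The point x + (s - x . i) i is the point at height s on the line through x, so the
  measured section depends only on the line. Sections of the symmetrized set become open intervals
  centred at height 0; the strict inequality drops their end points and leaves null sections
  empty.\<close>

definition steiner :: "'a::euclidean_space => 'a set => 'a set" where
  "steiner i S = {x. ennreal (2 * abs (x \<bullet> i)) < emeasure lborel {s. x + (s - x \<bullet> i) *R i \<in> S}}"

lemma steiner_borel:
  fixes S :: "'a::euclidean_space set"
  assumes S: "S \<in> sets borel"
  shows "steiner i S \<in> sets borel"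
proof -
  have [measurable]: "S \<in> sets borel" by fact
  let ?Q = "{z::'a \<times> real. fst z + (snd z - fst z \<bullet> i) *R i \<in> S}"
  have "(\<lambda>z::'a \<times> real. fst z + (snd z - fst z \<bullet> i) *R i) \<in> borel_measurable borel"
	by (intro borel_measurable_continuous_onI continuous_intros)
  from measurable_sets[OF this S] have "?Q \<in> sets borel" by (simp add: vimage_def)
  hence "?Q \<in> sets (lborel \<Otimes>\<^sub>M lborel)" by (simp only: sets_pair_measure_cong[OF sets_lborel sets_lborel] borel_prod)
  hence "(\<lambda>x. emeasure lborel (Pair x -` ?Q)) \<in> borel_measurable lborel" by (rule lborel.measurable_emeasure_Pair)
  hence [measurable]: "(\<lambda>x. emeasure lborel {s. x + (s - x \<bullet> i) *R i \<in> S}) \<in> borel_measurable borel"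
	by (simp add: vimage_def)
  show ?thesis unfolding steiner_def by measurable
qed

lemma emeasure_line_slice_finite:
  fixes S :: "'a::euclidean_space set"
  assumes i: "norm i = 1" and "bounded S"
  shows "emeasure lborel {s. x + s *R i \<in> S} < \<infinity>"
proof -
  obtain R where R: "\<And>y. y \<in> S ==> norm y \<le> R" using `bounded S` unfolding bounded_iff by auto
  have "{s. x + s *R i \<in> S} \<subseteq> cball 0 (R + norm x)"
  proof
	fix s assume "s \<in> {s. x + s *R i \<in> S}"
	hence "norm (x + s *R i) \<le> R" using R by auto
	moreover have "norm (s *R i) \<le> norm (x + s *R i) + norm x" by (metis add.commute add_diff_cancel_left' norm_triangle_ineq4)
	ultimately show "s \<in> cball 0 (R + norm x)" using i by simp
  qed
  thus ?thesis by (intro emeasure_bounded_finite bounded_subset[OF bounded_cball])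
qed

lemma emeasure_lborel_shift:
  fixes S :: "real set" assumes [measurable]: "S \<in> sets borel"
  shows "emeasure lborel {s. s - c \<in> S} = emeasure lborel S"
proof -
  have "emeasure lborel S = emeasure (distr lborel borel ((+) (- c))) S" by (simp add: lborel_distr_plus)
  also have "... = emeasure lborel {s. s - c \<in> S}" by (subst emeasure_distr) (auto simp: vimage_def)
  finally show ?thesis ..
qed

text \<open>Every line section of the symmetrized set is an interval of the same length as the
  original section, and the slice formula is applied to both sets. Boundedness makes the lengths
  finite.\<close>

lemma emeasure_steiner:
  fixes S :: "'a::euclidean_space set"
  assumes i: "norm i = 1" and S: "S \<in> sets borel" and "bounded S"
  shows "emeasure lborel (steiner i S) = emeasure lborel S"
proof -
  have ii: "i \<bullet> i = 1" using i by (simp add: norm_eq_1)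
  have [measurable]: "S \<in> sets borel" by fact
  have "emeasure lborel {s. x + s *R i \<in> steiner i S} = emeasure lborel {s. x + s *R i \<in> S}" for x
  proof -
	let ?g = "emeasure lborel {s. x + s *R i \<in> S}"
	have eq: "emeasure lborel {r. x + s *R i + (r - (x + s *R i) \<bullet> i) *R i \<in> S} = ?g" for s
	proof -
	  have "{r. x + s *R i + (r - (x + s *R i) \<bullet> i) *R i \<in> S} = {r. r - x \<bullet> i \<in> {s. x + s *R i \<in> S}}"
		by (auto simp: inner_add_left ii algebra_simps)
	  thus ?thesis by (simp only:) (subst emeasure_lborel_shift, auto)
	qed
	obtain g where g: "?g = ennreal g" "g \<ge> 0" using emeasure_line_slice_finite[OF i `bounded S`, of x] by (cases ?g) auto
	have "{s. x + s *R i \<in> steiner i S} = {s. 2 * abs (x \<bullet> i + s) < g}"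
	  unfolding steiner_def mem_Collect_eq eq g(1) by (simp add: inner_add_left ii ennreal_less_iff)
	also have "... = {- (x \<bullet> i) - g / 2<..<- (x \<bullet> i) + g / 2}" by (auto simp: abs_if split: if_splits)
	also have "emeasure lborel ... = ennreal g" using g(2) by simp
	finally show ?thesis using g by simp
  qed
  thus ?thesis unfolding emeasure_lborel_slices[OF i S] emeasure_lborel_slices[OF i steiner_borel[OF S]] by simp
qed

text \<open>On the lines through x and y there are heights p and q in S at least as far apart as the
  heights of x and y, while the horizontal offset is unchanged. Otherwise, with c = |x . i - y . i|,
  the two sections would lie in [u - c, l + c] and [l, u], whose lengths add up to 2 c, although
  they exceed 2 |x . i| and 2 |y . i|.\<close>

lemma steiner_dist_le:
  fixes S :: "'a::euclidean_space set"
  assumes i: "norm i = 1" and S: "S \<in> sets borel"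
	and D: "\<And>x y. x \<in> S ==> y \<in> S ==> dist x y \<le> D"
	and x: "x \<in> steiner i S" and y: "y \<in> steiner i S"
  shows "dist x y \<le> D"
proof -
  have ii: "i \<bullet> i = 1" using i by (simp add: norm_eq_1)
  have [measurable]: "S \<in> sets borel" by fact
  define A where "A x = {s. x + (s - x \<bullet> i) *R i \<in> S}" for x :: 'a
  have [measurable]: "A x \<in> sets borel" for x unfolding A_def by measurable
  have "\<exists>p\<in>A x. \<exists>q\<in>A y. abs (p - q) \<ge> abs (x \<bullet> i - y \<bullet> i)"
  proof (rule ccontr)
	assume "\<not> ?thesis"
	hence lt: "\<And>p q. p \<in> A x ==> q \<in> A y ==> abs (p - q) < abs (x \<bullet> i - y \<bullet> i)" by force
	define c where "c = abs (x \<bullet> i - y \<bullet> i)"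
	have px: "ennreal (2 * abs (x \<bullet> i)) < emeasure lborel (A x)"
	  and py: "ennreal (2 * abs (y \<bullet> i)) < emeasure lborel (A y)" using x y by (auto simp: steiner_def A_def)
	hence "A x \<noteq> {}" "A y \<noteq> {}" by auto
	then obtain p0 q0 where pq: "p0 \<in> A x" "q0 \<in> A y" by auto
	have bdd: "bdd_below (A y)" "bdd_above (A y)"
	  using lt[OF pq(1)] by (auto intro!: bdd_belowI[of _ "p0 - c"] bdd_aboveI[of _ "p0 + c"] simp: c_def abs_less_iff)
	   (smt (verit))+
	define l u where "l = Inf (A y)" and "u = Sup (A y)"
	have lu: "l \<le> u" unfolding l_def u_def using bdd pq(2) by (meson cInf_lower cSup_upper order_trans)
	have "A y \<subseteq> {l..u}" unfolding l_def u_def using bdd by (auto intro: cInf_lower cSup_upper)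
	hence "emeasure lborel (A y) \<le> emeasure lborel {l..u}" by (intro emeasure_mono) auto
	hence 1: "emeasure lborel (A y) \<le> ennreal (u - l)" using lu by simp
	have "p \<in> {u - c..l + c}" if "p \<in> A x" for p
	proof -
	  have "u \<le> p + c" unfolding u_def using lt[OF that] pq by (intro cSup_least) (auto simp: c_def abs_less_iff, smt (verit))
	  moreover have "p - c \<le> l" unfolding l_def using lt[OF that] pq by (intro cInf_greatest) (auto simp: c_def abs_less_iff, smt (verit))
	  ultimately show ?thesis by auto
	qed
	hence sub: "A x \<subseteq> {u - c..l + c}" by auto
	hence le: "u - c \<le> l + c" using pq by force
	have "emeasure lborel (A x) \<le> emeasure lborel {u - c..l + c}" using sub by (intro emeasure_mono) auto
	hence 2: "emeasure lborel (A x) \<le> ennreal (l + c - (u - c))" using le by simp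
	have "2 * abs (y \<bullet> i) < u - l" using less_le_trans[OF py 1] by (subst (asm) ennreal_less_iff) auto
	moreover have "2 * abs (x \<bullet> i) < l + c - (u - c)" using less_le_trans[OF px 2] by (subst (asm) ennreal_less_iff) auto
	ultimately show False unfolding c_def by linarith
  qed
  then obtain p q where p: "p \<in> A x" and q: "q \<in> A y" and pq: "abs (x \<bullet> i - y \<bullet> i) \<le> abs (p - q)" by auto
  define x' y' where "x' = x + (p - x \<bullet> i) *R i" and "y' = y + (q - y \<bullet> i) *R i"
  have "dist x' y' \<le> D" using p q by (intro D) (auto simp: A_def x'_def y'_def)
  moreover have "(dist x y)^2 \<le> (dist x' y')^2"
  proof -
	have "x' - y' = (x - y) + (p - q - (x - y) \<bullet> i) *R i" by (simp add: x'_def y'_def algebra_simps)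
	moreover have "(norm (v + c *R i))^2 = (norm v)^2 + 2 * c * (v \<bullet> i) + c^2" for v c
	  by (simp only: power2_norm_eq_inner inner_add_left inner_add_right inner_scaleR_left inner_scaleR_right ii
		  inner_commute[of i v]) (simp add: algebra_simps power2_eq_square)
	ultimately have "(dist x' y')^2 = (norm (x - y))^2 + 2 * (p - q - (x - y) \<bullet> i) * ((x - y) \<bullet> i) + (p - q - (x - y) \<bullet> i)^2"
	  by (simp only: dist_norm)
	also have "... = (norm (x - y))^2 + ((p - q)^2 - (x \<bullet> i - y \<bullet> i)\<^sup>2)"
	  by (simp add: power2_eq_square algebra_simps inner_diff_left)
	finally show ?thesis using pq by (simp add: dist_norm abs_le_square_iff)
  qed
  hence "dist x y \<le> dist x' y'" by (simp add: power2_le_iff_abs_le)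
  ultimately show ?thesis by simp
qed

lemma steiner_symmetric_same:
  assumes i: "norm i = 1" and x: "x \<in> steiner i S"
  shows "x - (2 * (x \<bullet> i)) *R i \<in> steiner i S"
proof -
  have ii: "i \<bullet> i = 1" using i by (simp add: norm_eq_1)
  have "(x - (2 * (x \<bullet> i)) *R i) \<bullet> i = - (x \<bullet> i)" by (simp add: inner_diff_left ii)
  moreover have "x - (2 * (x \<bullet> i)) *R i + (s - - (x \<bullet> i)) *R i = x + (s - x \<bullet> i) *R i" for s
	by (simp add: algebra_simps flip: scaleR_add_left)
  ultimately show ?thesis using x unfolding steiner_def mem_Collect_eq by (simp only: abs_minus_cancel)
qed

text \<open>Reflection in j maps lines parallel to i to lines parallel to i and keeps heights, so a
  symmetry gained in an earlier direction survives the symmetrization in a later one.\<close>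

lemma steiner_symmetric_other:
  assumes ij: "i \<bullet> j = 0" and S: "\<And>x. x \<in> S ==> x - (2 * (x \<bullet> j)) *R j \<in> S" and j: "norm j = 1"
	and x: "x \<in> steiner i S"
  shows "x - (2 * (x \<bullet> j)) *R j \<in> steiner i S"
proof -
  have jj: "j \<bullet> j = 1" using j by (simp add: norm_eq_1)
  let ?r = "\<lambda>x. x - (2 * (x \<bullet> j)) *R j"
  have rr: "?r (?r z) = z" for z by (simp add: inner_diff_left jj algebra_simps)
  have iff: "?r z \<in> S \<longleftrightarrow> z \<in> S" for z using S[of z] S[of "?r z"] unfolding rr by auto
  have ri: "?r z \<bullet> i = z \<bullet> i" for z using ij by (simp add: inner_diff_left inner_commute[of j i])
  have "?r x + (s - ?r x \<bullet> i) *R i = ?r (x + (s - x \<bullet> i) *R i)" for s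
	unfolding ri using ij by (simp add: algebra_simps inner_add_left)
  hence "{s. ?r x + (s - ?r x \<bullet> i) *R i \<in> S} = {s. x + (s - x \<bullet> i) *R i \<in> S}" using iff by (simp only:)
  thus ?thesis using x unfolding steiner_def mem_Collect_eq ri by simp
qed

lemma steiner_iterated:
  fixes S :: "'a::euclidean_space set"
  assumes "finite J" "J \<subseteq> (Basis :: 'a set)" and S: "S \<in> sets borel"
	and D: "\<And>x y. x \<in> S ==> y \<in> S ==> dist x y \<le> D"
  shows "\<exists>S'\<in>sets borel. emeasure lborel S' = emeasure lborel S \<and> (\<forall>x\<in>S'. \<forall>y\<in>S'. dist x y \<le> D)
	\<and> (\<forall>j\<in>J. \<forall>x\<in>S'. x - (2 * (x \<bullet> j)) *R j \<in> S')" using assms(1,2)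
proof (induction J rule: finite_induct)
  case empty
  have "emeasure lborel S = emeasure lborel S \<and> (\<forall>x\<in>S. \<forall>y\<in>S. dist x y \<le> D)
	\<and> (\<forall>j\<in>{}. \<forall>x\<in>S. x - (2 * (x \<bullet> j)) *R j \<in> S)" using D by blast
  thus ?case by (intro bexI[where x = S] S)
next
  case (insert i J)
  then obtain S' where S': "S' \<in> sets borel" "emeasure lborel S' = emeasure lborel S"
	"\<And>x y. x \<in> S' ==> y \<in> S' ==> dist x y \<le> D"
	"\<And>j x. j \<in> J ==> x \<in> S' ==> x - (2 * (x \<bullet> j)) *R j \<in> S'" by auto
  have i: "norm i = 1" using insert by auto
  have "bounded S'" using S'(3) by (auto simp: bounded_two_points)
  show ?case
  proof (intro bexI[of _ "steiner i S'"] conjI ballI)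
	show "steiner i S' \<in> sets borel" by (rule steiner_borel) fact
	show "emeasure lborel (steiner i S') = emeasure lborel S" using emeasure_steiner[OF i S'(1) `bounded S'`] S'(2) by simp
	show "dist x y \<le> D" if "x \<in> steiner i S'" "y \<in> steiner i S'" for x y using steiner_dist_le[OF i S'(1) S'(3) that] .
	show "x - (2 * (x \<bullet> j)) *R j \<in> steiner i S'" if "j \<in> insert i J" "x \<in> steiner i S'" for j x
	proof (cases "j = i")
	  case True
	  thus ?thesis using steiner_symmetric_same[OF i] that by simp
	next
	  case False
	  hence j: "j \<in> J" "j \<in> Basis" "i \<in> Basis" using that insert.prems by auto
	  thus ?thesis using False S'(4)[OF j(1)] that(2) by (intro steiner_symmetric_other) (auto simp: inner_Basis)
	qed
  qed
qed

text \<open>Symmetrizing in all basis directions produces a set of the same volume, with no larger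
  distances, that is invariant under x -> -x. Then x and -x are at distance 2 |x|, which puts the
  set into the ball whose radius is half the diameter.\<close>

theorem isodiametric_inequality:
  fixes S :: "'a::euclidean_space set"
  assumes S: "S \<in> sets borel" and "bounded S"
  shows "emeasure lborel S \<le> ennreal (unit_ball_vol (DIM('a)) * (diameter S / 2) ^ DIM('a))"
proof -
  have "dist x y \<le> diameter S" if "x \<in> S" "y \<in> S" for x y using diameter_bounded_bound[OF `bounded S` that] .
  hence "\<exists>S'\<in>sets (borel :: 'a measure). emeasure lborel S' = emeasure lborel S \<and> (\<forall>x\<in>S'. \<forall>y\<in>S'. dist x y \<le> diameter S)
	\<and> (\<forall>j\<in>Basis. \<forall>x\<in>S'. x - (2 * (x \<bullet> j)) *R j \<in> S')"
	by (intro steiner_iterated[OF finite_Basis order_refl S])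
  then obtain S' where S'1: "S' \<in> sets (borel :: 'a measure)" and S'2: "emeasure lborel S' = emeasure lborel S
	\<and> (\<forall>x\<in>S'. \<forall>y\<in>S'. dist x y \<le> diameter S) \<and> (\<forall>j\<in>Basis. \<forall>x\<in>S'. x - (2 * (x \<bullet> j)) *R j \<in> S')"
	by (rule bexE)
  note S' = S'1 conjunct1[OF S'2]
  have D: "\<And>x y. x \<in> S' ==> y \<in> S' ==> dist x y \<le> diameter S"
	and sym: "\<And>j x. j \<in> Basis ==> x \<in> S' ==> x - (2 * (x \<bullet> j)) *R j \<in> S'" using S'2 by simp_all
  \<comment> \<open>The reflections are composed one coordinate at a time; subtracting the earlier
    components does not change the coordinate along the next basis vector.\<close>
  have neg: "x - (\<Sum>j\<in>J. (2 * (x \<bullet> j)) *R j) \<in> S'" if "finite J" "J \<subseteq> Basis" "x \<in> S'" for J x using that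
  proof (induction J rule: finite_induct)
	case (insert i J)
	have "(\<Sum>j\<in>J. (2 * (x \<bullet> j)) *R j) \<bullet> i = 0" unfolding inner_sum_left
	proof (intro sum.neutral ballI)
	  fix j assume "j \<in> J"
	  hence "j \<in> Basis" "i \<in> Basis" "j \<noteq> i" using insert.hyps insert.prems by auto
	  thus "(2 * (x \<bullet> j)) *R j \<bullet> i = 0" by (simp add: inner_Basis)
	qed
	hence "(x - (\<Sum>j\<in>J. (2 * (x \<bullet> j)) *R j)) \<bullet> i = x \<bullet> i" by (simp add: inner_diff_left)
	with sym[of i "x - (\<Sum>j\<in>J. (2 * (x \<bullet> j)) *R j)"] insert show ?case by (simp add: algebra_simps)
  qed auto
  have "S' \<subseteq> cball 0 (diameter S / 2)"
  proof
	fix x assume x: "x \<in> S'"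
	have "x - (\<Sum>j\<in>Basis. (2 * (x \<bullet> j)) *R j) = - x"
	proof -
	  have "(\<Sum>j\<in>Basis. (2 * (x \<bullet> j)) *R j) = 2 *R (\<Sum>j\<in>Basis. (x \<bullet> j) *R j)" by (simp add: scaleR_sum_right)
	  thus ?thesis by (simp add: euclidean_representation scaleR_2)
	qed
	hence "- x \<in> S'" using neg[OF finite_Basis order_refl x] by simp
	from D[OF x this] have "norm (2 *R x) \<le> diameter S" by (simp add: dist_norm scaleR_2)
	thus "x \<in> cball 0 (diameter S / 2)" by simp
  qed
  hence "emeasure lborel S' \<le> emeasure lborel (cball (0::'a) (diameter S / 2))" by (intro emeasure_mono) auto
  also have "... = ennreal (unit_ball_vol (DIM('a)) * (diameter S / 2) ^ DIM('a))"
	using diameter_ge_0[OF `bounded S`] by (subst emeasure_cball) auto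
  finally show ?thesis using S' by simp
qed

section \<open>Hausdorff measure\<close>

definition hausdorff_term :: "nat => 'a::metric_space set => ennreal" where
  "hausdorff_term s C = (if C = {} then 0 else ennreal (unit_ball_vol (real s) * (diameter C / 2) ^ s))"

lemma hausdorff_term_empty [simp]: "hausdorff_term s {} = 0" by (simp add: hausdorff_term_def)

lemma hausdorff_content_eq:
  "hausdorff_content s \<delta> S =
	 (INF C\<in>{C. S \<subseteq> (\<Union>k. C k) \<and> (\<forall>k. bounded (C k) \<and> diameter (C k) \<le> \<delta>)}. \<Sum>k. hausdorff_term s (C k))"
  unfolding hausdorff_content_def hausdorff_term_def ..

lemma hausdorff_content_le:
  assumes "S \<subseteq> (\<Union>k. C k)" "\<And>k. bounded (C k)" "\<And>k. diameter (C k) \<le> \<delta>"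
  shows "hausdorff_content s \<delta> S \<le> (\<Sum>k. hausdorff_term s (C k))"
  unfolding hausdorff_content_eq by (rule INF_lower) (use assms in auto)

text \<open>Covers may have any countable index set: gaps of the enumeration are filled with empty
  sets, which cost nothing. Vitali families and the union of two covers are used in this
  form.\<close>

lemma hausdorff_content_le_countable:
  assumes "countable I" "S \<subseteq> (\<Union>i\<in>I. C i)" "\<And>i. i \<in> I ==> bounded (C i)"
	"\<And>i. i \<in> I ==> diameter (C i) \<le> \<delta>" "\<delta> \<ge> 0"
  shows "hausdorff_content s \<delta> S \<le> (\<integral>\<^sup>+i. hausdorff_term s (C i) \<partial>count_space I)"
proof -
  define J where "J = to_nat_on I ` I"
  define D where "D k = (if k \<in> J then C (from_nat_into I k) else {})" for k
  have bij: "bij_betw (to_nat_on I) I J" unfolding J_def using inj_on_to_nat_on[OF `countable I`] by (rule inj_on_imp_bij_betw)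
  have Dto: "D (to_nat_on I i) = C i" if "i \<in> I" for i using that `countable I` by (simp add: D_def J_def)
  have Dk: "D k = {} \<or> (\<exists>i\<in>I. D k = C i)" for k using Dto by (cases "k \<in> J") (auto simp: J_def D_def)
  have "hausdorff_content s \<delta> S \<le> (\<Sum>k. hausdorff_term s (D k))"
  proof (rule hausdorff_content_le)
	show "S \<subseteq> (\<Union>k. D k)"
	proof
	  fix x assume "x \<in> S"
	  then obtain i where "i \<in> I" "x \<in> C i" using assms by auto
	  thus "x \<in> (\<Union>k. D k)" using Dto by auto
	qed
	fix k
	show "bounded (D k)" "diameter (D k) \<le> \<delta>" using Dk[of k] assms by auto
  qed
  also have "... = (\<integral>\<^sup>+k. hausdorff_term s (D k) \<partial>count_space UNIV)" by (rule nn_integral_count_space_nat[symmetric])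
  also have "... = (\<integral>\<^sup>+k. hausdorff_term s (D k) \<partial>count_space J)"
	by (rule nn_integral_count_space_eq) (auto simp: D_def)
  also have "... = (\<integral>\<^sup>+i. hausdorff_term s (D (to_nat_on I i)) \<partial>count_space I)"
	by (rule nn_integral_bij_count_space[OF bij, symmetric])
  also have "... = (\<integral>\<^sup>+i. hausdorff_term s (C i) \<partial>count_space I)" by (rule nn_integral_cong) (simp add: Dto)
  finally show ?thesis .
qed

lemma hausdorff_content_mono:
  "S \<subseteq> T ==> hausdorff_content s \<delta> S \<le> hausdorff_content s \<delta> T"
  unfolding hausdorff_content_def by (rule INF_superset_mono) auto

lemma ennreal_le_INF_add_INF:
  fixes f g :: "'i => ennreal"
  assumes "\<And>x y. x \<in> X ==> y \<in> Y ==> c \<le> f x + g y"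
  shows "c \<le> (INF x\<in>X. f x) + (INF y\<in>Y. g y)"
proof (rule ennreal_le_epsilon)
  fix e :: real assume fin: "(INF x\<in>X. f x) + (INF y\<in>Y. g y) < top" and "e > 0"
  have lt: "a < a + ennreal (e / 2)" if "a < top" for a :: ennreal
	using that `e > 0` ennreal_add_left_cancel_less[of a 0 "ennreal (e / 2)"] by auto
  have "(INF x\<in>X. f x) < top" "(INF y\<in>Y. g y) < top"
	using fin by (metis add_increasing2 le_less_trans order_refl zero_le, metis add_increasing le_less_trans order_refl zero_le)
  note lt[OF this(1)] lt[OF this(2)]
  then obtain x y where x: "x \<in> X" "f x < (INF x\<in>X. f x) + ennreal (e / 2)"
	and y: "y \<in> Y" "g y < (INF y\<in>Y. g y) + ennreal (e / 2)" unfolding INF_less_iff by auto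
  have "c \<le> f x + g y" using assms x y by auto
  also have "... \<le> ((INF x\<in>X. f x) + ennreal (e / 2)) + ((INF y\<in>Y. g y) + ennreal (e / 2))" using x y by (intro add_mono) auto
  also have "... = (INF x\<in>X. f x) + (INF y\<in>Y. g y) + ennreal e" using `e > 0` by (simp add: algebra_simps flip: ennreal_plus)
  finally show "c \<le> (INF x\<in>X. f x) + (INF y\<in>Y. g y) + ennreal e" .
qed

lemma hausdorff_content_Un:
  assumes "\<delta> \<ge> 0"
  shows "hausdorff_content s \<delta> (A \<union> B) \<le> hausdorff_content s \<delta> A + hausdorff_content s \<delta> B"
proof -
  have *: "hausdorff_content s \<delta> (A \<union> B) \<le> (\<Sum>k. hausdorff_term s (C k)) + (\<Sum>k. hausdorff_term s (D k))"
	if C: "A \<subseteq> (\<Union>k. C k)" "\<And>k. bounded (C k) \<and> diameter (C k) \<le> \<delta>"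
	  and D: "B \<subseteq> (\<Union>k. D k)" "\<And>k. bounded (D k) \<and> diameter (D k) \<le> \<delta>" for C D :: "nat => 'a set"
  proof -
	define E where "E z = (if fst z then C (snd z) else D (snd z))" for z :: "bool \<times> nat"
	let ?h = "\<lambda>z. hausdorff_term s (E z)"
	have row: "(\<integral>\<^sup>+z. ?h z \<partial>count_space ({b} \<times> UNIV)) = (\<Sum>k. ?h (b, k))" for b
	proof -
	  have "bij_betw (Pair b) UNIV ({b} \<times> (UNIV :: nat set))" by (auto simp: bij_betw_def inj_on_def)
	  from nn_integral_bij_count_space[OF this, of ?h, symmetric] show ?thesis unfolding nn_integral_count_space_nat .
	qed
	have "hausdorff_content s \<delta> (A \<union> B) \<le> (\<integral>\<^sup>+z. ?h z \<partial>count_space UNIV)"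
	proof (rule hausdorff_content_le_countable)
	  show "A \<union> B \<subseteq> (\<Union>z\<in>UNIV. E z)"
	  proof
		fix x assume "x \<in> A \<union> B"
		then consider k where "x \<in> C k" | k where "x \<in> D k" using C D by auto
		thus "x \<in> (\<Union>z\<in>UNIV. E z)"
		proof cases
		  case 1 thus ?thesis by (intro UN_I[of "(True, k)"]) (auto simp: E_def)
		next
		  case 2 thus ?thesis by (intro UN_I[of "(False, k)"]) (auto simp: E_def)
		qed
	  qed
	qed (use C D assms in \<open>auto simp: E_def\<close>)
	also have "... = (\<integral>\<^sup>+z. ?h z * indicator ({True} \<times> UNIV) z + ?h z * indicator ({False} \<times> UNIV) z \<partial>count_space UNIV)"
	  by (rule nn_integral_cong) (auto simp: indicator_def)
	also have "... = (\<integral>\<^sup>+z. ?h z * indicator ({True} \<times> UNIV) z \<partial>count_space UNIV)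
		+ (\<integral>\<^sup>+z. ?h z * indicator ({False} \<times> UNIV) z \<partial>count_space UNIV)" by (rule nn_integral_add) auto
	also have "... = (\<integral>\<^sup>+z. ?h z \<partial>count_space ({True} \<times> UNIV)) + (\<integral>\<^sup>+z. ?h z \<partial>count_space ({False} \<times> UNIV))"
	  by (simp add: nn_integral_count_space_indicator)
	also have "... = (\<Sum>k. ?h (True, k)) + (\<Sum>k. ?h (False, k))" unfolding row ..
	finally show ?thesis by (simp add: E_def)
  qed
  show ?thesis unfolding hausdorff_content_eq[of s \<delta> A] hausdorff_content_eq[of s \<delta> B]
	by (rule ennreal_le_INF_add_INF) (use * in auto)
qed

lemma hausdorff_measure_Un:
  "hausdorff_measure s (A \<union> B) \<le> hausdorff_measure s A + hausdorff_measure s B"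
proof -
  have "hausdorff_content s \<delta> (A \<union> B) \<le> hausdorff_measure s A + hausdorff_measure s B" if "\<delta> > 0" for \<delta>
	unfolding hausdorff_measure_def using that by (intro order_trans[OF hausdorff_content_Un] add_mono SUP_upper) auto
  thus ?thesis unfolding hausdorff_measure_def[of s "A \<union> B"] by (intro SUP_least) auto
qed

lemma hausdorff_measure_empty [simp]: "hausdorff_measure s {} = 0"
proof -
  have "hausdorff_content s \<delta> ({} :: 'a set) \<le> 0" if "\<delta> > 0" for \<delta>
	using hausdorff_content_le[of "{}" "\<lambda>_. {} :: 'a set" \<delta> s] that by simp
  thus ?thesis unfolding hausdorff_measure_def by (simp add: SUP_eq_const)
qed

lemma hausdorff_measure_finite_Union_null:
  assumes "finite \<F>" "\<And>C. C \<in> \<F> ==> hausdorff_measure s C = 0"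
  shows "hausdorff_measure s (\<Union>\<F>) = 0" using assms
proof (induction \<F> rule: finite_induct)
  case (insert C \<F>)
  thus ?case using hausdorff_measure_Un[of s C "\<Union>\<F>"] by simp
qed simp

lemma hausdorff_measure_image_le:
  fixes f :: "'a::metric_space => 'b::metric_space"
  assumes f: "\<And>x y. x \<in> S ==> y \<in> S ==> dist (f x) (f y) \<le> dist x y"
  shows "hausdorff_measure s (f ` S) \<le> hausdorff_measure s S"
proof -
  have "hausdorff_content s \<delta> (f ` S) \<le> hausdorff_content s \<delta> S" if "\<delta> > 0" for \<delta>
	unfolding hausdorff_content_eq[of s \<delta> S]
  proof (rule INF_greatest)
	fix C :: "nat => 'a set" assume C: "C \<in> {C. S \<subseteq> (\<Union>k. C k) \<and> (\<forall>k. bounded (C k) \<and> diameter (C k) \<le> \<delta>)}"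
	\<comment> \<open>The covering sets are cut down to S first, because f is only known to contract
	  distances between points of S.\<close>
	have bd: "bounded (f ` (C k \<inter> S)) \<and> diameter (f ` (C k \<inter> S)) \<le> diameter (C k)" for k
	proof -
	  have le: "dist (f x) (f y) \<le> diameter (C k)" if "x \<in> C k \<inter> S" "y \<in> C k \<inter> S" for x y
		using f[of x y] diameter_bounded_bound[of "C k" x y] C that by force
	  have "bounded (f ` (C k \<inter> S))" unfolding bounded_two_points using le by auto
	  moreover have "diameter (f ` (C k \<inter> S)) \<le> diameter (C k)" unfolding diameter_def[of "f ` (C k \<inter> S)"]
		using le diameter_ge_0[of "C k"] C by (auto intro!: cSUP_least)
	  ultimately show ?thesis ..
	qed
	have "hausdorff_content s \<delta> (f ` S) \<le> (\<Sum>k. hausdorff_term s (f ` (C k \<inter> S)))"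
	  by (rule hausdorff_content_le) (use C bd in \<open>auto intro: order_trans\<close>, blast)
	also have "... \<le> (\<Sum>k. hausdorff_term s (C k))"
	proof (rule suminf_le)
	  fix k
	  have "diameter (f ` (C k \<inter> S)) \<ge> 0" using bd diameter_ge_0 by blast
	  thus "hausdorff_term s (f ` (C k \<inter> S)) \<le> hausdorff_term s (C k)" using bd[of k] unfolding hausdorff_term_def
		by (auto intro!: ennreal_leI mult_left_mono power_mono)
	qed auto
	finally show "hausdorff_content s \<delta> (f ` S) \<le> (\<Sum>k. hausdorff_term s (C k))" .
  qed
  thus ?thesis unfolding hausdorff_measure_def by (intro SUP_mono) auto
qed

lemma hausdorff_measure_isometry:
  assumes f: "\<And>x y. x \<in> S ==> y \<in> S ==> dist (f x) (f y) = dist x y"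
  shows "hausdorff_measure s (f ` S) = hausdorff_measure s S"
proof (rule antisym)
  show "hausdorff_measure s (f ` S) \<le> hausdorff_measure s S" by (rule hausdorff_measure_image_le) (simp add: f)
  have inj: "inj_on f S" using f by (metis dist_eq_0_iff inj_onI)
  have "hausdorff_measure s (inv_into S f ` f ` S) \<le> hausdorff_measure s (f ` S)"
	by (rule hausdorff_measure_image_le) (auto simp: f inj inv_into_f_f)
  thus "hausdorff_measure s S \<le> hausdorff_measure s (f ` S)" using inj by (simp add: image_image inv_into_f_f)
qed

lemma nn_integral_disjoint_cballs_le:
  fixes T :: "'a::euclidean_space set"
  assumes C: "countable C" "pairwise (\<lambda>i j. disjnt (cball (a i) (r i)) (cball (a j) (r j))) C"
	and T: "open T" "\<And>i. i \<in> C ==> cball (a i) (r i) \<subseteq> T"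
  shows "(\<integral>\<^sup>+i. emeasure lborel (cball (a i) (r i)) \<partial>count_space C) \<le> emeasure lborel T"
proof -
  have "(\<integral>\<^sup>+i. emeasure lborel (cball (a i) (r i)) \<partial>count_space C)
	  = emeasure lborel (\<Union>i\<in>C. cball (a i) (r i))" by (rule emeasure_UN_countable[symmetric])
	   (use C in \<open>auto simp: disjoint_family_on_def pairwise_def disjnt_def\<close>)
  also have "... \<le> emeasure lborel T" using T by (intro emeasure_mono) auto
  finally show ?thesis .
qed

lemma hausdorff_term_cball:
  fixes x :: "'a::euclidean_space"
  assumes "r > 0" "c > 0"
  shows "hausdorff_term DIM('a) (cball x (c * r)) = ennreal (c ^ DIM('a)) * emeasure lborel (cball x r)"
proof -
  have pos: "c * r > 0" using assms by simp
  hence "diameter (cball x (c * r)) / 2 = c * r" by (simp del: zero_less_mult_iff)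
  moreover have "cball x (c * r) \<noteq> {}" using pos by (simp del: zero_less_mult_iff)
  ultimately show ?thesis using assms
	by (simp add: hausdorff_term_def emeasure_cball power_mult_distrib ennreal_mult'[symmetric] mult_ac del: diameter_cball)
qed

text \<open>Needed before any comparison with Lebesgue measure, for the null set that a Vitali
  covering leaves over. Disjoint balls inside a small open superset are enlarged five times; radii
  of at most \<delta> / 10 keep the enlarged diameters within \<delta>, and the cost is 5^d times
  the measure of the superset.\<close>

lemma hausdorff_content_negligible:
  fixes N :: "'a::euclidean_space set"
  assumes N: "negligible N" and "\<delta> > 0"
  shows "hausdorff_content DIM('a) \<delta> N = 0"
proof -
  have "hausdorff_content DIM('a) \<delta> N \<le> 0 + ennreal e" if "e > 0" for e
  proof -
	define e' where "e' = e / 5 ^ DIM('a)"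
	have "e' > 0" using that by (simp add: e'_def)
	have "N \<in> sets lebesgue" using N by (simp add: negligible_iff_null_sets null_setsD2)
	then obtain T where T: "open T" "N \<subseteq> T" "emeasure lebesgue (T - N) < ennreal e'" by (rule sets_lebesgue_outer_open[OF _ `e' > 0`])
	have "emeasure lebesgue (T - N) = emeasure lebesgue T" using N T(1) by (intro emeasure_Diff_null_set) (auto simp: negligible_iff_null_sets)
	hence eT: "emeasure lborel T \<le> ennreal e'" using T by simp
	define K where "K = {z::'a \<times> real. snd z > 0 \<and> snd z \<le> \<delta> / 10 \<and> cball (fst z) (snd z) \<subseteq> T}"
	have "N \<subseteq> (\<Union>z\<in>K. cball (fst z) (snd z))"
	proof
	  fix x assume "x \<in> N"
	  hence "x \<in> T" using T(2) by auto
	  then obtain r where r: "r > 0" "cball x r \<subseteq> T" using open_contains_cball[THEN iffD1, OF T(1), rule_format, OF `x \<in> T`] by auto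
	  have "(x, min r (\<delta> / 10)) \<in> K" using r `\<delta> > 0` by (auto simp: K_def)
	  thus "x \<in> (\<Union>z\<in>K. cball (fst z) (snd z))" using r `\<delta> > 0` by (intro UN_I) auto
	qed
	from Vitali_covering_lemma_cballs[OF this, of "\<delta> / 10"] obtain C where
	  C: "countable C" "C \<subseteq> K" "pairwise (\<lambda>i j. disjnt (cball (fst i) (snd i)) (cball (fst j) (snd j))) C"
		"N \<subseteq> (\<Union>i\<in>C. cball (fst i) (5 * snd i))" unfolding K_def by auto
	have "hausdorff_content DIM('a) \<delta> N \<le> (\<integral>\<^sup>+i. hausdorff_term DIM('a) (cball (fst i) (5 * snd i)) \<partial>count_space C)"
	  using C `\<delta> > 0` by (intro hausdorff_content_le_countable) (auto simp: K_def)
	also have "... = (\<integral>\<^sup>+i. ennreal (5 ^ DIM('a)) * emeasure lborel (cball (fst i) (snd i)) \<partial>count_space C)"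
	  using C by (intro nn_integral_cong hausdorff_term_cball) (auto simp: K_def)
	also have "... = ennreal (5 ^ DIM('a)) * (\<integral>\<^sup>+i. emeasure lborel (cball (fst i) (snd i)) \<partial>count_space C)"
	  by (rule nn_integral_cmult) auto
	also have "... \<le> ennreal (5 ^ DIM('a)) * ennreal e'"
	  using C T by (intro mult_left_mono order_trans[OF nn_integral_disjoint_cballs_le eT]) (auto simp: K_def)
	also have "... = ennreal e" using `e' > 0` by (simp add: e'_def ennreal_mult'[symmetric])
	finally show ?thesis by simp
  qed
  hence "hausdorff_content DIM('a) \<delta> N \<le> 0" by (rule ennreal_le_epsilon)
  thus ?thesis by simp
qed

text \<open>Almost all of S is covered by disjoint small balls inside an open superset of nearly the
  same measure. The normalisation makes the cost of a ball equal to its volume, and the null set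
  left over has content zero.\<close>

lemma hausdorff_measure_le_lebesgue:
  fixes S :: "'a::euclidean_space set"
  assumes S: "S \<in> sets lebesgue"
  shows "hausdorff_measure DIM('a) S \<le> emeasure lebesgue S" unfolding hausdorff_measure_def
proof (rule SUP_least)
  fix \<delta> :: real assume "\<delta> \<in> {0<..}"
  hence "\<delta> > 0" by simp
  let ?H = "hausdorff_content DIM('a) \<delta>" and ?b = "\<lambda>i. cball (fst i) (snd i)"
  show "?H S \<le> emeasure lebesgue S"
  proof (rule ennreal_le_epsilon)
	fix e :: real assume "e > 0"
	obtain T where T: "open T" "S \<subseteq> T" "emeasure lebesgue (T - S) < ennreal e" by (rule sets_lebesgue_outer_open[OF S `e > 0`])
	have "emeasure lebesgue T = emeasure lebesgue (S \<union> (T - S))" using T by (simp add: Un_absorb1)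
	also have "... = emeasure lebesgue S + emeasure lebesgue (T - S)" using S T by (intro plus_emeasure[symmetric]) auto
	also have "... \<le> emeasure lebesgue S + ennreal e" using T by (intro add_left_mono) auto
	finally have eT: "emeasure lborel T \<le> emeasure lebesgue S + ennreal e" using T by simp
	define K where "K = {z::'a \<times> real. snd z > 0 \<and> snd z \<le> \<delta> / 2 \<and> cball (fst z) (snd z) \<subseteq> T}"
	have fine: "\<exists>i. i \<in> K \<and> x \<in> ?b i \<and> snd i < d" if "x \<in> S" "0 < d" for x d
	proof -
	  have "x \<in> T" using T(2) that(1) ..
	  then obtain r where r: "r > 0" "cball x r \<subseteq> T" using open_contains_cball[THEN iffD1, OF T(1), rule_format, OF `x \<in> T`] by auto
	  have "(x, min r (min (\<delta> / 2) (d / 2))) \<in> K" using r `\<delta> > 0` `d > 0` by (auto simp: K_def)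
	  thus ?thesis using r `\<delta> > 0` `d > 0` by (intro exI[of _ "(x, min r (min (\<delta> / 2) (d / 2)))"] conjI) auto
	qed
	obtain C where C: "countable C" "C \<subseteq> K" "pairwise (\<lambda>i j. disjnt (?b i) (cball (fst j) (snd j))) C"
		"negligible (S - (\<Union>i\<in>C. ?b i))" by (rule Vitali_covering_theorem_cballs[of K snd S fst, OF _ fine]) (auto simp: K_def)
	define B where "B = (\<Union>i\<in>C. ?b i)"
	have "?H S \<le> ?H (B \<union> (S - B))" by (rule hausdorff_content_mono) auto
	also have "... \<le> ?H B + ?H (S - B)" using `\<delta> > 0` by (intro hausdorff_content_Un) auto
	also have "... = ?H B" using hausdorff_content_negligible[OF C(4)] `\<delta> > 0` by (simp add: B_def)
	also have "... \<le> (\<integral>\<^sup>+i. hausdorff_term DIM('a) (?b i) \<partial>count_space C)"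
	  using C `\<delta> > 0` unfolding B_def by (intro hausdorff_content_le_countable) (auto simp: K_def)
	also have "... = (\<integral>\<^sup>+i. emeasure lborel (?b i) \<partial>count_space C)"
	proof (rule nn_integral_cong)
	  fix i assume "i \<in> space (count_space C)"
	  hence "snd i > 0" using C by (auto simp: K_def)
	  from hausdorff_term_cball[OF this, of 1 "fst i"]
	  show "hausdorff_term DIM('a) (?b i) = emeasure lborel (?b i)" by simp
	qed
	also have "... \<le> emeasure lborel T" using C T by (intro nn_integral_disjoint_cballs_le) (auto simp: K_def)
	finally show "?H S \<le> emeasure lebesgue S + ennreal e" using eT by simp
  qed
qed

text \<open>The isodiametric inequality bounds the volume of each covering set by its cost. Covering
  sets need not be measurable, so closures are taken, which keeps the diameter. The content at scale
  1 suffices, as the measure is a supremum over scales.\<close>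

lemma lebesgue_le_hausdorff_measure:
  fixes S :: "'a::euclidean_space set"
  assumes S: "S \<in> sets lebesgue"
  shows "emeasure lebesgue S \<le> hausdorff_measure DIM('a) S"
proof -
  have "emeasure lebesgue S \<le> hausdorff_content DIM('a) 1 S" unfolding hausdorff_content_eq
  proof (rule INF_greatest)
	fix C :: "nat => 'a set" assume C: "C \<in> {C. S \<subseteq> (\<Union>k. C k) \<and> (\<forall>k. bounded (C k) \<and> diameter (C k) \<le> 1)}"
	have "emeasure lebesgue S \<le> emeasure lebesgue (\<Union>k. closure (C k))" using C closure_subset by (intro emeasure_mono) (auto, blast)
	also have "... \<le> (\<Sum>k. emeasure lebesgue (closure (C k)))" by (rule emeasure_subadditive_countably) auto
	also have "... \<le> (\<Sum>k. hausdorff_term DIM('a) (C k))"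
	proof (rule suminf_le)
	  fix k
	  show "emeasure lebesgue (closure (C k)) \<le> hausdorff_term DIM('a) (C k)" using isodiametric_inequality[of "closure (C k)"] C
		by (auto simp: hausdorff_term_def bounded_closure diameter_closure)
	qed auto
	finally show "emeasure lebesgue S \<le> (\<Sum>k. hausdorff_term DIM('a) (C k))" .
  qed
  also have "... \<le> hausdorff_measure DIM('a) S" unfolding hausdorff_measure_def by (rule SUP_upper) auto
  finally show ?thesis .
qed

theorem hausdorff_measure_eq_lebesgue:
  fixes S :: "'a::euclidean_space set"
  assumes "S \<in> sets lebesgue"
  shows "hausdorff_measure DIM('a) S = emeasure lebesgue S"
  using hausdorff_measure_le_lebesgue[OF assms] lebesgue_le_hausdorff_measure[OF assms] by (rule antisym)

text \<open>Hausdorff measure does not see the ambient type, so Lebesgue measure can be transported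
  between different types of equal dimension, in particular along the charts of the next
  section.\<close>

lemma emeasure_lebesgue_isometry:
  fixes f :: "'a::euclidean_space => 'b::euclidean_space"
  assumes "DIM('a) = DIM('b)" "\<And>x y. dist (f x) (f y) = dist x y" "S \<in> sets lebesgue" "f ` S \<in> sets lebesgue"
  shows "emeasure lebesgue (f ` S) = emeasure lebesgue S"
  using hausdorff_measure_isometry[of S f "DIM('a)"] hausdorff_measure_eq_lebesgue[OF assms(3)]
	hausdorff_measure_eq_lebesgue[OF assms(4)] assms(1,2) by simp

section \<open>Slabs and cones over compact subsets of hyperplanes\<close>

text \<open>An index type for the coordinates of a hyperplane; it has \<open>DIM('a) - 1\<close> elements except that it
  has one element if \<open>DIM('a) = 1\<close>.\<close>

typedef (overloaded) ('a::euclidean_space) codim1 = "{..<max 1 (DIM('a) - 1)}" by (rule exI[of _ 0]) auto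

instance codim1 :: (euclidean_space) finite
proof
  show "finite (UNIV :: 'a codim1 set)" unfolding type_definition.univ[OF type_definition_codim1] by simp
qed

lemma CARD_codim1: "DIM('a::euclidean_space) \<ge> 2 ==> CARD('a codim1) = DIM('a) - 1"
  by (simp add: type_definition.card[OF type_definition_codim1])

lemma hyperplane_isometry:
  fixes \<nu> :: "'a::euclidean_space"
  assumes "norm \<nu> = 1" "DIM('a) \<ge> 2"
  obtains g :: "real ^ 'a codim1 => 'a" where "linear g" "\<And>y. norm (g y) = norm y" "range g = plane \<nu> 0"
proof -
  have "\<nu> \<noteq> 0" using assms by auto
  hence "dim (UNIV :: (real ^ 'a codim1) set) = dim (plane \<nu> 0)" using assms CARD_codim1[where 'a = 'a] by (simp add: dim_hyperplane)
  from isometries_subspaces[OF subspace_UNIV subspace_hyperplane this]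
  show thesis using that by (metis UNIV_I)
qed

definition slab :: "'a::real_vector set => 'a => 'a set" where
  "slab \<sigma> w = (\<lambda>(y, s). y + s *R w) ` (\<sigma> \<times> {0..1})"

definition cone_over :: "'a::real_vector => 'a set => 'a set" where
  "cone_over p \<sigma> = (\<lambda>(y, r). p + r *R (y - p)) ` (\<sigma> \<times> {0..1})"

lemma compact_slab: "compact \<sigma> ==> compact (slab \<sigma> (w :: 'a::euclidean_space))" unfolding slab_def
  by (intro compact_continuous_image compact_Times) (auto intro!: continuous_intros simp: case_prod_unfold)

lemma compact_cone_over: "compact \<sigma> ==> compact (cone_over (p :: 'a::euclidean_space) \<sigma>)" unfolding cone_over_def
  by (intro compact_continuous_image compact_Times) (auto intro!: continuous_intros simp: case_prod_unfold)

text \<open>Serves the one-dimensional case, in which nonempty faces are points and the surface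
  measure counts them.\<close>

lemma hausdorff_measure_0_singleton: "hausdorff_measure 0 {y :: 'a::metric_space} = 1"
proof -
  have one: "hausdorff_term 0 C = (if C = {} then 0 else 1)" for C :: "'a set" by (simp add: hausdorff_term_def)
  have "hausdorff_content 0 \<delta> {y} = 1" if "\<delta> > 0" for \<delta>
  proof (rule antisym)
	have "hausdorff_content 0 \<delta> {y} \<le> (\<Sum>k. hausdorff_term 0 (if k = 0 then {y} else {}))"
	  by (rule hausdorff_content_le) (use that in auto)
	also have "... = (\<Sum>k. if k = 0 then 1 else 0)" by (intro suminf_cong) (simp add: one)
	also have "... = 1" using suminf_finite[of "{0::nat}" "\<lambda>k. if k = 0 then 1 else (0::ennreal)"] by simp
	finally show "hausdorff_content 0 \<delta> {y} \<le> 1" .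
	show "1 \<le> hausdorff_content 0 \<delta> {y}" unfolding hausdorff_content_eq
	proof (rule INF_greatest)
	  fix C :: "nat => 'a set" assume "C \<in> {C. {y} \<subseteq> (\<Union>k. C k) \<and> (\<forall>k. bounded (C k) \<and> diameter (C k) \<le> \<delta>)}"
	  then obtain k where "y \<in> C k" by auto
	  hence "1 = hausdorff_term 0 (C k)" by (auto simp: one)
	  also have "... \<le> (\<Sum>k. hausdorff_term 0 (C k))" using sum_le_suminf[of "\<lambda>k. hausdorff_term 0 (C k)" "{k}"] by simp
	  finally show "1 \<le> (\<Sum>k. hausdorff_term 0 (C k))" .
	qed
  qed
  thus ?thesis unfolding hausdorff_measure_def by (simp add: SUP_eq_const)
qed

text \<open>Isometric coordinates: the height along \<nu> and the position in the hyperplane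
  orthogonal to \<nu>. The origin q is free because for cones it is the apex. In dimension one the
  index type has one element too many, hence the assumption on the dimension.\<close>

locale hyperplane_chart =
  fixes \<nu> :: "'a::euclidean_space" and g :: "real ^ 'a codim1 => 'a" and q :: 'a
  assumes nu: "norm \<nu> = 1" and dim2: "DIM('a) \<ge> 2"
	and g: "linear g" "\<And>y. norm (g y) = norm y" "range g = plane \<nu> 0"
begin

definition chart :: "real \<times> (real ^ 'a codim1) => 'a" where
  "chart z = q + fst z *R \<nu> + g (snd z)"

lemma nunu: "\<nu> \<bullet> \<nu> = 1" using nu by (simp add: norm_eq_1)

lemma nu_g: "\<nu> \<bullet> g y = 0" using g(3) by auto

lemma obtain_g: assumes "\<nu> \<bullet> x = 0" obtains y where "x = g y" using g(3) assms by (metis (mono_tags, lifting) mem_Collect_eq rangeE)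

lemma chart_dist: "dist (chart x) (chart y) = dist x y"
proof -
  have "chart x - chart y = (fst x - fst y) *R \<nu> + g (snd x - snd y)" by (simp add: chart_def linear_diff[OF g(1)] algebra_simps)
  hence "(dist (chart x) (chart y))^2 = (fst x - fst y)^2 + (norm (snd x - snd y))^2"
	by (simp add: dist_norm norm_add_Pythagorean orthogonal_def nu_g nu g power_mult_distrib)
  also have "... = (dist x y)^2" by (simp add: dist_prod_def dist_norm)
  finally show ?thesis by (simp add: power2_eq_iff_nonneg)
qed

lemma continuous_chart: "continuous_on A chart" unfolding continuous_on_iff using chart_dist by metis

lemma emeasure_chart:
  assumes "compact W"
  shows "emeasure lebesgue (chart ` W) = emeasure lborel W"
proof -
  have "compact (chart ` W)" using assms continuous_chart by (rule compact_continuous_image[rotated])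
  hence "emeasure lebesgue (chart ` W) = emeasure lebesgue W" using dim2 CARD_codim1[where 'a = 'a] assms
	by (intro emeasure_lebesgue_isometry chart_dist) (auto simp: lmeasurable_compact fmeasurableD)
  thus ?thesis using assms by (simp add: borel_compact)
qed

definition section_set :: "real => 'a set => (real ^ 'a codim1) set" where
  "section_set s \<sigma> = {y. chart (s, y) \<in> \<sigma>}"

lemma compact_section_set:
  assumes "compact \<sigma>" shows "compact (section_set s \<sigma>)"
proof -
  have "continuous_on UNIV (\<lambda>y. chart (s, y))" by (rule continuous_on_compose2[OF continuous_chart]) (auto intro!: continuous_intros)
  hence "closed (section_set s \<sigma>)" unfolding section_set_def
	using closed_vimage[of \<sigma> "\<lambda>y. chart (s, y)"] compact_imp_closed[OF assms]
	by (simp add: vimage_def continuous_on_eq_continuous_at)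
  moreover have "bounded (section_set s \<sigma>)"
  proof -
	obtain B where B: "\<And>x y. x \<in> \<sigma> ==> y \<in> \<sigma> ==> dist x y \<le> B"
	  using compact_imp_bounded[OF assms] unfolding bounded_two_points by auto
	have "dist x y \<le> B" if "x \<in> section_set s \<sigma>" "y \<in> section_set s \<sigma>" for x y
	  using B[of "chart (s, x)" "chart (s, y)"] that chart_dist[of "(s, x)" "(s, y)"] by (simp add: section_set_def dist_prod_def)
	thus ?thesis unfolding bounded_two_points by blast
  qed
  ultimately show ?thesis by (simp add: compact_eq_bounded_closed)
qed

lemma chart_section_set:
  assumes "\<sigma> \<subseteq> plane \<nu> b"
  shows "\<sigma> = (\<lambda>y. chart (b - \<nu> \<bullet> q, y)) ` section_set (b - \<nu> \<bullet> q) \<sigma>"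
proof
  show "\<sigma> \<subseteq> (\<lambda>y. chart (b - \<nu> \<bullet> q, y)) ` section_set (b - \<nu> \<bullet> q) \<sigma>"
  proof
	fix x assume x: "x \<in> \<sigma>"
	have "\<nu> \<bullet> (x - q - (b - \<nu> \<bullet> q) *R \<nu>) = 0" using x assms by (auto simp: inner_diff_right nunu)
	then obtain y where "x - q - (b - \<nu> \<bullet> q) *R \<nu> = g y" by (rule obtain_g)
	hence "x = chart (b - \<nu> \<bullet> q, y)" by (simp add: chart_def algebra_simps)
	thus "x \<in> (\<lambda>y. chart (b - \<nu> \<bullet> q, y)) ` section_set (b - \<nu> \<bullet> q) \<sigma>"
	  using x by (auto simp: section_set_def)
  qed
qed (auto simp: section_set_def)

lemma surface_measure_section:
  assumes "compact \<sigma>" "\<sigma> \<subseteq> plane \<nu> b"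
  shows "surface_measure \<sigma> = emeasure lborel (section_set (b - \<nu> \<bullet> q) \<sigma>)"
proof -
  let ?s = "b - \<nu> \<bullet> q"
  have "surface_measure \<sigma> = hausdorff_measure (DIM('a) - 1) ((\<lambda>y. chart (?s, y)) ` section_set ?s \<sigma>)"
	unfolding surface_measure_def using chart_section_set[OF assms(2)] by simp
  also have "... = hausdorff_measure (DIM('a) - 1) (section_set ?s \<sigma>)"
	by (rule hausdorff_measure_isometry) (simp add: chart_dist dist_prod_def)
  also have "DIM('a) - 1 = DIM(real ^ 'a codim1)" using CARD_codim1[OF dim2] by simp
  also have "hausdorff_measure ... (section_set ?s \<sigma>) = emeasure lebesgue (section_set ?s \<sigma>)"
	by (rule hausdorff_measure_eq_lebesgue) (simp add: compact_section_set[OF assms(1)] lmeasurable_compact fmeasurableD)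
  finally show ?thesis using compact_section_set[OF assms(1)] by (simp add: borel_compact)
qed

lemma emeasure_Times_slices:
  fixes W :: "(real \<times> (real ^ 'a codim1)) set"
  assumes "compact W"
  shows "emeasure lborel W = (NBINT r. emeasure lborel {y. (r, y) \<in> W})"
proof -
  have "W \<in> sets (lborel \<Otimes>\<^sub>M lborel)" using borel_compact[OF assms] unfolding lborel_prod by simp
  from lborel.emeasure_pair_measure_alt[OF this] show ?thesis by (simp add: lborel_prod vimage_def)
qed

text \<open>Cavalieri's principle: in the chart every level of the prism is a translate of the base,
  and the levels fill an interval of length |w . \<nu>|.\<close>

lemma emeasure_slab:
  assumes \<sigma>: "compact \<sigma>" "\<sigma> \<subseteq> plane \<nu> b" and c: "w \<bullet> \<nu> \<noteq> 0"
  shows "emeasure lebesgue (slab \<sigma> w) = surface_measure \<sigma> * ennreal (abs (w \<bullet> \<nu>))"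
proof -
  define s0 S c where "s0 = b - \<nu> \<bullet> q" and "S = section_set s0 \<sigma>" and "c = w \<bullet> \<nu>"
  have "c \<noteq> 0" using assms c_def by simp
  have "\<nu> \<bullet> (w - c *R \<nu>) = 0" by (simp add: inner_diff_right nunu c_def inner_commute)
  then obtain w0 where "w - c *R \<nu> = g w0" by (rule obtain_g)
  hence w: "w = c *R \<nu> + g w0" by (simp add: algebra_simps)
  have "compact S" unfolding S_def by (rule compact_section_set) fact
  define W where "W = (\<lambda>(y, s). (s0 + s * c, y + s *R w0)) ` (S \<times> {0..1})"
  have "compact W" unfolding W_def using `compact S`
	by (intro compact_continuous_image compact_Times) (auto intro!: continuous_intros simp: case_prod_unfold)
  have \<sigma>S: "\<sigma> = (\<lambda>y. chart (s0, y)) ` S" unfolding S_def s0_def by (rule chart_section_set) fact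
  have "chart (s0 + s * c, y + s *R w0) = chart (s0, y) + s *R w" for s y
	by (simp add: chart_def w algebra_simps linear_add[OF g(1)] linear_cmul[OF g(1)])
  hence "slab \<sigma> w = chart ` W" unfolding slab_def W_def by (subst \<sigma>S) (force simp: image_iff)
  hence "emeasure lebesgue (slab \<sigma> w) = (NBINT r. emeasure lborel {y. (r, y) \<in> W})"
	using emeasure_chart[OF `compact W`] emeasure_Times_slices[OF `compact W`] by simp
  also have "... = (NBINT r. surface_measure \<sigma> * indicator {min s0 (s0 + c)..max s0 (s0 + c)} r)"
  proof (rule nn_integral_cong)
	fix r
	have *: "r = s0 + s * c \<longleftrightarrow> s = (r - s0) / c" for s using `c \<noteq> 0` by (auto simp: field_simps)
	have iff: "r \<in> {min s0 (s0 + c)..max s0 (s0 + c)} \<longleftrightarrow> (r - s0) / c \<in> {0..1}"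
	  using `c \<noteq> 0` by (cases "c > 0") (auto simp: divide_le_eq le_divide_eq zero_le_divide_iff)
	have Wiff: "(r, y) \<in> W \<longleftrightarrow> (\<exists>x\<in>S. \<exists>s\<in>{0..1}. s = (r - s0) / c \<and> y = x + s *R w0)" for y
	  unfolding W_def *[symmetric] by auto
	show "emeasure lborel {y. (r, y) \<in> W} = surface_measure \<sigma> * indicator {min s0 (s0 + c)..max s0 (s0 + c)} r"
	proof (cases "(r - s0) / c \<in> {0..1}")
	  case True
	  hence "{y. (r, y) \<in> W} = (\<lambda>y. 1 *R y + ((r - s0) / c) *R w0) ` S" using Wiff by auto
	  hence "emeasure lebesgue {y. (r, y) \<in> W} = emeasure lebesgue S" using emeasure_lebesgue_affine[of 1 "((r - s0) / c) *R w0" S] by simp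
	  moreover have "{y. (r, y) \<in> W} \<in> sets borel"
	  proof -
		have "{y. (r, y) \<in> W} = Pair r -` W" by auto
		moreover have "closed (Pair r -` W)" using compact_imp_closed[OF `compact W`] by (intro closed_vimage) (auto intro!: continuous_intros)
		ultimately show ?thesis by simp
	  qed
	  ultimately have "emeasure lborel {y. (r, y) \<in> W} = emeasure lborel S" using borel_compact[OF `compact S`] by simp
	  thus ?thesis using True iff surface_measure_section[OF \<sigma>] by (simp add: S_def s0_def)
	next
	  case False
	  hence "{y. (r, y) \<in> W} = {}" using Wiff by auto
	  hence "emeasure lborel {y. (r, y) \<in> W} = 0" by (simp only: emeasure_empty)
	  with False iff show ?thesis by (simp only: indicator_simps mult_zero_right simp_thms)
	qed
  qed
  also have "... = surface_measure \<sigma> * ennreal (abs c)" by (subst nn_integral_cmult) (auto simp: abs_if min_def max_def)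
  finally show ?thesis by (simp add: c_def)
qed

text \<open>At height s above the apex the section is the base scaled by s / \<delta>, of measure (s
  / \<delta>)^(d-1) times that of the base; integration over [0, \<delta>] gives the factor \<delta>
  / d.\<close>

lemma emeasure_cone_over:
  assumes \<sigma>: "compact \<sigma>" "\<sigma> \<subseteq> plane \<nu> b" and b: "\<nu> \<bullet> q < b"
  shows "emeasure lebesgue (cone_over q \<sigma>) = surface_measure \<sigma> * ennreal ((b - \<nu> \<bullet> q) / DIM('a))"
proof -
  define \<delta> S where "\<delta> = b - \<nu> \<bullet> q" and "S = section_set \<delta> \<sigma>"
  let ?n = "DIM('a) - 1"
  have n: "DIM(real ^ 'a codim1) = ?n" using CARD_codim1[OF dim2] by simp
  have "\<delta> > 0" using b by (simp add: \<delta>_def)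
  have "compact S" unfolding S_def by (rule compact_section_set) fact
  define W where "W = (\<lambda>(y, r). (r * \<delta>, r *R y)) ` (S \<times> {0..1})"
  have "compact W" unfolding W_def using `compact S`
	by (intro compact_continuous_image compact_Times) (auto intro!: continuous_intros simp: case_prod_unfold)
  have \<sigma>S: "\<sigma> = (\<lambda>y. chart (\<delta>, y)) ` S" unfolding S_def \<delta>_def by (rule chart_section_set) fact
  have "chart (r * \<delta>, r *R y) = q + r *R (chart (\<delta>, y) - q)" for r y by (simp add: chart_def algebra_simps linear_cmul[OF g(1)])
  hence "cone_over q \<sigma> = chart ` W" unfolding cone_over_def W_def by (subst \<sigma>S) (force simp: image_iff)
  hence "emeasure lebesgue (cone_over q \<sigma>) = (NBINT s. emeasure lborel {y. (s, y) \<in> W})"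
	using emeasure_chart[OF `compact W`] emeasure_Times_slices[OF `compact W`] by simp
  also have "... = (NBINT s. surface_measure \<sigma> * (ennreal ((s / \<delta>) ^ ?n) * indicator {0..\<delta>} s))"
  proof (rule nn_integral_cong)
	fix s
	have *: "s = r * \<delta> \<longleftrightarrow> r = s / \<delta>" for r using `\<delta> > 0` by (auto simp: field_simps)
	have iff: "s \<in> {0..\<delta>} \<longleftrightarrow> s / \<delta> \<in> {0..1}" using `\<delta> > 0` by (auto simp: field_simps)
	have Wiff: "(s, y) \<in> W \<longleftrightarrow> (\<exists>x\<in>S. \<exists>r\<in>{0..1}. r = s / \<delta> \<and> y = r *R x)" for y
	  unfolding W_def *[symmetric] by auto
	show "emeasure lborel {y. (s, y) \<in> W} = surface_measure \<sigma> * (ennreal ((s / \<delta>) ^ ?n) * indicator {0..\<delta>} s)"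
	proof (cases "s / \<delta> \<in> {0..1}")
	  case True
	  hence "{y. (s, y) \<in> W} = (\<lambda>y. (s / \<delta>) *R y + 0) ` S" using Wiff by auto
	  hence "emeasure lebesgue {y. (s, y) \<in> W} = ennreal ((s / \<delta>) ^ ?n) * emeasure lebesgue S"
		using emeasure_lebesgue_affine[of "s / \<delta>" 0 S] True unfolding n by (simp only: atLeastAtMost_iff abs_of_nonneg)
	  moreover have "{y. (s, y) \<in> W} \<in> sets borel"
	  proof -
		have "{y. (s, y) \<in> W} = Pair s -` W" by auto
		moreover have "closed (Pair s -` W)" using compact_imp_closed[OF `compact W`] by (intro closed_vimage) (auto intro!: continuous_intros)
		ultimately show ?thesis by simp
	  qed
	  ultimately have "emeasure lborel {y. (s, y) \<in> W} = ennreal ((s / \<delta>) ^ ?n) * emeasure lborel S"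
		using borel_compact[OF `compact S`] by simp
	  thus ?thesis using True iff surface_measure_section[OF \<sigma>] by (simp add: S_def \<delta>_def mult_ac)
	next
	  case False
	  hence "{y. (s, y) \<in> W} = {}" using Wiff by auto
	  hence "emeasure lborel {y. (s, y) \<in> W} = 0" by (simp only: emeasure_empty)
	  with False iff show ?thesis by (simp only: indicator_simps mult_zero_right simp_thms)
	qed
  qed
  also have "... = surface_measure \<sigma> * (NBINT s. ennreal ((s / \<delta>) ^ ?n) * indicator {0..\<delta>} s)"
	by (rule nn_integral_cmult) measurable
  also have "(NBINT s. ennreal ((s / \<delta>) ^ ?n) * indicator {0..\<delta>} s)
	 = ennreal (\<delta> * (\<delta> / \<delta>) ^ (Suc ?n) / Suc ?n - \<delta> * (0 / \<delta>) ^ (Suc ?n) / Suc ?n)"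
  proof (rule nn_integral_FTC_Icc[where F = "\<lambda>s. \<delta> * (s / \<delta>) ^ (Suc ?n) / Suc ?n"])
	fix s assume "s \<in> {0..\<delta>}"
	hence "0 \<le> s" by simp
	have "((\<lambda>s. \<delta> * (s / \<delta>) ^ (Suc ?n) / Suc ?n) has_real_derivative
		\<delta> * (real (Suc ?n) * ((1 / \<delta>) * (s / \<delta>) ^ (Suc ?n - Suc 0))) / Suc ?n) (at s)"
	  by (intro DERIV_cdivide DERIV_cmult DERIV_power DERIV_ident)
	also have "\<delta> * (real (Suc ?n) * ((1 / \<delta>) * (s / \<delta>) ^ (Suc ?n - Suc 0))) / Suc ?n = (s / \<delta>) ^ ?n"
	  using `\<delta> > 0` by (simp del: of_nat_Suc)
	finally show "((\<lambda>s. \<delta> * (s / \<delta>) ^ (Suc ?n) / Suc ?n) has_real_derivative (s / \<delta>) ^ ?n) (at s)" .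
	show "0 \<le> (s / \<delta>) ^ ?n" using `0 \<le> s` `\<delta> > 0` by simp
  qed (use \<open>\<delta> > 0\<close> in auto)
  also have "\<delta> * (\<delta> / \<delta>) ^ (Suc ?n) / Suc ?n - \<delta> * (0 / \<delta>) ^ (Suc ?n) / Suc ?n = \<delta> / DIM('a)"
	using `\<delta> > 0` by simp
  finally show ?thesis by (simp add: \<delta>_def)
qed

end

lemma one_dim_orthogonal_zero:
  fixes \<nu> :: "'a::euclidean_space"
  assumes "norm \<nu> = 1" "DIM('a) < 2"
  shows "x = (x \<bullet> \<nu>) *R \<nu>"
proof -
  have "\<nu> \<noteq> 0" "\<nu> \<bullet> \<nu> = 1" using assms by (auto simp: norm_eq_1)
  hence "dim (plane \<nu> 0) = 0" using assms by (simp add: dim_hyperplane)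
  hence "plane \<nu> 0 \<subseteq> {0}" by (simp only: dim_eq_0)
  moreover have "\<nu> \<bullet> (x - (x \<bullet> \<nu>) *R \<nu>) = 0" by (simp add: inner_diff_right `\<nu> \<bullet> \<nu> = 1` inner_commute)
  ultimately show ?thesis by auto
qed

lemma one_dim_hyperplane_subset:
  fixes \<sigma> :: "'a::euclidean_space set"
  assumes "norm \<nu> = 1" "DIM('a) < 2" "\<sigma> \<subseteq> plane \<nu> b"
  shows "\<sigma> = {} \<or> \<sigma> = {b *R \<nu>}"
  using assms(3) one_dim_orthogonal_zero[OF assms(1,2)] by (auto simp: inner_commute) (metis+)?

lemma one_dim_segment:
  fixes \<nu> p :: "'a::euclidean_space"
  assumes "norm \<nu> = 1" "DIM('a) < 2"
  shows "emeasure lebesgue ((\<lambda>s. p + (s * c) *R \<nu>) ` {0..1}) = ennreal (abs c)"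
proof -
  have "DIM(real) = DIM('a)" using assms(2) DIM_positive[where 'a = 'a] unfolding DIM_real by linarith
  moreover have "dist (p + s *R \<nu>) (p + r *R \<nu>) = dist s r" for s r using assms(1) by (simp add: dist_norm flip: scaleR_diff_left)
  ultimately have iso: "emeasure lebesgue ((\<lambda>s. p + s *R \<nu>) ` I) = emeasure lebesgue I" if "compact I" for I
  proof (intro emeasure_lebesgue_isometry)
	have "compact ((\<lambda>s. p + s *R \<nu>) ` I)" by (rule compact_continuous_image) (auto intro!: continuous_intros that)
	thus "(\<lambda>s. p + s *R \<nu>) ` I \<in> sets lebesgue" by (simp add: lmeasurable_compact fmeasurableD)
  qed (use that in \<open>auto simp: lmeasurable_compact fmeasurableD\<close>)
  have "(\<lambda>s. p + (s * c) *R \<nu>) ` {0..1} = (\<lambda>s. p + s *R \<nu>) ` ((\<lambda>s. c *R s + 0) ` {0..1})"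
	by (simp add: image_image mult.commute)
  also have "emeasure lebesgue ... = emeasure lebesgue ((\<lambda>s. c *R s + 0) ` {0..1::real})"
	by (intro iso compact_continuous_image) (auto intro!: continuous_intros)
  also have "... = ennreal (abs c)" by (subst emeasure_lebesgue_affine) simp
  finally show ?thesis .
qed

theorem emeasure_slab:
  fixes \<sigma> :: "'a::euclidean_space set"
  assumes \<sigma>: "compact \<sigma>" "\<sigma> \<subseteq> plane \<nu> b" and \<nu>: "norm \<nu> = 1" and w: "w \<bullet> \<nu> \<noteq> 0"
  shows "emeasure lebesgue (slab \<sigma> w) = surface_measure \<sigma> * ennreal (abs (w \<bullet> \<nu>))"
proof (cases "DIM('a) \<ge> 2")
  case True
  obtain g :: "real ^ 'a codim1 => 'a" where g: "linear g" "\<And>y. norm (g y) = norm y" "range g = plane \<nu> 0"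
	using hyperplane_isometry[OF \<nu> True] by blast
  interpret hyperplane_chart \<nu> g 0 by (rule hyperplane_chart.intro[OF \<nu> True g])
  show ?thesis by (rule emeasure_slab) fact+
next
  case False
  hence d: "DIM('a) < 2" by simp
  consider "\<sigma> = {}" | "\<sigma> = {b *R \<nu>}" using one_dim_hyperplane_subset[OF \<nu> d \<sigma>(2)] by blast
  thus ?thesis
  proof cases
	case 2
	have "(\<lambda>s. b *R \<nu> + (s * (w \<bullet> \<nu>)) *R \<nu>) = (\<lambda>s. b *R \<nu> + s *R w)"
	  using one_dim_orthogonal_zero[OF \<nu> d, of w] by (metis scaleR_scaleR)
	moreover have "slab \<sigma> w = (\<lambda>s. b *R \<nu> + s *R w) ` {0..1}" by (auto simp: slab_def 2)
	ultimately have "slab \<sigma> w = (\<lambda>s. b *R \<nu> + (s * (w \<bullet> \<nu>)) *R \<nu>) ` {0..1}" by (simp only:)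
	moreover have "DIM('a) - 1 = 0" using d by simp
	ultimately show ?thesis using one_dim_segment[OF \<nu> d] by (simp add: surface_measure_def 2 hausdorff_measure_0_singleton)
  qed (simp add: slab_def surface_measure_def)
qed

lemma emeasure_cone_over:
  fixes \<sigma> :: "'a::euclidean_space set"
  assumes \<sigma>: "compact \<sigma>" "\<sigma> \<subseteq> plane \<nu> b" and \<nu>: "norm \<nu> = 1" and b: "\<nu> \<bullet> q < b"
  shows "emeasure lebesgue (cone_over q \<sigma>) = surface_measure \<sigma> * ennreal ((b - \<nu> \<bullet> q) / DIM('a))"
proof (cases "DIM('a) \<ge> 2")
  case True
  obtain g :: "real ^ 'a codim1 => 'a" where g: "linear g" "\<And>y. norm (g y) = norm y" "range g = plane \<nu> 0"
	using hyperplane_isometry[OF \<nu> True] by blast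
  interpret hyperplane_chart \<nu> g q by (rule hyperplane_chart.intro[OF \<nu> True g])
  show ?thesis by (rule emeasure_cone_over) fact+
next
  case False
  hence d: "DIM('a) < 2" by simp
  consider "\<sigma> = {}" | "\<sigma> = {b *R \<nu>}" using one_dim_hyperplane_subset[OF \<nu> d \<sigma>(2)] by blast
  thus ?thesis
  proof cases
	case 2
	have "b *R \<nu> - q = (b - \<nu> \<bullet> q) *R \<nu>"
	  using one_dim_orthogonal_zero[OF \<nu> d, of q] by (simp add: scaleR_diff_left inner_commute)
	hence "(\<lambda>s. q + (s * (b - \<nu> \<bullet> q)) *R \<nu>) = (\<lambda>s. q + s *R (b *R \<nu> - q))" by (metis scaleR_scaleR)
	moreover have "cone_over q \<sigma> = (\<lambda>s. q + s *R (b *R \<nu> - q)) ` {0..1}" by (auto simp: cone_over_def 2)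
	ultimately have "cone_over q \<sigma> = (\<lambda>s. q + (s * (b - \<nu> \<bullet> q)) *R \<nu>) ` {0..1}" by (simp only:)
	moreover have "DIM('a) - 1 = 0" "DIM('a) = 1" using d DIM_positive[where 'a = 'a] by linarith+
	ultimately show ?thesis using one_dim_segment[OF \<nu> d] b by (simp add: surface_measure_def 2 hausdorff_measure_0_singleton)
  qed (simp add: cone_over_def surface_measure_def)
qed

text \<open>The prism with unit edge over the face is compact. Consequently \<open>enn2real\<close>
  loses nothing when applied to the measure of a face.\<close>

lemma surface_measure_finite:
  fixes \<sigma> :: "'a::euclidean_space set"
  assumes \<sigma>: "compact \<sigma>" "\<sigma> \<subseteq> plane \<nu> b" and \<nu>: "norm \<nu> = 1"
  shows "surface_measure \<sigma> < \<infinity>"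
proof -
  have "emeasure lebesgue (slab \<sigma> \<nu>) < \<infinity>"
	using compact_slab[OF \<sigma>(1)] lmeasurable_compact by (auto simp: fmeasurable_def)
  moreover have "\<nu> \<bullet> \<nu> = 1" using \<nu> by (simp add: norm_eq_1)
  ultimately show ?thesis using emeasure_slab[OF \<sigma> \<nu>, of \<nu>] by simp
qed

lemma measure_slab:
  fixes \<sigma> :: "'a::euclidean_space set"
  assumes \<sigma>: "compact \<sigma>" "\<sigma> \<subseteq> plane \<nu> b" and \<nu>: "norm \<nu> = 1" and w: "w \<bullet> \<nu> \<noteq> 0"
  shows "vol (slab \<sigma> w) = enn2real (surface_measure \<sigma>) * abs (w \<bullet> \<nu>)"
  using emeasure_slab[OF assms] by (simp add: measure_def enn2real_mult)

lemma measure_cone_over: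
  fixes \<sigma> :: "'a::euclidean_space set"
  assumes \<sigma>: "compact \<sigma>" "\<sigma> \<subseteq> plane \<nu> b" and \<nu>: "norm \<nu> = 1" and b: "\<nu> \<bullet> q < b"
  shows "vol (cone_over q \<sigma>) = enn2real (surface_measure \<sigma>) * (b - \<nu> \<bullet> q) / DIM('a)"
  using emeasure_cone_over[OF assms] b by (simp add: measure_def enn2real_mult)

text \<open>Since \<open>\<sigma>\<close> has positive measure, it is contained in only one hyperplane.\<close>

lemma orthogonal_to_face_parallel:
  fixes \<sigma> :: "'a::euclidean_space set"
  assumes \<sigma>: "compact \<sigma>" "\<sigma> \<subseteq> plane \<nu> b" and \<nu>: "norm \<nu> = 1" and pos: "surface_measure \<sigma> > 0"
	and v: "orthogonal_to_face v \<sigma>"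
  shows "v = (v \<bullet> \<nu>) *R \<nu>"
proof (rule ccontr)
  assume "v \<noteq> (v \<bullet> \<nu>) *R \<nu>"
  define v' where "v' = v - (v \<bullet> \<nu>) *R \<nu>"
  have nunu: "\<nu> \<bullet> \<nu> = 1" using \<nu> by (simp add: norm_eq_1)
  have "v' \<noteq> 0" using `v \<noteq> _` by (simp add: v'_def)
  have "v' \<bullet> \<nu> = 0" by (simp add: v'_def inner_diff_left nunu)
  have "\<sigma> \<noteq> {}" using pos by (auto simp: surface_measure_def)
  then obtain y0 where y0: "y0 \<in> \<sigma>" by auto
  have "v' \<bullet> y = v' \<bullet> y0" if "y \<in> \<sigma>" for y
  proof -
	have "v \<bullet> (y - y0) = 0" using v that y0 by (auto simp: orthogonal_to_face_def orthogonal_def)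
	moreover have "\<nu> \<bullet> (y - y0) = 0" using \<sigma>(2) that y0 by (auto simp: inner_diff_right)
	ultimately show ?thesis by (simp add: v'_def inner_diff_left inner_diff_right algebra_simps)
  qed
  hence "slab \<sigma> \<nu> \<subseteq> {x. v' \<bullet> x = v' \<bullet> y0}"
	using `v' \<bullet> \<nu> = 0` by (auto simp: slab_def inner_add_right)
  moreover have "negligible {x. v' \<bullet> x = v' \<bullet> y0}" using `v' \<noteq> 0` by (intro negligible_hyperplane) auto
  ultimately have "negligible (slab \<sigma> \<nu>)" by (rule negligible_subset[rotated])
  hence "emeasure lebesgue (slab \<sigma> \<nu>) = 0" unfolding negligible_iff_null_sets by (rule null_setsD1)
  thus False using emeasure_slab[OF \<sigma> \<nu>, of \<nu>] nunu pos by simp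
qed

lemma open_convex_separation:
  fixes K L :: "'a::euclidean_space set"
  assumes "open K" "open L" "convex K" "convex L" "K \<noteq> {}" "L \<noteq> {}" "K \<inter> L = {}"
  obtains \<nu> b where "norm \<nu> = 1" "K \<subseteq> below \<nu> b" "L \<subseteq> above \<nu> b"
proof -
  obtain a b where ab: "a \<noteq> 0" "\<forall>x\<in>K. a \<bullet> x \<le> b" "\<forall>x\<in>L. a \<bullet> x \<ge> b"
	using separating_hyperplane_sets[of K L] assms by auto
  have "K \<subseteq> interior {x. a \<bullet> x \<le> b}" using ab assms by (intro interior_maximal) auto
  hence K: "\<And>x. x \<in> K ==> a \<bullet> x < b" using ab(1) by (auto simp: interior_halfspace_le)
  have "L \<subseteq> interior {x. a \<bullet> x \<ge> b}" using ab assms by (intro interior_maximal) auto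
  hence L: "\<And>x. x \<in> L ==> a \<bullet> x > b" using ab(1) by (auto simp: interior_halfspace_ge)
  show thesis
  proof (rule that[of "a /\<^sub>R norm a" "b / norm a"])
	show "norm (a /\<^sub>R norm a) = 1" using ab(1) by simp
  qed (use K L ab(1) in \<open>auto simp: field_simps divide_inverse_commute[symmetric]\<close>)
qed

lemma closure_subset_halfspaces:
  fixes \<nu> :: "'a::euclidean_space"
  assumes "K \<subseteq> below \<nu> b" "L \<subseteq> above \<nu> b"
  shows "closure K \<subseteq> {x. \<nu> \<bullet> x \<le> b}" "closure L \<subseteq> {x. \<nu> \<bullet> x \<ge> b}" "face K L \<subseteq> plane \<nu> b"
proof -
  show 1: "closure K \<subseteq> {x. \<nu> \<bullet> x \<le> b}"
	using assms by (intro closure_minimal) (auto simp: closed_halfspace_le less_imp_le)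
  show 2: "closure L \<subseteq> {x. \<nu> \<bullet> x \<ge> b}"
	using assms by (intro closure_minimal) (auto simp: closed_halfspace_ge less_imp_le)
  show "face K L \<subseteq> plane \<nu> b" using 1 2 by force
qed

text \<open>Replaces the image by a pointwise condition: base point and parameter are functions of
  x. In this form slabs commute with intersections of their bases, which
  \<open>fattened_limit\<close> needs.\<close>

lemma slab_eq:
  assumes "\<sigma> \<subseteq> plane \<nu> b" "w \<bullet> \<nu> \<noteq> 0"
  shows "slab \<sigma> w = {x. (\<nu> \<bullet> x - b) / (w \<bullet> \<nu>) \<in> {0..1} \<and> x - ((\<nu> \<bullet> x - b) / (w \<bullet> \<nu>)) *R w \<in> \<sigma>}"
proof (intro set_eqI iffI)
  fix x assume "x \<in> slab \<sigma> w"
  then obtain y s where ys: "y \<in> \<sigma>" "s \<in> {0..1}" "x = y + s *R w" unfolding slab_def by auto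
  hence "\<nu> \<bullet> y = b" using assms by auto
  hence "(\<nu> \<bullet> x - b) / (w \<bullet> \<nu>) = s" using ys assms by (simp add: inner_add_right inner_commute)
  thus "x \<in> {x. (\<nu> \<bullet> x - b) / (w \<bullet> \<nu>) \<in> {0..1} \<and> x - ((\<nu> \<bullet> x - b) / (w \<bullet> \<nu>)) *R w \<in> \<sigma>}"
	using ys by simp
next
  fix x assume "x \<in> {x. (\<nu> \<bullet> x - b) / (w \<bullet> \<nu>) \<in> {0..1} \<and> x - ((\<nu> \<bullet> x - b) / (w \<bullet> \<nu>)) *R w \<in> \<sigma>}"
  thus "x \<in> slab \<sigma> w" unfolding slab_def
	by (intro image_eqI[of _ _ "(x - ((\<nu> \<bullet> x - b) / (w \<bullet> \<nu>)) *R w, (\<nu> \<bullet> x - b) / (w \<bullet> \<nu>))"]) auto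
qed

text \<open>Starting at z, the direction -e leads into K at once. The point z is slightly overshot
  to y, away from the point k' where the line through the inner point k in direction e meets the
  hyperplane; y is still in the closure of K, and the segment from y to k meets the ray at z - r0 e.
  Convexity gives the smaller parameters.\<close>

lemma ray_enters_cell:
  fixes K :: "'a::euclidean_space set"
  assumes K: "open K" "convex K" "k \<in> K" "K \<subseteq> below \<nu> b" and z: "\<nu> \<bullet> z = b" and "\<rho> > 0"
	and ball: "{y. \<nu> \<bullet> y = b} \<inter> ball z \<rho> \<subseteq> closure K" and c: "e \<bullet> \<nu> > 0"
  shows "\<exists>r0>0. \<forall>r. 0 < r \<and> r \<le> r0 \<longrightarrow> z - r *R e \<in> K"
proof -
  define \<beta> where "\<beta> = b - \<nu> \<bullet> k"
  have "\<beta> > 0" using K by (auto simp: \<beta>_def)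
  define k' where "k' = k + (\<beta> / (e \<bullet> \<nu>)) *R e"
  have k': "\<nu> \<bullet> k' = b" using c by (simp add: k'_def inner_add_right \<beta>_def inner_commute)
  define t where "t = \<rho> / (norm (z - k') + 1)"
  have "t > 0" using `\<rho> > 0` by (simp add: t_def add_nonneg_pos)
  have "t * (norm (z - k') + 1) = \<rho>" using add_nonneg_pos[OF norm_ge_zero[of "z - k'"] zero_less_one] by (simp add: t_def)
  hence "t * norm (z - k') < \<rho>" using `t > 0` by (simp add: algebra_simps)
  define y where "y = z + t *R (z - k')"
  have "y \<in> closure K" using ball `t * norm (z - k') < \<rho>` `t > 0`
	by (intro subsetD[OF ball]) (auto simp: y_def dist_norm inner_add_right inner_diff_right z k')
  have "t / (1 + t) > 0" "t / (1 + t) \<le> 1" using `t > 0` by auto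
  with mem_interior_closure_convex_shrink[OF K(2) _ `y \<in> closure K`, of k "t / (1 + t)"]
  have in_K: "y - (t / (1 + t)) *R (y - k) \<in> K" using K by (simp add: interior_open)
  define r0 where "r0 = t / (1 + t) * (\<beta> / (e \<bullet> \<nu>))"
  have "r0 > 0" using `t > 0` `\<beta> > 0` c by (simp add: r0_def)
  have "(1 + t) *R (y - (t / (1 + t)) *R (y - k)) = (1 + t) *R (z - r0 *R e)"
  proof -
	have "(1 + t) *R (y - (t / (1 + t)) *R (y - k)) = (1 + t) *R y - t *R (y - k)" using `t > 0` by (simp add: scaleR_diff_right)
	also have "... = y + t *R k" by (simp add: algebra_simps)
	also have "... = (1 + t) *R z - (t * (\<beta> / (e \<bullet> \<nu>))) *R e" by (simp add: y_def k'_def algebra_simps)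
	also have "t * (\<beta> / (e \<bullet> \<nu>)) = (1 + t) * r0" using `t > 0` by (simp add: r0_def)
	finally show ?thesis by (simp add: scaleR_diff_right)
  qed
  hence "y - (t / (1 + t)) *R (y - k) = z - r0 *R e" using `t > 0` by simp
  with in_K have zr0: "z - r0 *R e \<in> K" by simp
  have "z \<in> closure K" using ball z `\<rho> > 0` by auto
  have "z - r *R e \<in> K" if "0 < r" "r \<le> r0" for r
	using mem_interior_closure_convex_shrink[OF K(2) _ `z \<in> closure K`, of "z - r0 *R e" "r / r0"] that `r0 > 0` K(1) zr0
	by (simp add: interior_open)
  thus ?thesis using `r0 > 0` by blast
qed

text \<open>The unit prism over \<sigma> is convex and not null, hence has an interior point. A ball
  around it, moved back along \<nu>, meets the hyperplane inside \<sigma>.\<close>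

lemma surface_measure_pos_interior_point:
  fixes \<sigma> :: "'a::euclidean_space set"
  assumes \<sigma>: "compact \<sigma>" "\<sigma> \<subseteq> plane \<nu> b" "convex \<sigma>" and \<nu>: "norm \<nu> = 1" and pos: "surface_measure \<sigma> > 0"
  obtains z \<rho> where "\<nu> \<bullet> z = b" "\<rho> > 0" "{y. \<nu> \<bullet> y = b} \<inter> ball z \<rho> \<subseteq> \<sigma>"
proof -
  have nunu: "\<nu> \<bullet> \<nu> = 1" using \<nu> by (simp add: norm_eq_1)
  have "convex (slab \<sigma> \<nu>)"
  proof -
	have "slab \<sigma> \<nu> = (\<Union>x\<in>\<sigma>. \<Union>y\<in>(\<lambda>s. s *R \<nu>) ` {0..1}. {x + y})" by (auto simp: slab_def)
	moreover have "convex ((\<lambda>s. s *R \<nu>) ` {0..1::real})" by (intro convex_linear_image linear_scale_left) auto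
	ultimately show ?thesis using convex_sums[OF `convex \<sigma>`] by (simp only:)
  qed
  moreover have "\<not> negligible (slab \<sigma> \<nu>)"
  proof
	assume "negligible (slab \<sigma> \<nu>)"
	hence "emeasure lebesgue (slab \<sigma> \<nu>) = 0" unfolding negligible_iff_null_sets by (rule null_setsD1)
	thus False using emeasure_slab[OF \<sigma>(1,2) \<nu>, of \<nu>] nunu pos by simp
  qed
  ultimately have "interior (slab \<sigma> \<nu>) \<noteq> {}" by (simp add: negligible_convex_interior)
  then obtain x0 \<rho> where \<rho>: "\<rho> > 0" "ball x0 \<rho> \<subseteq> slab \<sigma> \<nu>" by (auto simp: mem_interior)
  hence "x0 \<in> slab \<sigma> \<nu>" by auto
  then obtain z s0 where z: "z \<in> \<sigma>" "x0 = z + s0 *R \<nu>" unfolding slab_def by auto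
  have "y \<in> \<sigma>" if y: "\<nu> \<bullet> y = b" "y \<in> ball z \<rho>" for y
  proof -
	have "y + s0 *R \<nu> \<in> slab \<sigma> \<nu>" using y z by (intro subsetD[OF \<rho>(2)]) (simp add: dist_norm)
	then obtain y1 s1 where y1: "y1 \<in> \<sigma>" "y + s0 *R \<nu> = y1 + s1 *R \<nu>" unfolding slab_def by auto
	hence "\<nu> \<bullet> (y + s0 *R \<nu>) = \<nu> \<bullet> (y1 + s1 *R \<nu>)" by simp
	moreover have "\<nu> \<bullet> y1 = b" using y1 \<sigma> by auto
	ultimately have "s0 = s1" using y by (simp add: inner_add_right nunu)
	thus ?thesis using y1 by simp
  qed
  hence "{y. \<nu> \<bullet> y = b} \<inter> ball z \<rho> \<subseteq> \<sigma>" by blast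
  moreover have "\<nu> \<bullet> z = b" using z \<sigma>(2) by auto
  ultimately show thesis using that \<rho>(1) by blast
qed

section \<open>Translates across the common face of two convex cells\<close>

text \<open>Two separated convex cells that need not share a proper face: \<sigma> may be null or
  empty, in which case \<open>face_area\<close> is 0.\<close>

locale adjacent_cells =
  fixes K L :: "'a::euclidean_space set" and \<nu> :: 'a and b :: real
  assumes K: "open K" "convex K" "bounded K" "K \<noteq> {}" "K \<subseteq> below \<nu> b"
	and L: "open L" "convex L" "bounded L" "L \<noteq> {}" "L \<subseteq> above \<nu> b"
	and \<nu>: "norm \<nu> = 1"
begin

abbreviation \<sigma> where "\<sigma> \<equiv> face K L"

definition face_area :: real where "face_area = enn2real (surface_measure \<sigma>)"

lemma \<sigma>: "compact \<sigma>" "\<sigma> \<subseteq> plane \<nu> b" "convex \<sigma>" using K L closure_subset_halfspaces[OF K(5) L(5)]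
  by (auto simp: compact_Int_closed convex_Int convex_closure)

lemma face_area_nonneg: "face_area \<ge> 0" by (simp add: face_area_def)

definition crossing :: "'a => 'a set" where "crossing e = {x\<in>K. x + e \<in> L}"

lemma crossing_eq: "crossing e = K \<inter> (\<lambda>x. x + e) -` L" by (auto simp: crossing_def)

lemma crossing_lmeasurable: "crossing e \<in> lmeasurable"
proof -
  have "open ((\<lambda>x. x + e) -` L)" using L(1) by (intro open_vimage) (auto intro!: continuous_intros)
  hence "open (crossing e)" "bounded (crossing e)" unfolding crossing_eq using K by auto
  thus ?thesis by (simp add: lmeasurable_open)
qed

lemma crossing_empty: "e \<bullet> \<nu> \<le> 0 ==> crossing e = {}"
proof (rule ccontr)
  assume e: "e \<bullet> \<nu> \<le> 0" and "crossing e \<noteq> {}"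
  then obtain x where "x \<in> K" "x + e \<in> L" by (auto simp: crossing_def)
  hence "\<nu> \<bullet> x < b" "\<nu> \<bullet> (x + e) > b" using K(5) L(5) by auto
  with e show False by (simp add: inner_add_right inner_commute)
qed

text \<open>Every segment of length at most r from K to L meets the hyperplane in this set. It is an
  outer approximation that shrinks to \<sigma> as r tends to 0, because the closures of K and L meet
  exactly in \<sigma>.\<close>

definition fattened :: "real => 'a set" where
  "fattened r = plane \<nu> b \<inter> {x. infdist x K \<le> r} \<inter> {x. infdist x L \<le> r}"

lemma compact_fattened: "compact (fattened r)"
proof -
  have "closed (fattened r)" unfolding fattened_def by (intro closed_Int closed_hyperplane closed_Collect_le continuous_intros)
  moreover have "bounded (fattened r)"
  proof -
	obtain B where B: "\<And>x. x \<in> K ==> norm x \<le> B" using K(3) unfolding bounded_iff by auto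
	have "norm x \<le> B + (abs r + 1)" if "x \<in> fattened r" for x
	proof -
	  have "infdist x K < abs r + 1" using that by (auto simp: fattened_def)
	  hence "\<exists>y\<in>K. dist x y < abs r + 1" using K(4) by (simp add: infdist_notempty cINF_less_iff)
	  then obtain y where "y \<in> K" "dist x y < abs r + 1" ..
	  thus ?thesis using B[of y] norm_triangle_sub[of x y] by (simp add: dist_norm)
	qed
	thus ?thesis unfolding bounded_iff by blast
  qed
  ultimately show ?thesis by (simp add: compact_eq_bounded_closed)
qed

lemma fattened_Inter: assumes "C \<ge> 0" shows "(\<Inter>n. fattened (C / real (Suc n))) = \<sigma>"
proof
  have "x \<in> \<sigma>" if x: "\<And>n. x \<in> fattened (C / real (Suc n))" for x
  proof -
	have lim: "(\<lambda>n. C / real (Suc n)) ----> 0" using LIMSEQ_Suc[OF lim_const_over_n[of C]] by simp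
	have "infdist x K \<le> 0" "infdist x L \<le> 0" using x by (auto intro!: LIMSEQ_le_const[OF lim] simp: fattened_def)
	hence "infdist x K = 0" "infdist x L = 0" using infdist_nonneg[of x] by (auto intro: antisym)
	thus ?thesis using K(4) L(4) by (simp add: in_closure_iff_infdist_zero)
  qed
  thus "(\<Inter>n. fattened (C / real (Suc n))) \<subseteq> \<sigma>" by blast
next
  have "x \<in> fattened (C / real (Suc n))" if "x \<in> \<sigma>" for x n
	using that subsetD[OF \<sigma>(2) that] K(4) L(4) assms by (auto simp: fattened_def in_closure_iff_infdist_zero)
  thus "\<sigma> \<subseteq> (\<Inter>n. fattened (C / real (Suc n)))" by blast
qed

lemma crossing_subset_slab:
  assumes c: "e \<bullet> \<nu> > 0"
  shows "crossing e \<subseteq> slab (fattened (norm e)) (- e)"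
proof
  fix x assume "x \<in> crossing e"
  hence x: "x \<in> K" "x + e \<in> L" by (auto simp: crossing_def)
  \<comment> \<open>The parameter at which the segment from x to x + e meets the hyperplane.\<close>
  define s where "s = (b - \<nu> \<bullet> x) / (e \<bullet> \<nu>)"
  have lt: "\<nu> \<bullet> x < b" "b < \<nu> \<bullet> x + e \<bullet> \<nu>" using x K(5) L(5) by (auto simp: inner_add_right inner_commute)
  hence s: "0 \<le> s" "s \<le> 1" using c by (auto simp: s_def field_simps)
  let ?y = "x + s *R e"
  have "\<nu> \<bullet> ?y = b" using c by (simp add: s_def inner_add_right inner_commute)
  moreover have "infdist ?y K \<le> norm e"
  proof -
	have "infdist ?y K \<le> dist ?y x" using x by (intro infdist_le)
	also have "... = s * norm e" using s by (simp add: dist_norm)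
	also have "... \<le> norm e" using s by (intro mult_left_le_one_le) auto
	finally show ?thesis .
  qed
  moreover have "infdist ?y L \<le> norm e"
  proof -
	have "infdist ?y L \<le> dist ?y (x + e)" using x by (intro infdist_le)
	also have "... = norm ((s - 1) *R e)" by (simp add: dist_norm algebra_simps)
	also have "... = (1 - s) * norm e" using s by simp
	also have "... \<le> norm e" using s by (intro mult_left_le_one_le) auto
	finally show ?thesis .
  qed
  ultimately have "?y \<in> fattened (norm e)" by (simp add: fattened_def)
  thus "x \<in> slab (fattened (norm e)) (- e)" unfolding slab_def using s by (intro image_eqI[of _ _ "(?y, s)"]) auto
qed

lemma fattened_mono: "r \<le> r' ==> fattened r \<subseteq> fattened r'" by (auto simp: fattened_def)

lemma fattened_hyperplane: "fattened r \<subseteq> plane \<nu> b" by (auto simp: fattened_def)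

text \<open>Continuity from above is applied to the volumes of the slabs, which are finite; dividing
  by e . \<nu> transfers it to the surface measures.\<close>

lemma fattened_limit:
  assumes c: "e \<bullet> \<nu> > 0"
  shows "(\<lambda>n. enn2real (surface_measure (fattened (norm e / real (Suc n))))) ----> face_area"
proof -
  have c': "(- e) \<bullet> \<nu> \<noteq> 0" using c by simp
  let ?F = "\<lambda>n. fattened (norm e / real (Suc n))"
  have "(\<lambda>n. vol (slab (?F n) (- e))) ----> vol (\<Inter>n. slab (?F n) (- e))"
  proof (rule Lim_measure_decseq)
	show "range (\<lambda>n. slab (?F n) (- e)) \<subseteq> sets lebesgue"
	  using lmeasurable_compact[OF compact_slab[OF compact_fattened]] by (auto dest: fmeasurableD)
	show "emeasure lebesgue (slab (?F n) (- e)) \<noteq> \<infinity>" for n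
	  using lmeasurable_compact[OF compact_slab[OF compact_fattened]] fmeasurableD2 by (metis infinity_ennreal_def)
	have "?F (Suc n) \<subseteq> ?F n" for n by (intro fattened_mono divide_left_mono) auto
	thus "decseq (\<lambda>n. slab (?F n) (- e))" by (intro decseq_SucI) (force simp: slab_def)
  qed
  also have "(\<Inter>n. slab (?F n) (- e)) = slab \<sigma> (- e)"
  proof -
	have "(\<Inter>n. ?F n) \<subseteq> plane \<nu> b" using fattened_hyperplane by blast
	hence "(\<Inter>n. slab (?F n) (- e)) = slab (\<Inter>n. ?F n) (- e)" using slab_eq[OF _ c'] slab_eq[OF fattened_hyperplane c'] by auto
	thus ?thesis by (simp only: fattened_Inter[OF norm_ge_zero])
  qed
  finally have "(\<lambda>n. enn2real (surface_measure (?F n)) * (e \<bullet> \<nu>)) ----> face_area * (e \<bullet> \<nu>)"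
	using c measure_slab[OF compact_fattened fattened_hyperplane \<nu> c'] measure_slab[OF \<sigma>(1,2) \<nu> c'] by (simp add: face_area_def)
  from tendsto_divide[OF this tendsto_const, of "e \<bullet> \<nu>"] c show ?thesis by simp
qed

lemma crossing_upper:
  assumes c: "e \<bullet> \<nu> > 0"
  shows "real (Suc n) * vol (crossing (e /\<^sub>R real (Suc n)))
	 \<le> enn2real (surface_measure (fattened (norm e / real (Suc n)))) * (e \<bullet> \<nu>)"
proof -
  let ?e = "e /\<^sub>R real (Suc n)"
  have c1: "?e \<bullet> \<nu> > 0" using c by simp
  have norm: "norm ?e = norm e / real (Suc n)" by (simp add: divide_inverse_commute del: of_nat_Suc)
  have "vol (crossing ?e) \<le> vol (slab (fattened (norm ?e)) (- ?e))"
	using crossing_subset_slab[OF c1] crossing_lmeasurable[of ?e] lmeasurable_compact[OF compact_slab[OF compact_fattened]]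
	by (intro measure_mono_fmeasurable) (auto dest: fmeasurableD)
  also have "... = enn2real (surface_measure (fattened (norm ?e))) * (e \<bullet> \<nu>) / real (Suc n)"
	using c1 c by (subst measure_slab[OF compact_fattened fattened_hyperplane \<nu>])
	  (auto simp: field_simps simp del: of_nat_Suc)
  finally show ?thesis unfolding norm by (simp add: field_simps del: of_nat_Suc)
qed

text \<open>Inner approximation. The face is shrunk by 1 - \<epsilon> towards a relatively interior
  point z. Points of the prism over the shrunk face are convex combinations of a face point and a
  point z - r e in K, and after the translation of a face point and a point z + r' e in L; so they
  cross, for steps up to \<epsilon> r0.\<close>

lemma crossing_lower:
  assumes c: "e \<bullet> \<nu> > 0" and pos: "face_area > 0" and \<epsilon>: "0 < \<epsilon>" "\<epsilon> < 1"
  shows "\<forall>\<^sub>F n in sequentially. (1 - \<epsilon>) ^ (DIM('a) - 1) * face_area * (e \<bullet> \<nu>)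
	 \<le> real (Suc n) * vol (crossing (e /\<^sub>R real (Suc n)))"
proof -
  have "surface_measure \<sigma> > 0" using pos by (auto simp: face_area_def zero_less_iff_neq_zero)
  from surface_measure_pos_interior_point[OF \<sigma> \<nu> this] obtain z \<rho> where
	z: "\<nu> \<bullet> z = b" "\<rho> > 0" "{y. \<nu> \<bullet> y = b} \<inter> ball z \<rho> \<subseteq> \<sigma>" by blast
  obtain k where "k \<in> K" using K by auto
  obtain l where "l \<in> L" using L by auto
  have "z \<in> \<sigma>" using z by auto
  obtain r1 where r1: "r1 > 0" "\<And>r. 0 < r ==> r \<le> r1 ==> z - r *R e \<in> K"
	using ray_enters_cell[OF K(1,2) `k \<in> K` K(5) z(1,2) _ c] z(3) by auto
  obtain r2 where r2: "r2 > 0" "\<And>r. 0 < r ==> r \<le> r2 ==> z + r *R e \<in> L"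
	using ray_enters_cell[OF L(1,2) `l \<in> L`, of "- \<nu>" "- b" z \<rho> "- e"] z c L(5) by auto
  define r0 where "r0 = min r1 r2"
  have "r0 > 0" using r1 r2 by (simp add: r0_def)
  define \<tau> where "\<tau> = (\<lambda>y. (1 - \<epsilon>) *R y + \<epsilon> *R z) ` \<sigma>"
  have \<tau>: "compact \<tau>" unfolding \<tau>_def using \<sigma>(1) by (intro compact_continuous_image) (auto intro!: continuous_intros)
  have \<tau>H: "\<tau> \<subseteq> plane \<nu> b" unfolding \<tau>_def using \<sigma>(2) z(1) by (auto simp: inner_add_right algebra_simps)
  have c': "(- e) \<bullet> \<nu> \<noteq> 0" using c by simp
  \<comment> \<open>The whole prism scales by (1 - \<epsilon>)^d, and its edge accounts for one of
    the factors.\<close>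
  have area: "enn2real (surface_measure \<tau>) = (1 - \<epsilon>) ^ (DIM('a) - 1) * face_area"
  proof -
	have "slab \<tau> ((1 - \<epsilon>) *R (- e)) = (\<lambda>x. (1 - \<epsilon>) *R x + \<epsilon> *R z) ` slab \<sigma> (- e)"
	proof -
	  have "(1 - \<epsilon>) *R y + \<epsilon> *R z + s *R ((1 - \<epsilon>) *R (- e)) = (1 - \<epsilon>) *R (y + s *R (- e)) + \<epsilon> *R z" for y s
		by (simp add: algebra_simps)
	  thus ?thesis unfolding slab_def \<tau>_def by (force simp: image_iff)
	qed
	hence "vol (slab \<tau> ((1 - \<epsilon>) *R (- e))) = (1 - \<epsilon>) ^ DIM('a) * vol (slab \<sigma> (- e))"
	  using \<epsilon> by (simp add: measure_lebesgue_affine)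
	also have "... = (1 - \<epsilon>) ^ DIM('a) * (face_area * (e \<bullet> \<nu>))"
	  using measure_slab[OF \<sigma>(1,2) \<nu> c'] c by (simp add: face_area_def)
	also have "(1 - \<epsilon>) ^ DIM('a) = (1 - \<epsilon>) * (1 - \<epsilon>) ^ (DIM('a) - 1)"
	  using DIM_positive[where 'a = 'a] by (simp flip: power_Suc)
	finally show ?thesis using measure_slab[OF \<tau> \<tau>H \<nu>, of "(1 - \<epsilon>) *R (- e)"] c \<epsilon> by (simp add: abs_mult)
  qed
  \<comment> \<open>The two ends of the prism, t = 0 and t = 1, need not cross; they lie in two
    hyperplanes, which are null.\<close>
  have sub: "slab \<tau> (- (s *R e)) \<subseteq> crossing (s *R e) \<union> (plane \<nu> b \<union> plane \<nu> (b - s * (e \<bullet> \<nu>)))"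
	if s: "0 < s" "s \<le> \<epsilon> * r0" for s
  proof
	fix x assume "x \<in> slab \<tau> (- (s *R e))"
	then obtain y t where y: "y \<in> \<sigma>" and t: "0 \<le> t" "t \<le> 1"
	  and x: "x = (1 - \<epsilon>) *R y + \<epsilon> *R z - (t * s) *R e" unfolding slab_def \<tau>_def by auto
	have xh: "\<nu> \<bullet> x = b - t * s * (e \<bullet> \<nu>)"
	  using y \<sigma>(2) z(1) by (auto simp: x inner_add_right inner_diff_right inner_commute algebra_simps)
	show "x \<in> crossing (s *R e) \<union> (plane \<nu> b \<union> plane \<nu> (b - s * (e \<bullet> \<nu>)))"
	proof (cases "t = 0 \<or> t = 1")
	  case False
	  hence t: "0 < t" "t < 1" using t by auto
	  have "x = y - \<epsilon> *R (y - (z - (t * s / \<epsilon>) *R e))" using \<epsilon> by (simp add: x algebra_simps)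
	  moreover have "z - (t * s / \<epsilon>) *R e \<in> K"
	  proof (rule r1)
		have "t * s \<le> s" using t s by simp
		also have "s \<le> r1 * \<epsilon>" using order_trans[OF s(2) mult_left_mono[of r0 r1 \<epsilon>]] \<epsilon> by (simp add: r0_def mult.commute)
		finally show "t * s / \<epsilon> \<le> r1" using \<epsilon> by (simp add: pos_divide_le_eq)
	  qed (use t s \<epsilon> in auto)
	  ultimately have "x \<in> K"
		using mem_interior_closure_convex_shrink[OF K(2), of "z - (t * s / \<epsilon>) *R e" y \<epsilon>] y \<epsilon> K(1) by (simp add: interior_open)
	  moreover have "x + s *R e = y - \<epsilon> *R (y - (z + ((1 - t) * s / \<epsilon>) *R e))"
	  proof -
		have "\<epsilon> *R (((1 - t) * s / \<epsilon>) *R e) = s *R e - (t * s) *R e"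
		  using \<epsilon> by (simp add: left_diff_distrib flip: scaleR_diff_left)
		thus ?thesis by (simp only: x scaleR_diff_right scaleR_add_right) (simp add: algebra_simps)
	  qed
	  moreover have "z + ((1 - t) * s / \<epsilon>) *R e \<in> L"
	  proof (rule r2)
		have "(1 - t) * s \<le> s" using t s by simp
		also have "s \<le> r2 * \<epsilon>" using order_trans[OF s(2) mult_left_mono[of r0 r2 \<epsilon>]] \<epsilon> by (simp add: r0_def mult.commute)
		finally show "(1 - t) * s / \<epsilon> \<le> r2" using \<epsilon> by (simp add: pos_divide_le_eq)
	  qed (use t s \<epsilon> in auto)
	  hence "y - \<epsilon> *R (y - (z + ((1 - t) * s / \<epsilon>) *R e)) \<in> L"
		using mem_interior_closure_convex_shrink[OF L(2), of "z + ((1 - t) * s / \<epsilon>) *R e" y \<epsilon>] y \<epsilon> L(1) by (simp add: interior_open)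
	  ultimately show ?thesis by (auto simp: crossing_def)
	qed (use xh in auto)
  qed
  have "\<nu> \<noteq> 0" using \<nu> by auto
  have bound: "(1 - \<epsilon>) ^ (DIM('a) - 1) * face_area * (e \<bullet> \<nu>) \<le> real (Suc n) * vol (crossing (e /\<^sub>R real (Suc n)))"
	if n: "inverse (real (Suc n)) \<le> \<epsilon> * r0" for n
  proof -
	define s where "s = inverse (real (Suc n))"
	let ?v = "vol (slab \<tau> (- (s *R e)))" and ?w = "vol (crossing (s *R e))"
	have s: "0 < s" "s \<le> \<epsilon> * r0" using n by (auto simp: s_def)
	let ?N = "plane \<nu> b \<union> plane \<nu> (b - s * (e \<bullet> \<nu>))"
	have "negligible ?N" using `\<nu> \<noteq> 0` by (intro negligible_Un negligible_hyperplane) auto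
	hence N: "?N \<in> lmeasurable" "vol ?N = 0" by (rule negligible_imp_measurable, rule negligible_imp_measure0)
	have "?v \<le> vol (crossing (s *R e) \<union> ?N)" using sub[OF s] crossing_lmeasurable N(1) lmeasurable_compact[OF compact_slab[OF \<tau>]]
	  by (intro measure_mono_fmeasurable) (auto dest: fmeasurableD)
	also have "... \<le> ?w + vol ?N" using crossing_lmeasurable N(1) by (intro measure_Un_le) (auto dest: fmeasurableD)
	finally have "?v \<le> ?w" using N by simp
	moreover have "?v = (1 - \<epsilon>) ^ (DIM('a) - 1) * face_area * (s * (e \<bullet> \<nu>))"
	  using measure_slab[OF \<tau> \<tau>H \<nu>, of "- (s *R e)"] c s area by simp
	ultimately have "(1 - \<epsilon>) ^ (DIM('a) - 1) * face_area * (e \<bullet> \<nu>) \<le> ?w / s" using s by (simp add: field_simps)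
	thus ?thesis by (simp add: s_def divide_inverse mult.commute del: of_nat_Suc)
  qed
  have "\<forall>\<^sub>F n in sequentially. inverse (real (Suc n)) < \<epsilon> * r0"
	using \<epsilon> `r0 > 0` by (intro order_tendstoD(2)[OF LIMSEQ_inverse_real_of_nat]) auto
  thus ?thesis by eventually_elim (use bound in auto)
qed

text \<open>To first order the crossing volume is the face area times the normal component of the
  translation. The upper bound comes from the fattened face, the lower one from the shrunk face; if
  the face is null, only the upper bound says something.\<close>

theorem crossing_limit:
  "(\<lambda>n. real (Suc n) * vol (crossing (e /\<^sub>R real (Suc n)))) ----> face_area * max 0 (e \<bullet> \<nu>)"
proof (cases "e \<bullet> \<nu> > 0")
  case False
  hence "crossing (e /\<^sub>R real (Suc n)) = {}" for n by (intro crossing_empty) (simp add: mult_nonneg_nonpos del: of_nat_Suc)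
  thus ?thesis using False by (simp add: max_def)
next
  case True
  let ?f = "\<lambda>n. real (Suc n) * vol (crossing (e /\<^sub>R real (Suc n)))"
  let ?F = "face_area * (e \<bullet> \<nu>)" and ?g = "\<lambda>\<epsilon>. (1 - \<epsilon>) ^ (DIM('a) - 1) * face_area * (e \<bullet> \<nu>)"
  have up: "(\<lambda>n. enn2real (surface_measure (fattened (norm e / real (Suc n)))) * (e \<bullet> \<nu>)) ----> ?F"
	by (intro tendsto_intros fattened_limit True)
  have "?f ----> ?F"
  proof (rule order_tendstoI)
	fix a assume "?F < a"
	from order_tendstoD(2)[OF up this] show "\<forall>\<^sub>F n in sequentially. ?f n < a"
	  by eventually_elim (rule le_less_trans[OF crossing_upper[OF True]])
  next
	fix a assume a: "a < ?F"
	show "\<forall>\<^sub>F n in sequentially. a < ?f n"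
	proof (cases "face_area > 0")
	  case False
	  hence "a < 0" using a face_area_nonneg by (auto simp: not_less)
	  thus ?thesis by (intro always_eventually allI) (auto intro: less_le_trans)
	next
	  case pos: True
	  have "((\<lambda>\<epsilon>. ?g \<epsilon>) \<longlongrightarrow> ?g 0) (at_right 0)" by (intro tendsto_intros)
	  hence "\<forall>\<^sub>F \<epsilon> in at_right 0. a < ?g \<epsilon>" using a by (intro order_tendstoD(1)) auto
	  moreover have "\<forall>\<^sub>F \<epsilon> in at_right (0::real). \<epsilon> \<in> {0<..<1}" by (rule eventually_at_right_real) simp
	  ultimately have "\<forall>\<^sub>F \<epsilon> in at_right 0. a < ?g \<epsilon> \<and> \<epsilon> \<in> {0<..<1}" by eventually_elim simp
	  then obtain \<epsilon> where "a < ?g \<epsilon>" "0 < \<epsilon>" "\<epsilon> < 1" using eventually_happens by force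
	  thus ?thesis by (intro eventually_mono[OF crossing_lower[OF True pos]]) (auto intro: less_le_trans)
	qed
  qed
  thus ?thesis using True by (simp add: max_def)
qed

end

section \<open>Admissible meshes\<close>

text \<open>A face of positive measure lies in only one hyperplane, so any hyperplane separating K
  from L coincides with it, up to the sign of the normal.\<close>

lemma opposite_sides:
  fixes \<sigma> :: "'a::euclidean_space set"
  assumes \<sigma>: "compact \<sigma>" "\<sigma> \<subseteq> plane \<nu> b" and \<nu>: "norm \<nu> = 1" and pos: "surface_measure \<sigma> > 0"
	and KL: "open K" "open L" "convex K" "convex L" "K \<noteq> {}" "L \<noteq> {}" "K \<inter> L = {}"
	and sub: "\<sigma> \<subseteq> closure K" "\<sigma> \<subseteq> closure L"
  shows "K \<subseteq> below \<nu> b \<and> L \<subseteq> above \<nu> b \<or> K \<subseteq> above \<nu> b \<and> L \<subseteq> below \<nu> b"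
proof -
  obtain \<mu> c where \<mu>: "norm \<mu> = 1" "K \<subseteq> {x. \<mu> \<bullet> x < c}" "L \<subseteq> {x. \<mu> \<bullet> x > c}"
	using open_convex_separation[OF KL] by blast
  have \<sigma>c: "\<mu> \<bullet> y = c" if "y \<in> \<sigma>" for y using closure_subset_halfspaces(3)[OF \<mu>(2,3)] sub that by auto
  have "orthogonal_to_face \<mu> \<sigma>" by (auto simp: orthogonal_to_face_def orthogonal_def inner_diff_right \<sigma>c)
  hence par: "\<mu> = (\<mu> \<bullet> \<nu>) *R \<nu>" by (rule orthogonal_to_face_parallel[OF \<sigma> \<nu> pos])
  obtain y where y: "y \<in> \<sigma>" using pos by (cases "\<sigma> = {}") (auto simp: surface_measure_def)
  have "norm \<mu> = abs (\<mu> \<bullet> \<nu>)" by (subst par) (simp add: \<nu>)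
  then consider "\<mu> \<bullet> \<nu> = 1" | "\<mu> \<bullet> \<nu> = - 1" using \<mu>(1) by (auto simp: abs_if split: if_splits)
  thus ?thesis
  proof cases
	case 1
	hence "\<mu> = \<nu>" using par by simp
	thus ?thesis using \<mu> \<sigma>c[OF y] y \<sigma>(2) by auto
  next
	case 2
	hence "\<mu> = - \<nu>" using par by simp
	moreover have "c = - b" using \<sigma>c[OF y] y \<sigma>(2) `\<mu> = - \<nu>` by auto
	ultimately show ?thesis using \<mu> by auto
  qed
qed

text \<open>If \<sigma> had positive measure, its hyperplane would separate each two of the cells,
  and three cells do not fit on two sides.\<close>

lemma three_cells_null:
  fixes \<sigma> :: "'a::euclidean_space set"
  assumes \<sigma>: "compact \<sigma>" "\<And>i. i \<in> {1,2,3::nat} ==> \<sigma> \<subseteq> closure (K i)"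
	and K: "\<And>i. i \<in> {1,2,3} ==> open (K i) \<and> convex (K i) \<and> K i \<noteq> {}"
	and disj: "\<And>i j. i \<in> {1,2,3} ==> j \<in> {1,2,3} ==> i \<noteq> j ==> K i \<inter> K j = {}"
  shows "surface_measure \<sigma> = 0"
proof (rule ccontr)
  assume "surface_measure \<sigma> \<noteq> 0"
  hence pos: "surface_measure \<sigma> > 0" by (simp add: zero_less_iff_neq_zero)
  obtain \<nu> b where \<nu>: "norm \<nu> = 1" "K 1 \<subseteq> below \<nu> b" "K 2 \<subseteq> above \<nu> b"
	by (rule open_convex_separation[of "K 1" "K 2"]) (use K disj[of 1 2] in auto)
  have "\<sigma> \<subseteq> plane \<nu> b" using closure_subset_halfspaces(3)[OF \<nu>(2,3)] \<sigma>(2)[of 1] \<sigma>(2)[of 2] by auto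
  note opp = opposite_sides[OF \<sigma>(1) this \<nu>(1) pos]
  have "K 1 \<subseteq> below \<nu> b \<and> K 3 \<subseteq> above \<nu> b \<or> K 1 \<subseteq> above \<nu> b \<and> K 3 \<subseteq> below \<nu> b"
	by (rule opp) (use K[of 1] K[of 3] disj[of 1 3] \<sigma>(2)[of 1] \<sigma>(2)[of 3] in auto)
  moreover have "K 2 \<subseteq> below \<nu> b \<and> K 3 \<subseteq> above \<nu> b \<or> K 2 \<subseteq> above \<nu> b \<and> K 3 \<subseteq> below \<nu> b"
	by (rule opp) (use K[of 2] K[of 3] disj[of 2 3] \<sigma>(2)[of 2] \<sigma>(2)[of 3] in auto)
  ultimately show False using \<nu>(2,3) K[of 1] K[of 2] K[of 3] by force
qed

section \<open>Geometry of one admissible mesh\<close>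

locale fv_mesh =
  fixes \<Omega> :: "'a::euclidean_space set" and M :: "'a mesh"
  assumes open_domain: "open \<Omega>" and bounded_domain: "bounded \<Omega>" and domain_nonempty: "\<Omega> \<noteq> {}"
	and admissible: "admissible_mesh \<Omega> M"
begin

abbreviation cell_sum (binder "\<Sigma>" 10) where "cell_sum f \<equiv> sum f (cells M)"

lemma admissible_conjuncts:
  "finite (cells M)" "finite (faces M)"
  "\<forall>K\<in>cells M. K \<noteq> {} \<and> open K \<and> convex K \<and> polyhedron (closure K) \<and> K \<subseteq> \<Omega>"
  "\<forall>K\<in>cells M. \<forall>L\<in>cells M. K \<noteq> L \<longrightarrow> K \<inter> L = {}"
  "(\<Union>K\<in>cells M. closure K) = closure \<Omega>"
  "\<forall>\<sigma>\<in>faces M. closed \<sigma> \<and> (\<exists>a b. a \<noteq> 0 \<and> \<sigma> \<subseteq> {x. a \<bullet> x = b}) \<and> surface_measure \<sigma> > 0"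
  "\<forall>\<sigma>\<in>faces M. \<forall>\<tau>\<in>faces M. \<sigma> \<noteq> \<tau> \<longrightarrow> surface_measure (\<sigma> \<inter> \<tau>) = 0"
  "\<forall>K\<in>cells M. cell_faces M K \<subseteq> faces M \<and> frontier K = \<Union> (cell_faces M K)"
  "\<forall>K\<in>cells M. \<forall>L\<in>cells M. K \<noteq> L \<longrightarrow>
		face K L \<in> faces M \<or> surface_measure (face K L) = 0"
  "\<forall>K\<in>cells M. center M K \<in> K"
  "\<forall>K\<in>cells M. \<forall>L\<in>cells M. K \<noteq> L \<and> face K L \<in> faces M \<longrightarrow>
		orthogonal_to_face (center M L - center M K) (face K L)" by (insert admissible[unfolded admissible_mesh_def], (elim conjE, assumption)+)

lemmas finite_cells = admissible_conjuncts(1) and finite_faces = admissible_conjuncts(2)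

lemma cell: assumes "K \<in> cells M"
  shows "K \<noteq> {}" "open K" "convex K" "K \<subseteq> \<Omega>" "center M K \<in> K" "bounded K"
proof -
  show "K \<noteq> {}" "open K" "convex K" "K \<subseteq> \<Omega>" "center M K \<in> K" using admissible_conjuncts(3,10) assms by auto
  thus "bounded K" using bounded_domain bounded_subset by blast
qed

lemma cells_disjoint: "K \<in> cells M ==> L \<in> cells M ==> K \<noteq> L ==> K \<inter> L = {}" using admissible_conjuncts(4) by simp

lemmas cells_cover = admissible_conjuncts(5)

lemma cells_nonempty: "cells M \<noteq> {}" using cells_cover domain_nonempty closure_subset[of \<Omega>] by auto

lemma cell_faces_frontier: "K \<in> cells M ==> cell_faces M K \<subseteq> faces M \<and> frontier K = \<Union> (cell_faces M K)"
  using admissible_conjuncts(8) by simp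

lemma face_pos: "\<sigma> \<in> faces M ==> surface_measure \<sigma> > 0" using admissible_conjuncts(6) by simp

definition adj :: "'a set => 'a set => bool" where
  "adj K L \<longleftrightarrow> K \<in> cells M \<and> L \<in> cells M \<and> K \<noteq> L \<and> face K L \<in> faces M"

text \<open>Zero for cells that share no face, so that sums can run over all pairs of cells.\<close>

definition area :: "'a set => 'a set => real" where
  "area K L = (if adj K L then enn2real (surface_measure (face K L)) else 0)"

definition cdist :: "'a set => 'a set => real" where
  "cdist K L = dist (center M K) (center M L)"

definition normal :: "'a set => 'a set => 'a" where
  "normal K L = (center M L - center M K) /\<^sub>R cdist K L"

text \<open>The distance from the centre of K to the hyperplane of the face. For adjacent cells the
  choice of y does not matter, since \<open>normal K L\<close> is orthogonal to the face.\<close>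

definition depth :: "'a set => 'a set => real" where
  "depth K L = normal K L \<bullet> ((SOME y. y \<in> face K L) - center M K)"

lemma adj_sym: "adj K L \<longleftrightarrow> adj L K" by (auto simp: adj_def Int_commute)

lemma area_sym: "area K L = area L K" by (simp add: area_def adj_sym[of K L] Int_commute)

lemma cdist_sym: "cdist K L = cdist L K" by (simp add: cdist_def dist_commute)

lemma normal_sym: "normal L K = - normal K L" by (simp add: normal_def cdist_sym[of K L] flip: scaleR_minus_right)

lemma area_nonneg: "area K L \<ge> 0" by (simp add: area_def)

lemma cell_separation:
  assumes "K \<in> cells M" "L \<in> cells M" "K \<noteq> L"
  obtains \<nu> b where "adjacent_cells K L \<nu> b"
proof -
  obtain \<nu> b where "norm \<nu> = 1" "K \<subseteq> below \<nu> b" "L \<subseteq> above \<nu> b"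
	using open_convex_separation[of K L] cell[OF assms(1)] cell[OF assms(2)] cells_disjoint[OF assms] by auto
  with that show thesis using cell[OF assms(1)] cell[OF assms(2)] by (auto simp: adjacent_cells_def)
qed

text \<open>The orthogonality condition makes the difference of the centres parallel to the normal
  of a separating hyperplane; the centres lie on opposite sides, which fixes the sign.\<close>

lemma adj_geometry:
  assumes "adj K L"
  obtains b where "adjacent_cells K L (normal K L) b" "b = normal K L \<bullet> center M K + depth K L"
proof -
  have KL: "K \<in> cells M" "L \<in> cells M" "K \<noteq> L" and f: "face K L \<in> faces M" using assms by (auto simp: adj_def)
  obtain \<nu> b where "adjacent_cells K L \<nu> b" using cell_separation[OF KL] .
  then interpret adjacent_cells K L \<nu> b .
  have "orthogonal_to_face (center M L - center M K) \<sigma>" using admissible_conjuncts(11) KL f by simp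
  from orthogonal_to_face_parallel[OF \<sigma>(1,2) \<nu> face_pos[OF f] this]
  have par: "center M L - center M K = ((center M L - center M K) \<bullet> \<nu>) *R \<nu>" .
  have "\<nu> \<bullet> center M K < b" "b < \<nu> \<bullet> center M L" using K(5) L(5) cell(5)[OF KL(1)] cell(5)[OF KL(2)] by auto
  hence pos: "(center M L - center M K) \<bullet> \<nu> > 0" by (simp add: inner_diff_left inner_commute[of \<nu>])
  have "cdist K L = (center M L - center M K) \<bullet> \<nu>"
	unfolding cdist_def dist_norm norm_minus_commute[of "center M K"] by (subst par) (use \<nu> pos in simp)
  hence n: "normal K L = \<nu>" unfolding normal_def using pos by (subst par) simp
  have "\<sigma> \<noteq> {}" using face_pos[OF f] by (auto simp: surface_measure_def)
  hence "(SOME y. y \<in> \<sigma>) \<in> \<sigma>" by (rule some_in_eq[THEN iffD2])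
  hence "\<nu> \<bullet> (SOME y. y \<in> \<sigma>) = b" using \<sigma>(2) by auto
  hence "b = normal K L \<bullet> center M K + depth K L" by (simp add: depth_def n inner_diff_right)
  with that[of b] show thesis using `adjacent_cells K L \<nu> b` n by simp
qed

lemma depth_pos: "adj K L ==> depth K L > 0"
proof -
  assume a: "adj K L"
  then obtain b where "adjacent_cells K L (normal K L) b" and b: "b = normal K L \<bullet> center M K + depth K L" by (rule adj_geometry)
  then interpret adjacent_cells K L "normal K L" b by simp
  have "normal K L \<bullet> center M K < b" using K(5) cell(5) a unfolding adj_def by auto
  with b show ?thesis by simp
qed

lemma cdist_pos: "adj K L ==> cdist K L > 0" using cell(5) cells_disjoint unfolding adj_def cdist_def by (metis disjoint_iff zero_less_dist_iff)

lemma norm_normal: "adj K L ==> norm (normal K L) = 1"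
  using cdist_pos[of K L] by (simp add: normal_def) (simp add: cdist_def dist_norm norm_minus_commute)

lemma center_diff: "adj K L ==> center M L - center M K = cdist K L *R normal K L" using cdist_pos[of K L] by (simp add: normal_def)

lemma depth_add: assumes "adj K L" shows "depth K L + depth L K = cdist K L"
proof -
  let ?y = "SOME y. y \<in> face K L"
  have "depth L K = - (normal K L \<bullet> (?y - center M L))" by (simp add: depth_def normal_sym[of L K] Int_commute)
  hence "depth K L + depth L K = normal K L \<bullet> (center M L - center M K)" by (simp add: depth_def inner_diff_right)
  also have "... = cdist K L" using norm_normal[OF assms] by (simp add: center_diff[OF assms] norm_eq_1)
  finally show ?thesis .
qed

text \<open>Holds for every pair of distinct cells: without a common face the intersection of the
  closures has surface measure zero by admissibility, and the limit is 0.\<close>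

lemma area_crossing_limit:
  assumes KL: "K \<in> cells M" "L \<in> cells M" "K \<noteq> L"
  shows "(\<lambda>n. real (Suc n) * vol {x\<in>K. x + e /\<^sub>R real (Suc n) \<in> L}) ----> area K L * max 0 (e \<bullet> normal K L)"
proof (cases "adj K L")
  case True
  then obtain b where "adjacent_cells K L (normal K L) b" by (rule adj_geometry)
  then interpret adjacent_cells K L "normal K L" b .
  show ?thesis using crossing_limit[of e] True by (simp add: crossing_def face_area_def area_def)
next
  case False
  obtain \<nu> b where "adjacent_cells K L \<nu> b" using cell_separation[OF KL] .
  then interpret adjacent_cells K L \<nu> b .
  have "surface_measure \<sigma> = 0" using False KL admissible_conjuncts(9) unfolding adj_def by blast
  thus ?thesis using crossing_limit[of e] False by (simp add: crossing_def face_area_def area_def)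
qed

lemma three_cells:
  assumes "K \<in> cells M" "L \<in> cells M" "L' \<in> cells M" "K \<noteq> L" "K \<noteq> L'" "\<sigma> \<in> faces M"
	and "\<sigma> \<subseteq> closure K" "\<sigma> \<subseteq> closure L" "\<sigma> \<subseteq> closure L'"
  shows "L = L'"
proof (rule ccontr)
  assume "L \<noteq> L'"
  define F where "F i = (if i = 1 then K else if i = 2 then L else L')" for i :: nat
  have "closed \<sigma>" using admissible_conjuncts(6) assms(6) by simp
  hence "compact \<sigma>" using assms(7) cell(6)[OF assms(1)] by (meson bounded_closure bounded_subset compact_eq_bounded_closed)
  hence "surface_measure \<sigma> = 0"
  proof (rule three_cells_null[where K = F])
	fix i :: nat assume i: "i \<in> {1, 2, 3}"
	show "\<sigma> \<subseteq> closure (F i)" using assms i by (auto simp: F_def)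
	show "open (F i) \<and> convex (F i) \<and> F i \<noteq> {}" using assms(1-3) cell i by (auto simp: F_def)
	fix j :: nat assume j: "j \<in> {1, 2, 3}" "i \<noteq> j"
	have "F i \<noteq> F j" "F i \<in> cells M" "F j \<in> cells M" using assms(1-5) `L \<noteq> L'` i j by (auto simp: F_def)
	thus "F i \<inter> F j = {}" using cells_disjoint by blast
  qed
  thus False using face_pos[OF assms(6)] by simp
qed

lemma adj_same_face: "adj K L ==> adj K L' ==> face K L = face K L' ==> L = L'" by (rule three_cells[of K L L' "face K L"]) (auto simp: adj_def)

text \<open>Admissibility does not say directly that K|L is one of the faces of K. It lies in the
  frontier of K, a finite union of faces; if it were none of them, it would meet each in a null set
  and be null itself.\<close>

lemma adj_cell_face: assumes "adj K L" shows "face K L \<in> cell_faces M K"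
proof (rule ccontr)
  let ?\<sigma> = "face K L"
  assume no: "?\<sigma> \<notin> cell_faces M K"
  have KL: "K \<in> cells M" "L \<in> cells M" "K \<noteq> L" and f: "?\<sigma> \<in> faces M" using assms by (auto simp: adj_def)
  have "K \<inter> closure L = {}" using cells_disjoint[OF KL] cell(2)[OF KL(1)] open_Int_closure_eq_empty by blast
  hence "?\<sigma> \<subseteq> frontier K" using cell(2)[OF KL(1)] by (auto simp: frontier_def interior_open)
  hence eq: "?\<sigma> = \<Union> ((\<lambda>\<tau>. \<tau> \<inter> ?\<sigma>) ` cell_faces M K)" using cell_faces_frontier[OF KL(1)] by auto
  have "finite ((\<lambda>\<tau>. \<tau> \<inter> ?\<sigma>) ` cell_faces M K)"
	using finite_faces cell_faces_frontier[OF KL(1)] finite_subset by blast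
  moreover have "hausdorff_measure (DIM('a) - 1) C = 0" if "C \<in> (\<lambda>\<tau>. \<tau> \<inter> ?\<sigma>) ` cell_faces M K" for C
  proof -
	from that obtain \<tau> where \<tau>: "C = \<tau> \<inter> ?\<sigma>" "\<tau> \<in> cell_faces M K" by (rule imageE)
	hence "\<tau> \<in> faces M" "\<tau> \<noteq> ?\<sigma>" using no cell_faces_frontier[OF KL(1)] by auto
	thus ?thesis using admissible_conjuncts(7) f \<tau>(1) unfolding surface_measure_def by simp
  qed
  ultimately have "hausdorff_measure (DIM('a) - 1) (\<Union> ((\<lambda>\<tau>. \<tau> \<inter> ?\<sigma>) ` cell_faces M K)) = 0"
	by (rule hausdorff_measure_finite_Union_null)
  thus False using face_pos[OF f] eq unfolding surface_measure_def by simp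
qed

lemma interior_face_neighbour:
  assumes K: "K \<in> cells M" and \<sigma>: "\<sigma> \<in> cell_faces M K" "\<sigma> \<in> interior_faces M"
  shows "\<exists>L. adj K L \<and> \<sigma> = face K L"
proof -
  obtain K' L' where KL: "K' \<in> cells M" "L' \<in> cells M" "K' \<noteq> L'" "\<sigma> = face K' L'" "\<sigma> \<in> faces M"
	using \<sigma>(2) unfolding interior_faces_def by auto
  have "\<sigma> \<subseteq> closure K" using \<sigma>(1) cell_faces_frontier[OF K] by (auto simp: frontier_def)
  hence "K = K' \<or> K = L'" using three_cells[of K K' L' \<sigma>] K KL by auto
  thus ?thesis using KL by (auto simp: adj_def Int_commute)
qed

text \<open>Three cells cannot share a face, so the definite description has exactly one
  candidate.\<close>

lemma neighbour_eq: "adj K L ==> neighbour M K (face K L) = L" unfolding neighbour_def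
proof (rule the_equality)
  assume a: "adj K L"
  thus "L \<in> cells M \<and> L \<noteq> K \<and> face K L = face K L" by (auto simp: adj_def)
  show "L' = L" if "L' \<in> cells M \<and> L' \<noteq> K \<and> face K L' = face K L" for L'
  proof -
	have "adj K L'" using a that by (auto simp: adj_def)
	thus ?thesis using adj_same_face[OF _ a] that by blast
  qed
qed

lemma adj_interior_face: "adj K L ==> face K L \<in> interior_faces M" unfolding interior_faces_def adj_def by blast

text \<open>Passes from faces to neighbouring cells. The map L -> K|L is injective because no face
  belongs to three cells, and it reaches exactly the interior faces of K; the others must carry zero
  terms.\<close>

lemma sum_cell_faces:
  assumes K: "K \<in> cells M" and zero: "\<And>\<sigma>. \<sigma> \<in> cell_faces M K ==> \<sigma> \<notin> interior_faces M ==> g \<sigma> = 0"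
  shows "(\<Sum>\<sigma>\<in>cell_faces M K. g \<sigma>) = (\<Sum>L\<in>{L\<in>cells M. adj K L}. g (face K L))"
proof -
  have "finite (cell_faces M K)" using finite_faces cell_faces_frontier[OF K] finite_subset by blast
  hence "(\<Sum>\<sigma>\<in>cell_faces M K. g \<sigma>) = (\<Sum>\<sigma>\<in>cell_faces M K \<inter> interior_faces M. g \<sigma>)"
	using zero by (intro sum.mono_neutral_right) auto
  also have "... = (\<Sum>L\<in>{L\<in>cells M. adj K L}. g (face K L))"
  proof (rule sum.reindex_bij_betw[symmetric])
	show "bij_betw (\<lambda>L. face K L) {L \<in> cells M. adj K L} (cell_faces M K \<inter> interior_faces M)" unfolding bij_betw_def
	proof
	  show "inj_on (\<lambda>L. face K L) {L \<in> cells M. adj K L}" by (rule inj_onI) (use adj_same_face in blast)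
	  show "(\<lambda>L. face K L) ` {L \<in> cells M. adj K L} = cell_faces M K \<inter> interior_faces M"
		using adj_cell_face adj_interior_face interior_face_neighbour[OF K] by (auto simp: adj_def image_iff)
	qed
  qed
  finally show ?thesis .
qed

lemma cdist_le: assumes "adj K L" shows "cdist K L \<le> 2 * mesh_size M"
proof -
  have KL: "K \<in> cells M" "L \<in> cells M" and f: "face K L \<in> faces M" using assms by (auto simp: adj_def)
  have "face K L \<noteq> {}" using face_pos[OF f] by (auto simp: surface_measure_def)
  then obtain y where y: "y \<in> closure K" "y \<in> closure L" by auto
  have d: "dist (center M C) y \<le> mesh_size M" if "C \<in> cells M" "y \<in> closure C" for C
  proof -
	have "dist (center M C) y \<le> diameter (closure C)"
	  using cell(5,6)[OF that(1)] that(2) closure_subset[of C] by (intro diameter_bounded_bound) auto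
	also have "... = diameter C" using cell(6)[OF that(1)] by (rule diameter_closure)
	also have "... \<le> mesh_size M" unfolding mesh_size_def using finite_cells that by (intro Max_ge) auto
	finally show ?thesis .
  qed
  show ?thesis unfolding cdist_def using d[OF KL(1) y(1)] d[OF KL(2) y(2)] dist_triangle2[of "center M K" "center M L" y]
	by (simp add: dist_commute)
qed

lemma dist_center_le:
  assumes "K \<in> cells M" "x \<in> K" shows "dist x (center M K) \<le> mesh_size M"
proof -
  have "dist x (center M K) \<le> diameter K" using cell(5,6)[OF assms(1)] assms(2) by (intro diameter_bounded_bound)
  also have "... \<le> mesh_size M" unfolding mesh_size_def using finite_cells assms by (intro Max_ge) auto
  finally show ?thesis .
qed

lemma mesh_size_nonneg: "mesh_size M \<ge> 0" using cells_nonempty dist_center_le cell(5) by (meson all_not_in_conv order_trans zero_le_dist)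

lemma cell_lmeasurable: "K \<in> cells M ==> K \<in> lmeasurable" using cell by (simp add: lmeasurable_open)

lemma domain_lmeasurable: "\<Omega> \<in> lmeasurable" using open_domain bounded_domain by (simp add: lmeasurable_open)

lemma cell_measure_pos: "K \<in> cells M ==> vol K > 0"
  using cell(1,2)[of K] open_not_negligible[of K] negligible_iff_measure0[OF cell_lmeasurable[of K]]
	measure_nonneg[of lebesgue K] by linarith

lemma negligible_outside_cells: "negligible (\<Omega> - \<Union> (cells M))"
proof -
  have "\<Omega> - \<Union> (cells M) \<subseteq> (\<Union>K\<in>cells M. frontier K)"
	using closure_subset[of \<Omega>] unfolding cells_cover[symmetric] by (auto simp: frontier_def cell interior_open)
  moreover have "negligible (\<Union>K\<in>cells M. frontier K)"
	using finite_cells cell by (intro negligible_Union) (auto intro: negligible_convex_frontier)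
  ultimately show ?thesis by (rule negligible_subset[rotated])
qed

lemma sum_cell_measures: "(\<Sigma> K. vol K) = vol \<Omega>"
proof -
  have "vol (\<Union> (cells M)) = (\<Sigma> K. vol K)" using finite_cells cell_lmeasurable cells_disjoint
	by (intro measure_negligible_finite_Union) (auto simp: pairwise_def)
  moreover have "vol (\<Union> (cells M)) = vol \<Omega>"
  proof (rule measure_negligible_symdiff)
	show "\<Omega> \<in> lmeasurable" by (rule domain_lmeasurable)
	have "\<Omega> - \<Union> (cells M) \<union> (\<Union> (cells M) - \<Omega>) = \<Omega> - \<Union> (cells M)" using cell(4) by auto
	thus "negligible (\<Omega> - \<Union> (cells M) \<union> (\<Union> (cells M) - \<Omega>))" using negligible_outside_cells by simp
  qed
  ultimately show ?thesis by simp
qed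

text \<open>A ray from the centre leaves a convex cell only once, so a direction determines the
  frontier point. Hence, up to the apex, the two cones meet in the cone over the intersection of the
  faces, which has surface measure zero.\<close>

lemma cone_disjoint:
  assumes adjs: "adj K L" "adj K L'" "L \<noteq> L'"
  shows "negligible (cone_over (center M K) (face K L) \<inter> cone_over (center M K) (face K L'))"
proof -
  let ?p = "center M K"
  let ?I = "cone_over ?p (face K L) \<inter> cone_over ?p (face K L')"
  have K: "K \<in> cells M" using adjs by (auto simp: adj_def)
  have p: "?p \<in> interior K" using cell(2,5)[OF K] by (simp add: interior_open)
  have frontier: "y \<notin> K" "y \<in> closure K" if "y \<in> face K L''" "adj K L''" for y L''
  proof -
	have "K \<inter> closure L'' = {}"
	  using cells_disjoint[of K L''] cell(2)[OF K] that(2) open_Int_closure_eq_empty[of K L''] by (auto simp: adj_def)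
	thus "y \<notin> K" "y \<in> closure K" using that by auto
  qed
  let ?\<tau> = "(face K L) \<inter> (face K L')"
  \<comment> \<open>Of two frontier points on one ray the nearer would be a proper convex
    combination of the farther one and the interior point \<open>center M K\<close>, hence itself
    interior.\<close>
  have no_ray: False if "y \<in> closure K" "y' \<in> closure K" "y' \<notin> K" "0 < r" "r < r'" "r *R (y - ?p) = r' *R (y' - ?p)" for y y' r r'
  proof -
	have "y' - ?p = (r / r') *R (y - ?p)"
	proof -
	  have "y' - ?p = (1 / r') *R (r' *R (y' - ?p))" using that by simp
	  thus ?thesis unfolding that(6)[symmetric] by simp
	qed
	hence "y' = y - (1 - r / r') *R (y - ?p)" by (simp add: algebra_simps)
	moreover have "y - (1 - r / r') *R (y - ?p) \<in> interior K"
	  using that by (intro mem_interior_closure_convex_shrink[OF cell(3)[OF K] p]) auto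
	ultimately show False using that interior_subset by blast
  qed
  have "?I \<subseteq> insert ?p (cone_over ?p ?\<tau>)"
  proof
	fix x assume x: "x \<in> ?I"
	then obtain y r where y: "y \<in> face K L" "0 \<le> r" "r \<le> 1" "x = ?p + r *R (y - ?p)" by (auto simp: cone_over_def)
	from x obtain y' r' where y': "y' \<in> face K L'" "0 \<le> r'" "r' \<le> 1" "x = ?p + r' *R (y' - ?p)" by (auto simp: cone_over_def)
	show "x \<in> insert ?p (cone_over ?p ?\<tau>)"
	proof (cases "r = 0 \<or> r' = 0")
	  case False
	  hence pos: "r > 0" "r' > 0" using y y' by auto
	  have eq: "r *R (y - ?p) = r' *R (y' - ?p)" using y(4) y'(4) by simp
	  have "r = r'" using no_ray[of y y' r r'] no_ray[of y' y r' r] frontier[OF y(1) adjs(1)] frontier[OF y'(1) adjs(2)] pos eq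
		by (metis linorder_neqE_linordered_idom)
	  hence "y = y'" using eq pos by simp
	  thus ?thesis using y y' unfolding cone_over_def by (intro insertI2 image_eqI[of _ _ "(y, r)"]) auto
	qed (use y y' in auto)
  qed
  moreover have "negligible (cone_over ?p ?\<tau>)"
  proof -
	obtain b where "adjacent_cells K L (normal K L) b" "b = normal K L \<bullet> ?p + depth K L" using adjs(1) by (rule adj_geometry)
	then interpret adjacent_cells K L "normal K L" b by simp
	have "?\<tau> \<subseteq> {x. normal K L \<bullet> x = b}" "compact (\<sigma> \<inter> (face L' K))"
	  using \<sigma> cell(6)[OF `K \<in> cells M`] by auto
	hence "compact ?\<tau>" by (simp add: Int_commute)
	note `?\<tau> \<subseteq> {x. normal K L \<bullet> x = b}` `compact ?\<tau>`
	moreover have "normal K L \<bullet> ?p < b" using adjacent_cells_axioms K(5) cell(5)[OF `K \<in> cells M`] by auto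
	ultimately have "emeasure lebesgue (cone_over ?p ?\<tau>) = surface_measure ?\<tau> * ennreal ((b - normal K L \<bullet> ?p) / DIM('a))"
	  by (intro emeasure_cone_over \<nu>)
	also have "surface_measure ?\<tau> = 0"
	proof -
	  have "face K L \<noteq> face K L'" using adj_same_face[OF adjs(1,2)] adjs(3) by blast
	  moreover have "face K L \<in> faces M" "face K L' \<in> faces M" using adjs(1,2) unfolding adj_def by simp_all
	  ultimately show ?thesis using admissible_conjuncts(7)[rule_format] by simp
	qed
	finally show ?thesis using `compact ?\<tau>`
	  by (auto simp: negligible_iff_null_sets null_sets_def lmeasurable_compact compact_cone_over fmeasurableD)
  qed
  ultimately show ?thesis by (meson negligible_insert negligible_subset)
qed

text \<open>The cones over the faces shared with other cells are almost disjoint, lie in the closure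
  of K, and have volume area times depth over d. The bound is an inequality, as the cones over
  exterior faces are left out.\<close>

lemma sum_area_depth:
  assumes K: "K \<in> cells M"
  shows "(\<Sigma> L. area K L * depth K L) \<le> DIM('a) * vol K"
proof -
  let ?C = "\<lambda>L. cone_over (center M K) (face K L)"
  let ?A = "{L\<in>cells M. adj K L}"
  have C: "compact (?C L)" "?C L \<subseteq> closure K" "vol (?C L) = area K L * depth K L / DIM('a)" if adj: "adj K L" for L
  proof -
	obtain b where b: "adjacent_cells K L (normal K L) b" "b = normal K L \<bullet> center M K + depth K L" by (rule adj_geometry[OF adj])
	then interpret adjacent_cells K L "normal K L" b by simp
	show "compact (?C L)" using \<sigma>(1) by (rule compact_cone_over)
	have "center M K \<in> closure K" using cell(5)[OF `K \<in> cells M`] closure_subset by auto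
	thus "?C L \<subseteq> closure K" using convexD_alt[OF convex_closure[OF cell(3)[OF `K \<in> cells M`]]]
	  by (auto simp: cone_over_def algebra_simps)
	show "vol (?C L) = area K L * depth K L / DIM('a)"
	  using measure_cone_over[OF \<sigma>(1,2) \<nu>, of "center M K"] depth_pos[OF that] b(2) that by (simp add: area_def)
  qed
  have "(\<Sum>L\<in>?A. area K L * depth K L / DIM('a)) = (\<Sum>L\<in>?A. vol (?C L))" using C(3) by (intro sum.cong) auto
  also have "... = vol (\<Union> (?C ` ?A))" using finite_cells C(1) cone_disjoint
	by (intro measure_negligible_finite_Union_image[symmetric]) (auto simp: pairwise_def lmeasurable_compact)
  also have "... \<le> vol (closure K)" using C(1,2) finite_cells cell(6)[OF K]
	by (intro measure_mono_fmeasurable) (auto intro!: sets.finite_UN simp: lmeasurable_compact fmeasurableD)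
  also have "... = vol K" using cell[OF K] negligible_convex_frontier[of K] by (intro measure_closure) auto
  finally have "(\<Sum>L\<in>?A. area K L * depth K L) \<le> DIM('a) * vol K" by (simp add: field_simps flip: sum_divide_distrib)
  also have "(\<Sum>L\<in>?A. area K L * depth K L) = (\<Sigma> L. area K L * depth K L)"
	using finite_cells by (intro sum.mono_neutral_left) (auto simp: area_def)
  finally show ?thesis .
qed

definition tau :: "'a set => 'a set => real" where
  "tau K L = (if adj K L then area K L / cdist K L else 0)"

lemma tau_nonneg: "tau K L \<ge> 0" using area_nonneg[of K L] by (simp add: tau_def cdist_def)

lemma tau_sym: "tau K L = tau L K" by (simp add: tau_def adj_sym[of K L] area_sym[of K L] cdist_sym[of K L])

lemma tau_eq_0: "\<not> adj K L ==> tau K L = 0" by (simp add: tau_def)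

lemma tau_pos: "adj K L ==> tau K L > 0"
proof -
  assume a: "adj K L"
  hence "face K L \<in> faces M" "K \<in> cells M" by (auto simp: adj_def)
  have "area K L > 0"
  proof -
	obtain b where "adjacent_cells K L (normal K L) b" using a by (rule adj_geometry)
	then interpret adjacent_cells K L "normal K L" b .
	show ?thesis using surface_measure_finite[OF \<sigma>(1,2) \<nu>] face_pos[OF `face K L \<in> faces M`] a
	  by (simp add: area_def enn2real_positive_iff)
  qed
  thus ?thesis using cdist_pos[OF a] a by (simp add: tau_def)
qed

lemma area_eq: "area K L = tau K L * cdist K L" using cdist_pos[of K L] by (auto simp: tau_def area_def)

text \<open>On exterior faces the mirror value is the value of the cell itself, so the flux vanishes
  there and only neighbours remain.\<close>

lemma flux_sum:
  assumes K: "K \<in> cells M"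
  shows "(\<Sum>\<sigma>\<in>cell_faces M K. flux M A astar V i K \<sigma>)
	= - (\<Sigma> L. tau K L * (astar * (V L $ i - V K $ i) + (SU j. (A $ i $ j - astar) *
		(log_mean (V K $ j) (V L $ j) * (V L $ i - V K $ i) - log_mean (V K $ i) (V L $ i) * (V L $ j - V K $ j)))))"
	(is "_ = - (\<Sigma> L. tau K L * ?J L)")
proof -
  have "(\<Sum>\<sigma>\<in>cell_faces M K. flux M A astar V i K \<sigma>) = (\<Sum>L\<in>{L\<in>cells M. adj K L}. flux M A astar V i K (face K L))"
	by (rule sum_cell_faces[OF K]) (simp add: flux_def Let_def face_jump_def mirror_value_def)
  also have "... = (\<Sum>L\<in>{L\<in>cells M. adj K L}. - (tau K L * ?J L))"
  proof (rule sum.cong)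
	fix L assume "L \<in> {L\<in>cells M. adj K L}"
	hence a: "adj K L" by simp
	have "transmissivity M K (face K L) = tau K L" using a adj_interior_face[OF a] neighbour_eq[OF a]
	  by (simp add: transmissivity_def face_dist_def tau_def area_def cdist_def)
	thus "flux M A astar V i K (face K L) = - (tau K L * ?J L)" using adj_interior_face[OF a] neighbour_eq[OF a]
	  by (simp add: flux_def Let_def face_jump_def face_value_def mirror_value_def algebra_simps)
  qed simp
  also have "... = (\<Sigma> L. - (tau K L * ?J L))" using finite_cells tau_eq_0 by (intro sum.mono_neutral_left) auto
  finally show ?thesis by (simp add: sum_negf)
qed

end

section \<open>Entropy and energy estimate\<close>

lemma log_mean_sym: "log_mean a b = log_mean b a" unfolding log_mean_def by (simp add: min.commute) (metis minus_diff_eq minus_divide_divide)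

lemma log_mean_mult: assumes "a > 0" "b > 0" shows "log_mean a b * (ln b - ln a) = b - a"
proof (cases "a = b")
  case False
  hence "ln a \<noteq> ln b" using assms by simp
  thus ?thesis using assms False by (simp add: log_mean_def field_simps)
qed simp

text \<open>The derivative of the difference of both sides is (y - 1)^2 / (y (y + 1)^2). With x = b
  / a the inequality compares the logarithmic with the arithmetic mean.\<close>

lemma ln_ge_twice: assumes "x \<ge> (1::real)" shows "2 * (x - 1) / (x + 1) \<le> ln x"
proof -
  have "ln 1 - 2 * (1 - 1) / (1 + 1) \<le> ln x - 2 * (x - 1) / (x + 1)"
  proof (rule DERIV_nonneg_imp_nondecreasing[OF assms])
	fix y :: real assume y: "1 \<le> y" "y \<le> x"
	have "((\<lambda>y. ln y - 2 * (y - 1) / (y + 1)) has_real_derivative 1 / y - (2 * (y + 1) - 2 * (y - 1)) / (y + 1)^2) (at y)"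
	  using y by (auto intro!: derivative_eq_intros simp: power2_eq_square)
	moreover have "1 / y - (2 * (y + 1) - 2 * (y - 1)) / (y + 1)^2 = (y - 1)^2 / (y * (y + 1)^2)"
	proof -
	  have "1 / y - (2 * (y + 1) - 2 * (y - 1)) / (y + 1)^2 = (1 * (y + 1)^2 - (2 * (y + 1) - 2 * (y - 1)) * y) / (y * (y + 1)^2)"
		using y by (intro diff_frac_eq) auto
	  also have "1 * (y + 1)^2 - (2 * (y + 1) - 2 * (y - 1)) * y = (y - 1)^2" by (simp add: power2_eq_square algebra_simps)
	  finally show ?thesis .
	qed
	ultimately show "\<exists>d. ((\<lambda>y. ln y - 2 * (y - 1) / (y + 1)) has_real_derivative d) (at y) \<and> 0 \<le> d" using y by auto
  qed
  thus ?thesis by simp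
qed

lemma log_mean_nonneg: "log_mean a b \<ge> 0"
proof -
  have "(a - b) / (ln a - ln b) \<ge> 0" if "a > 0" "b > 0" using that by (simp add: zero_le_divide_iff) (metis linear ln_le_cancel_iff)
  thus ?thesis by (auto simp: log_mean_def min_def)
qed

lemma log_mean_le_mean_aux: assumes "0 < a" "a < b" shows "log_mean a b \<le> (a + b) / 2"
proof -
  have "2 * (b / a - 1) / (b / a + 1) \<le> ln (b / a)" using assms by (intro ln_ge_twice) simp
  also have "ln (b / a) = ln b - ln a" using assms by (simp add: ln_div)
  also have "2 * (b / a - 1) / (b / a + 1) = 2 * (b - a) / (b + a)"
  proof -
	have "b / a - 1 = (b - a) / a" "b / a + 1 = (b + a) / a" using assms by (simp_all add: diff_divide_distrib add_divide_distrib)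
	thus ?thesis using assms by simp
  qed
  finally have "2 * (b - a) / (b + a) \<le> ln b - ln a" .
  hence "log_mean a b * (2 * (b - a) / (b + a)) \<le> b - a"
	using log_mean_mult[of a b] assms mult_left_mono[of "2 * (b - a) / (b + a)" "ln b - ln a" "log_mean a b"]
	  log_mean_nonneg[of a b] by simp
  hence "log_mean a b * (2 / (b + a)) * (b - a) \<le> 1 * (b - a)" by (simp add: mult.assoc)
  hence "log_mean a b * (2 / (b + a)) \<le> 1" by (rule mult_right_le_imp_le) (use assms in simp)
  thus ?thesis using assms by (simp add: field_simps)
qed

lemma log_mean_le_mean: assumes "a \<ge> 0" "b \<ge> 0" shows "log_mean a b \<le> (a + b) / 2"
proof (cases "min a b \<le> 0")
  case False
  hence pos: "a > 0" "b > 0" by auto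
  consider "a < b" | "b < a" | "a = b" by linarith
  thus ?thesis
  proof cases
	case 1
	thus ?thesis using log_mean_le_mean_aux[OF pos(1)] by simp
  next
	case 2
	thus ?thesis unfolding log_mean_sym[of a b] using log_mean_le_mean_aux[OF pos(2), of a] by simp
  qed (use pos in \<open>simp add: log_mean_def\<close>)
qed (use assms in \<open>simp add: log_mean_def\<close>)

lemma log_mean_ge_min: assumes "a > 0" "b > 0" "a \<le> b" shows "a \<le> log_mean a b"
proof (cases "a = b")
  case False
  have "ln b - ln a = ln (b / a)" using assms by (simp add: ln_div)
  also have "... \<le> b / a - 1" using assms by (intro ln_le_minus_one) simp
  finally have "a * (ln b - ln a) \<le> b - a" using assms by (simp add: field_simps)
  moreover have "ln b - ln a > 0" using assms False by simp
  moreover have "log_mean a b = (b - a) / (ln b - ln a)" using log_mean_mult[OF assms(1,2)] `ln b - ln a > 0` by (simp add: field_simps)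
  ultimately show ?thesis by (simp add: pos_le_divide_eq)
qed (use assms in \<open>simp add: log_mean_def\<close>)

text \<open>For positive arguments the mean lies between them; otherwise the mean and the smaller
  argument are 0. So replacing a face value by a cell value is an error of first order in the
  jump.\<close>

lemma log_mean_diff: assumes "a \<ge> 0" "b \<ge> 0" shows "abs (log_mean a b - a) \<le> abs (b - a)"
proof (cases "min a b \<le> 0")
  case True
  thus ?thesis using assms by (auto simp: log_mean_def min_def split: if_splits)
next
  case False
  thus ?thesis using log_mean_le_mean[OF assms] log_mean_ge_min[of a b] log_mean_ge_min[of b a] log_mean_sym[of a b] by (cases "a \<le> b") auto
qed

text \<open>The flux divided by the transmissivity, with reversed sign, as a function of the two
  adjacent states; no mesh data enter.\<close>

definition cross_flux :: "real ^ 'n ^ 'n => real => real ^ 'n => real ^ 'n => 'n => real" where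
  "cross_flux A astar p q i = astar * (q $ i - p $ i) + (SU j. (A $ i $ j - astar) *
	 (log_mean (p $ j) (q $ j) * (q $ i - p $ i) - log_mean (p $ i) (q $ i) * (q $ j - p $ j)))"

lemma cross_flux_antisym: "cross_flux A astar q p i = - cross_flux A astar p q i"
  unfolding cross_flux_def minus_add_distrib sum_negf[symmetric] log_mean_sym[of "q $ _"]
  by (intro arg_cong2[where f = "(+)"] sum.cong) (simp_all add: algebra_simps)

lemma simplex_nonneg: "p \<in> unit_simplex ==> 0 \<le> p $ i"
  and simplex_sum: "p \<in> unit_simplex ==> (SU i. p $ i) = 1" by (auto simp: unit_simplex_def)

lemma simplex_le_1: assumes "p \<in> unit_simplex" shows "p $ i \<le> 1"
  using member_le_sum[of i UNIV "\<lambda>i. p $ i"] simplex_nonneg[OF assms] simplex_sum[OF assms] by simp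

text \<open>Logarithmic means are at most arithmetic means, and the latter sum to 1. The remainder,
  1 minus this sum, is the weight with which \<open>astar\<close> acts.\<close>

lemma simplex_log_mean_sum:
  assumes "p \<in> unit_simplex" "q \<in> unit_simplex"
  shows "(SU j. log_mean (p $ j) (q $ j)) \<le> 1"
proof -
  have "(SU j. log_mean (p $ j) (q $ j)) \<le> (SU j. (p $ j + q $ j) / 2)" using assms simplex_nonneg by (intro sum_mono log_mean_le_mean) auto
  also have "... = 1" using assms by (simp add: simplex_sum sum.distrib flip: sum_divide_distrib)
  finally show ?thesis .
qed

lemma simplex_log_mean_le_1:
  assumes "p \<in> unit_simplex" "q \<in> unit_simplex"
  shows "log_mean (p $ j) (q $ j) \<le> 1" using log_mean_le_mean[of "p $ j" "q $ j"] assms simplex_le_1[of p j] simplex_le_1[of q j]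
  by (simp add: simplex_nonneg)

text \<open>With p_i = 0 the mean w_i vanishes and the flux becomes q_i (astar (1 - W) + sum of a_ij
  w_j), where W is the sum of the means w_j. As w_i = 0, the diagonal coefficient, which c need not
  bound, drops out.\<close>

lemma cross_flux_at_zero:
  fixes A :: "real ^ 'n ^ 'n"
  assumes pq: "p \<in> unit_simplex" "q \<in> unit_simplex" and A: "\<And>i j. 0 \<le> A $ i $ j" "\<And>i j. i \<noteq> j ==> c \<le> A $ i $ j"
	and c: "0 < c" "c \<le> astar" and p0: "p $ i = 0"
  shows "c * q $ i \<le> cross_flux A astar p q i"
proof -
  let ?w = "\<lambda>j. log_mean (p $ j) (q $ j)"
  have w: "?w j \<ge> 0" for j by (rule log_mean_nonneg)
  have wi: "?w i = 0" using p0 by (simp add: log_mean_def)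
  have "cross_flux A astar p q i = q $ i * (astar * (1 - (SU j. ?w j)) + (SU j. A $ i $ j * ?w j))"
  proof -
	have "cross_flux A astar p q i = astar * q $ i + (SU j. (A $ i $ j - astar) * (?w j * q $ i))" unfolding cross_flux_def wi by (simp add: p0)
	thus ?thesis by (simp add: algebra_simps sum_subtractf sum_distrib_left)
  qed
  moreover have "c \<le> astar * (1 - (SU j. ?w j)) + (SU j. A $ i $ j * ?w j)"
  proof -
	have "c * (SU j. ?w j) \<le> (SU j. A $ i $ j * ?w j)" unfolding sum_distrib_left
	proof (rule sum_mono)
	  fix j show "c * ?w j \<le> A $ i $ j * ?w j" using A(2)[of i j] w[of j] wi by (cases "j = i") (auto intro: mult_right_mono)
	qed
	moreover have "c * (1 - (SU j. ?w j)) \<le> astar * (1 - (SU j. ?w j))" using simplex_log_mean_sum[OF pq] c by (intro mult_right_mono) auto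
	ultimately show ?thesis by (simp add: algebra_simps)
  qed
  ultimately show ?thesis using simplex_nonneg[OF pq(2), of i] by (simp only: mult.commute[of c]) (rule mult_left_mono)
qed

text \<open>The discrete chain rule \<open>D u\<^sub>i = u\<^sub>i\<^sub>,\<^sub>\<sigma> D ln u\<^sub>i\<close> turns the cross-diffusion terms into
  \<open>u\<^sub>i\<^sub>,\<^sub>\<sigma> u\<^sub>j\<^sub>,\<^sub>\<sigma> D (ln u\<^sub>i - ln u\<^sub>j)\<close>. With the convention \<open>ln 0 = 0\<close> it also holds when both values vanish.\<close>

lemma cross_flux_dissipation:
  fixes A :: "real ^ 'n ^ 'n"
  assumes pq: "p \<in> unit_simplex" "q \<in> unit_simplex" and sym: "\<And>i j. A $ i $ j = A $ j $ i"
	and A: "\<And>i j. 0 \<le> A $ i $ j" "\<And>i j. i \<noteq> j ==> c \<le> A $ i $ j"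
	and c: "0 < c" "c \<le> astar" and zero: "\<And>i. p $ i = 0 \<longleftrightarrow> q $ i = 0"
  shows "c * (SU i. (q $ i - p $ i)^2) \<le> (SU i. cross_flux A astar p q i * (ln (q $ i) - ln (p $ i)))"
proof -
  define w where "w j = log_mean (p $ j) (q $ j)" for j
  define l where "l j = ln (q $ j) - ln (p $ j)" for j
  let ?P = "\<lambda>i j. w i * w j * (l i - l j)" and ?Q = "\<lambda>i j. w i * w j * (l i - l j)^2"
  have w: "w j \<ge> 0" "w j \<le> 1" for j using log_mean_nonneg simplex_log_mean_le_1[OF pq] by (auto simp: w_def)
  define W where "W = (SU j. w j)"
  have "W \<le> 1" using simplex_log_mean_sum[OF pq] by (simp add: W_def w_def)
  have D: "q $ i - p $ i = w i * l i" for i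
  proof (cases "p $ i = 0")
	case False
	hence "p $ i > 0" "q $ i > 0" using zero[of i] simplex_nonneg[OF pq(1), of i] simplex_nonneg[OF pq(2), of i] by auto
	from log_mean_mult[OF this] show ?thesis by (simp add: w_def l_def)
  qed (use zero[of i] in \<open>simp add: l_def\<close>)
  have sumD: "(SU i. w i * l i) = 0" using simplex_sum[OF pq(1)] simplex_sum[OF pq(2)] by (simp add: D[symmetric] sum_subtractf)
  define S where "S = (SU i. w i * (l i)^2)"
  have "S \<ge> 0" unfolding S_def using w by (intro sum_nonneg) auto
  have flux: "cross_flux A astar p q i = astar * (w i * l i) + (SU j. (A $ i $ j - astar) * ?P i j)" for i
	unfolding cross_flux_def D w_def[symmetric] by (simp add: algebra_simps)
  \<comment> \<open>\<open>?P\<close> is antisymmetric in i and j, so with symmetric coefficients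
    averaging over both orders replaces the factor l i by (l i - l j) / 2.\<close>
  have swap: "(SU i j. B i j * ?P i j * l i) = (SU i j. B i j * ?Q i j) / 2" if B: "\<And>i j. B i j = B j i" for B :: "'n => 'n => real"
  proof -
	let ?f = "\<lambda>i j. B i j * ?P i j * l i"
	have "(SU i j. ?f i j) = (SU i j. ?f j i)" by (rule sum.swap)
	hence "2 * (SU i j. ?f i j) = (SU i j. ?f i j + ?f j i)" by (simp add: sum.distrib)
	also have "... = (SU i j. B i j * ?Q i j)"
	proof (intro sum.cong refl)
	  fix i j
	  show "?f i j + ?f j i = B i j * ?Q i j" unfolding B[of j i] by (simp add: power2_eq_square algebra_simps)
	qed
	finally show ?thesis by simp
  qed
  \<comment> \<open>When the square is expanded, the mixed term is the square of the sum of all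
    increments w_i l_i, which vanishes because both states have sum 1.\<close>
  have WS: "(SU i j. ?Q i j) / 2 = W * S"
  proof -
	have "(SU i j. ?Q i j) = (SU i j. w j * (w i * (l i)^2)) + (SU i j. w i * (w j * (l j)^2))
		  - 2 * (SU i j. (w i * l i) * (w j * l j))" by (simp add: power2_eq_square algebra_simps sum.distrib sum_subtractf sum_distrib_left)
	also have "(SU i j. w j * (w i * (l i)^2)) = W * S" unfolding W_def S_def sum_product by (rule sum.swap)
	also have "(SU i j. w i * (w j * (l j)^2)) = W * S" unfolding W_def S_def by (simp add: sum_product)
	also have "(SU i j. (w i * l i) * (w j * l j)) = 0" using sumD by (simp flip: sum_product)
	finally show ?thesis by simp
  qed
  have "(SU i. cross_flux A astar p q i * l i) = astar * S + (SU i j. (A $ i $ j - astar) * ?P i j * l i)"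
	unfolding flux S_def by (simp add: algebra_simps sum.distrib sum_distrib_left power2_eq_square)
  also have "... = astar * S + (SU i j. (A $ i $ j - astar) * ?Q i j) / 2" by (subst swap) (simp_all add: sym)
  also have "... = astar * S + (SU i j. A $ i $ j * ?Q i j) / 2 - astar * (W * S)"
	unfolding WS[symmetric] by (simp add: left_diff_distrib sum_subtractf sum_distrib_left diff_divide_distrib)
  finally have total: "(SU i. cross_flux A astar p q i * l i) = astar * S * (1 - W) + (SU i j. A $ i $ j * ?Q i j) / 2"
	by (simp add: algebra_simps)
  have "c * (W * S) = (SU i j. c * ?Q i j) / 2" unfolding WS[symmetric] by (simp add: sum_distrib_left)
  also have "... \<le> (SU i j. A $ i $ j * ?Q i j) / 2"
  proof (intro divide_right_mono sum_mono)
	fix i j show "c * ?Q i j \<le> A $ i $ j * ?Q i j" using A(2)[of i j] w by (cases "i = j") (auto intro!: mult_right_mono)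
  qed simp
  finally have 1: "c * (W * S) \<le> (SU i j. A $ i $ j * ?Q i j) / 2" .
  have 2: "c * S * (1 - W) \<le> astar * S * (1 - W)" using c `S \<ge> 0` `W \<le> 1` by (intro mult_right_mono) auto
  have "c * S \<le> (SU i. cross_flux A astar p q i * l i)" using 1 2 unfolding total by (simp add: algebra_simps)
  \<comment> \<open>The increment is w_i l_i and w_i <= 1, so its square is at most w_i
    l_i^2.\<close>
  moreover have "(SU i. (q $ i - p $ i)^2) \<le> S" unfolding S_def D
  proof (rule sum_mono)
	fix i show "(w i * l i)^2 \<le> w i * (l i)^2" using w[of i] mult_right_mono[of "w i * w i" "w i" "(l i)^2"] mult_left_mono[of "w i" 1 "w i"]
	  by (simp add: power_mult_distrib power2_eq_square[of "w i"])
  qed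
  ultimately show ?thesis unfolding l_def using c by (meson less_imp_le mult_left_mono order_trans)
qed

text \<open>Summing over both indices yields one constant for all species; the factor 2 counts the
  two products in each summand of the flux.\<close>

definition flux_const :: "real ^ 'n ^ 'n => real => real" where
  "flux_const A astar = abs astar + 2 * (SU i j. abs (A $ i $ j - astar))"

lemma flux_const_nonneg: "flux_const A astar \<ge> 0" unfolding flux_const_def by (intro add_nonneg_nonneg mult_nonneg_nonneg sum_nonneg) auto

lemma cross_flux_bound:
  fixes A :: "real ^ 'n ^ 'n"
  assumes pq: "p \<in> unit_simplex" "q \<in> unit_simplex"
  shows "abs (cross_flux A astar p q i) \<le> flux_const A astar * (SU j. abs (q $ j - p $ j))"
proof -
  let ?D = "SU j. abs (q $ j - p $ j)"
  have Dj: "abs (q $ j - p $ j) \<le> ?D" for j by (intro member_le_sum) auto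
  have w: "abs (log_mean (p $ j) (q $ j)) \<le> 1" for j using log_mean_nonneg simplex_log_mean_le_1[OF pq] by simp
  have "abs (cross_flux A astar p q i) \<le> abs astar * ?D + (SU j. abs (A $ i $ j - astar) * (2 * ?D))" unfolding cross_flux_def
  proof (intro order_trans[OF abs_triangle_ineq] add_mono order_trans[OF sum_abs] sum_mono)
	show "abs (astar * (q $ i - p $ i)) \<le> abs astar * ?D" using Dj by (simp add: abs_mult mult_left_mono)
	fix j
	have "abs (log_mean (p $ j) (q $ j) * (q $ i - p $ i) - log_mean (p $ i) (q $ i) * (q $ j - p $ j)) \<le> 1 * ?D + 1 * ?D"
	  by (intro order_trans[OF abs_triangle_ineq4] add_mono; unfold abs_mult; intro mult_mono w Dj) auto
	thus "abs ((A $ i $ j - astar) * (log_mean (p $ j) (q $ j) * (q $ i - p $ i) - log_mean (p $ i) (q $ i) * (q $ j - p $ j)))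
	  \<le> abs (A $ i $ j - astar) * (2 * ?D)" unfolding abs_mult by (intro mult_left_mono) auto
  qed
  also have "... = (abs astar + 2 * (SU j. abs (A $ i $ j - astar))) * ?D" by (simp add: algebra_simps sum_distrib_left sum_distrib_right)
  also have "... \<le> flux_const A astar * ?D" unfolding flux_const_def by (intro mult_right_mono add_left_mono mult_left_mono sum_nonneg
	  member_le_sum[of i UNIV "\<lambda>i. SU j. abs (A $ i $ j - astar)"]) (auto intro: sum_nonneg)
  finally show ?thesis .
qed

lemma cross_flux_square_bound:
  fixes A :: "real ^ 'n ^ 'n"
  assumes pq: "p \<in> unit_simplex" "q \<in> unit_simplex"
  shows "(cross_flux A astar p q i)^2 \<le> (flux_const A astar)^2 * CARD('n) * (SU j. (q $ j - p $ j)^2)"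
proof -
  have "(cross_flux A astar p q i)^2 \<le> (flux_const A astar * (SU j. abs (q $ j - p $ j)))^2"
	using cross_flux_bound[OF pq, of A astar i] by (metis abs_ge_zero power2_abs power_mono)
  also have "... = (flux_const A astar)^2 * (SU j. abs (q $ j - p $ j))^2" by (rule power_mult_distrib)
  also have "... \<le> (flux_const A astar)^2 * (CARD('n) * (SU j. (q $ j - p $ j)^2))"
	using sum_squared_le_sum_of_squares[of "\<lambda>j. abs (q $ j - p $ j)" "UNIV::'n set"] by (intro mult_left_mono) (auto simp: mult.commute)
  finally show ?thesis by (simp add: mult.assoc)
qed

text \<open>The tangent of the convex function x ln x at a. With ln 0 = 0 the inequality fails at a
  = 0 for small b > 0, whence the assumption that b vanishes as well; \<open>zero_propagates\<close>
  provides it.\<close>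

lemma entropy_convex:
  fixes a b :: real
  assumes "0 \<le> a" "0 \<le> b" "a = 0 ==> b = 0"
  shows "a * ln a - b * ln b \<le> (a - b) * ln a + (a - b)"
proof (cases "b = 0")
  case False
  hence pos: "a > 0" "b > 0" using assms by (auto simp: less_le)
  have "ln (a / b) \<le> a / b - 1" using pos by (intro ln_le_minus_one) simp
  hence "b * ln (a / b) \<le> b * (a / b - 1)" using pos by (intro mult_left_mono) auto
  hence "b * (ln a - ln b) \<le> a - b" using pos by (simp add: ln_div right_diff_distrib)
  thus ?thesis by (simp add: algebra_simps)
qed (use assms in simp)

lemma entropy_bounds:
  fixes x :: real
  assumes "0 \<le> x" "x \<le> 1"
  shows "- 1 \<le> x * ln x" "x * ln x \<le> 0"
proof -
  show "x * ln x \<le> 0" using assms by (cases "x = 0") (auto simp: mult_nonneg_nonpos)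
  show "- 1 \<le> x * ln x" using entropy_convex[of 1 x] assms by simp
qed

section \<open>The scheme on one mesh: entropy, energy and time differences\<close>

lemma sum_swap3:
  "(\<Sum>i\<in>I. \<Sum>K\<in>C. \<Sum>L\<in>D. f i K L) = (\<Sum>K\<in>C. \<Sum>L\<in>D. \<Sum>i\<in>I. f i K L)"
  by (subst sum.swap) (intro sum.cong refl sum.swap)

text \<open>Discrete integration by parts. Every pair of cells is counted in both orders, hence the
  factor 1/2.\<close>

lemma sum_antisym:
  fixes f :: "'c => 'c => real"
  assumes "\<And>K L. f L K = - f K L"
  shows "(\<Sum>K\<in>C. \<Sum>L\<in>C. f K L * g K) = - (\<Sum>K\<in>C. \<Sum>L\<in>C. f K L * (g L - g K)) / 2"
proof -
  have "(\<Sum>K\<in>C. \<Sum>L\<in>C. f K L * g L) = (\<Sum>K\<in>C. \<Sum>L\<in>C. f L K * g K)" by (rule sum.swap)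
  also have "... = - (\<Sum>K\<in>C. \<Sum>L\<in>C. f K L * g K)" unfolding sum_negf[symmetric] by (intro sum.cong refl) (subst assms, simp)
  finally show ?thesis by (simp add: right_diff_distrib sum_subtractf)
qed

locale fv_solution = fv_mesh \<Omega> M for \<Omega> :: "'a::euclidean_space set" and M +
  fixes T :: real and NT :: nat and t :: "nat => real" and A :: "real ^ 'n ^ 'n" and astar :: real
	and U0 :: "'a => real ^ 'n" and V :: "nat => 'a set => real ^ 'n" and c :: real
  assumes T: "T > 0" and sym: "\<And>i j. A $ i $ j = A $ j $ i" and A_nonneg: "\<And>i j. 0 \<le> A $ i $ j"
	and c: "0 < c" "c \<le> astar" "\<And>i j. i \<noteq> j ==> c \<le> A $ i $ j"
	and time: "time_discretization T NT t"
	and U0: "in_Linf_simplex \<Omega> U0"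
	and scheme: "scheme_solution M NT t A astar U0 V"
	and V_simplex_pos: "\<And>n K. n \<in> {1..NT} ==> K \<in> cells M ==> V n K \<in> unit_simplex"
begin

abbreviation m :: "'a set => real" where "m K \<equiv> vol K"

definition dt :: "nat => real" where "dt n = t n - t (n - 1)"

lemma t_Suc: "n < NT ==> t n < t (Suc n)" and t_0: "t 0 = 0" and t_NT: "t NT = T" using time by (auto simp: time_discretization_def)

lemma dt_pos: "n \<in> {1..NT} ==> dt n > 0" using t_Suc[of "n - 1"] by (cases n) (simp_all add: dt_def)

lemma NT_pos: "NT \<ge> 1" using t_0 t_NT T by (cases NT) auto

lemma dt_le: "n \<in> {1..NT} ==> dt n \<le> time_step NT t" unfolding time_step_def dt_def by (intro Max_ge) auto

lemma time_step_pos: "time_step NT t > 0" using dt_le[of 1] dt_pos[of 1] NT_pos by simp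

lemma t_diff: "p \<le> n ==> n \<le> NT ==> (\<Sum>k\<in>{p<..n}. dt k) = t n - t p"
proof (induction n rule: dec_induct)
  case (step n)
  have "{p<..Suc n} = insert (Suc n) {p<..n}" using step by auto
  thus ?case using step by (simp add: dt_def)
qed simp

lemma sum_dt: "(\<Sum>n=1..NT. dt n) = T"
proof -
  have "{1..NT} = {0<..NT}" by auto
  thus ?thesis using t_diff[of 0 NT] t_0 t_NT by simp
qed

lemma U0_bounds: "AE x in lebesgue_on \<Omega>. U0 x \<in> unit_simplex" and U0_measurable: "U0 \<in> borel_measurable (lebesgue_on \<Omega>)"
  using U0 by (auto simp: in_Linf_simplex_def)

lemma U0_component_integrable: "integrable (lebesgue_on \<Omega>) (\<lambda>x. U0 x $ i)"
proof (rule finite_measure.integrable_const_bound)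
  show "finite_measure (lebesgue_on \<Omega>)" using domain_lmeasurable by (simp add: finite_measure_lebesgue_on)
  show "AE x in lebesgue_on \<Omega>. norm (U0 x $ i) \<le> 1" using U0_bounds by eventually_elim (simp add: simplex_nonneg simplex_le_1)
  show "(\<lambda>x. U0 x $ i) \<in> borel_measurable (lebesgue_on \<Omega>)"
	using U0_measurable by (rule measurable_compose) (intro borel_measurable_continuous_onI continuous_intros)
qed

lemma lebesgue_on_cell:
  assumes K: "K \<in> cells M"
  shows "integrable (lebesgue_on K) (\<lambda>x. U0 x $ i)" "AE x in lebesgue_on K. U0 x \<in> unit_simplex"
proof -
  have sub: "K \<subseteq> \<Omega>" "K \<in> sets lebesgue" "\<Omega> \<in> sets lebesgue" using cell[OF K] open_domain by auto
  show "integrable (lebesgue_on K) (\<lambda>x. U0 x $ i)"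
  proof -
	have "set_integrable lebesgue \<Omega> (\<lambda>x. U0 x $ i)"
	  using U0_component_integrable[of i] sub unfolding set_integrable_def by (simp add: integrable_restrict_space)
	hence "set_integrable lebesgue K (\<lambda>x. U0 x $ i)" using sub(2,1) by (rule set_integrable_subset)
	thus ?thesis using sub unfolding set_integrable_def by (simp add: integrable_restrict_space)
  qed
  have "AE x in lebesgue. x \<in> \<Omega> \<longrightarrow> U0 x \<in> unit_simplex" using U0_bounds sub by (simp add: AE_restrict_space_iff)
  hence "AE x in lebesgue. x \<in> K \<longrightarrow> U0 x \<in> unit_simplex" by eventually_elim (use sub in auto)
  thus "AE x in lebesgue_on K. U0 x \<in> unit_simplex" using sub by (simp add: AE_restrict_space_iff)
qed

lemma V_0: "K \<in> cells M ==> V 0 K $ i = (1 / m K) * (\<integral>x. U0 x $ i \<partial>lebesgue_on K)"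
  using scheme by (simp add: scheme_solution_def)

lemma V_0_simplex: assumes K: "K \<in> cells M" shows "V 0 K \<in> unit_simplex"
proof -
  have nn: "0 \<le> V 0 K $ i" for i
  proof -
	have "0 \<le> (\<integral>x. U0 x $ i \<partial>lebesgue_on K)"
	  using lebesgue_on_cell(2)[OF K] by (intro integral_nonneg_AE) (auto simp: simplex_nonneg elim: eventually_mono)
	thus ?thesis using V_0[OF K] cell_measure_pos[OF K] by simp
  qed
  have "(SU i. V 0 K $ i) = (1 / m K) * (\<integral>x. (SU i. U0 x $ i) \<partial>lebesgue_on K)"
	using lebesgue_on_cell(1)[OF K] by (simp add: V_0[OF K] integral_sum flip: sum_divide_distrib)
  also have "(\<integral>x. (SU i. U0 x $ i) \<partial>lebesgue_on K) = (\<integral>x. 1 \<partial>lebesgue_on K)"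
  proof (rule integral_cong_AE)
	show "AE x in lebesgue_on K. (SU i. U0 x $ i) = 1" using lebesgue_on_cell(2)[OF K] by eventually_elim (simp add: simplex_sum)
  qed (use lebesgue_on_cell(1)[OF K] in \<open>auto intro!: borel_measurable_sum\<close>)
  also have "... = m K" using cell_lmeasurable[OF K] by (simp add: measure_restrict_space fmeasurableD)
  finally show ?thesis using nn cell_measure_pos[OF K] by (simp add: unit_simplex_def)
qed

lemma V_simplex: "n \<le> NT ==> K \<in> cells M ==> V n K \<in> unit_simplex" using V_0_simplex V_simplex_pos by (cases "n = 0") auto

definition J :: "nat => 'n => 'a set => 'a set => real" where
  "J n i K L = cross_flux A astar (V n K) (V n L) i"

lemma J_antisym: "J n i L K = - J n i K L" unfolding J_def by (rule cross_flux_antisym)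

lemma scheme_step:
  assumes n: "n \<in> {1..NT}" and K: "K \<in> cells M"
  shows "m K * (V n K $ i - V (n - 1) K $ i) = dt n * (\<Sigma> L. tau K L * J n i K L)"
proof -
  have "m K * ((V n K $ i - V (n - 1) K $ i) / dt n) + (\<Sum>\<sigma>\<in>cell_faces M K. flux M A astar (V n) i K \<sigma>) = 0"
	using scheme n K by (simp add: scheme_solution_def dt_def)
  moreover have "(\<Sum>\<sigma>\<in>cell_faces M K. flux M A astar (V n) i K \<sigma>) = - (\<Sigma> L. tau K L * J n i K L)"
	unfolding flux_sum[OF K] J_def cross_flux_def ..
  ultimately show ?thesis using dt_pos[OF n] by (simp add: field_simps)
qed

lemma zero_propagates:
  assumes n: "n \<in> {1..NT}" and K: "K \<in> cells M" and zero: "V n K $ i = 0"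
  shows "V (n - 1) K $ i = 0" "\<And>L. adj K L ==> V n L $ i = 0"
proof -
  have L: "c * V n L $ i \<le> J n i K L" "0 \<le> V n L $ i" if "L \<in> cells M" for L
	unfolding J_def using cross_flux_at_zero[OF V_simplex_pos[OF n K] V_simplex_pos[OF n that] A_nonneg c(3,1,2) zero]
	  simplex_nonneg[OF V_simplex_pos[OF n that]] by auto
  have nn: "0 \<le> tau K L * J n i K L" if "L \<in> cells M" for L
	using tau_nonneg[of K L] L[OF that] c by (intro mult_nonneg_nonneg) (auto intro: order_trans[rotated])
  have prev: "0 \<le> V (n - 1) K $ i" using V_simplex[of "n - 1" K] n K by (intro simplex_nonneg) auto
  have "- (m K * V (n - 1) K $ i) = dt n * (\<Sigma> L. tau K L * J n i K L)" using scheme_step[OF n K, of i] zero by simp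
  moreover have "0 \<le> m K * V (n - 1) K $ i" using prev by simp
  moreover have "0 \<le> dt n * (\<Sigma> L. tau K L * J n i K L)"
	using dt_pos[OF n] sum_nonneg[of "cells M" "\<lambda>L. tau K L * J n i K L", OF nn] by simp
  ultimately have z: "m K * V (n - 1) K $ i = 0" "dt n * (\<Sigma> L. tau K L * J n i K L) = 0" by linarith+
  show "V (n - 1) K $ i = 0" using z(1) cell_measure_pos[OF K] by simp
  fix L assume a: "adj K L"
  hence "L \<in> cells M" by (simp add: adj_def)
  have "(\<Sigma> L. tau K L * J n i K L) = 0" using z(2) dt_pos[OF n] by simp
  hence "tau K L * J n i K L = 0" using sum_nonneg_eq_0_iff[OF finite_cells nn] `L \<in> cells M` by auto
  hence "J n i K L = 0" using tau_pos[OF a] by simp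
  thus "V n L $ i = 0" using L[OF `L \<in> cells M`] c by (simp add: mult_le_0_iff)
qed

text \<open>The square of a discrete H1 seminorm; every interior face is counted twice, once from
  each side.\<close>

definition energy :: "nat => real" where
  "energy n = (\<Sigma> K L. tau K L * (SU i. (V n L $ i - V n K $ i)^2))"

definition entropy :: "nat => real" where
  "entropy n = (\<Sigma> K. m K * (SU i. V n K $ i * ln (V n K $ i)))"

lemma energy_nonneg: "energy n \<ge> 0" unfolding energy_def by (intro sum_nonneg mult_nonneg_nonneg tau_nonneg) auto

lemma summation_by_parts:
  assumes n: "n \<in> {1..NT}"
  shows "(\<Sigma> K. m K * (V n K $ i - V (n - 1) K $ i) * g K) = - dt n * (\<Sigma> K L. tau K L * J n i K L * (g L - g K)) / 2"
proof -
  have "(\<Sigma> K. m K * (V n K $ i - V (n - 1) K $ i) * g K) = dt n * (\<Sigma> K L. (tau K L * J n i K L) * g K)"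
	unfolding sum_distrib_left[of "dt n"]
  proof (rule sum.cong)
	fix K assume "K \<in> cells M"
	thus "m K * (V n K $ i - V (n - 1) K $ i) * g K = (\<Sigma> L. dt n * (tau K L * J n i K L * g K))"
	  unfolding scheme_step[OF n `K \<in> cells M`] by (simp add: sum_distrib_left sum_distrib_right mult.assoc)
  qed simp
  also have "(\<Sigma> K L. (tau K L * J n i K L) * g K) = - (\<Sigma> K L. (tau K L * J n i K L) * (g L - g K)) / 2"
  proof -
	have "tau L K * J n i L K = - (tau K L * J n i K L)" for K L unfolding tau_sym[of L K] J_antisym[of n i L K] by simp
	thus ?thesis by (rule sum_antisym)
  qed
  finally show ?thesis by simp
qed

lemma entropy_step:
  assumes n: "n \<in> {1..NT}"
  shows "entropy n + dt n * (c / 2) * energy n \<le> entropy (n - 1)"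
proof -
  have n1: "n - 1 \<le> NT" "n \<le> NT" using n by auto
  let ?d = "\<lambda>K i. V n K $ i - V (n - 1) K $ i" and ?l = "\<lambda>K i. ln (V n K $ i)"
  let ?D = "\<lambda>K L. SU i. J n i K L * (?l L i - ?l K i)"
  have "entropy n - entropy (n - 1) \<le> (\<Sigma> K. m K * (SU i. ?d K i * ?l K i))" unfolding entropy_def sum_subtractf[symmetric]
  proof (rule sum_mono)
	fix K assume K: "K \<in> cells M"
	have "(SU i. V n K $ i * ?l K i - V (n - 1) K $ i * ln (V (n - 1) K $ i)) \<le> (SU i. ?d K i * ?l K i + ?d K i)"
	  using V_simplex[OF n1(1) K] V_simplex[OF n1(2) K] zero_propagates(1)[OF n K] by (intro sum_mono entropy_convex) (auto simp: simplex_nonneg)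
	\<comment> \<open>The linear terms of the tangent inequality cancel, because the components of both
	  states sum to 1.\<close>
	also have "... = (SU i. ?d K i * ?l K i)" using simplex_sum[OF V_simplex[OF n1(1) K]] simplex_sum[OF V_simplex[OF n1(2) K]]
	  by (simp add: sum.distrib sum_subtractf)
	finally have "(SU i. V n K $ i * ?l K i) - (SU i. V (n - 1) K $ i * ln (V (n - 1) K $ i))
	  \<le> (SU i. ?d K i * ?l K i)" by (simp add: sum_subtractf)
	from mult_left_mono[OF this, of "m K"]
	show "m K * (SU i. V n K $ i * ?l K i) - m K * (SU i. V (n - 1) K $ i * ln (V (n - 1) K $ i))
	  \<le> m K * (SU i. ?d K i * ?l K i)" by (simp add: right_diff_distrib)
  qed
  also have "... = (SU i. \<Sigma> K. m K * ?d K i * ?l K i)" by (subst sum.swap) (simp add: sum_distrib_left mult.assoc)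
  also have "... = (SU i. - dt n * (\<Sigma> K L. tau K L * J n i K L * (?l L i - ?l K i)) / 2)"
	by (intro sum.cong refl summation_by_parts[OF n])
  also have "... = - (dt n / 2) * (\<Sigma> K L. tau K L * ?D K L)"
  proof -
	have "(SU i. - dt n * X i / 2) = - (dt n / 2) * (SU i. X i)" for X :: "'n => real" by (simp add: sum_distrib_left sum_negf)
	moreover have "(SU i. \<Sigma> K L. tau K L * J n i K L * (?l L i - ?l K i)) = (\<Sigma> K L. tau K L * ?D K L)"
	  by (subst sum_swap3) (simp only: sum_distrib_left mult.assoc)
	ultimately show ?thesis by (simp only:)
  qed
  also have "... \<le> - (dt n / 2) * (c * energy n)"
  proof (rule mult_left_mono_neg)
	show "c * energy n \<le> (\<Sigma> K L. tau K L * ?D K L)" unfolding energy_def sum_distrib_left[of c]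
	proof (intro sum_mono)
	  fix K L assume KL: "K \<in> cells M" "L \<in> cells M"
	  show "c * (tau K L * (SU i. (V n L $ i - V n K $ i)^2)) \<le> tau K L * ?D K L"
	  proof (cases "adj K L")
		case True
		hence "adj L K" using adj_sym by blast
		\<comment> \<open>Zeros on the two sides of a face coincide, as the discrete chain rule with ln 0
		  = 0 requires.\<close>
		have zero: "V n K $ i = 0 \<longleftrightarrow> V n L $ i = 0" for i
		  using zero_propagates(2)[OF n KL(1) _ True] zero_propagates(2)[OF n KL(2) _ `adj L K`] by auto
		have "c * (SU i. (V n L $ i - V n K $ i)^2) \<le> ?D K L" unfolding J_def
		  by (rule cross_flux_dissipation[OF V_simplex_pos[OF n KL(1)] V_simplex_pos[OF n KL(2)] sym A_nonneg c(3,1,2) zero])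
		hence "tau K L * (c * (SU i. (V n L $ i - V n K $ i)^2)) \<le> tau K L * ?D K L" by (rule mult_left_mono) (rule tau_nonneg)
		thus ?thesis by (simp add: mult.left_commute)
	  qed (simp add: tau_eq_0)
	qed
	show "- (dt n / 2) \<le> 0" using dt_pos[OF n] by simp
  qed
  finally show ?thesis by (simp add: algebra_simps)
qed

text \<open>The entropy steps telescope, and the entropy lies between minus the number of species
  times |\<Omega>| and 0. So the bound is the same for all meshes.\<close>

theorem energy_estimate: "(\<Sum>n=1..NT. dt n * energy n) \<le> 2 * CARD('n) * vol \<Omega> / c"
proof -
  have tele: "entropy k + (\<Sum>n\<in>{1..k}. dt n * (c / 2) * energy n) \<le> entropy 0" if "k \<le> NT" for k using that
  proof (induction k)
	case (Suc k)
	thus ?case using entropy_step[of "Suc k"] by simp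
  qed simp
  have e0: "entropy 0 \<le> 0" unfolding entropy_def using V_simplex[of 0]
	by (intro sum_nonpos mult_nonneg_nonpos[OF measure_nonneg] entropy_bounds(2)) (auto simp: simplex_nonneg simplex_le_1)
  have "(\<Sigma> K. m K * (\<Sum>i\<in>(UNIV::'n set). - 1)) \<le> entropy NT" unfolding entropy_def using V_simplex[of NT]
	by (intro sum_mono mult_left_mono entropy_bounds(1)) (auto simp: simplex_nonneg simplex_le_1)
  hence eN: "- (CARD('n) * vol \<Omega>) \<le> entropy NT"
	by (simp add: sum_cell_measures mult.commute sum_negf flip: sum_distrib_left sum_distrib_right)
  have "(c / 2) * (\<Sum>n=1..NT. dt n * energy n) \<le> CARD('n) * vol \<Omega>" using tele[of NT] e0 eN by (simp add: sum_distrib_left mult_ac)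
  thus ?thesis using c by (simp add: field_simps)
qed

text \<open>As \<open>tau\<close> is area over distance, each summand is area times distance, and
  the distance splits into the two depths of the face; both halves are sums of cone volumes.\<close>

lemma sum_tau_cdist: "(\<Sigma> K L. tau K L * (cdist K L)^2) \<le> 2 * DIM('a) * vol \<Omega>"
proof -
  have "tau K L * (cdist K L)^2 = area K L * depth K L + area L K * depth L K" for K L
	by (cases "adj K L") (auto simp: area_eq tau_eq_0 adj_sym[of L K] power2_eq_square
	  depth_add[of K L, symmetric] tau_sym[of L K] cdist_sym[of L K] algebra_simps)
  hence "(\<Sigma> K L. tau K L * (cdist K L)^2) = (\<Sigma> K L. area K L * depth K L) + (\<Sigma> K L. area L K * depth L K)"
	by (simp add: sum.distrib)
  also have "(\<Sigma> K L. area L K * depth L K) = (\<Sigma> K L. area K L * depth K L)" by (rule sum.swap)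
  also have "(\<Sigma> K L. area K L * depth K L) \<le> (\<Sigma> K. DIM('a) * m K)" by (intro sum_mono sum_area_depth)
  also have "... = DIM('a) * vol \<Omega>" by (simp add: sum_cell_measures flip: sum_distrib_left)
  finally show ?thesis by simp
qed

text \<open>\<open>|D u| = |D u| d / d\<close> and Young's inequality.\<close>

lemma sum_area_jump:
  "(\<Sigma> K L. area K L * abs (V n L $ i - V n K $ i)) \<le> DIM('a) * vol \<Omega> + energy n / 2"
proof -
  have "(\<Sigma> K L. area K L * abs (V n L $ i - V n K $ i))
	 \<le> (\<Sigma> K L. tau K L * (cdist K L)^2 / 2 + tau K L * (SU i. (V n L $ i - V n K $ i)^2) / 2)"
  proof (intro sum_mono)
	fix K L
	let ?D = "abs (V n L $ i - V n K $ i)"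
	have "2 * cdist K L * ?D \<le> (cdist K L)^2 + ?D^2" by (rule sum_squares_bound)
	also have "?D^2 \<le> (SU i. (V n L $ i - V n K $ i)^2)" using member_le_sum[of i UNIV "\<lambda>i. (V n L $ i - V n K $ i)^2"] by simp
	finally have "tau K L * (cdist K L * ?D) \<le> tau K L * (((cdist K L)^2 + (SU i. (V n L $ i - V n K $ i)^2)) / 2)"
	  by (intro mult_left_mono tau_nonneg) simp
	thus "area K L * ?D \<le> tau K L * (cdist K L)^2 / 2 + tau K L * (SU i. (V n L $ i - V n K $ i)^2) / 2"
	  by (simp add: area_eq algebra_simps add_divide_distrib)
  qed
  also have "... = (\<Sigma> K L. tau K L * (cdist K L)^2) / 2 + energy n / 2" by (simp add: energy_def sum.distrib sum_divide_distrib)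
  finally show ?thesis using sum_tau_cdist by simp
qed

text \<open>The difference V n - V p serves both as test function w and as telescoping sum of scheme
  steps. Each step k gives fluxes times jumps of w, and Young's inequality leads to the energies at
  k, n and p. The constant is the square bound of the flux summed over species, plus 1 for the jumps
  of w.\<close>

lemma time_difference:
  assumes p: "1 \<le> p" "p \<le> n" "n \<le> NT"
  shows "(\<Sigma> K. m K * (SU i. (V n K $ i - V p K $ i)^2))
	 \<le> ((flux_const A astar)^2 * (CARD('n))^2 + 1) * (\<Sum>k\<in>{p<..n}. dt k * (energy k + energy n + energy p))"
proof -
  define C where "C = (flux_const A astar)^2 * (CARD('n))^2"
  have "C \<ge> 0" by (simp add: C_def)
  define w where "w i K = V n K $ i - V p K $ i" for i K
  let ?d = "\<lambda>k K i. V k K $ i - V (k - 1) K $ i" and ?P = "\<lambda>k i K L. abs (J k i K L) * abs (w i L - w i K)"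
  let ?e = "\<lambda>k. energy k + energy n + energy p"
  have tele: "w i K = (\<Sum>k\<in>{p<..n}. ?d k K i)" for i K unfolding w_def using p(2)
  proof (induction n rule: dec_induct)
	case (step n)
	have "{p<..Suc n} = insert (Suc n) {p<..n}" using step by auto
	thus ?case using step by simp
  qed simp
  have E: "(\<Sigma> K L. tau K L * (SU i. ?P k i K L)) \<le> (C + 1) * ?e k" if k: "k \<in> {p<..n}" for k
  proof -
	have k': "k \<in> {1..NT}" using k p by auto
	have "(\<Sigma> K L. tau K L * (SU i. ?P k i K L)) \<le> (\<Sigma> K L. C * (tau K L * (SU i. (V k L $ i - V k K $ i)^2))
		  + tau K L * (SU i. (V n L $ i - V n K $ i)^2) + tau K L * (SU i. (V p L $ i - V p K $ i)^2))"
	proof (intro sum_mono)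
	  fix K L assume KL: "K \<in> cells M" "L \<in> cells M"
	  let ?S = "\<lambda>k. SU i. (V k L $ i - V k K $ i)^2"
	  have "?P k i K L \<le> (J k i K L)^2 + (V n L $ i - V n K $ i)^2 + (V p L $ i - V p K $ i)^2" for i
	  proof -
		let ?x = "V n L $ i - V n K $ i" and ?y = "V p L $ i - V p K $ i"
		have "abs (w i L - w i K) \<le> abs ?x + abs ?y" unfolding w_def by linarith
		hence "?P k i K L \<le> abs (J k i K L) * abs ?x + abs (J k i K L) * abs ?y"
		  unfolding distrib_left[symmetric] by (rule mult_left_mono) simp
		moreover have "2 * abs (J k i K L) * abs ?x \<le> (J k i K L)^2 + ?x^2" "2 * abs (J k i K L) * abs ?y \<le> (J k i K L)^2 + ?y^2"
		  using sum_squares_bound[of "abs (J k i K L)" "abs ?x"] sum_squares_bound[of "abs (J k i K L)" "abs ?y"] by simp_all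
		moreover have "0 \<le> ?x^2" "0 \<le> ?y^2" by simp_all
		ultimately show ?thesis by linarith
	  qed
	  hence "(SU i. ?P k i K L) \<le> (SU i. (J k i K L)^2) + ?S n + ?S p" unfolding sum.distrib[symmetric] by (rule sum_mono)
	  also have "(SU i. (J k i K L)^2) \<le> (\<Sum>i\<in>(UNIV::'n set). (flux_const A astar)^2 * CARD('n) * ?S k)"
		unfolding J_def using V_simplex_pos[OF k'] KL by (intro sum_mono cross_flux_square_bound) auto
	  also have "... = C * ?S k" by (simp add: C_def power2_eq_square)
	  finally have "tau K L * (SU i. ?P k i K L) \<le> tau K L * (C * ?S k + ?S n + ?S p)" by (rule mult_left_mono) (auto intro: tau_nonneg)
	  thus "tau K L * (SU i. ?P k i K L) \<le> C * (tau K L * ?S k) + tau K L * ?S n + tau K L * ?S p" by (simp add: algebra_simps)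
	qed
	also have "... = C * energy k + energy n + energy p" by (simp add: energy_def sum.distrib sum_distrib_left)
	also have "... \<le> (C + 1) * ?e k" using `C \<ge> 0` energy_nonneg[of k] energy_nonneg[of n] energy_nonneg[of p]
	  by (simp add: algebra_simps)
	finally show ?thesis .
  qed
  have "(\<Sigma> K. m K * (SU i. (w i K)^2)) = (\<Sum>k\<in>{p<..n}. SU i. \<Sigma> K. m K * ?d k K i * w i K)"
  proof -
	have "m K * (SU i. (w i K)^2) = (\<Sum>k\<in>{p<..n}. SU i. m K * ?d k K i * w i K)" for K
	proof -
	  have "(w i K)^2 = (\<Sum>k\<in>{p<..n}. ?d k K i * w i K)" for i using tele[of i K] by (simp add: power2_eq_square flip: sum_distrib_right)
	  hence "m K * (SU i. (w i K)^2) = (SU i. \<Sum>k\<in>{p<..n}. m K * ?d k K i * w i K)" by (simp add: sum_distrib_left mult.assoc)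
	  thus ?thesis by (subst sum.swap)
	qed
	hence "(\<Sigma> K. m K * (SU i. (w i K)^2)) = (\<Sum>k\<in>{p<..n}. \<Sigma> K. SU i. m K * ?d k K i * w i K)"
	  by (simp only:) (rule sum.swap)
	also have "... = (\<Sum>k\<in>{p<..n}. SU i. \<Sigma> K. m K * ?d k K i * w i K)" by (intro sum.cong refl sum.swap)
	finally show ?thesis .
  qed
  also have "... \<le> (\<Sum>k\<in>{p<..n}. dt k * ((C + 1) * ?e k))"
  proof (rule sum_mono)
	fix k assume k: "k \<in> {p<..n}"
	hence k': "k \<in> {1..NT}" using p by auto
	let ?X = "\<Sigma> K L. tau K L * (SU i. ?P k i K L)"
	have "(SU i. \<Sigma> K. m K * ?d k K i * w i K) = (SU i. - dt k * (\<Sigma> K L. tau K L * J k i K L * (w i L - w i K)) / 2)"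
	  by (intro sum.cong refl summation_by_parts[OF k'])
	also have "... \<le> (SU i. dt k * (\<Sigma> K L. tau K L * ?P k i K L))"
	proof (rule sum_mono)
	  fix i
	  let ?Y = "\<Sigma> K L. tau K L * J k i K L * (w i L - w i K)"
	  let ?Z = "\<Sigma> K L. tau K L * ?P k i K L"
	  have "abs ?Y \<le> ?Z" by (intro order_trans[OF sum_abs] sum_mono) (simp add: abs_mult tau_nonneg mult.assoc)
	  hence "- ?Y / 2 \<le> ?Z" by linarith
	  hence "dt k * (- ?Y / 2) \<le> dt k * ?Z" using dt_pos[OF k'] by (intro mult_left_mono) auto
	  thus "- dt k * ?Y / 2 \<le> dt k * ?Z" by simp
	qed
	also have "... = dt k * (SU i. \<Sigma> K L. tau K L * ?P k i K L)" by (rule sum_distrib_left[symmetric])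
	also have "(SU i. \<Sigma> K L. tau K L * ?P k i K L) = ?X" by (subst sum_swap3) (simp only: sum_distrib_left)
	also have "dt k * ?X \<le> dt k * ((C + 1) * ?e k)" using E[OF k] dt_pos[OF k'] by (intro mult_left_mono) auto
	finally show "(SU i. \<Sigma> K. m K * ?d k K i * w i K) \<le> dt k * ((C + 1) * ?e k)" .
  qed
  also have "... = (C + 1) * (\<Sum>k\<in>{p<..n}. dt k * ?e k)" by (simp add: sum_distrib_left mult.left_commute)
  finally show ?thesis unfolding w_def C_def .
qed

end

section \<open>Integrability and invariance under translations\<close>

lemma integrable_indicator_bounded:
  fixes S :: "'b::euclidean_space set"
  assumes "bounded S" "S \<in> sets borel"
  shows "integrable lborel (\<lambda>z. indicator S z :: real)"
  using emeasure_bounded_finite[OF assms(1)] assms(2) by (intro integrable_real_indicator) auto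

lemma integrable_bounded_support:
  fixes g :: "'b::euclidean_space => 'c::euclidean_space"
  assumes [measurable]: "g \<in> borel_measurable borel" and B: "\<And>z. norm (g z) \<le> B" and R: "\<And>z. z \<notin> cball 0 R ==> g z = 0"
  shows "integrable lborel g"
proof (rule integrable_bound)
  show "integrable lborel (\<lambda>z. B * indicator (cball 0 R) z :: real)" by (intro integrable_mult_right integrable_indicator_bounded) auto
  show "AE z in lborel. norm (g z) \<le> norm (B * indicator (cball 0 R) z)"
	using B R by (intro always_eventually) (auto simp: indicator_def intro: order_trans[OF _ abs_ge_self])
qed simp

lemma integral_lborel_translate:
  fixes g :: "'b::euclidean_space => 'c::{banach, second_countable_topology}"
  assumes [measurable]: "g \<in> borel_measurable borel"
  shows "(LBINT z. g (a + z)) = (LBINT z. g z)"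
proof -
  have "(LBINT z. g z) = (\<integral>z. g z \<partial>distr lborel borel ((+) a))" by (simp add: lborel_distr_plus)
  also have "... = (LBINT z. g (a + z))" by (rule integral_distr) auto
  finally show ?thesis ..
qed

lemma integrable_lborel_translate:
  fixes g :: "'b::euclidean_space => 'c::{banach, second_countable_topology}"
  assumes "integrable lborel g"
  shows "integrable lborel (\<lambda>z. g (a + z))"
proof -
  have "integrable (distr lborel borel ((+) a)) g" using assms by (simp add: lborel_distr_plus)
  thus ?thesis by (rule integrable_distr[rotated]) simp
qed

section \<open>Compactness in L1 and convex combinations in L2\<close>

text \<open>A Lipschitz kernel with compact support is enough for mollification here: it makes the
  mollified functions equi-Lipschitz, which is what Arzela-Ascoli asks for.\<close>

definition tent :: "real => 'b::euclidean_space => real" where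
  "tent \<delta> y = max 0 (\<delta> - norm y)"

definition tent_mass :: "'b::euclidean_space itself => real => real" where
  "tent_mass _ \<delta> = (LBINT y. tent \<delta> (y::'b))"

definition tent_kernel :: "real => 'b::euclidean_space => real" where
  "tent_kernel \<delta> y = tent \<delta> y / tent_mass TYPE('b) \<delta>"

definition mollify :: "real => ('b::euclidean_space => 'c::euclidean_space) => 'b => 'c" where
  "mollify \<delta> f z = (LBINT y. tent_kernel \<delta> y *R f (z + y))"

lemma tent_measurable [measurable]: "tent \<delta> \<in> borel_measurable borel" unfolding tent_def by measurable

lemma tent_kernel_measurable [measurable]: "tent_kernel \<delta> \<in> borel_measurable borel" unfolding tent_kernel_def by measurable

lemma tent_facts: "0 \<le> tent \<delta> y" "\<delta> \<ge> 0 ==> tent \<delta> y \<le> \<delta>" "y \<notin> cball 0 \<delta> ==> tent \<delta> y = 0"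
  "abs (tent \<delta> y - tent \<delta> y') \<le> norm (y - y')" using norm_triangle_ineq3[of y y'] by (auto simp: tent_def max_def)

lemma tent_integrable: "\<delta> > 0 ==> integrable lborel (tent \<delta> :: 'b::euclidean_space => real)"
  by (rule integrable_bounded_support[where B = \<delta> and R = \<delta>]) (auto simp: tent_facts)

lemma tent_mass_pos: assumes "\<delta> > 0" shows "tent_mass TYPE('b::euclidean_space) \<delta> > 0"
proof -
  have "0 < (\<delta> / 2) * measure lborel (ball (0::'b) (\<delta> / 2))" using assms content_ball_pos[of "\<delta> / 2" "0::'b"] by simp
  also have "... = (LBINT y. (\<delta> / 2) * indicator (ball (0::'b) (\<delta> / 2)) y)" by simp
  also have "... \<le> tent_mass TYPE('b) \<delta>" unfolding tent_mass_def
  proof (rule integral_mono[OF _ tent_integrable[OF assms]])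
	show "integrable lborel (\<lambda>y. (\<delta> / 2) * indicator (ball (0::'b) (\<delta> / 2)) y)"
	  by (intro integrable_mult_right integrable_indicator_bounded) auto
	show "(\<delta> / 2) * indicator (ball (0::'b) (\<delta> / 2)) y \<le> tent \<delta> y" for y
	  by (cases "y \<in> ball 0 (\<delta> / 2)") (auto simp: tent_def max_def)
  qed
  finally show ?thesis .
qed

context
  fixes f :: "'b::euclidean_space => 'c::euclidean_space" and B R \<delta> :: real
  assumes f [measurable]: "f \<in> borel_measurable borel" and B: "\<And>z. norm (f z) \<le> B"
	and R: "\<And>z. z \<notin> cball 0 R ==> f z = 0" and \<delta>: "0 < \<delta>"
begin

abbreviation (input) kern :: "'b => real" where "kern \<equiv> tent_kernel \<delta>"

lemma kern: "0 \<le> kern y" "integrable lborel kern" "(LBINT y. kern y) = 1"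
  using tent_mass_pos[OF \<delta>, where 'b = 'b] tent_integrable[OF \<delta>, where 'b = 'b] tent_facts(1)[of \<delta> y]
  by (simp_all add: tent_mass_def tent_kernel_def[abs_def] integrable_divide)

lemma kern_support: "\<not> norm y \<le> \<delta> ==> kern y = 0" by (simp add: tent_kernel_def tent_facts)

lemma kern_diff: "abs (kern y - kern y') \<le> norm (y - y') / tent_mass TYPE('b) \<delta>"
  using tent_facts(4)[of \<delta> y y'] tent_mass_pos[OF \<delta>, where 'b = 'b]
  by (simp add: tent_kernel_def abs_divide divide_right_mono flip: diff_divide_distrib)

lemma kern_f_integrable: "integrable lborel (\<lambda>y. kern y *R f (z + y))"
proof (rule integrable_bound)
  show "integrable lborel (\<lambda>y. B * kern y)" using kern(2) by simp
  show "AE y in lborel. norm (kern y *R f (z + y)) \<le> norm (B * kern y)"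
  proof (intro always_eventually allI)
	fix y
	have "norm (kern y *R f (z + y)) = kern y * norm (f (z + y))" using kern(1)[of y] by simp
	also have "... \<le> kern y * B" using B kern(1) by (intro mult_left_mono) auto
	finally show "norm (kern y *R f (z + y)) \<le> norm (B * kern y)" by (simp add: mult.commute)
  qed
qed measurable

lemma mollify_bound: "norm (mollify \<delta> f z) \<le> B"
proof -
  have "norm (mollify \<delta> f z) \<le> (LBINT y. norm (kern y *R f (z + y)))" unfolding mollify_def by (rule integral_norm_bound)
  also have "... \<le> (LBINT y. kern y * B)"
  proof (rule integral_mono)
	fix y show "norm (kern y *R f (z + y)) \<le> kern y * B" using kern(1)[of y] B by (simp add: mult_left_mono)
  qed (intro integrable_norm kern_f_integrable integrable_mult_left kern(2))+
  also have "... = B" using kern(3) by simp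
  finally show ?thesis .
qed

lemma mollify_support: "z \<notin> cball 0 (R + \<delta>) ==> mollify \<delta> f z = 0"
proof -
  assume z: "z \<notin> cball 0 (R + \<delta>)"
  have zero: "kern y *R f (z + y) = 0" for y
  proof (cases "norm y \<le> \<delta>")
	case True
	have "norm z \<le> norm (z + y) + norm y" by (metis add_diff_cancel_right' norm_triangle_ineq4)
	hence "f (z + y) = 0" using z True by (intro R) auto
	thus ?thesis by simp
  qed (simp add: kern_support)
  show ?thesis unfolding mollify_def zero by simp
qed

lemma mollify_lipschitz:
  "norm (mollify \<delta> f z - mollify \<delta> f z') \<le> norm (z - z') * (B * measure lborel (cball (0::'b) R) / tent_mass TYPE('b) \<delta>)"
proof -
  let ?k = "\<lambda>y. norm (z - z') / tent_mass TYPE('b) \<delta> * (B * indicator (cball (0::'b) R) y)"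
  have eq: "mollify \<delta> f z = (LBINT y. kern (y - z) *R f y)" for z
	unfolding mollify_def using integral_lborel_translate[of "\<lambda>y. kern (y - z) *R f y" z] by simp
  have int: "integrable lborel (\<lambda>y. kern (y - z) *R f y)" for z
	using integrable_lborel_translate[OF kern_f_integrable[of z], of "- z"] by simp
  have "norm (mollify \<delta> f z - mollify \<delta> f z') = norm (LBINT y. kern (y - z) *R f y - kern (y - z') *R f y)"
	unfolding eq using int by (subst integral_diff) auto
  also have "... \<le> (LBINT y. norm (kern (y - z) *R f y - kern (y - z') *R f y))" by (rule integral_norm_bound)
  also have "... \<le> (LBINT y. ?k y)"
  proof (rule integral_mono)
	show "integrable lborel (\<lambda>y. ?k y)" by (intro integrable_mult_right integrable_indicator_bounded) auto
	fix y
	have "norm (kern (y - z) *R f y - kern (y - z') *R f y) = abs (kern (y - z) - kern (y - z')) * norm (f y)" by (simp flip: scaleR_diff_left)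
	also have "... \<le> ?k y"
	proof (rule mult_mono)
	  show "abs (kern (y - z) - kern (y - z')) \<le> norm (z - z') / tent_mass TYPE('b) \<delta>"
		using kern_diff[of "y - z" "y - z'"] by (simp add: norm_minus_commute)
	  show "norm (f y) \<le> B * indicator (cball 0 R) y" using B[of y] R[of y] by (auto simp: indicator_def)
	qed (use tent_mass_pos[OF \<delta>, where 'b = 'b] in auto)
	finally show "norm (kern (y - z) *R f y - kern (y - z') *R f y) \<le> ?k y" .
  qed (use int in auto)
  also have "... = norm (z - z') * (B * measure lborel (cball (0::'b) R) / tent_mass TYPE('b) \<delta>)" by simp
  finally show ?thesis .
qed

lemma mollify_continuous: "continuous_on UNIV (mollify \<delta> f)"
proof -
  define C where "C = B * measure lborel (cball (0::'b) R) / tent_mass TYPE('b) \<delta>"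
  have "B \<ge> 0" using order_trans[OF norm_ge_zero B] .
  hence "C \<ge> 0" using tent_mass_pos[OF \<delta>, where 'b = 'b] by (simp add: C_def)
  hence "C-lipschitz_on UNIV (mollify \<delta> f)" using mollify_lipschitz by (intro lipschitz_onI) (simp_all add: dist_norm C_def mult.commute)
  thus ?thesis by (rule lipschitz_on_continuous_on)
qed

lemma mollify_measurable: "mollify \<delta> f \<in> borel_measurable borel" using mollify_continuous by (rule borel_measurable_continuous_onI)

lemma mollify_integrable: "integrable lborel (mollify \<delta> f)"
  using mollify_measurable mollify_bound mollify_support by (rule integrable_bounded_support)

text \<open>The mollification is an average of translates by at most \<delta>; Tonelli exchanges
  this average with the L1 norm.\<close>

lemma mollify_L1_distance:
  assumes trans: "\<And>y. norm y \<le> \<delta> ==> (LBINT z. norm (f (z + y) - f z)) \<le> \<epsilon>"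
  shows "(LBINT z. norm (mollify \<delta> f z - f z)) \<le> \<epsilon>"
proof -
  let ?D = "\<lambda>y z. norm (f (z + y) - f z)" and ?m = "\<lambda>z. norm (mollify \<delta> f z - f z)"
  have f_int: "integrable lborel f" using f B R by (rule integrable_bounded_support)
  have "\<epsilon> \<ge> 0" using trans[of 0] \<delta> by simp
  have "(NBINT z. ennreal (?m z)) \<le> (NBINT z y. ennreal (kern y * ?D y z))"
  proof (rule nn_integral_mono)
	fix z
	have "f z = (LBINT y. kern y *R f z)" using kern(2,3) by simp
	hence "mollify \<delta> f z - f z = (LBINT y. kern y *R f (z + y)) - (LBINT y. kern y *R f z)" by (simp add: mollify_def)
	also have "... = (LBINT y. kern y *R f (z + y) - kern y *R f z)" using kern(2) kern_f_integrable by (intro integral_diff[symmetric]) auto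
	finally have "ennreal (?m z) \<le> (NBINT y. ennreal (norm (kern y *R f (z + y) - kern y *R f z)))" using kern(2) kern_f_integrable[of z]
	  by (simp only:) (intro integral_norm_bound_ennreal integrable_diff, auto)
	also have "... = (NBINT y. ennreal (kern y * ?D y z))" using kern(1) by (simp add: scaleR_diff_right[symmetric] del: scaleR_diff_right)
	finally show "ennreal (?m z) \<le> (NBINT y. ennreal (kern y * ?D y z))" .
  qed
  also have "... = (NBINT y z. ennreal (kern y * ?D y z))" by (rule lborel_pair.Fubini'[symmetric]) measurable
  also have "... \<le> (NBINT y. ennreal (kern y * \<epsilon>))"
  proof (rule nn_integral_mono)
	fix y
	have "integrable lborel (\<lambda>z. f (z + y))" using integrable_lborel_translate[OF f_int, of y] by (simp add: add.commute)
	hence int: "integrable lborel (\<lambda>z. ?D y z)" using f_int by auto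
	have "(NBINT z. ennreal (kern y * ?D y z)) = ennreal (kern y) * (NBINT z. ennreal (?D y z))"
	  using kern(1)[of y] by (simp add: ennreal_mult' nn_integral_cmult)
	also have "... = ennreal (kern y) * ennreal (LBINT z. ?D y z)" using int by (simp add: nn_integral_eq_integral)
	also have "... \<le> ennreal (kern y * \<epsilon>)"
	proof (cases "norm y \<le> \<delta>")
	  case True
	  from mult_left_mono[OF trans[OF this] kern(1)[of y]] show ?thesis using kern(1)[of y] by (simp add: ennreal_mult'[symmetric] ennreal_leI)
	qed (simp add: kern_support)
	finally show "(NBINT z. ennreal (kern y * ?D y z)) \<le> ennreal (kern y * \<epsilon>)" .
  qed
  also have "... = ennreal \<epsilon>" using kern `\<epsilon> \<ge> 0` by (subst nn_integral_eq_integral) (auto simp: mult_nonneg_nonneg)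
  finally have le: "(NBINT z. ennreal (?m z)) \<le> ennreal \<epsilon>" .
  have "(NBINT z. ennreal (?m z)) = ennreal (LBINT z. ?m z)" using f_int mollify_integrable by (intro nn_integral_eq_integral) auto
  with le show ?thesis using `\<epsilon> \<ge> 0` by (simp add: ennreal_le_iff)
qed

end

text \<open>Mollified functions are bounded, equi-Lipschitz and supported in one ball, so for each
  radius a subsequence converges uniformly; a diagonal subsequence works for all radii and is Cauchy
  in L1. Translates are asked to be small only for late indices, because the bound for time
  translates contains the time step.\<close>

theorem Kolmogorov_L1_compactness:
  fixes f :: "nat => 'b::euclidean_space => 'c::euclidean_space"
  assumes f [measurable]: "\<And>m. f m \<in> borel_measurable borel" and B: "\<And>m z. norm (f m z) \<le> B"
	and R: "\<And>m z. z \<notin> cball 0 R ==> f m z = 0"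
	and trans: "\<And>\<epsilon>. \<epsilon> > 0 ==> \<exists>\<delta>>0. \<exists>N. \<forall>m\<ge>N. \<forall>y. norm y \<le> \<delta> \<longrightarrow> (LBINT z. norm (f m (z + y) - f m z)) \<le> \<epsilon>"
  obtains r g where "strict_mono (r :: nat => nat)" "g \<in> borel_measurable borel"
	"AE z in lborel. (\<lambda>m. f (r m) z) ----> g z"
proof -
  define d where "d n = 1 / real (Suc n)" for n
  have d: "0 < d n" "d n \<le> 1" for n by (auto simp: d_def)
  have "B \<ge> 0" using order_trans[OF norm_ge_zero B] .
  let ?h = "\<lambda>n m. mollify (d n) (f m)"
  let ?D = "\<lambda>n s a b. LBINT z. norm (?h n (s a) z - ?h n (s b) z)"
  note moll = mollify_bound[OF f B R d(1)] mollify_support[OF f B R d(1)] mollify_lipschitz[OF f B R d(1)]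
	mollify_integrable[OF f B R d(1)]
  \<comment> \<open>Stated as a Cauchy property along s: it passes to further subsequences and names
    no limit, which suits the diagonal argument.\<close>
  define P where "P n s \<longleftrightarrow> (\<forall>e>0. \<exists>N. \<forall>a\<ge>N. \<forall>b\<ge>N. ?D n s a b < e)"
	for n and s :: "nat => nat"
  have PD: "\<exists>N. \<forall>a\<ge>N. \<forall>b\<ge>N. ?D n s a b < e" if "P n s" "e > 0" for n s e using that unfolding P_def by blast
  interpret subseqs P
  proof
	fix n and s :: "nat => nat" assume "strict_mono s"
	define C where "C = B * measure lborel (cball (0::'b) R) / tent_mass TYPE('b) (d n)"
	have "C \<ge> 0" using `B \<ge> 0` tent_mass_pos[OF d(1)[of n], where 'b = 'b] by (simp add: C_def)
	let ?S = "cball (0::'b) (R + 1)"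
	obtain g k where k: "strict_mono (k :: nat => nat)"
	  and unif: "\<And>e. 0 < e ==> \<exists>N. \<forall>i x. N \<le> i \<and> x \<in> ?S \<longrightarrow> norm (?h n (s (k i)) x - g x) < e"
	proof (rule Arzela_Ascoli[of ?S "\<lambda>i. ?h n (s i)" B])
	  show "\<exists>\<delta>>0. \<forall>i y. y \<in> ?S \<and> norm (x - y) < \<delta> \<longrightarrow> norm (?h n (s i) x - ?h n (s i) y) < e" if "0 < e" for x e
	  proof (intro exI[of _ "e / (C + 1)"] conjI allI impI)
		show "0 < e / (C + 1)" using that `C \<ge> 0` by simp
		fix i y assume "y \<in> ?S \<and> norm (x - y) < e / (C + 1)"
		hence "norm (x - y) * (C + 1) < e" using `C \<ge> 0` by (simp add: pos_less_divide_eq)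
		hence "norm (x - y) * C < e" using norm_ge_zero[of "x - y"] unfolding distrib_left by linarith
		moreover have "norm (?h n (s i) x - ?h n (s i) y) \<le> norm (x - y) * C" unfolding C_def by (rule moll(3))
		ultimately show "norm (?h n (s i) x - ?h n (s i) y) < e" by simp
	  qed
	qed (use moll(1) in auto)
	have "P n (s \<circ> k)" unfolding P_def
	proof (intro allI impI)
	  fix e :: real assume "e > 0"
	  define V where "V = measure lborel ?S"
	  have "V \<ge> 0" by (simp add: V_def)
	  define e' where "e' = e / (2 * (V + 1))"
	  have "e' > 0" using `e > 0` `V \<ge> 0` by (simp add: e'_def)
	  from unif[OF this] obtain N where N: "\<And>i x. N \<le> i ==> x \<in> ?S ==> norm (?h n (s (k i)) x - g x) < e'" by blast
	  have "?D n (s \<circ> k) a b < e" if "a \<ge> N" "b \<ge> N" for a b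
	  proof -
		have "?D n (s \<circ> k) a b \<le> (LBINT z. 2 * e' * indicator ?S z)"
		proof (rule integral_mono)
		  show "integrable lborel (\<lambda>z. 2 * e' * indicator ?S z)" by (intro integrable_mult_right integrable_indicator_bounded) auto
		  fix z
		  show "norm (?h n ((s \<circ> k) a) z - ?h n ((s \<circ> k) b) z) \<le> 2 * e' * indicator ?S z"
		  proof (cases "z \<in> ?S")
			case True
			have "norm (?h n ((s \<circ> k) a) z - ?h n ((s \<circ> k) b) z) \<le> norm (?h n (s (k a)) z - g z) + norm (?h n (s (k b)) z - g z)"
			  using norm_triangle_ineq4[of "?h n (s (k a)) z - g z" "?h n (s (k b)) z - g z"] by simp
			thus ?thesis using N[OF that(1) True] N[OF that(2) True] True by simp
		  next
			case False
			hence "z \<notin> cball 0 (R + d n)" using d(2)[of n] by auto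
			thus ?thesis using moll(2) False by simp
		  qed
		qed (use moll(4) in auto)
		also have "... = 2 * e' * V" by (simp add: V_def)
		also have "... < e" using `V \<ge> 0` `e > 0` by (simp add: e'_def field_simps)
		finally show ?thesis .
	  qed
	  thus "\<exists>N. \<forall>a\<ge>N. \<forall>b\<ge>N. ?D n (s \<circ> k) a b < e" by blast
	qed
	thus "\<exists>r'. strict_mono r' \<and> P n (s \<circ> r')" using k by blast
  qed
  have diag: "P n (diagseq \<circ> (+) (Suc n))" for n
  proof (rule diagseq_holds)
	fix r s :: "nat => nat" and n assume r: "strict_mono r" and P: "P n s"
	show "P n (s \<circ> r)" unfolding P_def
	proof (intro allI impI)
	  fix e :: real assume "e > 0"
	  then obtain N where N: "\<And>a b. a \<ge> N ==> b \<ge> N ==> ?D n s a b < e" using P unfolding P_def by blast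
	  thus "\<exists>N. \<forall>a\<ge>N. \<forall>b\<ge>N. ?D n (s \<circ> r) a b < e"
		using strict_mono_imp_increasing[OF r] by (intro exI[of _ N]) (auto intro: order_trans)
	qed
  qed
  have f_int: "integrable lborel (f m)" for m using f B R by (rule integrable_bounded_support)
  have cauchy: "\<exists>N. \<forall>a\<ge>N. \<forall>b\<ge>N. (LBINT z. norm (f (diagseq a) z - f (diagseq b) z)) < e" if "e > 0" for e
  proof -
	obtain \<delta> N1 where \<delta>: "\<delta> > 0" "\<And>m y. m \<ge> N1 ==> norm y \<le> \<delta> ==> (LBINT z. norm (f m (z + y) - f m z)) \<le> e / 4"
	  using trans[of "e / 4"] `e > 0` by auto
	obtain n where n: "d n < \<delta>" using \<delta>(1) unfolding d_def by (metis nat_approx_posE)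
	have "e / 4 > 0" using `e > 0` by simp
	from PD[OF diag[of n] this, unfolded comp_def] obtain N2 where
	  "\<forall>a\<ge>N2. \<forall>b\<ge>N2. (LBINT z. norm (?h n (diagseq (Suc n + a)) z - ?h n (diagseq (Suc n + b)) z)) < e / 4" ..
	hence N2: "\<And>a b. a \<ge> N2 ==> b \<ge> N2 ==>
		(LBINT z. norm (?h n (diagseq (Suc n + a)) z - ?h n (diagseq (Suc n + b)) z)) < e / 4" by simp
	have close: "(LBINT z. norm (?h n m z - f m z)) \<le> e / 4" if "m \<ge> N1" for m
	  using f B R d(1) by (rule mollify_L1_distance) (use \<delta>(2)[OF that] n in auto)
	have "(LBINT z. norm (f (diagseq a) z - f (diagseq b) z)) < e" if ab: "a \<ge> N1 + N2 + Suc n" "b \<ge> N1 + N2 + Suc n" for a b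
	proof -
	  have ge: "diagseq a \<ge> N1" "diagseq b \<ge> N1" using strict_mono_imp_increasing[OF subseq_diagseq] ab by (meson le_add1 order_trans)+
	  let ?a = "diagseq a" and ?b = "diagseq b"
	  have int: "integrable lborel (\<lambda>z. norm (?h n m z - f m z))" "integrable lborel (\<lambda>z. norm (?h n m z - ?h n m' z))" for m m'
		using f_int moll(4) by auto
	  have "(LBINT z. norm (f ?a z - f ?b z))
		\<le> (LBINT z. norm (?h n ?a z - f ?a z) + (norm (?h n ?a z - ?h n ?b z) + norm (?h n ?b z - f ?b z)))"
	  proof (rule integral_mono)
		fix z
		let ?u = "?h n ?a z - f ?a z" and ?v = "?h n ?a z - ?h n ?b z" and ?w = "?h n ?b z - f ?b z"
		have "f ?a z - f ?b z = - ?u + (?v + ?w)" by simp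
		hence "norm (f ?a z - f ?b z) \<le> norm (- ?u) + norm (?v + ?w)" by (simp only:) (rule norm_triangle_ineq)
		also have "norm (?v + ?w) \<le> norm ?v + norm ?w" by (rule norm_triangle_ineq)
		finally show "norm (f ?a z - f ?b z) \<le> norm ?u + (norm ?v + norm ?w)" by (simp only: norm_minus_cancel)
	  qed (use int f_int in auto)
	  also have "... = (LBINT z. norm (?h n ?a z - f ?a z)) + ((LBINT z. norm (?h n ?a z - ?h n ?b z)) + (LBINT z. norm (?h n ?b z - f ?b z)))"
		using int by simp
	  also have "... \<le> e / 4 + (e / 4 + e / 4)"
	  proof -
		have "N2 \<le> a - Suc n" "N2 \<le> b - Suc n" "Suc n + (a - Suc n) = a" "Suc n + (b - Suc n) = b" using ab by auto
		hence "(LBINT z. norm (?h n ?a z - ?h n ?b z)) < e / 4" using N2[of "a - Suc n" "b - Suc n"] by simp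
		thus ?thesis using close[OF ge(1)] close[OF ge(2)] by linarith
	  qed
	  also have "... < e" using `e > 0` by simp
	  finally show ?thesis .
	qed
	thus ?thesis by blast
  qed
  obtain r where r: "strict_mono r" "AE z in lborel. Cauchy (\<lambda>i. f (diagseq (r i)) z)"
	by (rule cauchy_L1_AE_cauchy_subseq[of lborel "\<lambda>i. f (diagseq i)"]) (use f_int cauchy in auto)
  show thesis
  proof (rule that[of "diagseq \<circ> r" "\<lambda>z. lim (\<lambda>i. f (diagseq (r i)) z)"])
	show "strict_mono (diagseq \<circ> r)" using subseq_diagseq r(1) by (rule strict_mono_o)
	show "(\<lambda>z. lim (\<lambda>i. f (diagseq (r i)) z)) \<in> borel_measurable borel" by measurable
	show "AE z in lborel. (\<lambda>m. f ((diagseq \<circ> r) m) z) ----> lim (\<lambda>i. f (diagseq (r i)) z)"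
	  using r(2) by eventually_elim (simp add: Cauchy_convergent[THEN convergent_LIMSEQ_iff[THEN iffD1]])
  qed
qed

section \<open>Square integrable functions and strongly convergent convex combinations\<close>

text \<open>Square integrability with respect to \<open>lborel\<close>; spaces of functions on a subset are represented by
  functions that vanish outside.\<close>

definition sq_integrable :: "('b::euclidean_space => 'c::euclidean_space) => bool" where
  "sq_integrable f \<longleftrightarrow> f \<in> borel_measurable borel \<and> integrable lborel (\<lambda>z. (norm (f z))^2)"

lemma sq_integrable_measurable: "sq_integrable f ==> f \<in> borel_measurable borel" by (simp add: sq_integrable_def)

lemma sq_integrable_scaleR: "sq_integrable f ==> sq_integrable (\<lambda>z. a *R f z)" by (auto simp: sq_integrable_def power_mult_distrib)

lemma norm_add_squared_le: "(norm (a + b))^2 \<le> 2 * (norm a)^2 + 2 * (norm b)^2" for a b :: "'c::real_normed_vector"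
proof -
  have "(norm (a + b))^2 \<le> (norm a + norm b)^2" by (intro power_mono norm_triangle_ineq) simp
  also have "... \<le> 2 * (norm a)^2 + 2 * (norm b)^2" using sum_squares_bound[of "norm a" "norm b"] by (simp add: power2_sum)
  finally show ?thesis .
qed

lemma sq_integrable_add: assumes "sq_integrable f" "sq_integrable g" shows "sq_integrable (\<lambda>z. f z + g z)" unfolding sq_integrable_def
proof
  have [measurable]: "f \<in> borel_measurable borel" "g \<in> borel_measurable borel" using assms by (auto dest: sq_integrable_measurable)
  show "(\<lambda>z. f z + g z) \<in> borel_measurable borel" by measurable
  show "integrable lborel (\<lambda>z. (norm (f z + g z))^2)"
  proof (rule integrable_bound)
	show "integrable lborel (\<lambda>z. 2 * (norm (f z))^2 + 2 * (norm (g z))^2)" using assms by (auto simp: sq_integrable_def)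
  qed (use norm_add_squared_le in auto)
qed

lemma sq_integrable_diff: assumes "sq_integrable f" "sq_integrable g" shows "sq_integrable (\<lambda>z. f z - g z)"
  using sq_integrable_add[OF assms(1) sq_integrable_scaleR[OF assms(2), of "- 1"]] by simp

lemma sq_integrable_sum: "(\<And>i. i \<in> I ==> sq_integrable (f i)) ==> sq_integrable (\<lambda>z. \<Sum>i\<in>I. f i z)"
proof (induction I rule: infinite_finite_induct)
  case (insert i I)
  thus ?case by (auto intro!: sq_integrable_add)
qed (auto simp: sq_integrable_def)

definition sq_norm :: "('b::euclidean_space => 'c::euclidean_space) => real" where
  "sq_norm f = (LBINT z. (norm (f z))^2)"

lemma sq_norm_nonneg: "sq_norm f \<ge> 0" unfolding sq_norm_def by simp

lemma sq_norm_parallelogram: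
  assumes "sq_integrable f" "sq_integrable g"
  shows "sq_norm (\<lambda>z. f z - g z) = 2 * sq_norm f + 2 * sq_norm g - 4 * sq_norm (\<lambda>z. (1/2) *R (f z + g z))"
proof -
  have int: "integrable lborel (\<lambda>z. (norm (f z))^2)" "integrable lborel (\<lambda>z. (norm (g z))^2)"
	"integrable lborel (\<lambda>z. (norm (f z + g z))^2)" using assms sq_integrable_add[OF assms] by (auto simp: sq_integrable_def)
  have "(norm (f z - g z))^2 = 2 * (norm (f z))^2 + 2 * (norm (g z))^2 - (norm (f z + g z))\<^sup>2" for z
	by (simp add: power2_norm_eq_inner inner_simps inner_commute)
  thus ?thesis unfolding sq_norm_def using int by (simp add: power_mult_distrib power_divide)
qed

lemma Cauchy_Schwarz_sq_norm:
  assumes f: "sq_integrable f" and g: "sq_integrable g"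
  shows "integrable lborel (\<lambda>z. norm (f z) * norm (g z))" "(LBINT z. norm (f z) * norm (g z)) \<le> sqrt (sq_norm f) * sqrt (sq_norm g)"
proof -
  have [measurable]: "f \<in> borel_measurable borel" "g \<in> borel_measurable borel" using f g by (auto dest: sq_integrable_measurable)
  have int: "integrable lborel (\<lambda>z. (norm (f z))^2)" "integrable lborel (\<lambda>z. (norm (g z))^2)" using f g by (auto simp: sq_integrable_def)
  show int2: "integrable lborel (\<lambda>z. norm (f z) * norm (g z))"
  proof (rule integrable_bound)
	show "integrable lborel (\<lambda>z. (norm (f z))^2 + (norm (g z))^2)" using int by simp
	show "AE z in lborel. norm (norm (f z) * norm (g z)) \<le> norm ((norm (f z))^2 + (norm (g z))^2)"
	proof (rule AE_I2)
	  fix z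
	  have "0 \<le> norm (f z) * norm (g z)" by simp
	  with sum_squares_bound[of "norm (f z)" "norm (g z)"]
	  have "norm (f z) * norm (g z) \<le> (norm (f z))^2 + (norm (g z))^2" by linarith
	  thus "norm (norm (f z) * norm (g z)) \<le> norm ((norm (f z))^2 + (norm (g z))^2)" by simp
	qed
  qed measurable
  let ?I = "(LBINT z. norm (f z) * norm (g z))"
  have I: "0 \<le> ?I" by simp
  have "(NBINT z. ennreal (norm (f z)) * ennreal (norm (g z)))^2 \<le> (NBINT z. (ennreal (norm (f z)))^2) * (NBINT z. (ennreal (norm (g z)))^2)"
	by (rule Cauchy_Schwarz_nn_integral) measurable
  moreover have "(NBINT z. ennreal (norm (f z)) * ennreal (norm (g z))) = ennreal ?I"
	using int2 by (simp add: nn_integral_eq_integral flip: ennreal_mult)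
  moreover have "(NBINT z. (ennreal (norm (f z)))^2) = ennreal (sq_norm f)" "(NBINT z. (ennreal (norm (g z)))^2) = ennreal (sq_norm g)"
	using int by (simp_all add: nn_integral_eq_integral ennreal_power sq_norm_def)
  ultimately have "ennreal (?I^2) \<le> ennreal (sq_norm f * sq_norm g)" using I by (simp add: ennreal_power ennreal_mult sq_norm_nonneg)
  hence "?I^2 \<le> sq_norm f * sq_norm g" by (simp add: sq_norm_nonneg)
  thus "?I \<le> sqrt (sq_norm f) * sqrt (sq_norm g)" by (simp add: real_le_rsqrt flip: real_sqrt_mult)
qed

lemma sq_integrable_imp_integrable:
  fixes h :: "'b::euclidean_space => 'c::euclidean_space"
  assumes S: "bounded S" "S \<in> sets borel" and h: "sq_integrable h" "\<And>z. z \<notin> S ==> h z = 0"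
  shows "integrable lborel h" "(LBINT z. norm (h z)) \<le> sqrt (sq_norm (indicator S :: 'b => real)) * sqrt (sq_norm h)"
proof -
  have [measurable]: "S \<in> sets borel" "h \<in> borel_measurable borel" using S h(1) by (auto dest: sq_integrable_measurable)
  have "(norm (indicator S z :: real))^2 = indicator S z" for z by (simp add: indicator_def)
  hence ind: "sq_integrable (indicator S :: 'b => real)" unfolding sq_integrable_def using integrable_indicator_bounded[OF S] by simp
  have eq: "norm (indicator S z :: real) * norm (h z) = norm (h z)" for z using h(2)[of z] by (cases "z \<in> S") auto
  show "integrable lborel h" using Cauchy_Schwarz_sq_norm(1)[OF ind h(1)] unfolding eq by (simp add: integrable_norm_iff)
  show "(LBINT z. norm (h z)) \<le> sqrt (sq_norm (indicator S :: 'b => real)) * sqrt (sq_norm h)"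
	using Cauchy_Schwarz_sq_norm(2)[OF ind h(1)] unfolding eq .
qed

definition tail_weights :: "nat => nat => (nat => real) => bool" where
  "tail_weights n N w \<longleftrightarrow> (\<forall>m. 0 \<le> w m) \<and> (\<forall>m. m < n \<or> N < m \<longrightarrow> w m = 0) \<and> (\<Sum>m\<le>N. w m) = 1"

lemma tail_weights_mono: "tail_weights n N w ==> k \<le> n ==> tail_weights k N w" by (auto simp: tail_weights_def)

lemma tail_weights_extend_sum:
  fixes f :: "nat => 'x::real_vector"
  assumes "tail_weights n N w" "N \<le> N'"
  shows "(\<Sum>m\<le>N'. w m *R f m) = (\<Sum>m\<le>N. w m *R f m)" using assms by (intro sum.mono_neutral_right) (auto simp: tail_weights_def)

lemma tail_weights_extend:
  assumes "tail_weights n N w" "N \<le> N'"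
  shows "tail_weights n N' w" using assms tail_weights_extend_sum[OF assms, of "\<lambda>_. 1::real"] by (auto simp: tail_weights_def)

lemma tail_weights_sum_le:
  assumes "tail_weights n N w" "\<And>m. m \<ge> n ==> e m \<le> \<epsilon>"
  shows "(\<Sum>m\<le>N. w m * e m) \<le> \<epsilon>"
proof -
  have "(\<Sum>m\<le>N. w m * e m) \<le> (\<Sum>m\<le>N. w m * \<epsilon>)"
  proof (rule sum_mono)
	fix m show "w m * e m \<le> w m * \<epsilon>" using assms by (cases "m < n") (auto simp: tail_weights_def intro!: mult_left_mono)
  qed
  also have "... = \<epsilon>" using assms(1) by (simp add: tail_weights_def flip: sum_distrib_right)
  finally show ?thesis .
qed

lemma tail_weights_tendsto_0:
  assumes tw: "\<And>k. tail_weights k (N k) (w k)" and e: "e ----> (0::real)"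
  shows "(\<lambda>k. \<Sum>m\<le>N k. w k m * e m) ----> 0"
proof (rule LIMSEQ_I)
  fix \<epsilon> :: real assume "\<epsilon> > 0"
  then obtain n where n: "\<And>m. m \<ge> n ==> abs (e m) \<le> \<epsilon> / 2"
	using LIMSEQ_D[OF e, of "\<epsilon> / 2"] by (auto intro: less_imp_le)
  have "norm ((\<Sum>m\<le>N k. w k m * e m) - 0) < \<epsilon>" if "k \<ge> n" for k
  proof -
	have "abs (\<Sum>m\<le>N k. w k m * e m) \<le> (\<Sum>m\<le>N k. w k m * abs (e m))"
	  using tw[of k] by (intro order_trans[OF sum_abs]) (simp add: abs_mult tail_weights_def)
	also have "... \<le> \<epsilon> / 2" by (rule tail_weights_sum_le[OF tw]) (use n that in auto)
	finally show ?thesis using `\<epsilon> > 0` by simp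
  qed
  thus "\<exists>no. \<forall>k\<ge>no. norm ((\<Sum>m\<le>N k. w k m * e m) - 0) < \<epsilon>" by blast
qed

text \<open>The infima \<rho> n of the squared norm over convex combinations of the n-th tail
  increase and are bounded by C. Near-minimizers are Cauchy by the parallelogram law, because the
  midpoint of two of them is again a combination of the earlier tail, so its squared norm is at
  least the earlier infimum.\<close>

theorem Mazur_L2:
  fixes f :: "nat => 'b::euclidean_space => 'c::euclidean_space"
  assumes f: "\<And>m. sq_integrable (f m)" and C: "\<And>m. sq_norm (f m) \<le> C" and S: "bounded S" "S \<in> sets borel"
	and supp: "\<And>m z. z \<notin> S ==> f m z = 0"
  obtains N w g where "\<And>k. tail_weights k (N k) (w k)" "sq_integrable g" "\<And>z. z \<notin> S ==> g z = 0"
	"(\<lambda>k. sq_norm (\<lambda>z. (\<Sum>m\<le>N k. w k m *R f m z) - g z)) ----> 0"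
proof -
  define comb where "comb p z = (\<Sum>m\<le>fst p. snd p m *R f m z)" for p and z
  have comb: "sq_integrable (comb p)" for p unfolding comb_def[abs_def] by (intro sq_integrable_sum sq_integrable_scaleR f)
  let ?W = "\<lambda>n. {p. tail_weights n (fst p) (snd p)}"
  define \<rho> where "\<rho> n = Inf ((\<lambda>p. sq_norm (comb p)) ` ?W n)" for n
  have bdd: "bdd_below ((\<lambda>p. sq_norm (comb p)) ` ?W n)" for n using sq_norm_nonneg by (intro bdd_belowI2[of _ 0]) auto
  have single: "(n, \<lambda>m. if m = n then 1 else 0) \<in> ?W n" for n by (auto simp: tail_weights_def)
  have comb_single: "comb (n, \<lambda>m. if m = n then 1 else 0) = f n" for n
  proof
	fix z
	have "comb (n, \<lambda>m. if m = n then 1 else 0) z = (\<Sum>m\<le>n. if m = n then f m z else 0)"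
	  unfolding comb_def fst_conv snd_conv by (rule sum.cong) auto
	thus "comb (n, \<lambda>m. if m = n then 1 else 0) z = f n z" by simp
  qed
  have \<rho>_le: "\<rho> n \<le> sq_norm (comb p)" if "p \<in> ?W n" for n p unfolding \<rho>_def using bdd that by (intro cInf_lower) auto
  have "\<rho> n \<le> C" for n using \<rho>_le[OF single[of n]] C[of n] comb_single[of n] by simp
  moreover have inc: "incseq \<rho>"
  proof (rule incseq_SucI)
	fix n
	have "?W (Suc n) \<subseteq> ?W n" by (auto intro: tail_weights_mono)
	moreover have "?W (Suc n) \<noteq> {}" using single[of "Suc n"] by blast
	ultimately show "\<rho> n \<le> \<rho> (Suc n)" unfolding \<rho>_def by (intro cInf_superset_mono bdd) auto
  qed
  ultimately obtain L where L: "\<rho> ----> L" "\<And>n. \<rho> n \<le> L" using incseq_convergent[of \<rho> C] by blast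
  have "\<exists>p. p \<in> ?W n \<and> sq_norm (comb p) < \<rho> n + 1 / real (Suc n)" for n
  proof -
	have "(\<lambda>p. sq_norm (comb p)) ` ?W n \<noteq> {}" using single[of n] by blast
	from cInf_lessD[OF this, of "\<rho> n + 1 / real (Suc n)"] show ?thesis unfolding \<rho>_def by auto
  qed
  then obtain p where p: "\<And>n. p n \<in> ?W n" "\<And>n. sq_norm (comb (p n)) < \<rho> n + 1 / real (Suc n)" by metis
  \<comment> \<open>Twice \<rho> b - \<rho> a plus the two slacks 2 / (a + 1) and 2 / (b + 1),
    bounded uniformly in b >= a.\<close>
  define \<epsilon> where "\<epsilon> n = 2 * (L - \<rho> n) + 4 / real (Suc n)" for n
  have "(\<lambda>n. 2 * (L - \<rho> n) + 4 * inverse (real (Suc n))) ----> 2 * (L - L) + 4 * 0"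
	by (intro tendsto_intros L(1) LIMSEQ_inverse_real_of_nat)
  hence \<epsilon>: "\<epsilon> ----> 0" by (simp add: \<epsilon>_def[abs_def] divide_inverse)
  have \<epsilon>_mono: "\<epsilon> b \<le> \<epsilon> a" if "a \<le> b" for a b
	unfolding \<epsilon>_def using incseqD[OF inc that] that by (intro add_mono divide_left_mono) auto
  let ?D = "\<lambda>a b. sq_norm (\<lambda>z. comb (p a) z - comb (p b) z)"
  have dist_bound: "?D a b \<le> \<epsilon> a" if ab: "a \<le> b" for a b
  proof -
	define q where "q = (max (fst (p a)) (fst (p b)), \<lambda>m. (snd (p a) m + snd (p b) m) / 2)"
	let ?M = "max (fst (p a)) (fst (p b))"
	have wa: "tail_weights a ?M (snd (p a))" and wb: "tail_weights a ?M (snd (p b))"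
	  using p(1)[of a] p(1)[of b] ab by (auto intro: tail_weights_extend tail_weights_mono)
	have "q \<in> ?W a" unfolding q_def using wa wb by (auto simp: tail_weights_def sum.distrib simp flip: sum_divide_distrib)
	hence "\<rho> a \<le> sq_norm (comb q)" by (rule \<rho>_le)
	moreover have "comb q = (\<lambda>z. (1/2) *R (comb (p a) z + comb (p b) z))"
	proof
	  fix z
	  have "comb (p a) z = (\<Sum>m\<le>?M. snd (p a) m *R f m z)" "comb (p b) z = (\<Sum>m\<le>?M. snd (p b) m *R f m z)"
		unfolding comb_def using p(1)[of a] p(1)[of b] by (auto intro!: tail_weights_extend_sum[symmetric])
	  thus "comb q z = (1/2) *R (comb (p a) z + comb (p b) z)"
		by (simp add: comb_def q_def scaleR_sum_right scaleR_add_left add_divide_distrib sum.distrib scaleR_add_right)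
	qed
	ultimately have "\<rho> a \<le> sq_norm (\<lambda>z. (1/2) *R (comb (p a) z + comb (p b) z))" by simp
	hence "?D a b \<le> 2 * (\<rho> b - \<rho> a) + 2 / real (Suc a) + 2 / real (Suc b)"
	  using sq_norm_parallelogram[OF comb comb, of "p a" "p b"] p(2)[of a] p(2)[of b] by simp
	moreover have "2 / real (Suc b) \<le> 2 / real (Suc a)" using ab by (intro divide_left_mono) auto
	ultimately show ?thesis using L(2)[of b] by (simp add: \<epsilon>_def)
  qed
  have Cauchy: "?D a b \<le> \<epsilon> n" if "n \<le> a" "n \<le> b" for n a b
  proof -
	have "?D a b = ?D b a" by (simp add: sq_norm_def norm_minus_commute)
	thus ?thesis using dist_bound[of a b] dist_bound[of b a] \<epsilon>_mono[OF that(1)] \<epsilon>_mono[OF that(2)] by linarith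
  qed
  have supp: "comb q z = 0" if "z \<notin> S" for q z using supp[OF that] by (simp add: comb_def)
  have [measurable]: "comb q \<in> borel_measurable borel" for q using comb by (rule sq_integrable_measurable)
  \<comment> \<open>On the bounded set S an L2 Cauchy sequence is Cauchy in L1, so a subsequence
    converges almost everywhere; Fatou's lemma then carries the L2 bound over to the limit.\<close>
  obtain r where r: "strict_mono r" "AE z in lborel. Cauchy (\<lambda>i. comb (p (r i)) z)"
  proof (rule cauchy_L1_AE_cauchy_subseq[of lborel "\<lambda>i. comb (p i)"])
	show "integrable lborel (comb (p n))" for n by (rule sq_integrable_imp_integrable(1)[OF S comb supp])
	fix e :: real assume "e > 0"
	let ?k = "sqrt (sq_norm (indicator S :: 'b => real))"
	have "(\<lambda>n. ?k * sqrt (\<epsilon> n)) ----> ?k * sqrt 0" by (intro tendsto_intros \<epsilon>)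
	hence "\<forall>\<^sub>F n in sequentially. ?k * sqrt (\<epsilon> n) < e" using `e > 0` by (intro order_tendstoD) auto
	then obtain N where N: "?k * sqrt (\<epsilon> N) < e" by (auto simp: eventually_sequentially)
	show "\<exists>N. \<forall>i\<ge>N. \<forall>j\<ge>N. (LBINT x. norm (comb (p i) x - comb (p j) x)) < e"
	proof (intro exI[of _ N] allI impI)
	  fix i j assume ij: "N \<le> i" "N \<le> j"
	  have "(LBINT x. norm (comb (p i) x - comb (p j) x)) \<le> ?k * sqrt (?D i j)"
		by (rule sq_integrable_imp_integrable(2)[OF S sq_integrable_diff[OF comb comb]]) (simp add: supp)
	  also have "... \<le> ?k * sqrt (\<epsilon> N)" using Cauchy[OF ij] by (intro mult_left_mono) (auto simp: sq_norm_nonneg)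
	  finally show "(LBINT x. norm (comb (p i) x - comb (p j) x)) < e" using N by linarith
	qed
  qed auto
  define g where "g z = (if z \<in> S then lim (\<lambda>i. comb (p (r i)) z) else 0)" for z
  have [measurable]: "S \<in> sets borel" by fact
  have [measurable]: "g \<in> borel_measurable borel" unfolding g_def[abs_def] by measurable
  have lim: "AE z in lborel. (\<lambda>i. comb (p (r i)) z) ----> g z"
	using r(2) by eventually_elim (auto simp: g_def supp Cauchy_convergent[THEN convergent_LIMSEQ_iff[THEN iffD1]])
  let ?e = "\<lambda>a i z. ennreal ((norm (comb (p a) z - comb (p (r i)) z))^2)"
  have fatou: "(NBINT z. ennreal ((norm (comb (p a) z - g z))^2)) \<le> ennreal (\<epsilon> a)" for a
  proof -
	have "(NBINT z. ennreal ((norm (comb (p a) z - g z))^2)) = (NBINT z. liminf (\<lambda>i. ?e a i z))"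
	proof (rule nn_integral_cong_AE)
	  show "AE z in lborel. ennreal ((norm (comb (p a) z - g z))^2) = liminf (\<lambda>i. ?e a i z)" using lim
	  proof eventually_elim
		case (elim z)
		have "(\<lambda>i. ?e a i z) ----> ennreal ((norm (comb (p a) z - g z))^2)" by (intro tendsto_intros elim)
		thus ?case by (rule lim_imp_Liminf[OF sequentially_bot, symmetric])
	  qed
	qed
	also have "... \<le> liminf (\<lambda>i. NBINT z. ?e a i z)" by (rule nn_integral_liminf) measurable
	also have "... \<le> ennreal (\<epsilon> a)"
	proof (rule Liminf_le)
	  show "\<forall>\<^sub>F i in sequentially. (NBINT z. ?e a i z) \<le> ennreal (\<epsilon> a)" using eventually_ge_at_top[of a]
	  proof eventually_elim
		case (elim i)
		have "(NBINT z. ?e a i z) = ennreal (?D a (r i))" unfolding sq_norm_def using sq_integrable_diff[OF comb comb, of "p a" "p (r i)"]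
		  by (intro nn_integral_eq_integral) (auto simp: sq_integrable_def)
		thus ?case using Cauchy[of a a "r i"] strict_mono_imp_increasing[OF r(1), of i] elim by (simp add: ennreal_leI)
	  qed
	qed simp
	finally show ?thesis .
  qed
  have int: "integrable lborel (\<lambda>z. (norm (comb (p a) z - g z))^2)" for a
	using fatou[of a] by (intro integrableI_nonneg) (auto simp: top_unique less_top[symmetric])
  have \<epsilon>0: "0 \<le> \<epsilon> a" for a using L(2)[of a] by (simp add: \<epsilon>_def)
  have le: "sq_norm (\<lambda>z. comb (p a) z - g z) \<le> \<epsilon> a" for a
	using fatou[of a] int[of a] \<epsilon>0 unfolding sq_norm_def by (subst (asm) nn_integral_eq_integral) auto
  show thesis
  proof (rule that[of "\<lambda>k. fst (p k)" "\<lambda>k. snd (p k)" g])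
	show "tail_weights k (fst (p k)) (snd (p k))" for k using p(1)[of k] by simp
	have "sq_integrable (\<lambda>z. comb (p 0) z - g z)" using int by (simp add: sq_integrable_def)
	from sq_integrable_diff[OF comb[of "p 0"] this] show "sq_integrable g" by simp
	show "g z = 0" if "z \<notin> S" for z using that by (simp add: g_def)
	show "(\<lambda>k. sq_norm (\<lambda>z. (\<Sum>m\<le>fst (p k). snd (p k) m *R f m z) - g z)) ----> 0" unfolding comb_def[symmetric]
	  by (rule Lim_null_comparison[OF always_eventually[OF allI] \<epsilon>]) (simp add: le sq_norm_nonneg)
  qed
qed

section \<open>Transfer between Borel and Lebesgue measure\<close>

lemma AE_lebesgue_onI:
  assumes "S \<in> sets borel" "AE x in lborel. x \<in> S \<longrightarrow> P x" shows "AE x in lebesgue_on S. P x"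
proof -
  have "AE x in lebesgue. x \<in> S \<longrightarrow> P x" using assms(2) by (rule AE_completion)
  thus ?thesis using assms(1) by (subst AE_restrict_space_iff) auto
qed

lemma borel_lebesgue_on: "f \<in> borel_measurable borel ==> f \<in> borel_measurable (lebesgue_on S)"
  by (intro measurable_restrict_space1 measurable_completion) simp

lemma AE_lborel_translate:
  fixes a :: "'b::euclidean_space"
  assumes "AE x in lborel. P x" and [measurable]: "Measurable.pred borel P"
  shows "AE x in lborel. P (a + x)"
proof -
  have "AE x in distr lborel borel ((+) a). P x" unfolding lborel_distr_plus by (rule assms(1))
  moreover have "{x \<in> space borel. P x} \<in> sets borel" by measurable
  ultimately show ?thesis by (subst (asm) AE_distr_iff) auto
qed

lemma nn_integral_lborel_translate:
  fixes g :: "'b::euclidean_space => ennreal"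
  assumes [measurable]: "g \<in> borel_measurable borel"
  shows "(NBINT z. g (a + z)) = (NBINT z. g z)"
proof -
  have "(NBINT z. g z) = (\<integral>\<^sup>+z. g z \<partial>distr lborel borel ((+) a))" by (simp add: lborel_distr_plus)
  also have "... = (NBINT z. g (a + z))" by (rule nn_integral_distr) auto
  finally show ?thesis ..
qed

section \<open>Space and time translates of the approximate solutions\<close>

definition inner_part :: "'a::euclidean_space set => real => 'a set" where
  "inner_part S r = {x\<in>S. r < infdist x (- S)}"

lemma inner_part_borel: assumes "open S" shows "inner_part S r \<in> sets borel"
proof -
  have [measurable]: "S \<in> sets borel" using assms by simp
  have "inner_part S r = S \<inter> {x. r < infdist x (- S)}" by (auto simp: inner_part_def)
  moreover have "open {x. r < infdist x (- S)}" by (intro open_Collect_less continuous_intros)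
  ultimately show ?thesis by simp
qed

lemma inner_part_mem:
  assumes "x \<in> inner_part S r" "dist x y \<le> r" shows "y \<in> S"
proof (rule ccontr)
  assume "y \<notin> S"
  hence "infdist x (- S) \<le> dist x y" by (intro infdist_le) auto
  thus False using assms by (auto simp: inner_part_def)
qed

text \<open>Every point of an open set has positive distance from the complement, so the layers
  decrease to the empty set; S has finite measure, and continuity from above applies.\<close>

lemma boundary_layer_small:
  fixes S :: "'a::euclidean_space set"
  assumes S: "open S" "bounded S" and "\<epsilon> > 0"
  obtains r where "r > 0" "\<And>s. s \<le> r ==> measure lborel (S - inner_part S s) < \<epsilon>"
proof -
  let ?A = "\<lambda>n. S - inner_part S (1 / real (Suc n))"
  have ne: "- S \<noteq> {}" using S(2) not_bounded_UNIV by (metis Compl_UNIV_eq double_compl)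
  have fin: "emeasure lborel S < \<infinity>" using emeasure_bounded_finite[OF S(2)] by simp
  have [measurable]: "S \<in> sets borel" using S by simp
  have [measurable]: "inner_part S r \<in> sets borel" for r using S(1) by (rule inner_part_borel)
  have "(\<lambda>n. measure lborel (?A n)) ----> measure lborel (\<Inter>n. ?A n)"
  proof (rule Lim_measure_decseq)
	show "range ?A \<subseteq> sets lborel" by auto
	show "decseq ?A"
	proof (rule decseq_SucI)
	  fix n
	  have "1 / real (Suc (Suc n)) \<le> 1 / real (Suc n)" by (intro divide_left_mono) auto
	  thus "?A (Suc n) \<subseteq> ?A n" by (auto simp: inner_part_def)
	qed
	show "emeasure lborel (?A n) \<noteq> \<infinity>" for n using le_less_trans[OF emeasure_mono[of "?A n" S lborel] fin] by auto
  qed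
  also have "(\<Inter>n. ?A n) = {}"
  proof -
	have False if "x \<in> S" "\<And>n. x \<notin> inner_part S (1 / real (Suc n))" for x
	proof -
	  have "x \<notin> closure (- S)" using S(1) that(1) by (simp add: closed_Compl)
	  hence "infdist x (- S) > 0" using ne in_closure_iff_infdist_zero[of "- S" x] infdist_nonneg[of x "- S"] by linarith
	  then obtain n where "1 / real (Suc n) < infdist x (- S)" by (rule nat_approx_posE)
	  thus False using that by (auto simp: inner_part_def)
	qed
	thus ?thesis by blast
  qed
  finally have "(\<lambda>n. measure lborel (?A n)) ----> 0" by simp
  hence "\<forall>\<^sub>F n in sequentially. measure lborel (?A n) < \<epsilon>" using `\<epsilon> > 0` by (rule order_tendstoD)
  then obtain n where n: "measure lborel (?A n) < \<epsilon>" using eventually_happens by force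
  show thesis
  proof (rule that[of "1 / real (Suc n)"])
	fix s :: real assume s: "s \<le> 1 / real (Suc n)"
	have "measure lborel (S - inner_part S s) \<le> measure lborel (?A n)"
	proof (rule measure_mono_fmeasurable)
	  show "S - inner_part S s \<subseteq> ?A n" using s by (auto simp: inner_part_def)
	  show "?A n \<in> fmeasurable lborel" using le_less_trans[OF emeasure_mono[of "?A n" S lborel] fin] by (auto simp: fmeasurable_def)
	qed auto
	thus "measure lborel (S - inner_part S s) < \<epsilon>" using n by simp
  qed simp
qed

section \<open>Step functions in space and their translates\<close>

context fv_mesh
begin

definition sstep :: "('a set => 'c::real_vector) => 'a => 'c" where
  "sstep w x = (\<Sigma> K. indicator K x *R w K)"

lemma sstep_in: assumes "K \<in> cells M" "x \<in> K" shows "sstep w x = w K"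
proof -
  have "sstep w x = (\<Sigma> L. if L = K then w L else 0)" unfolding sstep_def
  proof (rule sum.cong)
	fix L assume "L \<in> cells M"
	thus "indicator L x *R w L = (if L = K then w L else 0)" using assms cells_disjoint[of L K] by (auto simp: indicator_def)
  qed simp
  thus ?thesis using assms(1) finite_cells by simp
qed

lemma sstep_out: "x \<notin> \<Union> (cells M) ==> sstep w x = 0" unfolding sstep_def by (intro sum.neutral) auto

lemma sstep_cases: obtains K where "K \<in> cells M" "x \<in> K" "sstep w x = w K" | "x \<notin> \<Union> (cells M)" "sstep w x = 0"
  using sstep_in[of _ x w] sstep_out[of x w] by (cases "x \<in> \<Union> (cells M)") blast+

lemma cell_borel [measurable]: "K \<in> cells M ==> K \<in> sets borel" using cell(2) by simp

lemma sstep_measurable [measurable]: "(sstep w :: 'a => 'c::euclidean_space) \<in> borel_measurable borel"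
  unfolding sstep_def by (intro borel_measurable_sum borel_measurable_scaleR borel_measurable_indicator borel_measurable_const) simp

lemma measure_lborel_cell: "K \<in> cells M ==> measure lborel K = vol K" using cell_borel by simp

lemma integral_sstep:
  fixes w :: "'a set => 'c::euclidean_space"
  shows "integrable lborel (sstep w)" "(LBINT x. sstep w x) = (\<Sigma> K. vol K *R w K)"
proof -
  have int: "integrable lborel (\<lambda>x. indicator K x *R w K)" if "K \<in> cells M" for K
	by (rule integrable_scaleR_left[OF integrable_indicator_bounded[OF cell(6)[OF that] cell_borel[OF that]]])
  show "integrable lborel (sstep w)" unfolding sstep_def[abs_def] by (rule integrable_sum) (rule int)
  have "(LBINT x. sstep w x) = (\<Sigma> K. (LBINT x. indicator K x *R w K))" unfolding sstep_def using int by (rule integral_sum)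
  also have "... = (\<Sigma> K. vol K *R w K)"
  proof (rule sum.cong)
	fix K assume K: "K \<in> cells M"
	have "(LBINT x. indicator K x *R w K) = (LBINT x. indicator K x) *R w K"
	  by (rule integral_scaleR_left[OF integrable_indicator_bounded[OF cell(6)[OF K] cell_borel[OF K]]])
	thus "(LBINT x. indicator K x *R w K) = vol K *R w K" using measure_lborel_cell[OF K] by simp
  qed simp
  finally show "(LBINT x. sstep w x) = (\<Sigma> K. vol K *R w K)" .
qed

lemma sstep_comp: assumes "f 0 = 0" shows "f (sstep w x) = sstep (\<lambda>K. f (w K)) x"
proof (cases "x \<in> \<Union> (cells M)")
  case True
  then obtain K where "K \<in> cells M" "x \<in> K" by auto
  thus ?thesis by (simp add: sstep_in)
next
  case False
  thus ?thesis by (simp only: sstep_out[OF False] assms)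
qed

lemma nn_integral_sstep:
  assumes "\<And>K. K \<in> cells M ==> 0 \<le> w K"
  shows "(NBINT x. ennreal (sstep w x)) = ennreal (\<Sigma> K. vol K * w K)"
proof -
  have nn: "0 \<le> sstep w x" for x using assms by (cases rule: sstep_cases[of x w]) auto
  show ?thesis using integral_sstep[of w] by (subst nn_integral_eq_integral) (auto simp: nn)
qed

lemma AE_in_cells: "AE x in lborel. x \<in> \<Omega> \<longrightarrow> x \<in> \<Union> (cells M)"
proof -
  have "open (\<Union> (cells M))" using cell(2) by (rule open_Union[OF ballI])
  hence "\<Omega> - \<Union> (cells M) \<in> sets borel" using open_domain by auto
  moreover have "\<Omega> - \<Union> (cells M) \<in> null_sets lebesgue" using negligible_outside_cells by (simp add: negligible_iff_null_sets)
  ultimately have "\<Omega> - \<Union> (cells M) \<in> null_sets lborel" by (auto simp: null_sets_def)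
  thus ?thesis by (rule AE_I') auto
qed

lemma AE_in_cells_translate: "AE x in lborel. x + e \<in> \<Omega> \<longrightarrow> x + e \<in> \<Union> (cells M)"
proof -
  have "open (\<Union> (cells M))" using cell(2) by (rule open_Union[OF ballI])
  hence [measurable]: "\<Union> (cells M) \<in> sets borel" "\<Omega> \<in> sets borel" using open_domain by auto
  have "AE x in lborel. e + x \<in> \<Omega> \<longrightarrow> e + x \<in> \<Union> (cells M)"
	by (rule AE_lborel_translate[OF AE_in_cells]) measurable
  thus ?thesis by (simp only: add.commute)
qed

lemma cells_measurable: "\<Union> (cells M) \<in> sets borel" "\<Omega> \<in> sets borel"
  using open_domain open_Union[OF ballI, OF cell(2)] by auto

lemma crossing_sum:
  fixes w :: "'a set => 'c::euclidean_space"
  shows "(NBINT x. indicator {x. x \<in> \<Omega> \<and> x + e \<in> \<Omega>} x * ennreal (norm (sstep w (x + e) - sstep w x)))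
	\<le> ennreal (\<Sigma> K L. vol {x\<in>K. x + e \<in> L} * norm (w L - w K))"
proof -
  let ?X = "\<lambda>K L. {x\<in>K. x + e \<in> L}"
  let ?F = "\<lambda>K L x. indicator (?X K L) x * norm (w L - w K)"
  let ?I = "\<lambda>x. indicator {x. x \<in> \<Omega> \<and> x + e \<in> \<Omega>} x * ennreal (norm (sstep w (x + e) - sstep w x))"
  have meas: "(?X K L) \<in> sets borel" "bounded (?X K L)" if "K \<in> cells M" "L \<in> cells M" for K L
  proof -
	have "open (K \<inter> (\<lambda>x. x + e) -` L)" using cell(2) that by (intro open_Int open_vimage continuous_intros) auto
	moreover have "(?X K L) = K \<inter> (\<lambda>x. x + e) -` L" by auto
	ultimately show "(?X K L) \<in> sets borel" by simp
	show "bounded (?X K L)" using cell(6)[OF that(1)] by (rule bounded_subset) auto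
  qed
  have "(NBINT x. ?I x) \<le> (NBINT x. ennreal (\<Sigma> K L. ?F K L x))"
  proof (rule nn_integral_mono_AE)
	show "AE x in lborel. ?I x \<le> ennreal (\<Sigma> K L. ?F K L x)" using AE_in_cells AE_in_cells_translate[of e]
	proof eventually_elim
	  case (elim x)
	  show ?case
	  proof (cases "x \<in> \<Omega> \<and> x + e \<in> \<Omega>")
		case True
		then obtain K L where KL: "K \<in> cells M" "x \<in> K" "L \<in> cells M" "x + e \<in> L" using elim by auto
		have "norm (sstep w (x + e) - sstep w x) = ?F K L x" using KL by (simp add: sstep_in)
		also have "... \<le> (\<Sigma> L. ?F K L x)" using KL finite_cells by (intro member_le_sum) auto
		also have "... \<le> (\<Sigma> K L. ?F K L x)"
		  using KL finite_cells by (intro member_le_sum[of K "cells M" "\<lambda>K. \<Sigma> L. ?F K L x"])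
			(auto intro: sum_nonneg)
		finally show ?thesis using True by (simp add: ennreal_leI)
	  qed simp
	qed
  qed
  also have "... = ennreal (LBINT x. (\<Sigma> K L. ?F K L x))"
	using meas by (intro nn_integral_eq_integral integrable_sum integrable_mult_left integrable_indicator_bounded)
	  (auto intro!: sum_nonneg)
  also have "(LBINT x. (\<Sigma> K L. ?F K L x)) = (\<Sigma> K L. vol (?X K L) * norm (w L - w K))"
  proof -
	have int: "integrable lborel (\<lambda>x. ?F K L x)" if "K \<in> cells M" "L \<in> cells M" for K L
	  using meas[OF that] by (intro integrable_mult_left integrable_indicator_bounded) auto
	have "(LBINT x. ?F K L x) = vol (?X K L) * norm (w L - w K)"
	  if "K \<in> cells M" "L \<in> cells M" for K L using meas[OF that] by simp
	thus ?thesis using int by (simp only: integral_sum integrable_sum cong: sum.cong)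
  qed
  finally show ?thesis .
qed

text \<open>The left side does not depend on n, and \<open>Suc n\<close> steps bound it by
  \<open>Suc n\<close> times the volumes crossed in one step, weighted by the jumps; these converge.
  Restricting x to the inner part keeps all intermediate points in \<Omega>, where almost every
  point lies in a cell.\<close>

lemma sstep_translate_interior:
  fixes w :: "'a set => 'c::euclidean_space"
  shows "(NBINT x. indicator (inner_part \<Omega> (norm e)) x * ennreal (norm (sstep w (x + e) - sstep w x)))
	\<le> ennreal (norm e * (\<Sigma> K L. area K L * norm (w L - w K)))"
proof -
  have [measurable]: "\<Omega> \<in> sets borel" "inner_part \<Omega> r \<in> sets borel" for r using open_domain inner_part_borel by auto
  let ?X = "(NBINT x. indicator (inner_part \<Omega> (norm e)) x * ennreal (norm (sstep w (x + e) - sstep w x)))"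
  let ?c = "\<lambda>n K L. vol {x\<in>K. x + e /\<^sub>R real (Suc n) \<in> L}"
  let ?J = "\<lambda>K L. norm (w L - w K)" and ?s = "\<lambda>d k x. sstep w (real k *R d + x)"
  let ?e = "\<lambda>K L. area K L * max 0 (e \<bullet> normal K L) * norm (w L - w K)"
  have step: "?X \<le> ennreal (\<Sigma> K L. real (Suc n) * ?c n K L * ?J K L)" for n
  proof -
	define d where "d = e /\<^sub>R real (Suc n)"
	have e: "e = real (Suc n) *R d" by (simp add: d_def)
	let ?g = "\<lambda>x. indicator {x. x \<in> \<Omega> \<and> x + d \<in> \<Omega>} x * ennreal (norm (sstep w (x + d) - sstep w x))"
	have [measurable]: "?g \<in> borel_measurable borel" by measurable
	have "?X \<le> (NBINT x. (\<Sum>k<Suc n. ?g (real k *R d + x)))"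
	proof (rule nn_integral_mono)
	  fix x
	  show "indicator (inner_part \<Omega> (norm e)) x * ennreal (norm (sstep w (x + e) - sstep w x)) \<le> (\<Sum>k<Suc n. ?g (real k *R d + x))"
	  proof (cases "x \<in> inner_part \<Omega> (norm e)")
		case True
		have in_dom: "real k *R d + x \<in> \<Omega>" if "k \<le> Suc n" for k
		  by (rule inner_part_mem[OF True]) (use that in \<open>simp add: dist_norm e mult_right_mono del: of_nat_Suc\<close>)
		have "sstep w (x + e) - sstep w x = (\<Sum>k<Suc n. ?s d (Suc k) x - ?s d k x)"
		  by (subst sum_lessThan_telescope) (simp add: e add.commute)
		hence "norm (sstep w (x + e) - sstep w x) \<le> (\<Sum>k<Suc n. norm (?s d (Suc k) x - ?s d k x))" by (simp only:) (rule norm_sum)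
		hence "ennreal (norm (sstep w (x + e) - sstep w x)) \<le> (\<Sum>k<Suc n. ennreal (norm (?s d (Suc k) x - ?s d k x)))"
		  by (subst sum_ennreal) (auto intro: ennreal_leI)
		also have "... = (\<Sum>k<Suc n. ?g (real k *R d + x))"
		proof (rule sum.cong)
		  fix k assume "k \<in> {..<Suc n}"
		  hence in1: "real k *R d + x \<in> \<Omega>" and in2: "real (Suc k) *R d + x \<in> \<Omega>"
			using in_dom[of k] in_dom[of "Suc k"] by auto
		  have eq: "real (Suc k) *R d + x = real k *R d + x + d" by (simp add: algebra_simps)
		  have "indicator {x. x \<in> \<Omega> \<and> x + d \<in> \<Omega>} (real k *R d + x) = (1 :: ennreal)"
			using in1 in2 unfolding eq by (simp only: indicator_simps mem_Collect_eq simp_thms)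
		  thus "ennreal (norm (?s d (Suc k) x - ?s d k x)) = ?g (real k *R d + x)" unfolding eq by (simp only: mult_1)
		qed simp
		finally show ?thesis using True by simp
	  qed simp
	qed
	also have "... = (\<Sum>k<Suc n. (NBINT x. ?g (real k *R d + x)))" by (rule nn_integral_sum) measurable
	also have "... = (\<Sum>k<Suc n. (NBINT x. ?g x))" by (intro sum.cong refl nn_integral_lborel_translate) measurable
	also have "... \<le> (\<Sum>k<Suc n. ennreal (\<Sigma> K L. ?c n K L * ?J K L))" unfolding d_def[symmetric] by (intro sum_mono crossing_sum)
	also have "... = ennreal (\<Sum>k<Suc n. (\<Sigma> K L. ?c n K L * ?J K L))" by (intro sum_ennreal sum_nonneg) auto
	also have "(\<Sum>k<Suc n. (\<Sigma> K L. ?c n K L * ?J K L)) = (\<Sigma> K L. real (Suc n) * ?c n K L * ?J K L)"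
	  by (simp only: sum_constant card_lessThan sum_distrib_left mult.assoc)
	finally show ?thesis .
  qed
  have lim: "(\<lambda>n. ennreal (\<Sigma> K L. real (Suc n) * ?c n K L * ?J K L))
	 ----> ennreal (\<Sigma> K L. ?e K L)"
  proof (intro tendsto_ennrealI tendsto_sum)
	fix K L assume KL: "K \<in> cells M" "L \<in> cells M"
	show "(\<lambda>n. real (Suc n) * ?c n K L * ?J K L) ----> ?e K L"
	proof (cases "K = L")
	  case False
	  show ?thesis by (intro tendsto_mult area_crossing_limit KL False tendsto_const)
	qed simp
  qed
  have "?X \<le> ennreal (\<Sigma> K L. ?e K L)" by (rule LIMSEQ_le_const[OF lim]) (use step in auto)
  also have "... \<le> ennreal (norm e * (\<Sigma> K L. area K L * ?J K L))" unfolding sum_distrib_left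
  proof (intro ennreal_leI sum_mono)
	fix K L
	show "?e K L \<le> norm e * (area K L * ?J K L)"
	proof (cases "adj K L")
	  case True
	  hence "max 0 (e \<bullet> normal K L) \<le> norm e" using norm_cauchy_schwarz[of e "normal K L"] norm_normal[OF True] by simp
	  hence "(area K L * ?J K L) * max 0 (e \<bullet> normal K L) \<le> (area K L * ?J K L) * norm e"
		using area_nonneg by (intro mult_left_mono) auto
	  thus ?thesis by (simp add: mult_ac)
	qed (simp add: area_def)
  qed
  finally show ?thesis .
qed

text \<open>Values have norm at most 1. In the boundary layer the difference is at most 2; a point
  outside \<Omega> contributes at most 1, and only if its translate lies in \<Omega>, hence in the
  layer. Together this is 3 times the volume of the layer.\<close>

lemma sstep_translate:
  fixes w :: "'a set => 'c::euclidean_space"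
  assumes w: "\<And>K. K \<in> cells M ==> norm (w K) \<le> 1"
  shows "(NBINT x. ennreal (norm (sstep w (x + e) - sstep w x))) \<le> ennreal (norm e * (\<Sigma> K L. area K L * norm (w L - w K))
	   + 3 * measure lborel (\<Omega> - inner_part \<Omega> (norm e)))"
proof -
  have [measurable]: "\<Omega> \<in> sets borel" "inner_part \<Omega> r \<in> sets borel" for r using open_domain inner_part_borel by auto
  let ?I = "inner_part \<Omega> (norm e)"
  let ?D = "\<lambda>x. ennreal (norm (sstep w (x + e) - sstep w x))" and ?S = "\<Omega> - inner_part \<Omega> (norm e)"
  let ?R = "ennreal (norm e * (\<Sigma> K L. area K L * norm (w L - w K)))"
  have le1: "norm (sstep w x) \<le> 1" for x using w by (cases rule: sstep_cases[of x w]) auto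
  have out: "sstep w x = 0" if "x \<notin> \<Omega>" for x using that cell(4) by (intro sstep_out) auto
  have "(NBINT x. ?D x) \<le> (NBINT x. indicator ?I x * ?D x + (2 * indicator ?S x + indicator ?S (e + x)))"
  proof (rule nn_integral_mono)
	fix x
	show "?D x \<le> indicator ?I x * ?D x + (2 * indicator ?S x + indicator ?S (e + x))"
	proof (cases "x \<in> ?I")
	  case False
	  show ?thesis
	  proof (cases "x \<in> \<Omega>")
		case True
		have "norm (sstep w (x + e) - sstep w x) \<le> 1 + 1" by (intro order_trans[OF norm_triangle_ineq4] add_mono le1)
		hence "?D x \<le> 2" using ennreal_leI by fastforce
		thus ?thesis using True False by (simp add: add_increasing2)
	  next
		case nin: False
		show ?thesis
		proof (cases "x + e \<in> \<Omega>")
		  case True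
		  have "x + e \<notin> ?I" using nin inner_part_mem[of "x + e" \<Omega> "norm e" x] by (auto simp: dist_norm)
		  moreover have "?D x \<le> 1" using out[OF nin] le1[of "x + e"] by (simp add: ennreal_le_1)
		  ultimately show ?thesis using True False nin by (simp add: add.commute)
		qed (simp add: out nin)
	  qed
	qed (simp add: add_increasing2)
  qed
  also have "... = (NBINT x. indicator ?I x * ?D x) + ((NBINT x. 2 * indicator ?S x) + (NBINT x. indicator ?S (e + x)))"
	by (subst nn_integral_add, measurable, subst nn_integral_add) measurable
  also have "(NBINT x. indicator ?S (e + x)) = (\<integral>\<^sup>+x. indicator ?S x \<partial>(lborel :: 'a measure))"
	by (rule nn_integral_lborel_translate) measurable
  also have "(NBINT x. 2 * indicator ?S x) + (\<integral>\<^sup>+x. indicator ?S x \<partial>(lborel :: 'a measure)) = 3 * emeasure lborel ?S"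
  proof -
	have "2 * a + a = 3 * a" for a :: ennreal using distrib_right[of 2 1 a] by simp
	thus ?thesis by (simp add: nn_integral_cmult)
  qed
  also have "emeasure lborel ?S = ennreal (measure lborel ?S)"
  proof -
	have "bounded ?S" using bounded_domain by (rule bounded_subset) auto
	thus ?thesis using emeasure_bounded_finite[of "?S"] by (intro emeasure_eq_ennreal_measure) auto
  qed
  also have "(NBINT x. indicator ?I x * ?D x) + 3 * ennreal (measure lborel ?S) \<le> ?R + 3 * ennreal (measure lborel ?S)"
	by (intro add_right_mono sstep_translate_interior)
  also have "... = ennreal (norm e * (\<Sigma> K L. area K L * norm (w L - w K)) + 3 * measure lborel ?S)"
	using area_nonneg by (subst ennreal_plus) (auto intro!: mult_nonneg_nonneg sum_nonneg simp: ennreal_mult)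
  finally show ?thesis .
qed

end

lemma norm_real_vec_squared: "(norm (v :: real ^ 'n))^2 = (SU i. (v $ i)^2)" by (simp add: norm_vec_def L2_set_def sum_nonneg)

text \<open>Trades an L1 bound for an L2 bound: on \<Omega> the summand \<eta> costs only \<eta>
  |\<Omega>|, which can be made small.\<close>

lemma norm_le_young:
  fixes v :: "'c::real_normed_vector" and \<eta> :: real
  assumes "\<eta> > 0" shows "norm v \<le> \<eta> + (norm v)^2 / (4 * \<eta>)"
proof -
  have "0 \<le> (norm v - 2 * \<eta>)^2" by simp
  thus ?thesis using assms by (simp add: power2_eq_square field_simps)
qed

lemma simplex_norm_le_1: assumes "p \<in> unit_simplex" shows "norm p \<le> 1"
proof -
  have "norm p \<le> (SU i. abs (p $ i))" by (rule norm_le_l1_cart)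
  also have "... = 1" using assms by (simp add: unit_simplex_def)
  finally show ?thesis .
qed

section \<open>Step functions in time and translates of the approximate solutions\<close>

context fv_solution
begin

lemma t_mono: assumes "i \<le> j" "j \<le> NT" shows "t i \<le> t j" using assms
proof (induction j rule: dec_induct)
  case (step j)
  thus ?case using t_Suc[of j] by simp
qed simp

definition idx :: "real => nat" where "idx s = (LEAST n. s \<le> t n)"

lemma idx: assumes "0 < s" "s \<le> T"
  shows "1 \<le> idx s" "idx s \<le> NT" "t (idx s - 1) < s" "s \<le> t (idx s)"
proof -
  have ex: "s \<le> t NT" using assms t_NT by simp
  show le: "s \<le> t (idx s)" unfolding idx_def by (rule LeastI[of _ NT]) (rule ex)
  show "idx s \<le> NT" unfolding idx_def by (rule Least_le) (rule ex)
  show pos: "1 \<le> idx s" using le assms(1) t_0 by (cases "idx s") auto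
  have "\<not> s \<le> t (idx s - 1)" unfolding idx_def by (rule not_less_Least) (use pos idx_def in simp)
  thus "t (idx s - 1) < s" by simp
qed

lemma idx_eqI: assumes "n \<in> {1..NT}" "t (n - 1) < s" "s \<le> t n" shows "idx s = n" "0 < s" "s \<le> T"
proof -
  have "n - 1 \<le> NT" using assms(1) by auto
  thus s: "0 < s" using assms(2) t_mono[of 0 "n - 1"] t_0 by simp
  show sT: "s \<le> T" using assms t_mono[of n NT] t_NT by auto
  show "idx s = n"
  proof (rule antisym)
	show "idx s \<le> n" unfolding idx_def by (rule Least_le) fact
	show "n \<le> idx s"
	proof (rule ccontr)
	  assume "\<not> n \<le> idx s"
	  hence "t (idx s) \<le> t (n - 1)" using assms by (intro t_mono) auto
	  thus False using idx(4)[OF s sT] assms by simp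
	qed
  qed
qed

lemma idx_mono: assumes "s \<le> s'" "s' \<le> T" "0 < s" shows "idx s \<le> idx s'"
  unfolding idx_def[of s] by (rule Least_le) (use idx(4)[of s'] assms in auto)

definition tstep :: "(nat => 'c::real_vector) => real => 'c" where
  "tstep e s = (\<Sum>n=1..NT. indicator {t (n - 1)<..t n} s *R e n)"

lemma tstep_in: assumes "0 < s" "s \<le> T" shows "tstep e s = e (idx s)"
proof -
  have "tstep e s = (\<Sum>n=1..NT. if n = idx s then e n else 0)" unfolding tstep_def
  proof (rule sum.cong)
	fix n assume n: "n \<in> {1..NT}"
	show "indicator {t (n - 1)<..t n} s *R e n = (if n = idx s then e n else 0)"
	proof (cases "n = idx s")
	  case True
	  hence "s \<in> {t (n - 1)<..t n}" using idx(3,4)[OF assms] by simp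
	  thus ?thesis using True by simp
	next
	  case False
	  hence "s \<notin> {t (n - 1)<..t n}" using idx_eqI(1)[OF n, of s] by (simp only: greaterThanAtMost_iff) blast
	  thus ?thesis using False by simp
	qed
  qed simp
  thus ?thesis using idx[OF assms] by simp
qed

lemma tstep_out: assumes "\<not> (0 < s \<and> s \<le> T)" shows "tstep e s = 0" unfolding tstep_def
proof (rule sum.neutral, rule ballI)
  fix n assume n: "n \<in> {1..NT}"
  show "indicator {t (n - 1)<..t n} s *R e n = 0"
  proof -
	have "s \<notin> {t (n - 1)<..t n}" using idx_eqI(2,3)[OF n, of s] assms by (simp only: greaterThanAtMost_iff) blast
	thus ?thesis by simp
  qed
qed

lemma tstep_measurable [measurable]: "(tstep e :: real => 'c::euclidean_space) \<in> borel_measurable borel" unfolding tstep_def by measurable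

lemma integral_tstep:
  fixes e :: "nat => 'c::euclidean_space"
  shows "integrable lborel (tstep e)" "(LBINT s. tstep e s) = (\<Sum>n=1..NT. dt n *R e n)"
proof -
  have ind: "integrable lborel (\<lambda>s. indicator {t (n - 1)<..t n} s :: real)" for n by (intro integrable_indicator_bounded) auto
  have int: "integrable lborel (\<lambda>s. indicator {t (n - 1)<..t n} s *R e n)" for n by (rule integrable_scaleR_left) (rule ind)
  show "integrable lborel (tstep e)" unfolding tstep_def[abs_def] by (rule integrable_sum) (rule int)
  have "(LBINT s. tstep e s) = (\<Sum>n=1..NT. (LBINT s. indicator {t (n - 1)<..t n} s *R e n))"
	unfolding tstep_def using int by (rule integral_sum)
  also have "... = (\<Sum>n=1..NT. dt n *R e n)"
  proof (rule sum.cong)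
	fix n assume n: "n \<in> {1..NT}"
	have "(LBINT s. indicator {t (n - 1)<..t n} s *R e n) = (LBINT s. indicator {t (n - 1)<..t n} s) *R e n"
	  by (rule integral_scaleR_left) (rule ind)
	thus "(LBINT s. indicator {t (n - 1)<..t n} s *R e n) = dt n *R e n" using dt_pos[OF n] by (simp add: dt_def)
  qed simp
  finally show "(LBINT s. tstep e s) = (\<Sum>n=1..NT. dt n *R e n)" .
qed

lemma tstep_nonneg: assumes "\<And>n. n \<in> {1..NT} ==> 0 \<le> e n" shows "0 \<le> (tstep e s :: real)"
  unfolding tstep_def using assms by (intro sum_nonneg) auto

lemma nn_integral_tstep:
  assumes "\<And>n. n \<in> {1..NT} ==> 0 \<le> e n"
  shows "(NBINT s. ennreal (tstep e s)) = ennreal (\<Sum>n=1..NT. dt n * e n)"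
  using integral_tstep[of e] tstep_nonneg[OF assms] by (subst nn_integral_eq_integral) auto

definition pw :: "(nat => 'a set => 'c::real_vector) => real \<times> 'a => 'c" where
  "pw W z = (\<Sum>n=1..NT. \<Sigma> K. indicator ({t (n - 1)<..t n} \<times> K) z *R W n K)"

lemma pw_eq: "pw W (s, x) = tstep (\<lambda>n. sstep (W n) x) s"
  unfolding pw_def tstep_def sstep_def by (simp add: indicator_times scaleR_sum_right)

lemma approximate_solution_eq: "approximate_solution M NT t V z = pw V z" unfolding approximate_solution_def pw_def ..

lemma pw_in: "0 < s ==> s \<le> T ==> pw W (s, x) = sstep (W (idx s)) x" unfolding pw_eq by (rule tstep_in)

lemma pw_out: "\<not> (0 < s \<and> s \<le> T) ==> pw W (s, x) = 0" unfolding pw_eq by (rule tstep_out)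

lemma pw_measurable [measurable]: "(pw W :: real \<times> 'a => 'c::euclidean_space) \<in> borel_measurable borel"
proof -
  have "{t (n - 1)<..t n} \<times> K \<in> sets (borel :: (real \<times> 'a) measure)" if "K \<in> cells M" for n K
	using cell_borel[OF that] by (intro borel_Times) auto
  thus ?thesis unfolding pw_def[abs_def]
	by (intro borel_measurable_sum borel_measurable_scaleR borel_measurable_indicator borel_measurable_const)
qed

lemma pw_outside_domain: "x \<notin> \<Omega> ==> pw W (s, x) = 0"
proof -
  assume "x \<notin> \<Omega>"
  hence "x \<notin> \<Union> (cells M)" using cell(4) by auto
  thus ?thesis using pw_in[of s W x] pw_out[of s W x] sstep_out[of x "W (idx s)"] by auto
qed

lemma V_norm: "n \<le> NT ==> K \<in> cells M ==> norm (V n K) \<le> 1" using V_simplex simplex_norm_le_1 by blast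

lemma sstep_V_norm: "n \<le> NT ==> norm (sstep (V n) x) \<le> 1" using V_norm by (cases rule: sstep_cases[of x "V n"]) auto

lemma pw_V_norm: "norm (pw V z) \<le> 1"
proof (cases z)
  case (Pair s x)
  thus ?thesis using pw_in[of s V x] pw_out[of s V x] sstep_V_norm[of "idx s" x] idx(2)[of s] by (cases "0 < s \<and> s \<le> T") auto
qed

text \<open>The bound \<open>sum_area_norm\<close> integrated over time, with the energy replaced by
  its estimate.\<close>

definition space_const :: real where
  "space_const = CARD('n) * (DIM('a) * vol \<Omega> * T + CARD('n) * vol \<Omega> / c)"

lemma sum_area_norm:
  "(\<Sigma> K L. area K L * norm (V n L - V n K)) \<le> CARD('n) * (DIM('a) * vol \<Omega> + energy n / 2)"
proof -
  have "(\<Sigma> K L. area K L * norm (V n L - V n K)) \<le> (\<Sigma> K L. SU i. area K L * abs (V n L $ i - V n K $ i))"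
  proof (intro sum_mono)
	fix K L
	have "norm (V n L - V n K) \<le> (SU i. abs (V n L $ i - V n K $ i))" using norm_le_l1_cart[of "V n L - V n K"] by simp
	from mult_left_mono[OF this area_nonneg[of K L]]
	show "area K L * norm (V n L - V n K) \<le> (SU i. area K L * abs (V n L $ i - V n K $ i))" by (simp add: sum_distrib_left)
  qed
  also have "... = (SU i. \<Sigma> K L. area K L * abs (V n L $ i - V n K $ i))" by (rule sum_swap3[symmetric])
  also have "... \<le> (\<Sum>i\<in>(UNIV::'n set). DIM('a) * vol \<Omega> + energy n / 2)" by (intro sum_mono sum_area_jump)
  finally show ?thesis by simp
qed

lemma sum_dt_area_norm:
  "(\<Sum>n=1..NT. dt n * (\<Sigma> K L. area K L * norm (V n L - V n K))) \<le> space_const"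
proof -
  have "(\<Sum>n=1..NT. dt n * (\<Sigma> K L. area K L * norm (V n L - V n K)))
	\<le> (\<Sum>n=1..NT. dt n * (CARD('n) * (DIM('a) * vol \<Omega> + energy n / 2)))"
	using dt_pos by (intro sum_mono mult_left_mono sum_area_norm) (auto intro: less_imp_le)
  also have "... = CARD('n) * (DIM('a) * vol \<Omega> * (\<Sum>n=1..NT. dt n) + (\<Sum>n=1..NT. dt n * energy n) / 2)"
	by (simp add: algebra_simps sum.distrib sum_distrib_left sum_divide_distrib)
  also have "... \<le> space_const" using divide_right_mono[OF energy_estimate, of 2] unfolding sum_dt space_const_def
	by (intro mult_left_mono add_left_mono) auto
  finally show ?thesis .
qed

lemma space_translate:
  "(NBINT s x. ennreal (norm (pw V (s, x + e) - pw V (s, x))))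
	\<le> ennreal (norm e * space_const + 3 * T * measure lborel (\<Omega> - inner_part \<Omega> (norm e)))"
proof -
  let ?m = "measure lborel (\<Omega> - inner_part \<Omega> (norm e))"
  let ?b = "\<lambda>n. norm e * (\<Sigma> K L. area K L * norm (V n L - V n K)) + 3 * ?m"
  have nn: "0 \<le> ?b n" for n using area_nonneg by (intro add_nonneg_nonneg mult_nonneg_nonneg sum_nonneg) auto
  have "(NBINT s x. ennreal (norm (pw V (s, x + e) - pw V (s, x)))) \<le> (NBINT s. ennreal (tstep ?b s))"
  proof (rule nn_integral_mono)
	fix s
	show "(NBINT x. ennreal (norm (pw V (s, x + e) - pw V (s, x)))) \<le> ennreal (tstep ?b s)"
	proof (cases "0 < s \<and> s \<le> T")
	  case True
	  thus ?thesis using sstep_translate[of "V (idx s)" e] V_norm idx(2)[of s] by (simp add: pw_in tstep_in)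
	next
	  case False
	  thus ?thesis by (simp add: pw_out[OF False])
	qed
  qed
  also have "... = ennreal (\<Sum>n=1..NT. dt n * ?b n)" by (rule nn_integral_tstep) (rule nn)
  also have "(\<Sum>n=1..NT. dt n * ?b n) = norm e * (\<Sum>n=1..NT. dt n * (\<Sigma> K L. area K L * norm (V n L - V n K)))
	  + 3 * ?m * (\<Sum>n=1..NT. dt n)"
  proof -
	have "d * (u * v + 3 * r) = u * (d * v) + 3 * r * d" for d u v r :: real by (simp add: algebra_simps)
	hence "(\<Sum>n\<in>I. d n * (u * v n + 3 * r)) = (\<Sum>n\<in>I. u * (d n * v n) + 3 * r * d n)" for I d u v and r :: real by (simp only:)
	thus ?thesis by (simp only: sum.distrib sum_distrib_left[symmetric])
  qed
  also have "... \<le> norm e * space_const + 3 * T * ?m" using mult_left_mono[OF sum_dt_area_norm, of "norm e"] unfolding sum_dt by simp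
  finally show ?thesis by (simp add: ennreal_leI)
qed

definition time_const :: real where
  "time_const = ((flux_const A astar)^2 * (CARD('n))^2 + 1) * (2 * CARD('n) * vol \<Omega> / c)"

text \<open>The indices p and n of s and s + \<tau> satisfy t n - t p <= a, as t n exceeds s +
  \<tau> by at most one time step and t p >= s. The sum of dt k times the energy over p < k <= n is
  at most the integral of the energy step function over (s, s + a].\<close>

lemma time_translate_pointwise:
  assumes s: "0 < s" "s + \<tau> \<le> T" and \<tau>: "0 \<le> \<tau>" and \<eta>: "0 < \<eta>"
  defines "a \<equiv> \<tau> + time_step NT t"
  defines "C \<equiv> (flux_const A astar)^2 * (CARD('n))^2 + 1"
  shows "(NBINT x. ennreal (norm (pw V (s + \<tau>, x) - pw V (s, x))))
	\<le> ennreal (\<eta> * vol \<Omega>) + ennreal (C / (4 * \<eta>)) * ((NBINT y. ennreal (tstep energy y) * indicator {s<..s + a} y)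
	   + (ennreal a * ennreal (tstep energy (s + \<tau>)) + ennreal a * ennreal (tstep energy s)))"
proof -
  define p n where "p = idx s" and "n = idx (s + \<tau>)"
  have sT: "s \<le> T" "0 < s + \<tau>" using s \<tau> by auto
  note ip = idx[OF s(1) sT(1), folded p_def] and ii = idx[OF sT(2) s(2), folded n_def]
  have pn: "p \<le> n" unfolding p_def n_def using s \<tau> by (intro idx_mono) auto
  have "a > 0" unfolding a_def using \<tau> time_step_pos by simp
  have "C > 0" unfolding C_def by (rule add_nonneg_pos) auto
  define D where "D = (\<Sigma> K. m K * (SU i. (V n K $ i - V p K $ i)^2))"
  let ?E = "\<Sum>k\<in>{p<..n}. dt k * energy k" and ?v = "\<lambda>K. norm (V n K - V p K)"
  let ?D = "\<lambda>x. ennreal (norm (pw V (s + \<tau>, x) - pw V (s, x)))" and ?I = "NBINT y. ennreal (tstep energy y) * indicator {s<..s + a} y"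
  have "(NBINT x. ?D x) = (NBINT x. ennreal (sstep ?v x))"
  proof (rule nn_integral_cong)
	fix x
	have "norm (sstep (V n) x - sstep (V p) x) = sstep ?v x"
	proof (cases "x \<in> \<Union> (cells M)")
	  case True
	  then obtain K where "K \<in> cells M" "x \<in> K" by auto
	  thus ?thesis by (simp add: sstep_in)
	next
	  case False
	  thus ?thesis by (simp only: sstep_out[OF False] diff_self norm_zero)
	qed
	thus "?D x = ennreal (sstep ?v x)" unfolding pw_in[OF s(1) sT(1)] pw_in[OF sT(2) s(2)] p_def[symmetric] n_def[symmetric] by simp
  qed
  also have "... = ennreal (\<Sigma> K. m K * ?v K)" by (rule nn_integral_sstep) simp
  also have "... \<le> ennreal (\<Sigma> K. m K * (\<eta> + (?v K)^2 / (4 * \<eta>)))"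
	by (intro ennreal_leI sum_mono mult_left_mono norm_le_young \<eta>) auto
  also have "(\<Sigma> K. m K * (\<eta> + (?v K)^2 / (4 * \<eta>))) = \<eta> * vol \<Omega> + D / (4 * \<eta>)"
	unfolding D_def sum_cell_measures[symmetric] norm_real_vec_squared
	by (simp add: algebra_simps sum.distrib sum_distrib_left sum_divide_distrib)
  also have "... \<le> \<eta> * vol \<Omega> + C / (4 * \<eta>) * (?E + (a * energy n + a * energy p))"
  proof -
	have "D \<le> C * (\<Sum>k\<in>{p<..n}. dt k * (energy k + energy n + energy p))"
	  unfolding D_def C_def using ip ii pn by (intro time_difference) auto
	also have "(\<Sum>k\<in>{p<..n}. dt k * (energy k + energy n + energy p)) = ?E + (\<Sum>k\<in>{p<..n}. dt k) * (energy n + energy p)"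
	  by (simp add: algebra_simps sum.distrib sum_distrib_left sum_distrib_right)
	also have "(\<Sum>k\<in>{p<..n}. dt k) = t n - t p" using pn ii(2) by (rule t_diff)
	also have "C * (?E + (t n - t p) * (energy n + energy p)) \<le> C * (?E + a * (energy n + energy p))"
	proof (intro mult_left_mono add_left_mono mult_right_mono)
	  have "t n \<le> t (n - 1) + time_step NT t" using dt_le[of n] ii(1,2) by (simp add: dt_def)
	  thus "t n - t p \<le> a" using ii(3) ip(4) by (simp add: a_def)
	qed (use energy_nonneg \<open>C > 0\<close> in auto)
	finally have "D / (4 * \<eta>) \<le> C * (?E + a * (energy n + energy p)) / (4 * \<eta>)" using \<eta> by (intro divide_right_mono) auto
	thus ?thesis by (simp add: distrib_left add_divide_distrib)
  qed
  finally have "(NBINT x. ?D x) \<le> ennreal (\<eta> * vol \<Omega> + C / (4 * \<eta>) * (?E + (a * energy n + a * energy p)))"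
	by (simp add: ennreal_leI)
  also have "... = ennreal (\<eta> * vol \<Omega>) + ennreal (C / (4 * \<eta>)) * (ennreal ?E
	 + (ennreal a * ennreal (energy n) + ennreal a * ennreal (energy p)))"
  proof -
	have nn: "0 \<le> ?E" using dt_pos ii(2) energy_nonneg by (intro sum_nonneg mult_nonneg_nonneg) (auto intro: less_imp_le)
	have a0: "0 \<le> a" "0 \<le> C / (4 * \<eta>)" "0 \<le> \<eta> * vol \<Omega>" using `a > 0` `C > 0` \<eta> by auto
	have "ennreal (x + k * (S + (a * e + a * f))) = ennreal x + ennreal k * (ennreal S + (ennreal a * ennreal e + ennreal a * ennreal f))"
	  if "0 \<le> x" "0 \<le> k" "0 \<le> S" "0 \<le> e" "0 \<le> f" for x k S e f using that a0(1) by (simp add: ennreal_plus ennreal_mult)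
	from this[OF a0(3,2) nn energy_nonneg energy_nonneg] show ?thesis .
  qed
  also have "... \<le> ennreal (\<eta> * vol \<Omega>) + ennreal (C / (4 * \<eta>)) * (?I
	   + (ennreal a * ennreal (energy n) + ennreal a * ennreal (energy p)))"
  proof (intro add_left_mono mult_left_mono add_right_mono)
	let ?e = "\<lambda>k. if k \<in> {p<..n} then energy k else 0"
	have "ennreal ?E = ennreal (\<Sum>k=1..NT. dt k * ?e k)" using ii(2) by (intro arg_cong[where f = ennreal] sum.mono_neutral_cong_left) auto
	also have "... = (NBINT y. ennreal (tstep ?e y))" using energy_nonneg by (intro nn_integral_tstep[symmetric]) auto
	also have "... \<le> ?I"
	proof (rule nn_integral_mono)
	  fix y
	  show "ennreal (tstep ?e y) \<le> ennreal (tstep energy y) * indicator {s<..s + a} y"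
	  proof (cases "0 < y \<and> y \<le> T \<and> idx y \<in> {p<..n}")
		case True
		hence y: "0 < y" "y \<le> T" and i: "p < idx y" "idx y \<le> n" by auto
		have "t p \<le> t (idx y - 1)" using i idx(2)[OF y] by (intro t_mono) auto
		hence "s < y" using idx(3)[OF y] ip(4) by simp
		have "t (idx y) \<le> t n" using i ii(2) by (intro t_mono)
		moreover have "t n \<le> t (n - 1) + time_step NT t" using dt_le[of n] ii(1,2) by (simp add: dt_def)
		ultimately have "y \<le> s + a" using idx(4)[OF y] ii(3) by (simp add: a_def)
		thus ?thesis using `s < y` i y by (simp add: tstep_in)
	  next
		case False
		hence "tstep ?e y = 0" by (cases "0 < y \<and> y \<le> T") (auto simp: tstep_in tstep_out)
		thus ?thesis by simp
	  qed
	qed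
	finally show "ennreal ?E \<le> ?I" .
  qed auto
  finally show ?thesis using tstep_in[OF s(1) sT(1), of energy] tstep_in[OF sT(2) s(2), of energy] by (simp add: p_def n_def)
qed

text \<open>Integrated over s, the window of length a contributes a times the total energy, and so
  does each of the two end point terms: hence the factor 3. The times for which only one of s and s
  + \<tau> lies in (0, T] fill at most two intervals of length \<tau>, where the trivial bound
  |\<Omega>| is used.\<close>

lemma time_translate:
  assumes \<tau>: "0 \<le> \<tau>" and \<eta>: "0 < \<eta>"
  shows "(NBINT s x. ennreal (norm (pw V (s + \<tau>, x) - pw V (s, x))))
	\<le> ennreal (\<eta> * vol \<Omega> * T + 3 * (\<tau> + time_step NT t) * time_const / (4 * \<eta>) + 2 * \<tau> * vol \<Omega>)"
proof -
  define a where "a = \<tau> + time_step NT t"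
  define C where "C = (flux_const A astar)^2 * (CARD('n))^2 + 1"
  have "a > 0" unfolding a_def using \<tau> time_step_pos by simp
  have "C > 0" unfolding C_def by (rule add_nonneg_pos) auto
  define E where "E y = ennreal (tstep energy y)" for y
  have [measurable]: "E \<in> borel_measurable borel" unfolding E_def[abs_def] by measurable
  have intE: "(NBINT y. E y) \<le> ennreal (2 * CARD('n) * vol \<Omega> / c)"
	unfolding E_def using energy_nonneg energy_estimate by (subst nn_integral_tstep) (auto intro: ennreal_leI)
  define w where "w = ennreal (vol \<Omega>)"
  let ?D = "\<lambda>s x. ennreal (norm (pw V (s + \<tau>, x) - pw V (s, x)))" and ?K = "2 * CARD('n) * vol \<Omega> / c"
  let ?I = "\<lambda>s. NBINT y. E y * indicator {s<..s + a} y" and ?e = "NBINT y. E y"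
  let ?G = "\<lambda>s. ?I s + (ennreal a * E (s + \<tau>) + ennreal a * E s)"
  have ind_meas: "(\<lambda>(s, y). E y * indicator {s<..s + a} y) \<in> borel_measurable (lborel \<Otimes>\<^sub>M lborel)"
  proof -
	have "(\<lambda>(s, y). E y * indicator {s<..s + a} y) = (\<lambda>(s, y). E y * (if s < y \<and> y \<le> s + a then 1 else 0))"
	  by (auto simp: indicator_def)
	also have "... \<in> borel_measurable (lborel \<Otimes>\<^sub>M lborel)" by measurable
	finally show ?thesis .
  qed
  hence [measurable]: "(\<lambda>s. ?I s) \<in> borel_measurable borel" using lborel.borel_measurable_nn_integral_fst[OF ind_meas] by simp
  have intG: "(NBINT s. ?G s) \<le> ennreal (3 * a * ?K)"
  proof -
	have "(NBINT s. ?I s) = (NBINT y s. E y * indicator {s<..s + a} y)" by (rule lborel_pair.Fubini'[OF ind_meas, symmetric])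
	also have "... = (NBINT y. ennreal a * E y)"
	proof (rule nn_integral_cong)
	  fix y
	  have "(NBINT s. E y * indicator {s<..s + a} y) = (NBINT s. E y * indicator {y - a..<y} s)"
		by (intro nn_integral_cong) (auto simp: indicator_def)
	  also have "... = E y * ennreal a" using `a > 0` by (simp add: nn_integral_cmult)
	  finally show "(NBINT s. E y * indicator {s<..s + a} y) = ennreal a * E y" by (simp add: mult.commute)
	qed
	also have "... = ennreal a * ?e" by (rule nn_integral_cmult) measurable
	finally have 1: "(NBINT s. ?I s) = ennreal a * ?e" .
	have "(NBINT s. E (s + \<tau>)) = (NBINT s. E s)" using nn_integral_lborel_translate[of E \<tau>] by (simp add: add.commute)
	hence "(NBINT s. ?G s) = ennreal a * ?e + (ennreal a * ?e + ennreal a * ?e)" by (simp add: nn_integral_add nn_integral_cmult 1)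
	also have "... \<le> ennreal a * ennreal ?K + (ennreal a * ennreal ?K + ennreal a * ennreal ?K)" by (intro add_mono mult_left_mono intE) auto
	also have "... = ennreal (3 * a * ?K)" using `a > 0` c by (simp add: ennreal_mult[symmetric] ennreal_plus[symmetric] del: ennreal_plus)
	finally show ?thesis .
  qed
  have "(NBINT s x. ?D s x) \<le> (NBINT s. (ennreal \<eta> * w * indicator {0<..T} s + ennreal (C / (4 * \<eta>)) * ?G s)
		+ (w * indicator {T - \<tau><..T} s + w * indicator {- \<tau><..0} s))"
  proof (rule nn_integral_mono)
	fix s
	let ?X = "(NBINT x. ?D s x)"
	let ?R = "(ennreal \<eta> * w * indicator {0<..T} s + ennreal (C / (4 * \<eta>)) * ?G s)
		+ (w * indicator {T - \<tau><..T} s + w * indicator {- \<tau><..0} s)"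
	have one: "(NBINT x. ennreal (norm (pw V (r, x)))) \<le> w" for r
	proof -
	  have "(NBINT x. ennreal (norm (pw V (r, x)))) \<le> (NBINT x. indicator \<Omega> x)"
	  proof (rule nn_integral_mono)
		fix x show "ennreal (norm (pw V (r, x))) \<le> indicator \<Omega> x"
		  using pw_V_norm[of "(r, x)"] pw_outside_domain[of x V r] by (cases "x \<in> \<Omega>") (auto simp: ennreal_le_1)
	  qed
	  also have "... = emeasure lborel \<Omega>" using cells_measurable by simp
	  also have "... = w" unfolding w_def using emeasure_bounded_finite[OF bounded_domain] cells_measurable(2)
		by (simp add: emeasure_eq_ennreal_measure)
	  finally show ?thesis .
	qed
	show "?X \<le> ?R"
	proof (cases "0 < s \<and> s + \<tau> \<le> T")
	  case True
	  hence "?X \<le> ennreal (\<eta> * vol \<Omega>) + ennreal (C / (4 * \<eta>)) * ?G s"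
		unfolding E_def C_def a_def using \<tau> \<eta> by (intro time_translate_pointwise) auto
	  also have "ennreal (\<eta> * vol \<Omega>) = ennreal \<eta> * w * indicator {0<..T} s"
		using True \<tau> \<eta> by (simp add: w_def ennreal_mult)
	  finally show ?thesis by (rule order_trans) (simp add: add_increasing2)
	next
	  case False
	  show ?thesis
	  proof (cases "0 < s \<and> s \<le> T")
		case s: True
		hence "pw V (s + \<tau>, x) = 0" for x using False by (intro pw_out) auto
		hence "?X \<le> w" using one[of s] by simp
		moreover have "s \<in> {T - \<tau><..T}" using s False by auto
		hence "indicator {T - \<tau><..T} s = (1 :: ennreal)" by (rule indicator_simps)
		hence "w \<le> ?R" by (simp only: mult_1_right) (intro add_increasing[OF zero_le] add_increasing2[OF zero_le] order_refl)
		ultimately show ?thesis by (rule order_trans)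
	  next
		case s: False
		hence z: "pw V (s, x) = 0" for x by (rule pw_out)
		show ?thesis
		proof (cases "0 < s + \<tau> \<and> s + \<tau> \<le> T")
		  case True
		  hence "s \<in> {- \<tau><..0}" using s \<tau> by auto
		  hence "indicator {- \<tau><..0} s = (1 :: ennreal)" by (rule indicator_simps)
		  hence "w \<le> ?R" by (simp only: mult_1_right) (intro add_increasing[OF zero_le] order_refl)
		  moreover have "?X \<le> w" using one[of "s + \<tau>"] by (simp add: z)
		  ultimately show ?thesis by (rule order_trans[rotated])
		next
		  case False
		  hence "pw V (s + \<tau>, x) = 0" for x by (rule pw_out)
		  thus ?thesis by (simp add: z)
		qed
	  qed
	qed
  qed
  also have "... = (ennreal \<eta> * w * ennreal T + ennreal (C / (4 * \<eta>)) * (NBINT s. ?G s)) + (w * ennreal \<tau> + w * ennreal \<tau>)"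
	using T \<tau> by (simp add: nn_integral_add nn_integral_cmult)
  also have "... \<le> (ennreal \<eta> * w * ennreal T + ennreal (C / (4 * \<eta>)) * ennreal (3 * a * ?K)) + (w * ennreal \<tau> + w * ennreal \<tau>)"
	by (intro add_mono order_refl mult_left_mono intG) auto
  also have "... = ennreal (\<eta> * vol \<Omega> * T + C / (4 * \<eta>) * (3 * a * ?K) + (vol \<Omega> * \<tau> + vol \<Omega> * \<tau>))"
	unfolding w_def using T \<tau> \<eta> `a > 0` `C > 0` c by (simp add: ennreal_mult[symmetric] ennreal_plus[symmetric] del: ennreal_plus)
  also have "C / (4 * \<eta>) * (3 * a * ?K) = 3 * (\<tau> + time_step NT t) * time_const / (4 * \<eta>)"
	by (simp add: time_const_def C_def a_def)
  finally show ?thesis by (simp add: mult_ac)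
qed

end

section \<open>Translates in space and time together\<close>

lemma inner_part_antimono: "r \<le> s ==> S - inner_part S r \<subseteq> S - inner_part S s" by (auto simp: inner_part_def)

lemma borel_measurable_shift_pair:
  assumes "g \<in> borel_measurable (borel :: (real \<times> 'a::euclidean_space) measure)"
  shows "(\<lambda>z. g (fst z + a, snd z + b)) \<in> borel_measurable borel"
  by (rule measurable_compose[OF _ assms]) (intro borel_measurable_continuous_onI continuous_intros)

context fv_solution
begin

text \<open>The parameter \<eta> stems from Young's inequality; it is fixed first, after which r and
  h can be taken small in spite of the division by \<eta>.\<close>

definition translation_bound :: "real => real => real => real" where
  "translation_bound \<eta> h r = r * space_const + 3 * T * measure lborel (\<Omega> - inner_part \<Omega> r)
	 + (\<eta> * vol \<Omega> * T + 3 * (r + h) * time_const / (4 * \<eta>) + 2 * r * vol \<Omega>)"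

lemma consts_nonneg: "0 \<le> space_const" "0 \<le> time_const" using T c by (auto simp: space_const_def time_const_def)

lemma pw_V_translate:
  assumes "\<eta> > 0"
  shows "(NBINT z. ennreal (norm (pw V (z + y) - pw V z))) \<le> ennreal (translation_bound \<eta> (time_step NT t) (norm y))"
proof -
  obtain \<tau> e where y: "y = (\<tau>, e)" by (cases y)
  have ny: "abs \<tau> \<le> norm y" "norm e \<le> norm y" using norm_fst_le[of \<tau> e] norm_snd_le[of e \<tau>] y by auto
  have [measurable]: "\<Omega> \<in> sets borel" using open_domain by simp
  let ?A = "\<lambda>s x. ennreal (norm (pw V (s, x + e) - pw V (s, x)))"
  let ?B = "\<lambda>s x. ennreal (norm (pw V (s + \<tau>, x) - pw V (s, x)))"
  let ?D = "\<lambda>s x. ennreal (norm (pw V (s + \<tau>, x + e) - pw V (s, x)))"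
  let ?a = "\<lambda>r. norm r * space_const + 3 * T * measure lborel (\<Omega> - inner_part \<Omega> (norm r))"
  let ?b = "\<lambda>r. \<eta> * vol \<Omega> * T + 3 * (r + time_step NT t) * time_const / (4 * \<eta>) + 2 * r * vol \<Omega>"
  have shift: "(\<lambda>z. pw V (fst z + a, snd z + b)) \<in> borel_measurable borel" for a b
	by (rule borel_measurable_shift_pair[OF pw_measurable])
  note pair_shift [measurable] = shift[of 0 e, simplified] shift[of \<tau> 0, simplified] shift[of \<tau> e]
  have Ameas: "(\<lambda>(s, x). ?A s x) \<in> borel_measurable (lborel \<Otimes>\<^sub>M lborel)" by (simp add: lborel_prod split_beta' pair_shift)
  have Bmeas: "(\<lambda>(s, x). ?B s x) \<in> borel_measurable (lborel \<Otimes>\<^sub>M lborel)" by (simp add: lborel_prod split_beta' pair_shift)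
  have [measurable]: "(\<lambda>s. (NBINT x. ?A s x)) \<in> borel_measurable borel"
	"(\<lambda>s. (NBINT x. ?B s x)) \<in> borel_measurable borel"
	using lborel.borel_measurable_nn_integral_fst[OF Ameas] lborel.borel_measurable_nn_integral_fst[OF Bmeas] by auto
  have Afin: "(NBINT s x. ?A (s + \<tau>) x) \<le> ennreal (?a y)"
  proof -
	have "(NBINT s x. ?A (s + \<tau>) x) = (NBINT s x. ?A s x)"
	  using nn_integral_lborel_translate[of "\<lambda>s. (NBINT x. ?A s x)" \<tau>] by (simp add: add.commute)
	also have "... \<le> ennreal (?a e)" by (rule space_translate)
	also have "... \<le> ennreal (?a y)"
	proof (intro ennreal_leI add_mono mult_left_mono mult_right_mono ny(2) consts_nonneg)
	  show "measure lborel (\<Omega> - inner_part \<Omega> (norm e)) \<le> measure lborel (\<Omega> - inner_part \<Omega> (norm y))"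
	  proof (rule measure_mono_fmeasurable[OF inner_part_antimono[OF ny(2)]])
		have [measurable]: "inner_part \<Omega> r \<in> sets borel" for r using open_domain by (rule inner_part_borel)
		show "\<Omega> - inner_part \<Omega> (norm e) \<in> sets lborel" by simp
		have "bounded (\<Omega> - inner_part \<Omega> (norm y))" using bounded_domain by (rule bounded_subset) auto
		thus "\<Omega> - inner_part \<Omega> (norm y) \<in> fmeasurable lborel" using emeasure_bounded_finite by (intro fmeasurableI) auto
	  qed
	qed (use T in auto)
	finally show ?thesis .
  qed
  have Bfin: "(NBINT s x. ?B s x) \<le> ennreal (?b (norm y))"
  proof -
	have mono: "ennreal (?b (abs \<tau>)) \<le> ennreal (?b (norm y))"
	  using ny(1) assms by (intro ennreal_leI add_mono mult_left_mono mult_right_mono divide_right_mono consts_nonneg) auto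
	show ?thesis
	proof (cases "\<tau> \<ge> 0")
	  case True
	  thus ?thesis using time_translate[OF True assms] mono by simp
	next
	  case False
	  \<comment> \<open>A negative time translate becomes a positive one by the substitution s -> s -
	    \<tau>.\<close>
	  have "(NBINT s x. ?B s x) = (NBINT s x. ?B (- \<tau> + s) x)" by (rule nn_integral_lborel_translate[symmetric]) measurable
	  also have "... = (NBINT s x. ennreal (norm (pw V (s + - \<tau>, x) - pw V (s, x))))" by (simp add: norm_minus_commute)
	  also have "... \<le> ennreal (?b (- \<tau>))" using False by (intro time_translate assms) auto
	  finally show ?thesis using mono False by simp
	qed
  qed
  have "(NBINT z. ennreal (norm (pw V (z + y) - pw V z))) = (NBINT s x. ?D s x)"
  proof -
	have "(\<lambda>(s, x). ?D s x) \<in> borel_measurable (lborel \<Otimes>\<^sub>M lborel)" by (simp add: lborel_prod split_beta' pair_shift)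
	from lborel.nn_integral_fst[OF this] show ?thesis by (simp add: lborel_prod y split_beta' plus_prod_def)
  qed
  also have "... \<le> (NBINT s. (NBINT x. ?A (s + \<tau>) x) + (NBINT x. ?B s x))"
  proof (rule nn_integral_mono)
	fix s
	have "(NBINT x. ?D s x) \<le> (NBINT x. ?A (s + \<tau>) x + ?B s x)"
	proof (rule nn_integral_mono)
	  fix x
	  have "norm (pw V (s + \<tau>, x + e) - pw V (s, x)) \<le> norm (pw V (s + \<tau>, x + e) - pw V (s + \<tau>, x)) + norm (pw V (s + \<tau>, x) - pw V (s, x))"
		using norm_triangle_ineq[of "pw V (s + \<tau>, x + e) - pw V (s + \<tau>, x)" "pw V (s + \<tau>, x) - pw V (s, x)"] by simp
	  thus "?D s x \<le> ?A (s + \<tau>) x + ?B s x" by (simp add: ennreal_leI flip: ennreal_plus)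
	qed
	also have "... = (NBINT x. ?A (s + \<tau>) x) + (NBINT x. ?B s x)" by (rule nn_integral_add) simp_all
	finally show "(NBINT x. ?D s x) \<le> (NBINT x. ?A (s + \<tau>) x) + (NBINT x. ?B s x)" .
  qed
  also have "... = (NBINT s x. ?A (s + \<tau>) x) + (NBINT s x. ?B s x)" by (rule nn_integral_add) measurable
  also have "... \<le> ennreal (?a y) + ennreal (?b (norm y))" by (intro add_mono Afin Bfin)
  also have "... = ennreal (translation_bound \<eta> (time_step NT t) (norm y))"
	unfolding translation_bound_def using T consts_nonneg time_step_pos assms by (intro ennreal_plus[symmetric] add_nonneg_nonneg) auto
  finally show ?thesis .
qed

lemma integrable_pw: 
  fixes W :: "nat => 'a set => 'c::euclidean_space"
  shows "integrable lborel (pw W)"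
proof -
  have "integrable lborel (\<lambda>z. indicator ({t (n - 1)<..t n} \<times> K) z :: real)" if "K \<in> cells M" for n K
	using cell(6)[OF that] cell_borel[OF that] by (intro integrable_indicator_bounded bounded_Times borel_Times) auto
  thus ?thesis unfolding pw_def[abs_def] by (intro integrable_sum integrable_scaleR_left) auto
qed

lemma pw_V_translate_real:
  assumes "\<eta> > 0"
  shows "(LBINT z. norm (pw V (z + y) - pw V z)) \<le> translation_bound \<eta> (time_step NT t) (norm y)"
proof (rule ennreal_le_iff[THEN iffD1])
  show "0 \<le> translation_bound \<eta> (time_step NT t) (norm y)"
	unfolding translation_bound_def using T consts_nonneg time_step_pos assms by (intro add_nonneg_nonneg) auto
  have "integrable lborel (\<lambda>z. pw V (z + y) - pw V z)"
	using integrable_lborel_translate[OF integrable_pw, of V y] integrable_pw[of V] by (simp add: add.commute)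
  thus "ennreal (LBINT z. norm (pw V (z + y) - pw V z)) \<le> ennreal (translation_bound \<eta> (time_step NT t) (norm y))"
	using pw_V_translate[OF assms, of y] by (subst nn_integral_eq_integral[symmetric]) auto
qed

end

section \<open>A sequence of schemes and its compactness\<close>

locale fv_sequence =
  fixes \<Omega> :: "'a::euclidean_space set" and M :: "nat => 'a mesh" and T :: real and NT :: "nat => nat"
	and t :: "nat => nat => real" and A :: "real ^ 'n ^ 'n" and astar :: real
	and U0 :: "'a => real ^ 'n" and V :: "nat => nat => 'a set => real ^ 'n" and c :: real
  assumes sol: "\<And>m. fv_solution \<Omega> (M m) T (NT m) (t m) A astar U0 (V m) c"
	and mesh_fine: "(\<lambda>m. mesh_size (M m)) ----> 0"
	and time_fine: "(\<lambda>m. time_step (NT m) (t m)) ----> 0"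
begin

abbreviation Q :: "(real \<times> 'a) set" where "Q \<equiv> {0<..<T} \<times> \<Omega>"

abbreviation u :: "nat => real \<times> 'a => real ^ 'n" where "u m \<equiv> fv_solution.pw (M m) (NT m) (t m) (V m)"

lemma domain: "open \<Omega>" "bounded \<Omega>" "T > 0" "\<Omega> \<in> sets borel" "open Q" "bounded Q" "Q \<in> sets borel"
proof -
  interpret fv_solution \<Omega> "M 0" T "NT 0" "t 0" A astar U0 "V 0" c by (rule sol)
  show *: "open \<Omega>" "bounded \<Omega>" "T > 0" "\<Omega> \<in> sets borel" using open_domain bounded_domain T by auto
  show "open Q" "bounded Q" using * by (auto intro!: open_Times bounded_Times)
  thus "Q \<in> sets borel" by simp
qed

lemma u_measurable [measurable]: "u m \<in> borel_measurable borel" by (rule fv_solution.pw_measurable[OF sol])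

lemma u_norm: "norm (u m z) \<le> 1" by (rule fv_solution.pw_V_norm[OF sol])

lemma AE_u_simplex: "AE z in lborel. z \<in> Q \<longrightarrow> u m z \<in> unit_simplex"
proof -
  interpret fv_solution \<Omega> "M m" T "NT m" "t m" A astar U0 "V m" c by (rule sol)
  have "AE z in lborel \<Otimes>\<^sub>M lborel. snd (z :: real \<times> 'a) \<in> \<Omega> \<longrightarrow> snd z \<in> \<Union> (cells (M m))"
  proof (rule lborel_pair.AE_pair_measure)
	show "AE x in lborel. AE y in lborel. snd (x :: real, y) \<in> \<Omega> \<longrightarrow> snd (x, y) \<in> \<Union> (cells (M m))"
	  using AE_in_cells by simp
	have [measurable]: "\<Omega> \<in> sets borel" "\<Union> (cells (M m)) \<in> sets borel" using cells_measurable by auto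
	show "{x \<in> space (lborel \<Otimes>\<^sub>M lborel). snd (x :: real \<times> 'a) \<in> \<Omega> \<longrightarrow> snd x \<in> \<Union> (cells (M m))} \<in> sets (lborel \<Otimes>\<^sub>M lborel)"
	  by measurable
  qed
  hence "AE z in lborel. snd (z :: real \<times> 'a) \<in> \<Omega> \<longrightarrow> snd z \<in> \<Union> (cells (M m))" unfolding lborel_prod .
  thus ?thesis
  proof eventually_elim
	case (elim z)
	obtain s x where z: "z = (s, x)" by (cases z)
	show ?case
	proof
	  assume "z \<in> Q"
	  hence s: "0 < s" "s \<le> T" and "x \<in> \<Union> (cells (M m))" using elim z by auto
	  then obtain K where K: "K \<in> cells (M m)" "x \<in> K" by auto
	  thus "pw (V m) z \<in> unit_simplex" using V_simplex[OF idx(2)[OF s] K(1)] by (simp add: z pw_in[OF s] sstep_in[OF K])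
	qed
  qed
qed

lemma unit_simplex_closed: "closed (unit_simplex :: (real ^ 'n) set)"
proof -
  have "unit_simplex = (\<Inter>i. {p :: real ^ 'n. 0 \<le> p $ i}) \<inter> {p. (SU i. p $ i) = 1}" by (auto simp: unit_simplex_def)
  also have "closed ..." by (intro closed_Int closed_INT ballI closed_Collect_le closed_Collect_eq continuous_intros)
  finally show ?thesis .
qed

lemma equicontinuity:
  assumes \<epsilon>: "\<epsilon> > 0"
  shows "\<exists>\<delta>>0. \<exists>N. \<forall>m\<ge>N. \<forall>y. norm y \<le> \<delta> \<longrightarrow> (LBINT z. norm (u m (z + y) - u m z)) \<le> \<epsilon>"
proof -
  \<comment> \<open>The constants depend only on \<Omega>, T, the coefficients and c, so those of
    the scheme with index 0 serve for all m.\<close>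
  interpret s0: fv_solution \<Omega> "M 0" T "NT 0" "t 0" A astar U0 "V 0" c by (rule sol)
  define w where "w = vol \<Omega>"
  have w: "w \<ge> 0" by (simp add: w_def)
  \<comment> \<open>This choice keeps \<eta> |\<Omega>| T below a quarter of \<epsilon>; the
    boundary layer takes another quarter, and the terms proportional to s + h, collected in k, take
    the remaining half.\<close>
  define \<eta> where "\<eta> = \<epsilon> / (4 * (w * T + 1))"
  have wT: "w * T + 1 > 0" using w domain(3) by (simp add: add_nonneg_pos)
  have \<eta>: "\<eta> > 0" "\<eta> * w * T \<le> \<epsilon> / 4" using \<epsilon> wT by (auto simp: \<eta>_def field_simps)
  define k where "k = s0.space_const + 3 * s0.time_const / (4 * \<eta>) + 2 * w + 1"
  have k: "k > 0" using s0.consts_nonneg \<eta> w by (auto simp: k_def intro!: add_nonneg_pos)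
  have e': "\<epsilon> / (12 * T) > 0" using \<epsilon> domain(3) by simp
  obtain r where r: "r > 0" "\<And>s. s \<le> r ==> measure lborel (\<Omega> - inner_part \<Omega> s) < \<epsilon> / (12 * T)"
	by (rule boundary_layer_small[OF domain(1,2) e']) blast
  have bound: "s0.translation_bound \<eta> h s \<le> \<epsilon>" if s: "0 \<le> s" "s \<le> r" "s \<le> \<epsilon> / (4 * k)" and h: "0 \<le> h" "h \<le> \<epsilon> / (4 * k)" for s h
  proof -
	have "3 * T * measure lborel (\<Omega> - inner_part \<Omega> s) \<le> 3 * T * (\<epsilon> / (12 * T))"
	  using r(2)[OF s(2)] domain(3) by (intro mult_left_mono) auto
	hence 1: "3 * T * measure lborel (\<Omega> - inner_part \<Omega> s) \<le> \<epsilon> / 4" using domain(3) by simp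
	have "s * s0.space_const + 3 * (s + h) * s0.time_const / (4 * \<eta>) + 2 * s * w
	  \<le> (s + h) * s0.space_const + (s + h) * (3 * s0.time_const / (4 * \<eta>)) + (s + h) * (2 * w)"
	  using s h w s0.consts_nonneg by (intro add_mono) (auto intro!: mult_right_mono simp: algebra_simps)
	also have "... \<le> (s + h) * k" using s h unfolding k_def by (simp add: algebra_simps)
	also have "... \<le> (\<epsilon> / (4 * k) + \<epsilon> / (4 * k)) * k" using s h k by (intro mult_right_mono add_mono) auto
	also have "... = \<epsilon> / 2" using k by (simp add: field_simps)
	finally show ?thesis using 1 \<eta>(2) unfolding s0.translation_bound_def w_def[symmetric] by linarith
  qed
  have "\<forall>\<^sub>F m in sequentially. time_step (NT m) (t m) < \<epsilon> / (4 * k)"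
	using time_fine \<epsilon> k by (intro order_tendstoD) auto
  then obtain N where N: "\<And>m. m \<ge> N ==> time_step (NT m) (t m) < \<epsilon> / (4 * k)" by (auto simp: eventually_sequentially)
  show ?thesis
  proof (intro exI[of _ "min r (\<epsilon> / (4 * k))"] exI[of _ N] conjI allI impI)
	show "0 < min r (\<epsilon> / (4 * k))" using r \<epsilon> k by simp
	fix m :: nat and y :: "real \<times> 'a" assume m: "N \<le> m" and y: "norm y \<le> min r (\<epsilon> / (4 * k))"
	have "0 \<le> time_step (NT m) (t m)" using fv_solution.time_step_pos[OF sol[of m]] by simp
	hence "s0.translation_bound \<eta> (time_step (NT m) (t m)) (norm y) \<le> \<epsilon>" using N[OF m] y by (intro bound) auto
	thus "(LBINT z. norm (u m (z + y) - u m z)) \<le> \<epsilon>" using fv_solution.pw_V_translate_real[OF sol[of m] \<eta>(1), of y] by linarith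
  qed
qed

lemma compactness:
  obtains r U where "strict_mono (r :: nat => nat)" "U \<in> borel_measurable borel"
	"AE z in lborel. (\<lambda>m. u (r m) z) ----> U z" "\<And>z. norm (U z) \<le> 1" "\<And>z. z \<notin> Q ==> U z = 0"
	"AE z in lborel. z \<in> Q \<longrightarrow> U z \<in> unit_simplex"
proof -
  have "bounded ({0..T} \<times> \<Omega>)" using domain by (intro bounded_Times) auto
  then obtain R where "\<forall>z\<in>{0..T} \<times> \<Omega>. norm z \<le> R" unfolding bounded_iff by blast
  hence R: "{0..T} \<times> \<Omega> \<subseteq> cball 0 R" by (intro subsetI) (simp only: mem_cball_0)
  have supp: "u m z = 0" if "z \<notin> {0<..T} \<times> \<Omega>" for m z
  proof -
	obtain s x where z: "z = (s, x)" by (cases z)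
	show ?thesis
	proof (cases "x \<in> \<Omega>")
	  case True
	  hence "\<not> (0 < s \<and> s \<le> T)" using that z by auto
	  thus ?thesis unfolding z by (rule fv_solution.pw_out[OF sol])
	next
	  case False
	  thus ?thesis unfolding z by (rule fv_solution.pw_outside_domain[OF sol])
	qed
  qed
  have "u m z = 0" if "z \<notin> cball 0 R" for m z
  proof (rule supp)
	have "{0<..T} \<times> \<Omega> \<subseteq> {0..T} \<times> \<Omega>" by auto
	thus "z \<notin> {0<..T} \<times> \<Omega>" using R that by blast
  qed
  from Kolmogorov_L1_compactness[OF u_measurable u_norm this equicontinuity]
  obtain r g where r: "strict_mono (r :: nat => nat)" and g [measurable]: "g \<in> borel_measurable borel"
	and conv: "AE z in lborel. (\<lambda>m. u (r m) z) ----> g z" by blast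
  \<comment> \<open>The limit is set to 0 outside Q and where it misses the simplex, so that the
    norm bound and the vanishing outside Q hold everywhere and not only almost everywhere.\<close>
  define U where "U z = (if z \<in> Q \<and> g z \<in> unit_simplex then g z else 0)" for z
  have [measurable]: "unit_simplex \<in> sets (borel :: (real ^ 'n) measure)" "Q \<in> sets borel" using unit_simplex_closed domain by auto
  have "AE z in lborel. \<forall>m. z \<in> Q \<longrightarrow> u m z \<in> unit_simplex" unfolding AE_all_countable using AE_u_simplex by blast
  hence simplex: "AE z in lborel. z \<in> Q \<longrightarrow> g z \<in> unit_simplex" using conv
  proof eventually_elim
	case (elim z)
	show ?case
	proof
	  assume "z \<in> Q"
	  hence "u (r m) z \<in> unit_simplex" for m using elim(1) by blast
	  thus "g z \<in> unit_simplex" by (rule closed_sequentially[OF unit_simplex_closed _ elim(2)])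
	qed
  qed
  \<comment> \<open>Step functions live on (0, T], whereas Q uses (0, T); the level t = T is
    null.\<close>
  have endpoint: "AE z in lborel. fst (z :: real \<times> 'a) \<noteq> T"
  proof -
	have "AE z in lborel \<Otimes>\<^sub>M lborel. fst (z :: real \<times> 'a) \<noteq> T"
	proof (rule lborel_pair.AE_pair_measure)
	  show "AE x in lborel. AE y in lborel. fst (x, y :: 'a) \<noteq> T" using AE_lborel_singleton[of T] by eventually_elim simp
	qed measurable
	thus ?thesis unfolding lborel_prod .
  qed
  show thesis
  proof (rule that[OF r, of U])
	show "U \<in> borel_measurable borel" unfolding U_def[abs_def] by measurable
	show "AE z in lborel. (\<lambda>m. u (r m) z) ----> U z" using conv simplex endpoint
	proof eventually_elim
	  case (elim z)
	  show ?case
	  proof (cases "z \<in> Q")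
		case True
		thus ?thesis using elim by (simp add: U_def)
	  next
		case False
		hence "z \<notin> {0<..T} \<times> \<Omega>" using elim(3) by (cases z) auto
		thus ?thesis using False supp by (simp add: U_def)
	  qed
	qed
	show "norm (U z) \<le> 1" for z unfolding U_def by (simp add: simplex_norm_le_1)
	show "U z = 0" if "z \<notin> Q" for z using that by (auto simp: U_def)
	show "AE z in lborel. z \<in> Q \<longrightarrow> U z \<in> unit_simplex" using simplex by eventually_elim (auto simp: U_def)
  qed
qed

lemma finite_Q: "finite_measure (lebesgue_on Q)" using domain by (intro finite_measure_lebesgue_on lmeasurable_open) auto

lemma limit_Lp:
  assumes U [measurable]: "U \<in> borel_measurable borel" and conv: "AE z in lborel. (\<lambda>m. u (r m) z) ----> U z"
	and bd: "\<And>z. norm (U z) \<le> 1" and p: "p \<ge> 1"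
  shows "tendsto_Lp p Q (\<lambda>m. u (r m)) U"
proof -
  interpret finite_measure "lebesgue_on Q" by (rule finite_Q)
  let ?n = "\<lambda>m z. norm (u (r m) z - U z)"
  have int: "integrable (lebesgue_on Q) (\<lambda>z. norm (f z) powr p)"
	if f [measurable]: "f \<in> borel_measurable borel" and b: "\<And>z. norm (f z) \<le> 1" for f :: "real \<times> 'a => real ^ 'n"
  proof (rule integrable_const_bound[where B = 1])
	show "AE z in lebesgue_on Q. norm (norm (f z) powr p) \<le> 1" using b p by (intro AE_I2) (auto intro!: powr_le1)
	show "(\<lambda>z. norm (f z) powr p) \<in> borel_measurable (lebesgue_on Q)" by (rule borel_lebesgue_on) measurable
  qed
  have "(\<lambda>m. \<integral>z. ?n m z powr p \<partial>lebesgue_on Q) ----> (\<integral>z. 0 \<partial>lebesgue_on Q)"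
  proof (rule integral_dominated_convergence[where w = "\<lambda>_. 2 powr p"])
	show "(\<lambda>z. ?n m z powr p) \<in> borel_measurable (lebesgue_on Q)" for m by (rule borel_lebesgue_on) measurable
	show "AE z in lebesgue_on Q. norm (?n m z powr p) \<le> 2 powr p" for m
	proof (rule AE_I2)
	  fix z
	  have "?n m z \<le> 1 + 1" using norm_triangle_ineq4 u_norm bd by (rule order_trans[OF _ add_mono])
	  thus "norm (?n m z powr p) \<le> 2 powr p" using p by (simp add: powr_mono2)
	qed
	have "AE z in lebesgue_on Q. (\<lambda>m. u (r m) z) ----> U z"
	  using conv by (intro AE_lebesgue_onI[OF domain(7)]) (auto elim: eventually_mono)
	thus "AE z in lebesgue_on Q. (\<lambda>m. ?n m z powr p) ----> 0"
	proof eventually_elim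
	  case (elim z)
	  hence "(\<lambda>m. ?n m z) ----> 0" by (simp add: LIM_zero tendsto_norm_zero)
	  thus ?case using p by (intro tendsto_zero_powrI[where b = p]) auto
	qed
  qed auto
  hence "(\<lambda>m. \<integral>z. ?n m z powr p \<partial>lebesgue_on Q) ----> 0" by simp
  hence "(\<lambda>m. (\<integral>z. ?n m z powr p \<partial>lebesgue_on Q) powr (1 / p)) ----> 0"
	using p by (intro tendsto_zero_powrI[where b = "1 / p"]) auto
  thus ?thesis unfolding tendsto_Lp_def by (intro conjI allI int borel_lebesgue_on U bd u_norm u_measurable)
qed

end

lemma integrable_times_bounded:
  fixes f b :: "'b::euclidean_space => real"
  assumes f: "integrable lborel f" and [measurable]: "b \<in> borel_measurable borel" and C: "\<And>x. abs (b x) \<le> C"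
  shows "integrable lborel (\<lambda>x. f x * b x)"
proof (rule integrable_bound)
  show "integrable lborel (\<lambda>x. C * f x)" using f by simp
  have [measurable]: "f \<in> borel_measurable borel" using f by auto
  show "(\<lambda>x. f x * b x) \<in> borel_measurable lborel" by measurable
  show "AE x in lborel. norm (f x * b x) \<le> norm (C * f x)"
  proof (rule AE_I2)
	fix x
	have "abs (b x) \<le> abs C" using C[of x] by simp
	thus "norm (f x * b x) \<le> norm (C * f x)" by (simp add: abs_mult mult.commute mult_right_mono)
  qed
qed

section \<open>Discrete gradients and consistency\<close>

text \<open>The regularity that the zero extension of a test function on \<Omega> has: Lipschitz,
  supported in a compact subset of \<Omega>, with difference quotients in direction e converging to
  d\<psi>. The quotients are bounded by B, which allows dominated convergence.\<close>

locale space_test =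
  fixes \<Omega> :: "'a::euclidean_space set" and \<psi> d\<psi> :: "'a => real" and e :: 'a and B :: real and C :: "'a set"
  assumes lip: "\<And>x y. abs (\<psi> x - \<psi> y) \<le> B * dist x y" and B: "0 \<le> B" and e: "norm e \<le> 1"
	and C: "compact C" "C \<subseteq> \<Omega>" "\<And>x. x \<notin> C ==> \<psi> x = 0"
	and quotient_limit: "\<And>x. (\<lambda>n. real (Suc n) * (\<psi> x - \<psi> (x - e /\<^sub>R real (Suc n)))) ----> d\<psi> x"
begin

lemma continuous: "continuous_on UNIV \<psi>"
proof (rule lipschitz_on_continuous_on[of B])
  show "B-lipschitz_on UNIV \<psi>" using lip B by (auto simp: lipschitz_on_def dist_real_def)
qed

lemma psi_measurable [measurable]: "\<psi> \<in> borel_measurable borel" using continuous by (rule borel_measurable_continuous_onI)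

lemma dpsi_measurable [measurable]: "d\<psi> \<in> borel_measurable borel" by (rule borel_measurable_LIMSEQ_real[OF quotient_limit]) measurable

lemma psi_bounded: obtains P where "0 \<le> P" "\<And>x. abs (\<psi> x) \<le> P"
proof -
  have "compact (\<psi> ` C)" using C(1) continuous continuous_on_subset by (intro compact_continuous_image) auto
  then obtain P where "\<forall>y\<in>\<psi> ` C. norm y \<le> P" using compact_imp_bounded bounded_iff by metis
  hence "abs (\<psi> x) \<le> abs P" for x using C(3)[of x] by (cases "x \<in> C") force+
  thus thesis by (intro that[of "abs P"]) auto
qed

lemma psi_integrable: "integrable lborel \<psi>"
proof -
  obtain P where P: "\<And>x. abs (\<psi> x) \<le> P" using psi_bounded by blast
  obtain R where R: "C \<subseteq> cball 0 R" using C(1) compact_imp_bounded bounded_iff by (metis mem_cball_0 subsetI)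
  show ?thesis by (rule integrable_bounded_support[of _ P R]) (use P subsetD[OF R] C(3) in \<open>auto simp del: mem_cball\<close>)
qed

lemma quotient_bound: "abs (real (Suc n) * (\<psi> x - \<psi> (x - e /\<^sub>R real (Suc n)))) \<le> B"
proof -
  have "real (Suc n) * abs (\<psi> x - \<psi> (x - e /\<^sub>R real (Suc n))) \<le> real (Suc n) * (B * norm (e /\<^sub>R real (Suc n)))"
	using lip[of x "x - e /\<^sub>R real (Suc n)"] by (intro mult_left_mono) (auto simp: dist_norm)
  also have "... = B * norm e" by (simp add: field_simps)
  also have "... \<le> B * 1" using e B by (rule mult_left_mono)
  finally show ?thesis by (simp add: abs_mult)
qed

lemma dpsi_bound: "abs (d\<psi> x) \<le> B" by (rule LIMSEQ_le_const2[OF tendsto_rabs[OF quotient_limit]]) (use quotient_bound in blast)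

end

context fv_mesh
begin

text \<open>The factor \<open>depth K L / cdist K L\<close> is the part of the segment between the
  centres on the side of K. For the two cells of a face these factors add up to 1, so each jump is
  shared out exactly once.\<close>

definition grad :: "('a set => real) => 'a set => 'a" where
  "grad w K = (1 / vol K) *R
	 (\<Sigma> L. (area K L * (depth K L / cdist K L) * (w L - w K)) *R normal K L)"

lemma measure_grad:
  assumes "K \<in> cells M"
  shows "vol K *R grad w K = (\<Sigma> L. (area K L * (depth K L / cdist K L) * (w L - w K)) *R normal K L)"
  using cell_measure_pos[OF assms] by (simp add: grad_def)

lemma area_eq_0: "\<not> adj K L ==> area K L = 0" by (simp add: area_def)

lemma depth_ratio: "adj K L ==> 0 \<le> depth K L / cdist K L" "adj K L ==> depth K L / cdist K L \<le> 1"
  using depth_pos[of K L] depth_pos[of L K] depth_add[of K L] cdist_pos[of K L] adj_sym[of K L] by (auto simp: field_simps)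

lemma norm_grad_le:
  assumes "K \<in> cells M"
  shows "vol K * norm (grad w K) \<le> (\<Sigma> L. area K L * (depth K L / cdist K L) * abs (w L - w K))"
proof -
  have "vol K * norm (grad w K) = norm (vol K *R grad w K)" by simp
  also have "... \<le> (\<Sigma> L. norm ((area K L * (depth K L / cdist K L) * (w L - w K)) *R normal K L))"
	unfolding measure_grad[OF assms] by (rule norm_sum)
  also have "... = (\<Sigma> L. area K L * (depth K L / cdist K L) * abs (w L - w K))"
  proof (rule sum.cong)
	fix L
	show "norm ((area K L * (depth K L / cdist K L) * (w L - w K)) *R normal K L) = area K L * (depth K L / cdist K L) * abs (w L - w K)"
	proof (cases "adj K L")
	  case True
	  thus ?thesis using depth_pos[OF True] cdist_pos[OF True] norm_normal[OF True] area_nonneg[of K L] by (simp add: abs_mult)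
	qed (simp add: area_eq_0)
  qed simp
  finally show ?thesis .
qed

lemma norm_grad_le_area:
  assumes "K \<in> cells M"
  shows "vol K * norm (grad w K) \<le> (\<Sigma> L. area K L * abs (w L - w K))"
proof (rule order_trans[OF norm_grad_le[OF assms]], rule sum_mono)
  fix L
  show "area K L * (depth K L / cdist K L) * abs (w L - w K) \<le> area K L * abs (w L - w K)"
  proof (cases "adj K L")
	case True
	have "area K L * (depth K L / cdist K L) \<le> area K L * 1" using depth_ratio(2)[OF True] area_nonneg by (rule mult_left_mono)
	thus ?thesis by (intro mult_right_mono) auto
  qed (simp add: area_eq_0)
qed

text \<open>Cauchy-Schwarz with the weights area times depth, whose sum is at most d times the
  volume of K by \<open>sum_area_depth\<close>; afterwards one depth is bounded by
  \<open>cdist\<close>.\<close>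

lemma grad_squared_le:
  assumes K: "K \<in> cells M"
  shows "vol K * (norm (grad w K))^2 \<le> DIM('a) * (\<Sigma> L. tau K L * (w L - w K)^2)"
proof -
  let ?m = "vol K"
  define a where "a L = area K L * depth K L" for L
  have a: "0 \<le> a L" for L unfolding a_def using depth_pos[of K L] area_nonneg[of K L] area_eq_0[of K L] by (cases "adj K L") auto
  define b where "b L = abs (w L - w K) / cdist K L" for L
  have "(?m * norm (grad w K))^2 \<le> (\<Sigma> L. a L * b L)^2"
  proof (rule power_mono)
	show "?m * norm (grad w K) \<le> (\<Sigma> L. a L * b L)" using norm_grad_le[OF K] by (simp add: a_def b_def)
  qed auto
  also have "... = (\<Sigma> L. sqrt (a L) * (sqrt (a L) * b L))^2" using a by (simp flip: mult.assoc)
  also have "... \<le> (\<Sigma> L. (sqrt (a L))^2) * (\<Sigma> L. (sqrt (a L) * b L)^2)" by (rule Cauchy_Schwarz_ineq_sum)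
  also have "... = (\<Sigma> L. a L) * (\<Sigma> L. a L * (b L)^2)" using a by (simp add: power_mult_distrib)
  also have "... \<le> (DIM('a) * ?m) * (\<Sigma> L. tau K L * (w L - w K)^2)"
  proof (rule mult_mono)
	show "(\<Sigma> L. a L) \<le> DIM('a) * ?m" unfolding a_def by (rule sum_area_depth[OF K])
	show "(\<Sigma> L. a L * (b L)^2) \<le> (\<Sigma> L. tau K L * (w L - w K)^2)"
	proof (rule sum_mono)
	  fix L
	  show "a L * (b L)^2 \<le> tau K L * (w L - w K)^2"
	  proof (cases "adj K L")
		case True
		have "a L * (b L)^2 = (depth K L / cdist K L) * (tau K L * (w L - w K)^2)"
		  using True cdist_pos[OF True] by (simp add: a_def b_def tau_def power2_eq_square)
		also have "... \<le> 1 * (tau K L * (w L - w K)^2)" using depth_ratio(2)[OF True] tau_nonneg[of K L] by (intro mult_right_mono) auto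
		finally show ?thesis by simp
	  qed (simp add: a_def area_eq_0 tau_nonneg)
	qed
	show "0 \<le> (\<Sigma> L. a L * (b L)^2)" using a by (intro sum_nonneg) auto
  qed auto
  finally have "?m * (?m * (norm (grad w K))^2) \<le> ?m * (DIM('a) * (\<Sigma> L. tau K L * (w L - w K)^2))"
	by (simp add: power2_eq_square mult_ac)
  thus ?thesis using cell_measure_pos[OF K] by simp
qed

lemma sstep_norm_le: "norm (sstep w x) \<le> (\<Sigma> K. norm (w K))"
  unfolding sstep_def by (rule order_trans[OF norm_sum]) (auto intro!: sum_mono simp: indicator_def)

definition jump_sum :: "('a set => real) => real" where
  "jump_sum w = (\<Sigma> K L. area K L * abs (w L - w K))"

lemma jump_sum_nonneg: "0 \<le> jump_sum w" unfolding jump_sum_def using area_nonneg by (intro sum_nonneg mult_nonneg_nonneg) auto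

lemma double_sum_bound:
  fixes f g :: "'x => 'x => real"
  assumes "\<And>K L. K \<in> S ==> L \<in> S ==> abs (f K L) \<le> g K L"
  shows "abs (\<Sum>K\<in>S. \<Sum>L\<in>S. f K L) \<le> (\<Sum>K\<in>S. \<Sum>L\<in>S. g K L)"
  by (rule order_trans[OF sum_abs], rule sum_mono, rule order_trans[OF sum_abs], rule sum_mono, rule assms)

lemma sum_double_swap: "(\<Sum>K\<in>S. \<Sum>L\<in>S. f K L) = (\<Sum>K\<in>S. \<Sum>L\<in>S. (f K L + f L K) / 2)" for f :: "'x => 'x => real"
  using sum.swap[of "\<lambda>K L. f L K" S S] by (simp add: sum.distrib flip: sum_divide_distrib)

text \<open>In the first sum a face contributes its jump with \<psi> from one side only, in the
  second with \<psi> from both sides, weighted by depth. After averaging over both orders they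
  differ by a multiple of the difference of \<psi> at the two centres, which is at most 2 B times
  the mesh size.\<close>

lemma crossing_vs_grad:
  assumes B: "\<And>x y. abs (\<psi> x - \<psi> y) \<le> B * dist x y" "0 \<le> B" and e: "norm e \<le> 1"
  shows "\<bar>(\<Sigma> K L. area K L * max 0 (e \<bullet> normal K L) * (w L - w K) * \<psi> (center M K))
	- (\<Sigma> K. vol K * (grad w K \<bullet> e) * \<psi> (center M K))\<bar> \<le> 2 * B * mesh_size M * jump_sum w"
proof -
  let ?\<psi> = "\<lambda>K. \<psi> (center M K)"
  let ?f = "\<lambda>K L. area K L * max 0 (e \<bullet> normal K L) * (w L - w K) * ?\<psi> K"
  let ?g = "\<lambda>K L. area K L * (depth K L / cdist K L) * (w L - w K) * (e \<bullet> normal K L) * ?\<psi> K"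
  have 2: "(\<Sigma> K. vol K * (grad w K \<bullet> e) * ?\<psi> K) = (\<Sigma> K L. ?g K L)"
  proof (rule sum.cong)
	fix K assume K: "K \<in> cells M"
	have "vol K * (grad w K \<bullet> e) = (vol K *R grad w K) \<bullet> e" by simp
	also have "... = (\<Sigma> L. area K L * (depth K L / cdist K L) * (w L - w K) * (e \<bullet> normal K L))"
	  unfolding measure_grad[OF K] by (simp add: inner_sum_left) (simp add: inner_commute)
	finally show "vol K * (grad w K \<bullet> e) * ?\<psi> K = (\<Sigma> L. ?g K L)" by (simp add: sum_distrib_right)
  qed simp
  have bd: "abs ((?f K L + ?f L K) / 2 - (?g K L + ?g L K) / 2) \<le> 2 * B * mesh_size M * (area K L * abs (w L - w K))" for K L
  proof (cases "adj K L")
	case True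
	let ?p = "e \<bullet> normal K L" and ?D = "w L - w K"
	have p: "abs ?p \<le> 1" using Cauchy_Schwarz_ineq2[of e "normal K L"] e norm_normal[OF True] by simp
	have "abs (?\<psi> K - ?\<psi> L) \<le> B * cdist K L" using B(1)[of "center M K" "center M L"] by (simp add: cdist_def)
	also have "... \<le> B * (2 * mesh_size M)" using cdist_le[OF True] B(2) by (rule mult_left_mono)
	finally have \<psi>: "abs (?\<psi> K - ?\<psi> L) \<le> 2 * B * mesh_size M" by (simp add: mult_ac)
	have dL: "depth L K / cdist K L = 1 - depth K L / cdist K L" using depth_add[OF True] cdist_pos[OF True] by (simp add: field_simps)
	have mx: "max 0 (- ?p) = max 0 ?p - ?p" by auto
	define q where "q = max 0 ?p"
	define \<theta> where "\<theta> = depth K L / cdist K L"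
	have \<theta>: "0 \<le> \<theta>" "\<theta> \<le> 1" unfolding \<theta>_def using depth_ratio[OF True] by auto
	have "?f K L + ?f L K - (?g K L + ?g L K) = area K L * ?D * ((q - \<theta> * ?p) * (?\<psi> K - ?\<psi> L))"
	  unfolding area_sym[of L K] cdist_sym[of L K] normal_sym[of L K] dL inner_minus_right mx q_def[symmetric] \<theta>_def[symmetric]
	  by (simp add: algebra_simps)
	hence "abs ((?f K L + ?f L K) / 2 - (?g K L + ?g L K) / 2) = area K L * abs ?D * (abs (q - \<theta> * ?p) * abs (?\<psi> K - ?\<psi> L)) / 2"
	  using area_nonneg[of K L] by (simp add: abs_mult flip: diff_divide_distrib)
	also have "... \<le> area K L * abs ?D * (2 * (2 * B * mesh_size M)) / 2"
	proof (intro divide_right_mono mult_left_mono mult_mono \<psi>)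
	  have "abs q \<le> 1" using p by (auto simp: q_def)
	  moreover have "abs (\<theta> * ?p) \<le> 1 * 1" unfolding abs_mult using \<theta> p by (intro mult_mono) auto
	  ultimately show "abs (q - \<theta> * ?p) \<le> 2" by linarith
	qed (use area_nonneg in auto)
	finally show ?thesis by (simp add: mult_ac)
  qed (simp add: area_eq_0 adj_sym[of L K])
  show ?thesis unfolding 2 sum_double_swap[of ?f] sum_double_swap[of ?g] sum_subtractf[symmetric] jump_sum_def sum_distrib_left
	by (rule double_sum_bound) (rule bd)
qed

text \<open>Replaces integration by parts on polyhedral cells: the translation in the difference
  quotients of \<psi> is shifted onto the step function, whose increments live on the sets crossing
  from K to L. The factor 4 is 1 for evaluating \<psi> at the centres on these sets, 1 for the same
  in the gradient integral, and 2 from \<open>crossing_vs_grad\<close>.\<close>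

lemma gradient_consistency:
  assumes "space_test \<Omega> \<psi> d\<psi> e B C"
  shows "abs ((LBINT x. sstep w x * d\<psi> x) + (LBINT x. (sstep (grad w) x \<bullet> e) * \<psi> x)) \<le> 4 * B * mesh_size M * jump_sum w"
proof -
  interpret space_test \<Omega> \<psi> d\<psi> e B C by fact
  let ?h = "mesh_size M"
  define v where "v n = e /\<^sub>R real (Suc n)" for n
  have [measurable]: "\<Omega> \<in> sets borel" "\<Union> (cells M) \<in> sets borel" using cells_measurable by auto
  have \<psi>w_int: "integrable lborel (\<lambda>x. \<psi> x * sstep w (x + a))" for a
	by (rule integrable_times_bounded[OF psi_integrable _ sstep_norm_le[of w, unfolded real_norm_def]]) measurable
  define Tn where "Tn n = real (Suc n) * (LBINT x. \<psi> x * (sstep w (x + v n) - sstep w x))" for n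
  have Tlim: "Tn ----> - (LBINT x. sstep w x * d\<psi> x)"
  proof -
	have eq: "Tn n = - (LBINT x. sstep w x * (real (Suc n) * (\<psi> x - \<psi> (x - v n))))" for n
	proof -
	  have i0: "integrable lborel (\<lambda>x. \<psi> x * sstep w x)" using \<psi>w_int[of 0] by simp
	  have "integrable lborel (\<lambda>x. \<psi> (- v n + x) * sstep w (- v n + x + v n))"
		using \<psi>w_int[of "v n"] by (rule integrable_lborel_translate)
	  hence i1: "integrable lborel (\<lambda>x. sstep w x * \<psi> (x - v n))" by (simp add: mult.commute algebra_simps)
	  have "(LBINT x. \<psi> x * sstep w (x + v n)) = (LBINT x. \<psi> (- v n + x) * sstep w (- v n + x + v n))"
		by (rule integral_lborel_translate[symmetric]) measurable
	  also have "... = (LBINT x. sstep w x * \<psi> (x - v n))" by (simp add: mult.commute)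
	  finally have "(LBINT x. \<psi> x * (sstep w (x + v n) - sstep w x))
		= (LBINT x. sstep w x * \<psi> (x - v n)) - (LBINT x. \<psi> x * sstep w x)"
		using \<psi>w_int[of "v n"] i0 by (simp add: right_diff_distrib)
	  also have "... = (LBINT x. - (sstep w x * (\<psi> x - \<psi> (x - v n))))"
		using i0 i1 by (subst integral_diff[symmetric]) (auto simp: algebra_simps)
	  finally show ?thesis unfolding Tn_def by (simp add: mult.left_commute)
	qed
	have "(\<lambda>n. (LBINT x. sstep w x * (real (Suc n) * (\<psi> x - \<psi> (x - v n))))) ----> (LBINT x. sstep w x * d\<psi> x)"
	proof (rule integral_dominated_convergence[where w = "\<lambda>x. norm (sstep w x) * B"])
	  have lim: "(\<lambda>n. real (Suc n) * (\<psi> x - \<psi> (x - v n))) ----> d\<psi> x" for x using quotient_limit[of x] by (simp add: v_def)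
	  show "(\<lambda>x. sstep w x * d\<psi> x) \<in> borel_measurable lborel" by measurable
	  show "integrable lborel (\<lambda>x. norm (sstep w x) * B)" using integral_sstep(1)[of w] by (intro integrable_mult_left integrable_norm)
	  show "AE x in lborel. (\<lambda>n. sstep w x * (real (Suc n) * (\<psi> x - \<psi> (x - v n)))) ----> sstep w x * d\<psi> x"
		using lim by (intro AE_I2 tendsto_mult tendsto_const)
	  show "AE x in lborel. norm (sstep w x * (real (Suc n) * (\<psi> x - \<psi> (x - v n)))) \<le> norm (sstep w x) * B" for n
		unfolding norm_mult[of "sstep w _"] v_def by (intro AE_I2 mult_left_mono) (simp_all only: real_norm_def quotient_bound abs_ge_zero)
	qed measurable
	thus ?thesis unfolding eq by (rule tendsto_minus)
  qed
  define X where "X n K L = {x\<in>K. x + v n \<in> L}" for n K L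
  have X: "X n K L \<in> sets borel" "X n K L \<in> lmeasurable" if "K \<in> cells M" "L \<in> cells M" for n K L
  proof -
	have "open (K \<inter> (\<lambda>x. x + v n) -` L)" using cell(2) that by (intro open_Int open_vimage continuous_intros) auto
	moreover have "X n K L = K \<inter> (\<lambda>x. x + v n) -` L" by (auto simp: X_def)
	ultimately show "X n K L \<in> sets borel" "X n K L \<in> lmeasurable"
	  using cell(6)[OF that(1)] by (auto intro: lmeasurable_open bounded_subset)
  qed
  have near: "abs ((LBINT x. indicator S x * \<psi> x) - vol S * \<psi> (center M K)) \<le> B * ?h * vol S"
	if S: "S \<in> sets borel" "S \<in> lmeasurable" "S \<subseteq> K" and K: "K \<in> cells M" for S K
  proof -
	have ms: "measure lborel S = vol S" using S(1) by simp
	have fin: "emeasure lborel S < \<infinity>" using S(1,3) cell(6)[OF K] emeasure_bounded_finite bounded_subset by blast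
	have iS: "integrable lborel (\<lambda>x. indicator S x :: real)" using S(1) fin by (intro integrable_real_indicator) auto
	have i\<psi>: "integrable lborel (\<lambda>x. indicator S x * \<psi> x)" using integrable_mult_indicator[of S lborel \<psi>] S(1) psi_integrable by simp
	have "(LBINT x. indicator S x * \<psi> x) - vol S * \<psi> (center M K)
	  = (LBINT x. indicator S x * \<psi> x - indicator S x * \<psi> (center M K))" using iS i\<psi> S(1) ms by simp
	also have "norm ... \<le> (LBINT x. B * ?h * indicator S x)"
	proof (rule integral_norm_bound_integral)
	  show "integrable lborel (\<lambda>x. indicator S x * \<psi> x - indicator S x * \<psi> (center M K))"
		using iS i\<psi> by (intro integrable_diff integrable_mult_left)
	  show "integrable lborel (\<lambda>x. B * ?h * indicator S x)" using iS by (intro integrable_mult_right)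
	  fix x
	  show "norm (indicator S x * \<psi> x - indicator S x * \<psi> (center M K)) \<le> B * ?h * indicator S x"
	  proof (cases "x \<in> S")
		case True
		have "abs (\<psi> x - \<psi> (center M K)) \<le> B * dist x (center M K)" by (rule lip)
		also have "... \<le> B * ?h" using dist_center_le[OF K] True S(3) B by (intro mult_left_mono) auto
		finally show ?thesis using True by simp
	  qed simp
	qed
	also have "... = B * ?h * vol S" using S(1) ms by simp
	finally show ?thesis by simp
  qed
  let ?\<psi> = "\<lambda>K. \<psi> (center M K)"
  let ?c = "\<lambda>n K L. real (Suc n) * vol (X n K L)"
  define Rn where "Rn n = (\<Sigma> K L. ?c n K L * (w L - w K) * ?\<psi> K)" for n
  define En where "En n = (\<Sigma> K L. ?c n K L * abs (w L - w K) * (B * ?h))" for n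
  define S1 where "S1 = (\<Sigma> K L. area K L * max 0 (e \<bullet> normal K L) * (w L - w K) * ?\<psi> K)"
  have clim: "(\<lambda>n. ?c n K L * D) ----> area K L * max 0 (e \<bullet> normal K L) * D"
	if "K \<in> cells M" "L \<in> cells M" "K = L ==> D = 0" for K L D
  proof (cases "K = L")
	case False
	thus ?thesis using that unfolding X_def v_def by (intro tendsto_mult_right area_crossing_limit)
  qed (use that in simp)
  have Rlim: "Rn ----> S1" unfolding Rn_def[abs_def] S1_def by (intro tendsto_sum tendsto_mult_right clim) auto
  have Elim: "En ----> (\<Sigma> K L. area K L * max 0 (e \<bullet> normal K L) * abs (w L - w K) * (B * ?h))"
	unfolding En_def[abs_def] by (intro tendsto_sum tendsto_mult_right clim) auto
  \<comment> \<open>For steps shorter than d the translates of the support stay in \<Omega>, so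
    almost every point that matters lies in a cell together with its translate.\<close>
  obtain d where d: "d > 0" "\<And>x y. x \<in> C ==> dist x y < d ==> y \<in> \<Omega>"
  proof -
	obtain d where "d > 0" "(\<Union>x\<in>C. ball x d) \<subseteq> \<Omega>"
	  using compact_subset_open_imp_ball_epsilon_subset[OF C(1) open_domain C(2)] by blast
	thus thesis by (intro that[of d]) (auto simp: subset_iff)
  qed
  have Tn_Rn: "abs (Tn n - Rn n) \<le> En n" if n: "inverse (real (Suc n)) < d" for n
  proof -
	have iX: "integrable lborel (\<lambda>x. indicator (X n K L) x * \<psi> x)" if "K \<in> cells M" "L \<in> cells M" for K L
	  using integrable_mult_indicator[of "X n K L" lborel \<psi>] X(1)[OF that] psi_integrable by simp
	have "(LBINT x. \<psi> x * (sstep w (x + v n) - sstep w x)) = (LBINT x. (\<Sigma> K L. (indicator (X n K L) x * \<psi> x) * (w L - w K)))"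
	proof (rule integral_cong_AE)
	  show "(\<lambda>x. \<psi> x * (sstep w (x + v n) - sstep w x)) \<in> borel_measurable lborel" by measurable
	  show "(\<lambda>x. \<Sigma> K L. (indicator (X n K L) x * \<psi> x) * (w L - w K)) \<in> borel_measurable lborel"
		using iX by (intro borel_measurable_sum borel_measurable_times borel_measurable_const borel_measurable_integrable) auto
	  show "AE x in lborel. \<psi> x * (sstep w (x + v n) - sstep w x) = (\<Sigma> K L. (indicator (X n K L) x * \<psi> x) * (w L - w K))"
		using AE_in_cells AE_in_cells_translate[of "v n"]
	  proof eventually_elim
		case (elim x)
		show ?case
		proof (cases "x \<in> C")
		  case True
		  have "norm (v n) = inverse (real (Suc n)) * norm e" by (simp add: v_def)
		  also have "... \<le> inverse (real (Suc n)) * 1" using e by (intro mult_left_mono) auto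
		  finally have "norm (v n) \<le> inverse (real (Suc n))" by simp
		  hence "dist x (x + v n) < d" using n by (simp add: dist_norm)
		  hence "x + v n \<in> \<Omega>" using d(2)[OF True] by blast
		  with elim True C(2) obtain K L where K: "K \<in> cells M" "x \<in> K" and L: "L \<in> cells M" "x + v n \<in> L" by blast
		  have "(\<Sigma> K' L'. (indicator (X n K' L') x * \<psi> x) * (w L' - w K'))
			= (\<Sigma> K' L'. if K' = K then if L' = L then \<psi> x * (w L - w K) else 0 else 0)"
		  proof (intro sum.cong refl)
			fix K' L' assume K': "K' \<in> cells M" and L': "L' \<in> cells M"
			have "x \<in> X n K' L' \<longleftrightarrow> K' = K \<and> L' = L"
			  using cells_disjoint[OF K' K(1)] cells_disjoint[OF L' L(1)] K L by (auto simp: X_def)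
			thus "(indicator (X n K' L') x * \<psi> x) * (w L' - w K') = (if K' = K then if L' = L then \<psi> x * (w L - w K) else 0 else 0)"
			  by (simp add: indicator_def)
		  qed
		  also have "... = (\<Sigma> K'. if K' = K then \<psi> x * (w L - w K) else 0)"
			using finite_cells L(1) by (intro sum.cong refl) (simp add: sum.delta)
		  also have "... = \<psi> x * (w L - w K)" using finite_cells K(1) by (simp add: sum.delta)
		  finally show ?thesis by (simp add: sstep_in[OF K] sstep_in[OF L])
		qed (simp add: C(3))
	  qed
	qed
	also have "... = (\<Sigma> K L. (LBINT x. indicator (X n K L) x * \<psi> x) * (w L - w K))"
	  using iX by (simp add: integral_sum integrable_sum)
	finally have "Tn n - Rn n = (\<Sigma> K L. real (Suc n) *
	  ((LBINT x. indicator (X n K L) x * \<psi> x) - vol (X n K L) * ?\<psi> K) * (w L - w K))"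
	  unfolding Tn_def Rn_def by (simp add: sum_distrib_left sum_subtractf[symmetric] algebra_simps)
	also have "abs (...) \<le> En n" unfolding En_def
	proof (rule double_sum_bound)
	  fix K L assume KL: "K \<in> cells M" "L \<in> cells M"
	  let ?z = "(LBINT x. indicator (X n K L) x * \<psi> x) - vol (X n K L) * ?\<psi> K"
	  have "abs ?z \<le> B * ?h * vol (X n K L)" by (rule near[OF X[OF KL] _ KL(1)]) (auto simp: X_def)
	  hence "real (Suc n) * abs ?z * abs (w L - w K) \<le> real (Suc n) * (B * ?h * vol (X n K L)) * abs (w L - w K)"
		by (intro mult_right_mono mult_left_mono) auto
	  thus "abs (real (Suc n) * ?z * (w L - w K)) \<le> ?c n K L * abs (w L - w K) * (B * ?h)" by (simp add: abs_mult mult_ac)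
	qed
	finally show ?thesis .
  qed
  have first: "abs (- (LBINT x. sstep w x * d\<psi> x) - S1) \<le> B * ?h * jump_sum w"
  proof -
	have "\<forall>\<^sub>F n in sequentially. inverse (real (Suc n)) < d" using LIMSEQ_inverse_real_of_nat d(1) by (rule order_tendstoD)
	hence "\<forall>\<^sub>F n in sequentially. abs (Tn n - Rn n) \<le> En n" by eventually_elim (rule Tn_Rn)
	from tendsto_le[OF _ Elim tendsto_rabs[OF tendsto_diff[OF Tlim Rlim]] this]
	have "abs (- (LBINT x. sstep w x * d\<psi> x) - S1)
	  \<le> (\<Sigma> K L. area K L * max 0 (e \<bullet> normal K L) * abs (w L - w K) * (B * ?h))" by simp
	also have "... \<le> (\<Sigma> K L. B * ?h * (area K L * abs (w L - w K)))"
	proof (intro sum_mono)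
	  fix K L
	  show "area K L * max 0 (e \<bullet> normal K L) * abs (w L - w K) * (B * ?h) \<le> B * ?h * (area K L * abs (w L - w K))"
	  proof (cases "adj K L")
		case True
		have "abs (e \<bullet> normal K L) \<le> 1" using Cauchy_Schwarz_ineq2[of e "normal K L"] e norm_normal[OF True] by simp
		hence "max 0 (e \<bullet> normal K L) * (B * ?h * (area K L * abs (w L - w K))) \<le> 1 * (B * ?h * (area K L * abs (w L - w K)))"
		  using B mesh_size_nonneg area_nonneg by (intro mult_right_mono mult_nonneg_nonneg) auto
		thus ?thesis by (simp add: mult_ac)
	  qed (simp add: area_eq_0)
	qed
	also have "... = B * ?h * jump_sum w" unfolding jump_sum_def by (simp add: sum_distrib_left)
	finally show ?thesis .
  qed
  define S2 where "S2 = (\<Sigma> K. vol K * (grad w K \<bullet> e) * ?\<psi> K)"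
  have second: "abs ((LBINT x. (sstep (grad w) x \<bullet> e) * \<psi> x) - S2) \<le> B * ?h * jump_sum w"
  proof -
	have iK: "integrable lborel (\<lambda>x. indicator K x * \<psi> x)" if "K \<in> cells M" for K
	  using integrable_mult_indicator[of K lborel \<psi>] cell_borel[OF that] psi_integrable by simp
	have "(LBINT x. (sstep (grad w) x \<bullet> e) * \<psi> x) = (LBINT x. (\<Sigma> K. (grad w K \<bullet> e) * (indicator K x * \<psi> x)))"
	  unfolding sstep_def by (simp add: inner_sum_left sum_distrib_right) (simp add: mult_ac)
	also have "... = (\<Sigma> K. (grad w K \<bullet> e) * (LBINT x. indicator K x * \<psi> x))" using iK by (simp add: integral_sum)
	finally have "(LBINT x. (sstep (grad w) x \<bullet> e) * \<psi> x) - S2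
	  = (\<Sigma> K. (grad w K \<bullet> e) * ((LBINT x. indicator K x * \<psi> x) - vol K * ?\<psi> K))"
	  unfolding S2_def by (simp add: sum_subtractf[symmetric] algebra_simps)
	also have "abs (...) \<le> (\<Sigma> K. B * ?h * (\<Sigma> L. area K L * abs (w L - w K)))"
	proof (rule order_trans[OF sum_abs], rule sum_mono)
	  fix K assume K: "K \<in> cells M"
	  let ?z = "(LBINT x. indicator K x * \<psi> x) - vol K * ?\<psi> K"
	  have g: "abs (grad w K \<bullet> e) \<le> norm (grad w K)"
		using Cauchy_Schwarz_ineq2[of "grad w K" e] mult_left_mono[OF e norm_ge_zero[of "grad w K"]] by simp
	  have "abs ?z \<le> B * ?h * vol K" using near[OF _ cell_lmeasurable[OF K] order_refl K] cell_borel[OF K] by simp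
	  with g have "abs (grad w K \<bullet> e) * abs ?z \<le> norm (grad w K) * (B * ?h * vol K)" by (intro mult_mono) auto
	  also have "... = B * ?h * (vol K * norm (grad w K))" by simp
	  also have "... \<le> B * ?h * (\<Sigma> L. area K L * abs (w L - w K))"
		using norm_grad_le_area[OF K] B mesh_size_nonneg by (intro mult_left_mono) auto
	  finally show "abs ((grad w K \<bullet> e) * ?z) \<le> B * ?h * (\<Sigma> L. area K L * abs (w L - w K))" by (simp add: abs_mult)
	qed
	also have "... = B * ?h * jump_sum w" unfolding jump_sum_def by (simp add: sum_distrib_left)
	finally show ?thesis .
  qed
  have "abs (S1 - S2) \<le> 2 * B * ?h * jump_sum w" unfolding S1_def S2_def by (rule crossing_vs_grad[OF lip B e])
  with first second show ?thesis by linarith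
qed

end

text \<open>The components of p sum to 1 and the increments D to 0, so p_j D_i - p_i D_j sums over j
  to D_i and the \<open>astar\<close> terms can be absorbed. What remains are differences of
  logarithmic means and cell values, of first order in the jumps, times a further jump.\<close>

lemma cross_flux_consistent:
  fixes A :: "real ^ 'n ^ 'n"
  assumes p: "p \<in> unit_simplex" and q: "q \<in> unit_simplex"
  shows "abs (cross_flux A astar p q i - (SU j. A $ i $ j * (p $ j * (q $ i - p $ i) - p $ i * (q $ j - p $ j))))
	\<le> flux_const A astar * (SU j. (q $ j - p $ j)^2)"
proof -
  let ?D = "\<lambda>j. q $ j - p $ j" and ?w = "\<lambda>j. log_mean (p $ j) (q $ j)"
  let ?S = "SU j. (?D j)^2"
  have "(SU j. p $ j * ?D i - p $ i * ?D j) = ?D i"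
	using simplex_sum[OF p] simplex_sum[OF q] by (simp add: sum_subtractf flip: sum_distrib_left sum_distrib_right)
  hence "astar * ?D i = (SU j. astar * (p $ j * ?D i - p $ i * ?D j))" by (simp flip: sum_distrib_left)
  hence eq: "cross_flux A astar p q i - (SU j. A $ i $ j * (p $ j * ?D i - p $ i * ?D j))
	= (SU j. (A $ i $ j - astar) * ((?w j - p $ j) * ?D i - (?w i - p $ i) * ?D j))"
  proof -
	assume "astar * ?D i = (SU j. astar * (p $ j * ?D i - p $ i * ?D j))"
	hence "cross_flux A astar p q i - (SU j. A $ i $ j * (p $ j * ?D i - p $ i * ?D j))
	  = (SU j. astar * (p $ j * ?D i - p $ i * ?D j) + (A $ i $ j - astar) * (?w j * ?D i - ?w i * ?D j)
		  - A $ i $ j * (p $ j * ?D i - p $ i * ?D j))" by (simp only: cross_flux_def sum.distrib sum_subtractf)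
	thus ?thesis by (simp add: algebra_simps)
  qed
  have "abs (cross_flux A astar p q i - (SU j. A $ i $ j * (p $ j * ?D i - p $ i * ?D j))) \<le> (SU j. abs (A $ i $ j - astar) * (2 * ?S))"
	unfolding eq
  proof (rule order_trans[OF sum_abs], rule sum_mono)
	fix j
	have w: "abs (?w k - p $ k) \<le> abs (?D k)" for k using log_mean_diff[of "p $ k" "q $ k"] simplex_nonneg[OF p] simplex_nonneg[OF q] by simp
	have sq: "(?D k)^2 \<le> ?S" for k by (rule member_le_sum) auto
	have "abs ((?w j - p $ j) * ?D i - (?w i - p $ i) * ?D j) \<le> abs (?D j) * abs (?D i) + abs (?D i) * abs (?D j)"
	  by (rule order_trans[OF abs_triangle_ineq4], unfold abs_mult, intro add_mono mult_right_mono w) auto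
	also have "... \<le> (?D i)^2 + (?D j)^2" using sum_squares_bound[of "abs (?D i)" "abs (?D j)"] by (simp add: mult_ac)
	also have "... \<le> 2 * ?S" using sq[of i] sq[of j] by simp
	finally show "abs ((A $ i $ j - astar) * ((?w j - p $ j) * ?D i - (?w i - p $ i) * ?D j)) \<le> abs (A $ i $ j - astar) * (2 * ?S)"
	  unfolding abs_mult by (rule mult_left_mono) simp
  qed
  moreover have "(SU j. abs (A $ i $ j - astar) * (2 * ?S)) = (2 * (SU j. abs (A $ i $ j - astar))) * ?S" by (simp add: sum_distrib_right sum_distrib_left mult_ac)
  moreover have "(2 * (SU j. abs (A $ i $ j - astar))) * ?S \<le> flux_const A astar * ?S"
  proof (rule mult_right_mono)
	have "(SU j. abs (A $ i $ j - astar)) \<le> (SU i j. abs (A $ i $ j - astar))"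
	  by (rule member_le_sum[where f = "\<lambda>i. SU j. abs (A $ i $ j - astar)"]) (auto intro: sum_nonneg)
	thus "2 * (SU j. abs (A $ i $ j - astar)) \<le> flux_const A astar" unfolding flux_const_def by simp
  qed (auto intro: sum_nonneg)
  ultimately show ?thesis by linarith
qed

text \<open>The bounds are stated on [0, T] times a ball, which is later chosen to contain \<Omega>:
  Lipschitz and Taylor estimates are taken along segments, and those joining two centres may leave
  \<Omega>.\<close>

locale test_bounds =
  fixes T R B :: real and \<phi> \<phi>t :: "real \<times> 'a::euclidean_space => real" and g :: "real \<times> 'a => 'a"
  assumes B: "0 \<le> B"
	and test_measurable: "\<phi> \<in> borel_measurable borel" "\<phi>t \<in> borel_measurable borel" "g \<in> borel_measurable borel"
	and lip: "\<And>z z'. z \<in> {0..T} \<times> cball 0 R ==> z' \<in> {0..T} \<times> cball 0 R ==> abs (\<phi> z - \<phi> z') \<le> B * dist z z'"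
	and lip_t: "\<And>z z'. z \<in> {0..T} \<times> cball 0 R ==> z' \<in> {0..T} \<times> cball 0 R ==> abs (\<phi>t z - \<phi>t z') \<le> B * dist z z'"
	and lip_g: "\<And>z z'. z \<in> {0..T} \<times> cball 0 R ==> z' \<in> {0..T} \<times> cball 0 R ==> norm (g z - g z') \<le> B * dist z z'"
	and g_bound: "\<And>z. z \<in> {0..T} \<times> cball 0 R ==> norm (g z) \<le> B"
	and deriv_t: "\<And>s x. s \<in> {0..T} ==> x \<in> cball 0 R ==> ((\<lambda>s. \<phi> (s, x)) has_real_derivative \<phi>t (s, x)) (at s)"
	and taylor: "\<And>s x y. s \<in> {0..T} ==> x \<in> cball 0 R ==> y \<in> cball 0 R ==>
	  abs (\<phi> (s, y) - \<phi> (s, x) - g (s, x) \<bullet> (y - x)) \<le> B * (dist x y)^2"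

section \<open>Residual of the approximate solutions in the weak equation\<close>

context fv_solution
begin

definition in_cell :: "nat => 'a set => real => 'a => bool" where
  "in_cell n K s x \<longleftrightarrow> n \<in> {1..NT} \<and> K \<in> cells M \<and> t (n - 1) < s \<and> s \<le> t n \<and> x \<in> K"

lemma in_cellD: assumes "in_cell n K s x"
  shows "n \<in> {1..NT}" "K \<in> cells M" "t (n - 1) < s" "s \<le> t n" "x \<in> K" using assms by (auto simp: in_cell_def)

lemma pw_at: assumes "in_cell n K s x" shows "pw W (s, x) = W n K"
  using idx_eqI[OF in_cellD(1,3,4)[OF assms]] pw_in[of s W x] sstep_in[OF in_cellD(2,5)[OF assms]] by simp

lemma pw_nowhere: assumes "\<And>n K. \<not> in_cell n K s x" shows "pw W (s, x) = 0"
proof -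
  have "indicator ({t (n - 1)<..t n} \<times> K) (s, x) = (0 :: real)" if "n \<in> {1..NT}" "K \<in> cells M" for n K
	using assms[of n K] that by (auto simp: indicator_def in_cell_def)
  thus ?thesis unfolding pw_def by simp
qed

lemma pw_comp: assumes "f 0 = 0" shows "f (pw W z) = pw (\<lambda>n K. f (W n K)) z"
proof (cases z)
  case (Pair s x)
  show ?thesis
  proof (cases "\<exists>n K. in_cell n K s x")
	case True
	then obtain n K where nK: "in_cell n K s x" by blast
	show ?thesis unfolding Pair by (simp only: pw_at[OF nK])
  next
	case False
	hence "pw W (s, x) = 0" "pw (\<lambda>n K. f (W n K)) (s, x) = 0" by (auto intro!: pw_nowhere)
	thus ?thesis unfolding Pair using assms by simp
  qed
qed

lemma pw_component_measurable [measurable]: "(\<lambda>z. pw (V :: nat => 'a set => real ^ 'n) z $ i) \<in> borel_measurable borel"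
  by (rule measurable_compose[OF pw_measurable]) (intro borel_measurable_continuous_onI continuous_intros)

lemma integral_pw:
  fixes W :: "nat => 'a set => 'c::euclidean_space"
  shows "(LBINT z. pw W z) = (\<Sum>n=1..NT. dt n *R (\<Sigma> K. m K *R W n K))"
proof -
  have "integrable (lborel \<Otimes>\<^sub>M lborel) (pw W)" unfolding lborel_prod by (rule integrable_pw)
  hence "(\<integral>z. pw W z \<partial>(lborel \<Otimes>\<^sub>M lborel)) = (LBINT s. (LBINT x. pw W (s, x)))"
	by (rule lborel_pair.integral_fst'[symmetric])
  also have "(\<lambda>s. (LBINT x. pw W (s, x))) = tstep (\<lambda>n. \<Sigma> K. m K *R W n K)"
  proof
	fix s
	show "(LBINT x. pw W (s, x)) = tstep (\<lambda>n. \<Sigma> K. m K *R W n K) s"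
	proof (cases "0 < s \<and> s \<le> T")
	  case True
	  thus ?thesis by (simp add: pw_in integral_sstep(2) tstep_in)
	next
	  case False
	  thus ?thesis by (simp only: pw_out[OF False] tstep_out[OF False]) simp
	qed
  qed
  finally show ?thesis unfolding lborel_prod integral_tstep(2) .
qed

lemma integral_pw_compare:
  fixes F :: "real \<times> 'a => real"
  assumes [measurable]: "F \<in> borel_measurable borel"
	and close: "\<And>n K s x. in_cell n K s x ==> abs (F (s, x) - W n K) \<le> E n K"
	and zero: "\<And>s x. (\<And>n K. \<not> in_cell n K s x) ==> F (s, x) = 0"
  shows "abs ((LBINT z. F z) - (\<Sum>n=1..NT. dt n * (\<Sigma> K. m K * W n K))) \<le> (\<Sum>n=1..NT. dt n * (\<Sigma> K. m K * E n K))"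
proof -
  have pt: "abs (F z - pw W z) \<le> pw E z" for z
  proof (cases z)
	case (Pair s x)
	show ?thesis
	proof (cases "\<exists>n K. in_cell n K s x")
	  case True
	  then obtain n K where nK: "in_cell n K s x" by blast
	  from close[OF nK] show ?thesis unfolding Pair pw_at[OF nK] .
	next
	  case False
	  hence "F (s, x) = 0" "pw W (s, x) = 0" "pw E (s, x) = 0" by (auto intro!: zero pw_nowhere)
	  thus ?thesis unfolding Pair by simp
	qed
  qed
  have int: "integrable lborel (pw W)" "integrable lborel (pw E)" by (rule integrable_pw)+
  have d: "integrable lborel (\<lambda>z. F z - pw W z)" by (rule integrable_bound[OF int(2)]) (auto intro!: AE_I2 order_trans[OF pt])
  from integrable_add[OF d int(1)] have "integrable lborel F" by simp
  moreover have "abs (LBINT z. F z - pw W z) \<le> (LBINT z. pw E z)" using integral_norm_bound_integral[OF d int(2)] pt by simp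
  ultimately show ?thesis using int(1) by (simp add: integral_pw)
qed

definition G :: "nat => 'n => 'a set => 'a" where "G n i = grad (\<lambda>K. V n K $ i)"

definition Fv :: "nat => 'n => 'a set => 'a" where
  "Fv n i K = (SU j. A $ i $ j *R (V n K $ j *R G n i K - V n K $ i *R G n j K))"

definition jumps :: "nat => real" where "jumps n = (SU i. jump_sum (\<lambda>K. V n K $ i))"

definition A_sum :: real where "A_sum = (SU i j. A $ i $ j)"

lemma jump_le_jumps: "jump_sum (\<lambda>K. V n K $ i) \<le> jumps n"
  unfolding jumps_def by (rule member_le_sum[where f = "\<lambda>i. jump_sum (\<lambda>K. V n K $ i)"]) (auto simp: jump_sum_nonneg)

lemma jumps_nonneg: "0 \<le> jumps n" unfolding jumps_def by (intro sum_nonneg jump_sum_nonneg)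

lemma sum_dt_jumps: "(\<Sum>n=1..NT. dt n * jumps n) \<le> space_const"
proof -
  have "(\<Sum>n=1..NT. dt n * jumps n) \<le> (\<Sum>n=1..NT. dt n * (CARD('n) * (DIM('a) * vol \<Omega> + energy n / 2)))"
  proof (intro sum_mono mult_left_mono)
	fix n
	have "jumps n \<le> (\<Sum>i\<in>(UNIV :: 'n set). DIM('a) * vol \<Omega> + energy n / 2)"
	  unfolding jumps_def jump_sum_def by (intro sum_mono sum_area_jump)
	thus "jumps n \<le> CARD('n) * (DIM('a) * vol \<Omega> + energy n / 2)" by simp
  qed (use dt_pos in \<open>auto intro: less_imp_le\<close>)
  also have "... = CARD('n) * (DIM('a) * vol \<Omega> * (\<Sum>n=1..NT. dt n) + (\<Sum>n=1..NT. dt n * energy n) / 2)"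
	by (simp add: algebra_simps sum.distrib sum_distrib_left sum_divide_distrib)
  also have "... \<le> space_const" using divide_right_mono[OF energy_estimate, of 2] unfolding sum_dt space_const_def
	by (intro mult_left_mono add_left_mono) auto
  finally show ?thesis .
qed

lemma A_row: "(SU j. A $ i $ j) \<le> A_sum"
  unfolding A_sum_def by (rule member_le_sum[where f = "\<lambda>i. SU j. A $ i $ j"]) (auto intro: sum_nonneg A_nonneg)

lemma sum_norm_Fv:
  assumes n: "n \<in> {1..NT}"
  shows "(\<Sigma> K. m K * norm (Fv n i K)) \<le> 2 * A_sum * jumps n"
proof -
  have g: "(\<Sigma> K. m K * norm (G n j K)) \<le> jumps n" for j
  proof -
	have "(\<Sigma> K. m K * norm (G n j K)) \<le> jump_sum (\<lambda>K. V n K $ j)"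
	  unfolding G_def jump_sum_def by (intro sum_mono norm_grad_le_area)
	thus ?thesis using jump_le_jumps[of n j] by simp
  qed
  have "(\<Sigma> K. m K * norm (Fv n i K)) \<le> (\<Sigma> K. SU j. A $ i $ j * (m K * norm (G n i K) + m K * norm (G n j K)))"
  proof (rule sum_mono)
	fix K assume K: "K \<in> cells M"
	have v: "abs (V n K $ j) \<le> 1" for j using simplex_nonneg[OF V_simplex_pos[OF n K]] simplex_le_1[OF V_simplex_pos[OF n K]] by simp
	have "norm (Fv n i K) \<le> (SU j. A $ i $ j * (norm (G n i K) + norm (G n j K)))" unfolding Fv_def
	proof (rule order_trans[OF norm_sum], rule sum_mono)
	  fix j
	  have "norm (V n K $ j *R G n i K - V n K $ i *R G n j K) \<le> abs (V n K $ j) * norm (G n i K) + abs (V n K $ i) * norm (G n j K)"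
		using norm_triangle_ineq4[of "V n K $ j *R G n i K" "V n K $ i *R G n j K"] by simp
	  also have "... \<le> 1 * norm (G n i K) + 1 * norm (G n j K)" by (intro add_mono mult_right_mono v) auto
	  finally show "norm (A $ i $ j *R (V n K $ j *R G n i K - V n K $ i *R G n j K)) \<le> A $ i $ j * (norm (G n i K) + norm (G n j K))"
		using A_nonneg[of i j] by (simp add: mult_left_mono)
	qed
	from mult_left_mono[OF this, of "m K"]
	show "m K * norm (Fv n i K) \<le> (SU j. A $ i $ j * (m K * norm (G n i K) + m K * norm (G n j K)))"
	  by (simp add: sum_distrib_left algebra_simps)
  qed
  also have "... = (SU j. A $ i $ j * ((\<Sigma> K. m K * norm (G n i K)) + (\<Sigma> K. m K * norm (G n j K))))"
	by (subst sum.swap) (simp add: sum_distrib_left sum.distrib distrib_left)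
  also have "... \<le> (SU j. A $ i $ j * (jumps n + jumps n))" by (intro sum_mono mult_left_mono add_mono g A_nonneg)
  also have "... = (SU j. A $ i $ j) * (2 * jumps n)" by (simp add: sum_distrib_right)
  also have "... \<le> A_sum * (2 * jumps n)" using jumps_nonneg by (intro mult_right_mono A_row) auto
  finally show ?thesis by (simp add: mult_ac)
qed

lemma abel_summation:
  fixes a b :: "nat => real"
  shows "(\<Sum>n\<in>{1..N}. a n * (b n - b (n - 1))) = a N * b N - a 0 * b 0 - (\<Sum>n\<in>{1..N}. (a n - a (n - 1)) * b (n - 1))"
  by (induction N) (auto simp: algebra_simps)

text \<open>The terms stem, in this order, from the time derivative, the initial values, the
  evaluation of the test gradient at cell centres and times t (n - 1), and the two errors of
  \<open>flux_consistency\<close>.\<close>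

definition residual_const :: real where
  "residual_const = T * vol \<Omega> + vol \<Omega> + 2 * A_sum * space_const
	 + 2 * flux_const A astar * (2 * CARD('n) * vol \<Omega> / c) + 2 * flux_const A astar * space_const"

text \<open>The first error replaces the fluxes built from cell values by those of the scheme and is
  quadratic in the jumps, hence bounded by the energy. The second compares (f L - f K) over the
  distance with the normal components of \<gamma> at both centres, weighted by depth as in
  \<open>grad\<close>; by Taylor's formula it is linear in the distance, times the jumps.\<close>

lemma flux_consistency:
  assumes n: "n \<in> {1..NT}" and B: "0 \<le> B"
	and g: "\<And>K L. K \<in> cells M ==> L \<in> cells M ==> norm (\<gamma> K - \<gamma> L) \<le> B * cdist K L"
	and g1: "\<And>K. K \<in> cells M ==> norm (\<gamma> K) \<le> B"
	and f: "\<And>K L. K \<in> cells M ==> L \<in> cells M ==> abs (f L - f K - \<gamma> K \<bullet> (center M L - center M K)) \<le> B * (cdist K L)^2"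
  shows "abs ((\<Sigma> K. m K * (Fv n i K \<bullet> \<gamma> K)) - (\<Sigma> K L. tau K L * J n i K L * (f L - f K)) / 2)
	\<le> 2 * B * mesh_size M * flux_const A astar * (energy n + jumps n)"
proof -
  let ?h = "mesh_size M" and ?fc = "flux_const A astar"
  let ?th = "\<lambda>K L. depth K L / cdist K L"
  let ?a = "\<lambda>K L. area K L * ?th K L * (normal K L \<bullet> \<gamma> K)" and ?c = "2 * B * ?h * ?fc"
  let ?v = "\<lambda>K L j. V n L $ j - V n K $ j"
  let ?P = "\<lambda>K L. (SU j. A $ i $ j * (V n K $ j * ?v K L i - V n K $ i * ?v K L j))"
  let ?S = "\<lambda>K L. (SU j. ?v K L j^2)"
  have 1: "m K * (Fv n i K \<bullet> \<gamma> K) = (\<Sigma> L. ?a K L * ?P K L)" if K: "K \<in> cells M" for K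
  proof -
	have mG: "m K * (G n j K \<bullet> \<gamma> K) = (\<Sigma> L. ?a K L * ?v K L j)" for j
	proof -
	  have "m K * (G n j K \<bullet> \<gamma> K) = (m K *R grad (\<lambda>K. V n K $ j) K) \<bullet> \<gamma> K" by (simp add: G_def)
	  thus ?thesis unfolding measure_grad[OF K] by (simp add: inner_sum_left mult_ac)
	qed
	have "m K * (Fv n i K \<bullet> \<gamma> K) = (SU j. A $ i $ j * (V n K $ j * (m K * (G n i K \<bullet> \<gamma> K)) - V n K $ i * (m K * (G n j K \<bullet> \<gamma> K))))"
	  unfolding Fv_def by (simp add: inner_sum_left inner_diff_left sum_distrib_left algebra_simps)
	also have "... = (SU j. \<Sigma> L. ?a K L *
		(A $ i $ j * (V n K $ j * ?v K L i - V n K $ i * ?v K L j)))"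
	proof -
	  have "a * (x * (w * y) - z * (w * y')) = w * (a * (x * y - z * y'))" for a x w y z y' :: real by (simp add: algebra_simps)
	  thus ?thesis unfolding mG sum_distrib_left sum_subtractf[symmetric] by (simp only:)
	qed
	also have "... = (\<Sigma> L. ?a K L * ?P K L)" by (subst sum.swap) (simp only: sum_distrib_left)
	finally show ?thesis .
  qed
  let ?X = "\<lambda>K L. ?a K L * J n i K L"
  have first: "abs ((\<Sigma> K. m K * (Fv n i K \<bullet> \<gamma> K)) - (\<Sigma> K L. ?X K L)) \<le> ?c * energy n"
  proof -
	let ?Z = "\<lambda>K L. ?a K L * (?P K L - J n i K L)"
	have eq: "(\<Sigma> K. m K * (Fv n i K \<bullet> \<gamma> K)) - (\<Sigma> K L. ?X K L) = (\<Sigma> K L. ?Z K L)"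
	  using 1 by (simp add: sum_subtractf right_diff_distrib)
	have b: "abs (\<Sigma> K L. ?Z K L) \<le> (\<Sigma> K L. ?c * (tau K L * ?S K L))"
	proof (rule double_sum_bound)
	  fix K L assume KL: "K \<in> cells M" "L \<in> cells M"
	  show "abs (?Z K L) \<le> ?c * (tau K L * ?S K L)"
	  proof (cases "adj K L")
		case True
		have PJ: "abs (?P K L - J n i K L) \<le> ?fc * ?S K L"
		  using cross_flux_consistent[OF V_simplex_pos[OF n KL(1)] V_simplex_pos[OF n KL(2)], of A astar i]
		  unfolding J_def by (simp add: abs_minus_commute)
		have ng: "abs (normal K L \<bullet> \<gamma> K) \<le> B"
		  using Cauchy_Schwarz_ineq2[of "normal K L" "\<gamma> K"] norm_normal[OF True] g1[OF KL(1)] by simp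
		have "area K L * abs (?th K L) \<le> area K L * 1" using depth_ratio[OF True] area_nonneg by (intro mult_left_mono) auto
		also have "... \<le> tau K L * (2 * ?h)" using area_eq[of K L] cdist_le[OF True] tau_nonneg by (simp add: mult_left_mono)
		finally have "(area K L * abs (?th K L)) * abs (normal K L \<bullet> \<gamma> K) * abs (?P K L - J n i K L) \<le> (tau K L * (2 * ?h)) * B * (?fc * ?S K L)"
		  by (rule mult_mono[OF mult_mono[OF _ ng] PJ]) (use B tau_nonneg[of K L] mesh_size_nonneg in auto)
		thus ?thesis using area_nonneg[of K L] by (simp add: abs_mult mult_ac)
	  qed (simp add: area_eq_0 tau_eq_0)
	qed
	have c: "(\<Sigma> K L. ?c * (tau K L * ?S K L)) = ?c * energy n" unfolding energy_def by (simp add: sum_distrib_left)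
	show ?thesis unfolding eq c[symmetric] by (rule b)
  qed
  let ?Y = "\<lambda>K L. tau K L * J n i K L * (f L - f K) / 2"
  have second: "abs ((\<Sigma> K L. ?X K L) - (\<Sigma> K L. ?Y K L)) \<le> ?c * jumps n"
  proof -
	let ?W = "\<lambda>K L. (?X K L + ?X L K) / 2 - ?Y K L"
	have eq: "(\<Sigma> K L. ?X K L) - (\<Sigma> K L. ?Y K L) = (\<Sigma> K L. ?W K L)"
	  unfolding sum_double_swap[of ?X] by (simp add: sum_subtractf)
	have b: "abs (\<Sigma> K L. ?W K L) \<le> (\<Sigma> K L. ?c * (SU j. area K L * abs (?v K L j)))"
	proof (rule double_sum_bound)
	  fix K L assume KL: "K \<in> cells M" "L \<in> cells M"
	  show "abs (?W K L) \<le> ?c * (SU j. area K L * abs (?v K L j))"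
	  proof (cases "adj K L")
		case True
		let ?\<nu> = "normal K L" and ?d = "cdist K L" and ?D = "SU j. abs (?v K L j)"
		define \<theta> where "\<theta> = ?th K L"
		have d: "?d > 0" by (rule cdist_pos[OF True])
		have \<theta>: "0 \<le> \<theta>" "\<theta> \<le> 1" unfolding \<theta>_def using depth_ratio[OF True] by auto
		have dL: "depth L K / ?d = 1 - \<theta>" using depth_add[OF True] d by (simp add: field_simps \<theta>_def)
		have J: "abs (J n i K L) \<le> ?fc * ?D"
		  unfolding J_def by (rule cross_flux_bound[OF V_simplex_pos[OF n KL(1)] V_simplex_pos[OF n KL(2)]])
		define q where "q = (\<theta> * (?\<nu> \<bullet> \<gamma> K) + (1 - \<theta>) * (?\<nu> \<bullet> \<gamma> L)) - (f L - f K) / ?d"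
		\<comment> \<open>\<open>J\<close> and the normal both change sign when K and L are exchanged, so
		  the two contributions of a face add up with the weights \<theta> and 1 - \<theta>.\<close>
		have eq0: "?W K L = area K L * J n i K L * q / 2"
		  unfolding area_sym[of L K] cdist_sym[of L K] normal_sym[of L K] dL inner_minus_left J_antisym[of n i L K] \<theta>_def[symmetric] q_def tau_def
		  using True by (simp add: algebra_simps diff_divide_distrib add_divide_distrib)
		have eq: "abs (?W K L) = area K L * (abs (J n i K L) * abs q) / 2" unfolding eq0 using area_nonneg[of K L] by (simp add: abs_mult)
		have q: "abs q \<le> 2 * B * ?d"
		proof -
		  have c1: "center M L - center M K = ?d *R ?\<nu>" by (rule center_diff[OF True])
		  have "abs (f L - f K - ?d * (?\<nu> \<bullet> \<gamma> K)) \<le> B * ?d * ?d"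
			using f[OF KL] unfolding c1 by (simp add: inner_commute power2_eq_square mult_ac)
		  hence "abs (f L - f K - ?d * (?\<nu> \<bullet> \<gamma> K)) / ?d \<le> B * ?d" using d by (simp add: divide_le_eq)
		  moreover have "(f L - f K) / ?d - ?\<nu> \<bullet> \<gamma> K = (f L - f K - ?d * (?\<nu> \<bullet> \<gamma> K)) / ?d"
			using d by (simp add: field_simps)
		  ultimately have t1: "abs ((f L - f K) / ?d - ?\<nu> \<bullet> \<gamma> K) \<le> B * ?d" using d by (simp add: abs_divide)
		  have "abs (?\<nu> \<bullet> (\<gamma> L - \<gamma> K)) \<le> norm (\<gamma> L - \<gamma> K)"
			using Cauchy_Schwarz_ineq2[of ?\<nu> "\<gamma> L - \<gamma> K"] norm_normal[OF True] by simp
		  also have "... \<le> B * ?d" using g[OF KL] by (simp add: norm_minus_commute)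
		  finally have "(1 - \<theta>) * abs (?\<nu> \<bullet> (\<gamma> L - \<gamma> K)) \<le> 1 * (B * ?d)" using \<theta> by (intro mult_mono) auto
		  hence t2: "abs ((1 - \<theta>) * (?\<nu> \<bullet> (\<gamma> L - \<gamma> K))) \<le> B * ?d" using \<theta> by (simp add: abs_mult)
		  have "q = (1 - \<theta>) * (?\<nu> \<bullet> (\<gamma> L - \<gamma> K)) - ((f L - f K) / ?d - ?\<nu> \<bullet> \<gamma> K)"
			unfolding q_def inner_diff_right by (simp add: algebra_simps)
		  with t1 t2 show ?thesis by linarith
		qed
		also have "... \<le> 2 * B * (2 * ?h)" using cdist_le[OF True] B by (intro mult_left_mono) auto
		finally have "area K L * (abs (J n i K L) * abs q) / 2 \<le> area K L * ((?fc * ?D) * (2 * B * (2 * ?h))) / 2"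
		  using J area_nonneg by (intro divide_right_mono mult_left_mono mult_mono) auto
		thus ?thesis unfolding eq by (simp add: sum_distrib_left[symmetric] mult_ac)
	  qed (simp add: area_eq_0 tau_eq_0 adj_sym[of L K])
	qed
	have c: "(\<Sigma> K L. ?c * (SU j. area K L * abs (?v K L j))) = ?c * jumps n"
	proof -
	  have "jumps n = (\<Sigma> K L. SU j. area K L * abs (?v K L j))" unfolding jumps_def jump_sum_def by (rule sum_swap3)
	  thus ?thesis by (simp only: sum_distrib_left)
	qed
	show ?thesis unfolding eq c[symmetric] by (rule b)
  qed
  have "(\<Sigma> K L. ?Y K L) = (\<Sigma> K L. tau K L * J n i K L * (f L - f K)) / 2" by (simp add: sum_divide_distrib)
  with first second show ?thesis by (simp add: distrib_left)
qed

text \<open>Each integral is compared with a discrete sum; Abel summation in time and the scheme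
  connect the sums. In step n the test function is taken at the previous time, because Abel
  summation pairs the increment V n - V (n - 1) with the value at t (n - 1).\<close>

lemma residual_bound:
  assumes "test_bounds T R B \<phi> \<phi>t g" and R: "\<Omega> \<subseteq> cball 0 R" and final: "\<And>x. x \<in> \<Omega> ==> \<phi> (T, x) = 0"
  shows "\<bar>- (LBINT z. pw V z $ i * \<phi>t z) - (\<integral>x. U0 x $ i * \<phi> (0, x) \<partial>lebesgue_on \<Omega>)
	+ (LBINT z. pw (\<lambda>n. Fv n i) z \<bullet> g z)\<bar> \<le> B * (mesh_size M + time_step NT t) * residual_const"
proof -
  interpret test_bounds T R B \<phi> \<phi>t g by fact
  note [measurable] = test_measurable
  define h where "h = mesh_size M + time_step NT t"
  have h: "0 \<le> h" "mesh_size M \<le> h" using mesh_size_nonneg time_step_pos by (auto simp: h_def)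
  have tn: "0 \<le> t n" "t n \<le> T" if "n \<le> NT" for n using t_mono[of 0 n] t_mono[of n NT] that t_0 t_NT by auto
  have inR: "x \<in> cball 0 R" if "K \<in> cells M" "x \<in> K" for K x using that cell(4) R by blast
  have cR: "center M K \<in> cball 0 R" if "K \<in> cells M" for K using inR cell(5) that by blast
  have close: "dist (s, x) (s', center M K) \<le> h" if "in_cell n K s x" "t (n - 1) \<le> s'" "s' \<le> t n" for n K s x s'
  proof -
	note c = in_cellD[OF that(1)]
	have "dist (s, x) (s', center M K) \<le> abs (s - s') + dist x (center M K)"
	  unfolding dist_Pair_Pair by (rule order_trans[OF sqrt_sum_squares_le_sum_abs]) (simp add: dist_real_def)
	moreover have "abs (s - s') \<le> dt n" using that c by (auto simp: dt_def)
	ultimately show ?thesis using dt_le[OF c(1)] dist_center_le[OF c(2,5)] by (simp add: h_def)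
  qed
  have in_range: "(s, x) \<in> {0..T} \<times> cball 0 R" if "in_cell n K s x" for n K s x
  proof -
	note c = in_cellD[OF that]
	have "n - 1 \<le> NT" "n \<le> NT" using c(1) by auto
	thus ?thesis using tn(1)[of "n - 1"] tn(2)[of n] c(3,4) inR[OF c(2,5)] by auto
  qed
  let ?f = "\<lambda>n K. \<phi> (t n, center M K)"
  let ?I1 = "LBINT z. pw V z $ i * \<phi>t z" and ?I2 = "\<integral>x. U0 x $ i * \<phi> (0, x) \<partial>lebesgue_on \<Omega>"
  let ?I3 = "LBINT z. pw (\<lambda>n. Fv n i) z \<bullet> g z"
  define S1 where "S1 = (\<Sum>n=1..NT. \<Sigma> K. m K * (V n K $ i * (?f n K - ?f (n - 1) K)))"
  have e1: "abs (?I1 - S1) \<le> B * h * (T * vol \<Omega>)"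
  proof -
	\<comment> \<open>The time derivative is replaced by the difference quotient over the step, which
	  by the mean value theorem is its value at an intermediate time.\<close>
	let ?W = "\<lambda>n K. V n K $ i * ((?f n K - ?f (n - 1) K) / dt n)"
	have "abs (?I1 - (\<Sum>n=1..NT. dt n * (\<Sigma> K. m K * ?W n K))) \<le> (\<Sum>n=1..NT. dt n * (\<Sigma> K. m K * (B * h)))"
	proof (rule integral_pw_compare)
	  fix n K s x assume a: "in_cell n K s x"
	  note c = in_cellD[OF a]
	  have nn: "n - 1 \<le> NT" "n \<le> NT" "t (n - 1) < t n" using c by auto
	  have "\<exists>\<xi>. t (n - 1) < \<xi> \<and> \<xi> < t n \<and> ?f n K - ?f (n - 1) K = (t n - t (n - 1)) * \<phi>t (\<xi>, center M K)"
		using nn(3) by (rule MVT2) (use tn[OF nn(1)] tn[OF nn(2)] in \<open>auto intro!: deriv_t cR c(2)\<close>)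
	  then obtain \<xi> where \<xi>: "t (n - 1) < \<xi>" "\<xi> < t n" "?f n K - ?f (n - 1) K = dt n * \<phi>t (\<xi>, center M K)"
		unfolding dt_def by blast
	  have "in_cell n K \<xi> (center M K)" using \<xi> c cell(5)[OF c(2)] by (auto simp: in_cell_def)
	  hence "abs (\<phi>t (s, x) - \<phi>t (\<xi>, center M K)) \<le> B * dist (s, x) (\<xi>, center M K)"
		by (intro lip_t in_range[OF a] in_range)
	  also have "... \<le> B * h" using close[OF a, of \<xi>] \<xi> B by (intro mult_left_mono) auto
	  finally have "abs (V n K $ i * (\<phi>t (s, x) - \<phi>t (\<xi>, center M K))) \<le> 1 * (B * h)"
		unfolding abs_mult using simplex_nonneg[OF V_simplex_pos[OF c(1,2)], of i] simplex_le_1[OF V_simplex_pos[OF c(1,2)], of i]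
		by (intro mult_mono) auto
	  thus "abs (pw V (s, x) $ i * \<phi>t (s, x) - ?W n K) \<le> B * h"
		unfolding pw_at[OF a] \<xi>(3) using dt_pos[OF c(1)] by (simp add: right_diff_distrib)
	next
	  fix s x assume "\<And>n K. \<not> in_cell n K s x"
	  hence "pw V (s, x) = 0" by (rule pw_nowhere)
	  thus "pw V (s, x) $ i * \<phi>t (s, x) = 0" by simp
	qed measurable
	moreover have "(\<Sum>n=1..NT. dt n * (\<Sigma> K. m K * ?W n K)) = S1"
	  unfolding S1_def using dt_pos by (intro sum.cong refl) (simp add: sum_distrib_left less_imp_neq[THEN not_sym])
	moreover have "(\<Sum>n=1..NT. dt n * (\<Sigma> K. m K * (B * h))) = B * h * (T * vol \<Omega>)"
	  using sum_dt sum_cell_measures by (simp flip: sum_distrib_right)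
	ultimately show ?thesis by simp
  qed
  define S2 where "S2 = (\<Sigma> K. m K * (V 0 K $ i * ?f 0 K))"
  have e2: "abs (?I2 - S2) \<le> B * h * vol \<Omega>"
  proof -
	let ?L = "lebesgue_on \<Omega>" and ?s = "sstep (?f 0)"
	interpret finite_measure ?L using domain_lmeasurable by (rule finite_measure_lebesgue_on)
	have ind: "integrable ?L (\<lambda>x. indicator K x * U0 x $ i)" "(\<integral>x. indicator K x * U0 x $ i \<partial>?L) = m K * V 0 K $ i"
	  if K: "K \<in> cells M" for K
	proof -
	  have "K \<in> sets ?L" using cell(2,4)[OF K] open_domain by (simp add: sets_restrict_space_iff)
	  from integrable_mult_indicator[OF this U0_component_integrable[of i]]
	  show "integrable ?L (\<lambda>x. indicator K x * U0 x $ i)" by simp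
	  have "(\<integral>x. indicator K x * U0 x $ i \<partial>?L) = (\<integral>x. indicator \<Omega> x *R (indicator K x * U0 x $ i) \<partial>lebesgue)"
		by (rule integral_restrict_space) (simp add: open_domain)
	  also have "... = (\<integral>x. indicator K x *R U0 x $ i \<partial>lebesgue)"
		using cell(4)[OF K] by (intro integral_cong) (auto simp: indicator_def)
	  also have "... = (\<integral>x. U0 x $ i \<partial>lebesgue_on K)" by (rule integral_restrict_space[symmetric]) (simp add: cell(2)[OF K])
	  finally show "(\<integral>x. indicator K x * U0 x $ i \<partial>?L) = m K * V 0 K $ i" using V_0[OF K, of i] cell_measure_pos[OF K] by simp
	qed
	have s: "U0 x $ i * ?s x = (\<Sigma> K. ?f 0 K * (indicator K x * U0 x $ i))" for x by (simp add: sstep_def sum_distrib_left mult_ac)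
	have S2: "S2 = (\<integral>x. U0 x $ i * ?s x \<partial>?L)" "integrable ?L (\<lambda>x. U0 x $ i * ?s x)"
	  unfolding s S2_def using ind by (simp_all only: integral_sum integrable_sum integrable_mult_right integral_mult_right_zero) (simp add: mult_ac)
	have "AE x in ?L. x \<in> \<Union> (cells M)" by (rule AE_lebesgue_onI[OF cells_measurable(2) AE_in_cells])
	with U0_bounds have bd: "AE x in ?L. norm (U0 x $ i * \<phi> (0, x) - U0 x $ i * ?s x) \<le> B * h"
	proof eventually_elim
	  case (elim x)
	  then obtain K where K: "K \<in> cells M" "x \<in> K" by blast
	  have "abs (\<phi> (0, x) - ?f 0 K) \<le> B * dist (0 :: real, x) (0, center M K)"
		unfolding t_0 using inR[OF K] cR[OF K(1)] T by (intro lip) auto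
	  also have "... \<le> B * h" using dist_center_le[OF K] h B by (intro mult_left_mono) (auto simp: dist_Pair_Pair)
	  finally have "abs (U0 x $ i) * abs (\<phi> (0, x) - ?f 0 K) \<le> 1 * (B * h)"
		using simplex_nonneg[OF elim(1), of i] simplex_le_1[OF elim(1), of i] by (intro mult_mono) auto
	  thus ?case by (simp add: sstep_in[OF K] abs_mult[symmetric] right_diff_distrib)
	qed
	have "(\<lambda>x. \<phi> (0, x)) \<in> borel_measurable ?L"
	  by (intro borel_lebesgue_on measurable_compose[OF _ test_measurable(1)] borel_measurable_continuous_onI continuous_intros)
	hence d: "integrable ?L (\<lambda>x. U0 x $ i * \<phi> (0, x) - U0 x $ i * ?s x)"
	  using U0_component_integrable[of i] S2(2) by (intro integrable_const_bound[OF bd]) auto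
	have "?I2 - S2 = (\<integral>x. U0 x $ i * \<phi> (0, x) - U0 x $ i * ?s x \<partial>?L)" using integrable_add[OF d S2(2)] S2 by simp
	also have "norm ... \<le> (\<integral>x. B * h \<partial>?L)" using d bd by (intro order_trans[OF integral_norm_bound integral_mono_AE]) auto
	finally show ?thesis using open_domain by (simp add: measure_restrict_space mult_ac)
  qed
  let ?\<gamma> = "\<lambda>n K. g (t (n - 1), center M K)"
  define S3 where "S3 = (\<Sum>n=1..NT. dt n * (\<Sigma> K. m K * (Fv n i K \<bullet> ?\<gamma> n K)))"
  have e3: "abs (?I3 - S3) \<le> B * h * (2 * A_sum * space_const)"
  proof -
	have "abs (?I3 - S3) \<le> (\<Sum>n=1..NT. dt n * (\<Sigma> K. m K * (norm (Fv n i K) * (B * h))))" unfolding S3_def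
	proof (rule integral_pw_compare)
	  fix n K s x assume a: "in_cell n K s x"
	  note c = in_cellD[OF a]
	  have nn: "n - 1 \<le> NT" using c(1) by auto
	  have "norm (g (s, x) - ?\<gamma> n K) \<le> B * dist (s, x) (t (n - 1), center M K)"
		using in_range[OF a] tn[OF nn] cR[OF c(2)] by (intro lip_g) auto
	  also have "... \<le> B * h" using close[OF a, of "t (n - 1)"] c B by (intro mult_left_mono) auto
	  finally have "norm (Fv n i K) * norm (g (s, x) - ?\<gamma> n K) \<le> norm (Fv n i K) * (B * h)" by (rule mult_left_mono) simp
	  thus "abs (pw (\<lambda>n. Fv n i) (s, x) \<bullet> g (s, x) - Fv n i K \<bullet> ?\<gamma> n K) \<le> norm (Fv n i K) * (B * h)"
		unfolding pw_at[OF a] inner_diff_right[symmetric] by (rule order_trans[OF Cauchy_Schwarz_ineq2])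
	next
	  fix s x assume "\<And>n K. \<not> in_cell n K s x"
	  hence "pw (\<lambda>n. Fv n i) (s, x) = 0" by (rule pw_nowhere)
	  thus "pw (\<lambda>n. Fv n i) (s, x) \<bullet> g (s, x) = 0" by simp
	qed measurable
	also have "... = B * h * (\<Sum>n=1..NT. dt n * (\<Sigma> K. m K * norm (Fv n i K)))" by (simp add: sum_distrib_left mult_ac)
	also have "... \<le> B * h * (\<Sum>n=1..NT. dt n * (2 * A_sum * jumps n))"
	  using B h dt_pos by (intro mult_left_mono sum_mono sum_norm_Fv) (auto intro: less_imp_le)
	also have "... = B * h * (2 * A_sum * (\<Sum>n=1..NT. dt n * jumps n))" by (simp add: sum_distrib_left mult_ac)
	also have "... \<le> B * h * (2 * A_sum * space_const)"
	  using B h sum_dt_jumps A_nonneg unfolding A_sum_def by (intro mult_left_mono mult_nonneg_nonneg sum_nonneg) auto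
	finally show ?thesis .
  qed
  let ?X = "\<lambda>n. \<Sigma> K. m K * (Fv n i K \<bullet> ?\<gamma> n K)"
  let ?Y = "\<lambda>n. (\<Sigma> K L. tau K L * J n i K L * (?f (n - 1) L - ?f (n - 1) K)) / 2"
  let ?fc = "flux_const A astar" and ?E = "2 * CARD('n) * vol \<Omega> / c"
  define S5 where "S5 = (\<Sum>n=1..NT. dt n * ?Y n)"
  have e4: "abs (S3 - S5) \<le> B * h * (2 * ?fc * ?E + 2 * ?fc * space_const)"
  proof -
	have eq: "S3 - S5 = (\<Sum>n=1..NT. dt n * (?X n - ?Y n))" unfolding S3_def S5_def by (simp add: sum_subtractf[symmetric] right_diff_distrib)
	have "abs (S3 - S5) \<le> (\<Sum>n=1..NT. dt n * (2 * B * h * ?fc * (energy n + jumps n)))" unfolding eq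
	proof (rule order_trans[OF sum_abs], rule sum_mono)
	  fix n assume n: "n \<in> {1..NT}"
	  have "n - 1 \<le> NT" using n by auto
	  note s = tn[OF this]
	  have "abs (?X n - ?Y n) \<le> 2 * B * mesh_size M * ?fc * (energy n + jumps n)"
	  proof (rule flux_consistency[OF n B])
		fix K L assume KL: "K \<in> cells M" "L \<in> cells M"
		show "norm (?\<gamma> n K - ?\<gamma> n L) \<le> B * cdist K L"
		  using lip_g[of "(t (n - 1), center M K)" "(t (n - 1), center M L)"] s cR KL by (simp add: cdist_def dist_Pair_Pair)
		show "abs (?f (n - 1) L - ?f (n - 1) K - ?\<gamma> n K \<bullet> (center M L - center M K)) \<le> B * (cdist K L)^2"
		  unfolding cdist_def using s by (intro taylor cR KL) auto
		show "norm (?\<gamma> n K) \<le> B" using s cR[OF KL(1)] by (intro g_bound) auto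
	  qed
	  also have "... \<le> 2 * B * h * ?fc * (energy n + jumps n)"
		using h(2) B flux_const_nonneg energy_nonneg jumps_nonneg by (intro mult_right_mono mult_left_mono add_nonneg_nonneg) auto
	  finally show "abs (dt n * (?X n - ?Y n)) \<le> dt n * (2 * B * h * ?fc * (energy n + jumps n))" using dt_pos[OF n] by (simp add: abs_mult)
	qed
	also have "... = 2 * B * h * ?fc * ((\<Sum>n=1..NT. dt n * energy n) + (\<Sum>n=1..NT. dt n * jumps n))"
	  by (simp add: sum_distrib_left sum.distrib[symmetric] algebra_simps)
	also have "... \<le> 2 * B * h * ?fc * (?E + space_const)"
	  using B h flux_const_nonneg[of A astar] by (intro mult_left_mono add_mono energy_estimate sum_dt_jumps) auto
	finally show ?thesis by (simp add: algebra_simps)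
  qed
  have abel: "S1 = - S2 + S5"
  proof -
	let ?d = "\<lambda>n K. V n K $ i - V (n - 1) K $ i"
	have "S1 = (\<Sigma> K. m K * (\<Sum>n=1..NT. V n K $ i * (?f n K - ?f (n - 1) K)))"
	  unfolding S1_def by (subst sum.swap) (simp add: sum_distrib_left)
	also have "... = (\<Sigma> K. - (m K * (V 0 K $ i * ?f 0 K)) - (\<Sum>n=1..NT. m K * ?d n K * ?f (n - 1) K))"
	proof (rule sum.cong)
	  fix K assume K: "K \<in> cells M"
	  \<comment> \<open>The test function vanishes at time T, so Abel summation leaves only the initial
	    term.\<close>
	  have fin: "?f NT K = 0" using final cell(4,5)[OF K] t_NT by auto
	  have pull: "(\<Sum>n=1..NT. m K * ?d n K * ?f (n - 1) K) = m K * (\<Sum>n=1..NT. ?d n K * ?f (n - 1) K)"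
		by (simp only: sum_distrib_left mult.assoc)
	  show "m K * (\<Sum>n=1..NT. V n K $ i * (?f n K - ?f (n - 1) K))
		= - (m K * (V 0 K $ i * ?f 0 K)) - (\<Sum>n=1..NT. m K * ?d n K * ?f (n - 1) K)"
		unfolding pull abel_summation[of "\<lambda>n. V n K $ i" "\<lambda>n. ?f n K" NT] fin by (simp add: distrib_left right_diff_distrib)
	qed simp
	also have "... = - S2 - (\<Sum>n=1..NT. \<Sigma> K. m K * ?d n K * ?f (n - 1) K)"
	  unfolding S2_def sum_subtractf sum_negf by (rule arg_cong2[where f = minus, OF refl sum.swap])
	also have "(\<Sum>n=1..NT. \<Sigma> K. m K * ?d n K * ?f (n - 1) K) = - S5"
	  unfolding S5_def sum_negf[symmetric] by (intro sum.cong refl) (subst summation_by_parts, auto)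
	finally show ?thesis by simp
  qed
  have "B * h * residual_const = B * h * (T * vol \<Omega>) + B * h * vol \<Omega> + B * h * (2 * A_sum * space_const)
	+ B * h * (2 * ?fc * ?E + 2 * ?fc * space_const)" unfolding residual_const_def by (simp add: distrib_left)
  with e1 e2 e3 e4 abel show ?thesis unfolding h_def[symmetric] by linarith
qed

end

section \<open>Smooth test functions\<close>

lemma smooth_C_k: "smooth f ==> C_k k f" by (simp add: smooth_def)

lemma smooth_differentiable: "smooth f ==> f differentiable (at x)" using smooth_C_k[of f 1] by simp

lemma smooth_has_derivative: "smooth f ==> (f has_derivative frechet_derivative f (at x)) (at x)"
  using smooth_differentiable frechet_derivative_works by blast

lemma smooth_partial_deriv: "smooth f ==> e \<in> Basis ==> smooth (partial_deriv e f)" unfolding smooth_def by (metis C_k.simps(2))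

lemma smooth_continuous: "smooth f ==> continuous_on S f" using smooth_C_k[of f 0] continuous_on_subset by auto

lemma smooth_measurable: "smooth f ==> f \<in> borel_measurable borel" by (intro borel_measurable_continuous_onI smooth_continuous)

lemma onorm_frechet_le:
  fixes f :: "'a::euclidean_space => real"
  assumes f: "(f has_derivative f') (at x)"
  shows "onorm f' \<le> (\<Sum>e\<in>Basis. abs (partial_deriv e f x))"
proof (rule onorm_le)
  fix v
  interpret bounded_linear f' using f by (rule has_derivative_bounded_linear)
  have eq: "frechet_derivative f (at x) = f'" using frechet_derivative_at[OF f] by simp
  have "f' v = f' (\<Sum>e\<in>Basis. (v \<bullet> e) *R e)" by (simp add: euclidean_representation)
  also have "... = (\<Sum>e\<in>Basis. (v \<bullet> e) * partial_deriv e f x)" by (simp add: sum scaleR partial_deriv_def eq)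
  also have "abs (...) \<le> (\<Sum>e\<in>Basis. abs (partial_deriv e f x) * norm v)"
	by (rule order_trans[OF sum_abs]) (auto simp: abs_mult mult.commute intro!: sum_mono mult_mono Basis_le_norm)
  finally show "norm (f' v) \<le> (\<Sum>e\<in>Basis. abs (partial_deriv e f x)) * norm v" by (simp add: sum_distrib_right)
qed

lemma smooth_bounded:
  assumes "smooth f" "compact S" obtains B where "0 \<le> B" "\<And>x. x \<in> S ==> abs (f x) \<le> B"
proof -
  have "compact (f ` S)" using assms smooth_continuous by (intro compact_continuous_image)
  then obtain B where "\<And>y. y \<in> f ` S ==> norm y \<le> B" using compact_imp_bounded bounded_iff by metis
  thus thesis by (intro that[of "abs B"]) force+
qed

lemma smooth_partials_bounded:
  assumes "smooth f" "compact S"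
  obtains B where "0 \<le> B" "\<And>x. x \<in> S ==> (\<Sum>e\<in>Basis. abs (partial_deriv e f x)) \<le> B"
proof -
  have "\<forall>e\<in>Basis. \<exists>B. 0 \<le> B \<and> (\<forall>x\<in>S. abs (partial_deriv e f x) \<le> B)"
	using smooth_bounded[OF smooth_partial_deriv[OF assms(1)] assms(2)] by metis
  then obtain B where B: "\<And>e. e \<in> Basis ==> 0 \<le> B e" "\<And>e x. e \<in> Basis ==> x \<in> S ==> abs (partial_deriv e f x) \<le> B e"
	by metis
  show thesis by (rule that[of "\<Sum>e\<in>Basis. B e"]) (auto intro!: sum_nonneg sum_mono B)
qed

lemma smooth_lipschitz:
  fixes f :: "'a::euclidean_space => real"
  assumes f: "smooth f" and S: "compact S" "convex S"
  obtains B where "0 \<le> B" "\<And>x y. x \<in> S ==> y \<in> S ==> abs (f x - f y) \<le> B * dist x y"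
proof -
  obtain B where B: "0 \<le> B" "\<And>x. x \<in> S ==> (\<Sum>e\<in>Basis. abs (partial_deriv e f x)) \<le> B"
	by (rule smooth_partials_bounded[OF f S(1)]) blast
  show thesis
  proof (rule that[OF B(1)])
	fix x y assume xy: "x \<in> S" "y \<in> S"
	have "norm (f x - f y) \<le> B * norm (x - y)"
	proof (rule differentiable_bound[OF S(2) _ _ xy])
	  show "(f has_derivative frechet_derivative f (at z)) (at z within S)" for z
		using smooth_has_derivative[OF f] by (rule has_derivative_at_withinI)
	  show "onorm (frechet_derivative f (at z)) \<le> B" if "z \<in> S" for z
		using onorm_frechet_le[OF smooth_has_derivative[OF f]] B(2)[OF that] by (rule order_trans)
	qed
	thus "abs (f x - f y) \<le> B * dist x y" by (simp add: dist_norm)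
  qed
qed

lemma slice_derivatives:
  fixes \<phi> :: "real \<times> 'a::euclidean_space => real"
  assumes \<phi>: "smooth \<phi>"
  shows "((\<lambda>s. \<phi> (s, x)) has_real_derivative partial_deriv (1, 0) \<phi> (s, x)) (at s)"
	"((\<lambda>y. \<phi> (s, y)) has_derivative (\<lambda>v. gradient (\<lambda>y. \<phi> (s, y)) x \<bullet> v)) (at x)"
	"gradient (\<lambda>y. \<phi> (s, y)) x = (\<Sum>b\<in>Basis. partial_deriv (0, b) \<phi> (s, x) *R b)"
proof -
  let ?D = "frechet_derivative \<phi> (at (s, x))"
  have D: "(\<phi> has_derivative ?D) (at (s, x))" using \<phi> by (rule smooth_has_derivative)
  interpret bounded_linear ?D using D by (rule has_derivative_bounded_linear)
  have "((\<lambda>s. \<phi> (s, x)) has_derivative (\<lambda>h. ?D (h, 0))) (at s)"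
	using D by (auto intro!: derivative_eq_intros has_derivative_compose[of "\<lambda>s. (s, x)" "\<lambda>h. (h, 0)" s UNIV \<phi> ?D])
  moreover have "?D (h, 0) = partial_deriv (1, 0) \<phi> (s, x) * h" for h
	using scaleR[of h "(1, 0)"] by (simp add: partial_deriv_def mult.commute)
  ultimately show "((\<lambda>s. \<phi> (s, x)) has_real_derivative partial_deriv (1, 0) \<phi> (s, x)) (at s)"
	by (simp add: has_field_derivative_def)
  have S: "((\<lambda>y. \<phi> (s, y)) has_derivative (\<lambda>v. ?D (0, v))) (at x)"
	using D by (auto intro!: derivative_eq_intros has_derivative_compose[of "\<lambda>y. (s, y)" "\<lambda>v. (0, v)" x UNIV \<phi> ?D])
  have "partial_deriv b (\<lambda>y. \<phi> (s, y)) x = partial_deriv (0, b) \<phi> (s, x)" for b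
	using fun_cong[OF frechet_derivative_at[OF S], of b] by (simp add: partial_deriv_def)
  thus g: "gradient (\<lambda>y. \<phi> (s, y)) x = (\<Sum>b\<in>Basis. partial_deriv (0, b) \<phi> (s, x) *R b)" by (simp add: gradient_def)
  have "?D (0, v) = gradient (\<lambda>y. \<phi> (s, y)) x \<bullet> v" for v
  proof -
	have "(\<Sum>b\<in>Basis. (v \<bullet> b) *R (0 :: real, b)) = (0, v)" by (simp add: sum_prod euclidean_representation)
	hence "?D (0, v) = (\<Sum>b\<in>Basis. ?D ((v \<bullet> b) *R (0, b)))" using sum[of "\<lambda>b. (v \<bullet> b) *R (0 :: real, b)" Basis] by simp
	hence "?D (0, v) = (\<Sum>b\<in>Basis. (v \<bullet> b) *R ?D (0, b))" unfolding scaleR .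
	thus ?thesis unfolding g by (simp add: inner_sum_left partial_deriv_def) (simp add: inner_commute mult.commute)
  qed
  with S show "((\<lambda>y. \<phi> (s, y)) has_derivative (\<lambda>v. gradient (\<lambda>y. \<phi> (s, y)) x \<bullet> v)) (at x)" by simp
qed

lemma smooth_test_bounds:
  fixes \<phi> :: "real \<times> 'a::euclidean_space => real"
  assumes \<phi>: "smooth \<phi>"
  obtains B where "test_bounds T R B \<phi> (partial_deriv (1, 0) \<phi>) (\<lambda>z. gradient (\<lambda>y. \<phi> (fst z, y)) (snd z))"
proof -
  let ?Z = "{0..T} \<times> cball (0 :: 'a) R"
  let ?g = "\<lambda>z. gradient (\<lambda>y. \<phi> (fst z, y)) (snd z)"
  let ?p = "\<lambda>b. partial_deriv (0, b) \<phi>" and ?t = "partial_deriv (1, 0) \<phi>"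
  have Z: "compact ?Z" "convex ?Z" by (auto intro!: compact_Times convex_Times)
  have bas: "(1, 0) \<in> (Basis :: (real \<times> 'a) set)" "b \<in> Basis ==> (0, b) \<in> (Basis :: (real \<times> 'a) set)" for b :: 'a
	by (auto simp: Basis_prod_def)
  obtain B1 where B1: "0 \<le> B1" "\<And>x y. x \<in> ?Z ==> y \<in> ?Z ==> abs (\<phi> x - \<phi> y) \<le> B1 * dist x y"
	by (rule smooth_lipschitz[OF \<phi> Z]) blast
  obtain B2 where B2: "0 \<le> B2" "\<And>x y. x \<in> ?Z ==> y \<in> ?Z ==> abs (?t x - ?t y) \<le> B2 * dist x y"
	by (rule smooth_lipschitz[OF smooth_partial_deriv[OF \<phi> bas(1)] Z]) blast
  have g: "?g z = (\<Sum>b\<in>Basis. ?p b z *R b)" for z using slice_derivatives(3)[OF \<phi>, of "fst z" "snd z"] by simp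
  have "\<forall>b\<in>Basis. \<exists>B. 0 \<le> B \<and> (\<forall>x\<in>?Z. \<forall>y\<in>?Z. abs (?p b x - ?p b y) \<le> B * dist x y)"
  proof
	fix b :: 'a assume "b \<in> Basis"
	from smooth_lipschitz[OF smooth_partial_deriv[OF \<phi> bas(2)[OF this]] Z]
	show "\<exists>B. 0 \<le> B \<and> (\<forall>x\<in>?Z. \<forall>y\<in>?Z. abs (?p b x - ?p b y) \<le> B * dist x y)" by metis
  qed
  then obtain b3 where b3: "\<And>b. b \<in> Basis ==> 0 \<le> b3 b"
	"\<And>b x y. b \<in> Basis ==> x \<in> ?Z ==> y \<in> ?Z ==> abs (?p b x - ?p b y) \<le> b3 b * dist x y" by metis
  define B3 where "B3 = (\<Sum>b\<in>Basis. b3 b)"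
  have B3: "0 \<le> B3" unfolding B3_def by (intro sum_nonneg b3)
  have lg: "norm (?g x - ?g y) \<le> B3 * dist x y" if "x \<in> ?Z" "y \<in> ?Z" for x y
  proof -
	have "norm (?g x - ?g y) = norm (\<Sum>b\<in>Basis. (?p b x - ?p b y) *R b)" unfolding g by (simp add: sum_subtractf scaleR_diff_left)
	also have "... \<le> (\<Sum>b\<in>Basis. b3 b * dist x y)" by (rule order_trans[OF norm_sum], rule sum_mono) (simp add: b3(2)[OF _ that])
	finally show ?thesis unfolding B3_def by (simp add: sum_distrib_right)
  qed
  obtain B4 where B4: "0 \<le> B4" "\<And>x. x \<in> ?Z ==> (\<Sum>e\<in>Basis. abs (partial_deriv e \<phi> x)) \<le> B4"
	by (rule smooth_partials_bounded[OF \<phi> Z(1)]) blast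
  have ng: "norm (?g z) \<le> B4" if "z \<in> ?Z" for z
  proof -
	have "norm (?g z) \<le> (\<Sum>b\<in>Basis. abs (?p b z))" unfolding g by (rule order_trans[OF norm_sum]) simp
	also have "... = (\<Sum>e\<in>(\<lambda>b. (0, b)) ` Basis. abs (partial_deriv e \<phi> z))" by (subst sum.reindex) (auto simp: inj_on_def)
	also have "... \<le> (\<Sum>e\<in>Basis. abs (partial_deriv e \<phi> z))" using bas(2) by (intro sum_mono2) auto
	also have "... \<le> B4" using that by (rule B4(2))
	finally show ?thesis .
  qed
  let ?B = "max (max B1 B2) (max B3 B4)"
  have up: "x \<le> a * d ==> a \<le> b ==> 0 \<le> d ==> x \<le> b * d" for x a b d :: real by (meson mult_right_mono order_trans)
  show thesis
  proof (rule that[of ?B], unfold_locales)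
	show "0 \<le> ?B" using B1(1) by simp
	show "\<phi> \<in> borel_measurable borel" using \<phi> by (rule smooth_measurable)
	show "?t \<in> borel_measurable borel" by (rule smooth_measurable[OF smooth_partial_deriv[OF \<phi> bas(1)]])
	show "?g \<in> borel_measurable borel" unfolding g
	  using smooth_measurable[OF smooth_partial_deriv[OF \<phi> bas(2)]] by (intro borel_measurable_sum borel_measurable_scaleR) auto
	show "abs (\<phi> z - \<phi> z') \<le> ?B * dist z z'" if "z \<in> ?Z" "z' \<in> ?Z" for z z' by (rule up[OF B1(2)[OF that]]) auto
	show "abs (?t z - ?t z') \<le> ?B * dist z z'" if "z \<in> ?Z" "z' \<in> ?Z" for z z' by (rule up[OF B2(2)[OF that]]) auto
	show "norm (?g z - ?g z') \<le> ?B * dist z z'" if "z \<in> ?Z" "z' \<in> ?Z" for z z' by (rule up[OF lg[OF that]]) auto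
	show "norm (?g z) \<le> ?B" if "z \<in> ?Z" for z using ng[OF that] by simp
	show "((\<lambda>s. \<phi> (s, x)) has_real_derivative ?t (s, x)) (at s)" for s x using \<phi> by (rule slice_derivatives)
	fix s :: real and x y :: 'a assume s: "s \<in> {0..T}" and x: "x \<in> cball 0 R" and y: "y \<in> cball (0 :: 'a) R"
	have "norm (\<phi> (s, y) - \<phi> (s, x) - ?g (s, x) \<bullet> (y - x)) \<le> norm (y - x) * (B3 * dist x y)"
	proof (rule differentiable_bound_linearization[where S = "closed_segment x y" and f' = "\<lambda>\<xi> v. ?g (s, \<xi>) \<bullet> v"])
	  show "x + r *R (y - x) \<in> closed_segment x y" if "r \<in> {0..1}" for r
		using that by (auto simp: closed_segment_def algebra_simps intro!: exI[of _ r])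
	  show "((\<lambda>y. \<phi> (s, y)) has_derivative (\<lambda>v. ?g (s, \<xi>) \<bullet> v)) (at \<xi> within closed_segment x y)" for \<xi>
		using slice_derivatives(2)[OF \<phi>, of s \<xi>] by (simp add: has_derivative_at_withinI)
	  show "x \<in> closed_segment x y" by simp
	  fix \<xi> assume \<xi>: "\<xi> \<in> closed_segment x y"
	  hence "\<xi> \<in> cball 0 R" using closed_segment_subset[OF x y convex_cball] by blast
	  have "onorm (\<lambda>v. ?g (s, \<xi>) \<bullet> v - ?g (s, x) \<bullet> v) \<le> norm (?g (s, \<xi>) - ?g (s, x))"
	  proof (rule onorm_le)
		show "norm (?g (s, \<xi>) \<bullet> v - ?g (s, x) \<bullet> v) \<le> norm (?g (s, \<xi>) - ?g (s, x)) * norm v" for v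
		  using Cauchy_Schwarz_ineq2[of "?g (s, \<xi>) - ?g (s, x)" v] by (simp add: inner_diff_left)
	  qed
	  also have "... \<le> B3 * dist (s, \<xi>) (s, x)" using s x `\<xi> \<in> cball 0 R` by (intro lg) auto
	  also have "... \<le> B3 * dist x y"
		using dist_in_closed_segment[OF \<xi>] B3 by (intro mult_left_mono) (auto simp: dist_Pair_Pair dist_commute)
	  finally show "onorm ((\<lambda>v. ?g (s, \<xi>) \<bullet> v) - (\<lambda>v. ?g (s, x) \<bullet> v)) \<le> B3 * dist x y" unfolding fun_diff_def .
	qed
	also have "... = B3 * (dist x y)^2" by (simp add: dist_norm norm_minus_commute power2_eq_square)
	also have "... \<le> ?B * (dist x y)^2" by (intro mult_right_mono) auto
	finally show "abs (\<phi> (s, y) - \<phi> (s, x) - ?g (s, x) \<bullet> (y - x)) \<le> ?B * (dist x y)^2" by simp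
  qed
qed

lemma difference_quotient_limit:
  fixes f :: "'a::euclidean_space => real"
  assumes "(f has_derivative f') (at x)"
  shows "(\<lambda>n. real (Suc n) * (f x - f (x - e /\<^sub>R real (Suc n)))) ----> f' e"
proof -
  interpret bounded_linear f' using assms by (rule has_derivative_bounded_linear)
  have "((\<lambda>r. f (x - r *R e)) has_derivative (\<lambda>h. f' (- (h *R e)))) (at 0)"
	by (rule has_derivative_compose[of "\<lambda>r. x - r *R e" "\<lambda>h. - (h *R e)" 0 UNIV f f'])
	  (use assms in \<open>auto intro!: derivative_eq_intros\<close>)
  moreover have "f' (- (h *R e)) = - f' e * h" for h by (simp add: neg scaleR)
  ultimately have "((\<lambda>r. f (x - r *R e)) has_real_derivative - f' e) (at 0)" by (simp only: has_field_derivative_def)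
  hence "((\<lambda>r. (f (x - r *R e) - f x) / r) \<longlongrightarrow> - f' e) (at 0)" by (simp add: DERIV_def)
  moreover have "filterlim (\<lambda>n. inverse (real (Suc n))) (at 0) sequentially"
	unfolding filterlim_at using LIMSEQ_inverse_real_of_nat by auto
  ultimately have "(\<lambda>n. (f (x - inverse (real (Suc n)) *R e) - f x) / inverse (real (Suc n))) ----> - f' e" by (rule filterlim_compose)
  from tendsto_minus[OF this] show ?thesis by (simp add: divide_inverse algebra_simps)
qed

text \<open>A test function on \<Omega> is known to vanish only on \<Omega> minus C and is arbitrary
  outside \<Omega>, so it is cut off. The cut function is differentiable everywhere with derivative
  0 off C, and therefore Lipschitz on the whole space.\<close>

lemma zero_extension:
  fixes \<phi> :: "'a::euclidean_space => real"
  assumes \<phi>: "smooth \<phi>" and \<Omega>: "open \<Omega>" and C: "compact C" "C \<subseteq> \<Omega>" "\<And>x. x \<in> \<Omega> - C ==> \<phi> x = 0" and e: "e \<in> Basis"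
  defines "\<psi> \<equiv> \<lambda>x. if x \<in> \<Omega> then \<phi> x else 0"
  obtains B where "space_test \<Omega> \<psi> (\<lambda>x. if x \<in> \<Omega> then partial_deriv e \<phi> x else 0) e B C"
proof -
  define D where "D x = (if x \<in> \<Omega> then frechet_derivative \<phi> (at x) else (\<lambda>_. 0))" for x
  have "open (- C)" using C(1) compact_imp_closed by blast
  have off: "(\<psi> has_derivative (\<lambda>_. 0)) (at x)" if "x \<notin> C" for x
	by (rule has_derivative_transform_within_open[OF has_derivative_const[of 0] `open (- C)`]) (use that C(3) in \<open>auto simp: \<psi>_def\<close>)
  have D: "(\<psi> has_derivative D x) (at x)" for x
  proof (cases "x \<in> \<Omega>")
	case True
	have "(\<psi> has_derivative frechet_derivative \<phi> (at x)) (at x)"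
	  by (rule has_derivative_transform_within_open[OF smooth_has_derivative[OF \<phi>] \<Omega> True]) (simp add: \<psi>_def)
	thus ?thesis using True by (simp add: D_def)
  next
	case False
	thus ?thesis using off[of x] C(2) by (auto simp: D_def)
  qed
  obtain B where B: "0 \<le> B" "\<And>x. x \<in> C ==> (\<Sum>e\<in>Basis. abs (partial_deriv e \<phi> x)) \<le> B"
	by (rule smooth_partials_bounded[OF \<phi> C(1)]) blast
  show thesis
  proof (rule that[of B], unfold_locales)
	show "0 \<le> B" "norm e \<le> 1" "compact C" "C \<subseteq> \<Omega>" using B(1) C e by auto
	show "\<psi> x = 0" if "x \<notin> C" for x using that C(3)[of x] by (auto simp: \<psi>_def)
  next
	fix x y
	have "norm (\<psi> x - \<psi> y) \<le> B * norm (x - y)"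
	proof (rule differentiable_bound[where S = UNIV])
	  show "(\<psi> has_derivative D z) (at z within UNIV)" for z using D by simp
	  fix z
	  show "onorm (D z) \<le> B"
	  proof (cases "z \<in> C")
		case True
		hence "D z = frechet_derivative \<phi> (at z)" using C(2) by (auto simp: D_def)
		thus ?thesis using onorm_frechet_le[OF smooth_has_derivative[OF \<phi>, of z]] B(2)[OF True] by simp
	  next
		case False
		hence "D z = (\<lambda>_. 0)" using has_derivative_unique[OF D off] by blast
		thus ?thesis using B(1) by (simp add: onorm_zero)
	  qed
	qed auto
	thus "abs (\<psi> x - \<psi> y) \<le> B * dist x y" by (simp add: dist_norm)
  next
	fix x
	have "D x e = (if x \<in> \<Omega> then partial_deriv e \<phi> x else 0)" by (simp add: D_def partial_deriv_def)
	with difference_quotient_limit[OF D, of x e]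
	show "(\<lambda>n. real (Suc n) * (\<psi> x - \<psi> (x - e /\<^sub>R real (Suc n)))) ----> (if x \<in> \<Omega> then partial_deriv e \<phi> x else 0)" by simp
  qed
qed

section \<open>Gradient fields of the approximate solutions\<close>

context fv_solution
begin

text \<open>The gradients of all species form one vector-valued function, so that the same convex
  combinations converge for every species.\<close>

definition Gr :: "real \<times> 'a => 'a ^ 'n" where "Gr = pw (\<lambda>n K. \<chi> i. G n i K)"

lemma Gr_component: "Gr z $ i = pw (\<lambda>n. G n i) z" unfolding Gr_def by (subst pw_comp[where f = "\<lambda>v. v $ i"]) auto

lemma Gr_measurable [measurable]: "Gr \<in> borel_measurable borel" unfolding Gr_def by (rule pw_measurable)

lemma Gr_out: "z \<notin> {0<..T} \<times> \<Omega> ==> Gr z = 0"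
proof -
  assume a: "z \<notin> {0<..T} \<times> \<Omega>"
  obtain s x where z: "z = (s, x)" by (cases z)
  show ?thesis
  proof (cases "x \<in> \<Omega>")
	case True
	hence "\<not> (0 < s \<and> s \<le> T)" using a z by auto
	thus ?thesis unfolding z Gr_def by (rule pw_out)
  next
	case False
	thus ?thesis unfolding z Gr_def by (rule pw_outside_domain)
  qed
qed

lemma Gr_sq: "sq_integrable Gr" "sq_norm Gr \<le> DIM('a) * (2 * CARD('n) * vol \<Omega> / c)"
proof -
  let ?W = "\<lambda>n K. (norm (\<chi> i. G n i K))^2"
  let ?E = "\<lambda>n K. SU i. DIM('a) * (\<Sigma> L. tau K L * (V n L $ i - V n K $ i)^2)"
  have eq: "(norm (Gr z))^2 = pw ?W z" for z unfolding Gr_def by (subst pw_comp[where f = "\<lambda>v. (norm v)^2"]) auto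
  show "sq_integrable Gr" unfolding sq_integrable_def eq using integrable_pw by auto
  have "sq_norm Gr = (\<Sum>n=1..NT. dt n * (\<Sigma> K. m K * ?W n K))" unfolding sq_norm_def eq by (simp add: integral_pw)
  also have "... \<le> (\<Sum>n=1..NT. dt n * (DIM('a) * energy n))"
  proof (intro sum_mono mult_left_mono)
	fix n
	have "(\<Sigma> K. m K * ?W n K) \<le> (\<Sigma> K. ?E n K)"
	proof (rule sum_mono)
	  fix K assume K: "K \<in> cells M"
	  have "m K * ?W n K = (SU i. m K * (norm (G n i K))^2)" by (simp add: norm_vec_def L2_set_def sum_nonneg sum_distrib_left)
	  also have "... \<le> ?E n K" unfolding G_def by (intro sum_mono grad_squared_le K)
	  finally show "m K * ?W n K \<le> ?E n K" .
	qed
	also have "... = DIM('a) * energy n"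
	proof -
	  have "?E n K = DIM('a) * (\<Sigma> L. tau K L * (SU i. (V n L $ i - V n K $ i)^2))" for K
		unfolding sum_distrib_left by (subst sum.swap) simp
	  thus ?thesis unfolding energy_def by (simp add: sum_distrib_left)
	qed
	finally show "(\<Sigma> K. m K * ?W n K) \<le> DIM('a) * energy n" .
  qed (use dt_pos in \<open>auto intro: less_imp_le\<close>)
  also have "... = DIM('a) * (\<Sum>n=1..NT. dt n * energy n)" by (simp add: sum_distrib_left mult_ac)
  also have "... \<le> DIM('a) * (2 * CARD('n) * vol \<Omega> / c)" by (intro mult_left_mono energy_estimate) auto
  finally show "sq_norm Gr \<le> DIM('a) * (2 * CARD('n) * vol \<Omega> / c)" .
qed

lemma pw_Fv: "pw (\<lambda>n. Fv n i) z = (SU j. A $ i $ j *R (pw V z $ j *R Gr z $ i - pw V z $ i *R Gr z $ j))"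
proof -
  obtain s x where z: "z = (s, x)" by (cases z)
  show ?thesis
  proof (cases "\<exists>n K. in_cell n K s x")
	case True
	then obtain n K where nK: "in_cell n K s x" by blast
	show ?thesis unfolding z Gr_component pw_at[OF nK] by (simp only: Fv_def)
  next
	case False
	hence "pw V (s, x) = 0" "pw (\<lambda>n. Fv n i) (s, x) = 0" by (auto intro!: pw_nowhere)
	thus ?thesis unfolding z by simp
  qed
qed

lemma slice_consistency:
  assumes s: "0 < s" "s \<le> T" and \<psi>: "space_test \<Omega> \<psi> d\<psi> e B C"
  shows "abs ((LBINT x. pw V (s, x) $ i * d\<psi> x) + (LBINT x. (Gr (s, x) $ i \<bullet> e) * \<psi> x)) \<le> 4 * B * (mesh_size M * tstep jumps s)"
proof -
  have V: "pw V (s, x) $ i = sstep (\<lambda>K. V (idx s) K $ i) x" for x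
	unfolding pw_in[OF s] by (subst sstep_comp[where f = "\<lambda>v. v $ i"]) auto
  have G: "Gr (s, x) $ i = sstep (grad (\<lambda>K. V (idx s) K $ i)) x" for x unfolding Gr_component pw_in[OF s] G_def ..
  have "abs ((LBINT x. pw V (s, x) $ i * d\<psi> x) + (LBINT x. (Gr (s, x) $ i \<bullet> e) * \<psi> x))
	\<le> 4 * B * mesh_size M * jump_sum (\<lambda>K. V (idx s) K $ i)" unfolding V G by (rule gradient_consistency[OF \<psi>])
  also have "... \<le> 4 * B * mesh_size M * jumps (idx s)"
	using space_test.B[OF \<psi>] mesh_size_nonneg by (intro mult_left_mono jump_le_jumps) auto
  finally show ?thesis by (simp add: tstep_in[OF s] mult_ac)
qed

lemma integral_tstep_jumps: "integrable lborel (tstep jumps)" "(LBINT s. tstep jumps s) \<le> space_const" "0 \<le> tstep jumps s"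
  using integral_tstep[of jumps] sum_dt_jumps tstep_nonneg[of jumps] jumps_nonneg by auto

end

section \<open>Passage to the limit\<close>

definition cross_vec :: "real ^ 'n ^ 'n => real ^ 'n => 'a::euclidean_space ^ 'n => 'n => 'a" where
  "cross_vec A p b i = (SU j. A $ i $ j *R (p $ j *R b $ i - p $ i *R b $ j))"

lemma cross_vec_diff:
  "cross_vec A (p - q) b i = cross_vec A p b i - cross_vec A q b i"
  "cross_vec A p (b - b') i = cross_vec A p b i - cross_vec A p b' i"
  unfolding cross_vec_def sum_subtractf[symmetric] by (simp_all add: algebra_simps)

lemma cross_vec_sum: "cross_vec A p (\<Sum>k\<in>I. w k *R b k) i = (\<Sum>k\<in>I. w k *R cross_vec A p (b k) i)"
proof -
  have "(SU j. A $ i $ j *R (p $ j *R (\<Sum>k\<in>I. w k *R b k) $ i - p $ i *R (\<Sum>k\<in>I. w k *R b k) $ j))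
	= (SU j. \<Sum>k\<in>I. w k *R (A $ i $ j *R (p $ j *R b k $ i - p $ i *R b k $ j)))"
	by (simp add: sum_component scaleR_sum_right sum_subtractf[symmetric] algebra_simps)
  also have "... = (\<Sum>k\<in>I. w k *R (SU j. A $ i $ j *R (p $ j *R b k $ i - p $ i *R b k $ j)))"
	by (subst sum.swap) (simp add: scaleR_sum_right)
  finally show ?thesis unfolding cross_vec_def .
qed

lemma cross_vec_norm: "norm (cross_vec A p b i) \<le> 2 * (SU j. abs (A $ i $ j)) * (norm p * norm b)"
proof -
  have "norm (cross_vec A p b i) \<le> (SU j. abs (A $ i $ j) * (2 * (norm p * norm b)))" unfolding cross_vec_def
  proof (rule order_trans[OF norm_sum], rule sum_mono)
	fix j
	have c: "abs (p $ k) * norm (b $ l) \<le> norm p * norm b" for k l by (intro mult_mono component_le_norm_cart norm_nth_le) auto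
	have "norm (p $ j *R b $ i - p $ i *R b $ j) \<le> abs (p $ j) * norm (b $ i) + abs (p $ i) * norm (b $ j)"
	  using norm_triangle_ineq4[of "p $ j *R b $ i" "p $ i *R b $ j"] by simp
	also have "... \<le> 2 * (norm p * norm b)" using c[of j i] c[of i j] by simp
	finally show "norm (A $ i $ j *R (p $ j *R b $ i - p $ i *R b $ j)) \<le> abs (A $ i $ j) * (2 * (norm p * norm b))"
	  by (simp add: mult_left_mono)
  qed
  also have "... = 2 * (SU j. abs (A $ i $ j)) * (norm p * norm b)" unfolding sum_distrib_right[symmetric] by simp
  finally show ?thesis .
qed

lemma borel_measurable_vec_nth [measurable (raw)]:
  fixes f :: "_ => 'b::euclidean_space ^ 'n"
  assumes "f \<in> borel_measurable N" shows "(\<lambda>z. f z $ i) \<in> borel_measurable N"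
  by (rule measurable_compose[OF assms]) (intro borel_measurable_continuous_onI continuous_intros)

lemma cross_vec_measurable [measurable (raw)]:
  assumes [measurable]: "p \<in> borel_measurable N" "b \<in> borel_measurable N"
  shows "(\<lambda>z. cross_vec A (p z) (b z :: 'a::euclidean_space ^ 'n) i) \<in> borel_measurable N" unfolding cross_vec_def by measurable

text \<open>The bound on \<gamma> is asked only where b is nonzero, because test gradients are
  controlled only on a bounded set that contains the support of the discrete fields.\<close>

lemma cross_vec_integral:
  fixes \<gamma> :: "'b::euclidean_space => 'a::euclidean_space"
  assumes [measurable]: "q \<in> borel_measurable borel" "b \<in> borel_measurable borel" "\<gamma> \<in> borel_measurable borel"
	and int: "integrable lborel (\<lambda>z. norm (q z) * norm (b z))"
	and B: "0 \<le> B" "\<And>z. b z \<noteq> 0 ==> norm (\<gamma> z) \<le> B"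
  shows "integrable lborel (\<lambda>z. cross_vec A (q z) (b z) i \<bullet> \<gamma> z)"
	"abs (LBINT z. cross_vec A (q z) (b z) i \<bullet> \<gamma> z) \<le> 2 * (SU j. abs (A $ i $ j)) * B * (LBINT z. norm (q z) * norm (b z))"
proof -
  let ?k = "2 * (SU j. abs (A $ i $ j)) * B"
  let ?c = "\<lambda>z. cross_vec A (q z) (b z) i \<bullet> \<gamma> z" and ?n = "\<lambda>z. norm (q z) * norm (b z)"
  have k: "0 \<le> ?k" using B(1) by (simp add: sum_nonneg)
  have pt: "abs (?c z) \<le> ?k * ?n z" for z
  proof (cases "b z = 0")
	case True
	thus ?thesis by (simp add: cross_vec_def)
  next
	case False
	have "abs (?c z) \<le> norm (cross_vec A (q z) (b z) i) * norm (\<gamma> z)" by (rule Cauchy_Schwarz_ineq2)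
	also have "... \<le> (2 * (SU j. abs (A $ i $ j)) * ?n z) * B"
	  using B(2)[OF False] by (intro mult_mono cross_vec_norm mult_nonneg_nonneg sum_nonneg) auto
	finally show ?thesis by (simp add: mult_ac)
  qed
  have ik: "integrable lborel (\<lambda>z. ?k * ?n z)" using int by (rule integrable_mult_right)
  show i: "integrable lborel (\<lambda>z. ?c z)"
	by (rule integrable_bound[OF ik]) (use pt k in \<open>auto intro!: AE_I2 simp: abs_mult sum_nonneg B\<close>)
  show "abs (LBINT z. ?c z) \<le> ?k * (LBINT z. ?n z)" using integral_norm_bound_integral[OF i ik] pt by simp
qed

lemma integrable_bounded_times:
  fixes b :: "'b::euclidean_space => 'c::euclidean_space" and q :: "'b => 'd::euclidean_space"
  assumes [measurable]: "q \<in> borel_measurable borel" and "\<And>z. norm (q z) \<le> 1" and b: "integrable lborel b"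
  shows "integrable lborel (\<lambda>z. norm (q z) * norm (b z))"
proof (rule integrable_bound[OF b])
  have [measurable]: "b \<in> borel_measurable borel" using b by auto
  show "(\<lambda>z. norm (q z) * norm (b z)) \<in> borel_measurable lborel" by measurable
  show "AE z in lborel. norm (norm (q z) * norm (b z)) \<le> norm (b z)" using assms(2) by (intro AE_I2) (simp add: mult_left_le_one_le)
qed

locale fv_limit = fv_sequence \<Omega> M T NT t A astar U0 V c
  for \<Omega> :: "'a::euclidean_space set" and M T NT t and A :: "real ^ 'n ^ 'n" and astar U0 V c +
  fixes r :: "nat => nat" and U :: "real \<times> 'a => real ^ 'n" and N :: "nat => nat" and w :: "nat => nat => real"
	and g :: "real \<times> 'a => 'a ^ 'n"
  assumes r: "strict_mono r" and U_measurable [measurable]: "U \<in> borel_measurable borel"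
	and U_conv: "AE z in lborel. (\<lambda>m. u (r m) z) ----> U z"
	and U_norm: "\<And>z. norm (U z) \<le> 1" and U_out: "\<And>z. z \<notin> Q ==> U z = 0"
	and weights: "\<And>k. tail_weights k (N k) (w k)" and g_sq: "sq_integrable g"
	and g_out: "\<And>z. z \<notin> {0<..T} \<times> \<Omega> ==> g z = 0"
	and g_conv: "(\<lambda>k. sq_norm (\<lambda>z. (\<Sum>m\<le>N k. w k m *R fv_solution.Gr (M (r m)) (NT (r m)) (t (r m)) (V (r m)) z) - g z)) ----> 0"
begin

text \<open>Contains the time T, unlike \<open>Q\<close>, because the step functions live on (0,
  T].\<close>

definition S :: "(real \<times> 'a) set" where "S = {0<..T} \<times> \<Omega>"

abbreviation Gd :: "nat => real \<times> 'a => 'a ^ 'n" where "Gd m \<equiv> fv_solution.Gr (M m) (NT m) (t m) (V m)"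

definition P :: "nat => real \<times> 'a => 'a ^ 'n" where "P k z = (\<Sum>m\<le>N k. w k m *R Gd (r m) z)"

text \<open>The weights found for the gradients are applied to u as well; the consistency error is
  linear in the pair of function and gradient, so it carries over to \<open>p\<close> and
  \<open>P\<close>.\<close>

definition p :: "nat => real \<times> 'a => real ^ 'n" where "p k z = (\<Sum>m\<le>N k. w k m *R u (r m) z)"

lemma S_bounded: "bounded S" "S \<in> sets borel" unfolding S_def using domain by (auto intro!: bounded_Times borel_Times)

lemma S_integrable: "integrable lborel (\<lambda>z. indicator S z :: real)" using S_bounded by (rule integrable_indicator_bounded)

lemma g_measurable [measurable]: "g \<in> borel_measurable borel" using g_sq by (rule sq_integrable_measurable)

lemma Gd_measurable [measurable]: "Gd m \<in> borel_measurable borel" by (rule fv_solution.Gr_measurable[OF sol])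

lemma P_measurable [measurable]: "P k \<in> borel_measurable borel" unfolding P_def[abs_def] by measurable

lemma p_measurable [measurable]: "p k \<in> borel_measurable borel" unfolding p_def[abs_def] by measurable

lemma u_out: "z \<notin> S ==> u m z = 0"
proof -
  assume a: "z \<notin> S"
  obtain s x where z: "z = (s, x)" by (cases z)
  show ?thesis
  proof (cases "x \<in> \<Omega>")
	case True
	hence "\<not> (0 < s \<and> s \<le> T)" using a z by (auto simp: S_def)
	thus ?thesis unfolding z by (rule fv_solution.pw_out[OF sol])
  next
	case False
	thus ?thesis unfolding z by (rule fv_solution.pw_outside_domain[OF sol])
  qed
qed

lemma Gd_out: "z \<notin> S ==> Gd m z = 0" unfolding S_def by (rule fv_solution.Gr_out[OF sol])

lemma g_out': "z \<notin> S ==> g z = 0" unfolding S_def by (rule g_out)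

lemma U_out': "z \<notin> S ==> U z = 0" by (rule U_out) (auto simp: S_def)

lemma P_out: "z \<notin> S ==> P k z = 0" and p_out: "z \<notin> S ==> p k z = 0" unfolding P_def p_def by (simp_all add: Gd_out u_out)

lemma weights': "0 \<le> w k m" "(\<Sum>m\<le>N k. w k m) = 1" using weights by (auto simp: tail_weights_def)

lemma p_conv: "AE z in lborel. (\<lambda>k. p k z) ----> U z" using U_conv
proof eventually_elim
  case (elim z)
  have "norm (p k z - U z) \<le> (\<Sum>m\<le>N k. w k m * norm (u (r m) z - U z))" for k
  proof -
	have "p k z - U z = (\<Sum>m\<le>N k. w k m *R (u (r m) z - U z))"
	  unfolding p_def by (simp add: scaleR_diff_right sum_subtractf weights'(2) flip: scaleR_left.sum)
	thus ?thesis using norm_sum[of "\<lambda>m. w k m *R (u (r m) z - U z)" "{..N k}"] weights'(1) by simp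
  qed
  moreover have "(\<lambda>k. \<Sum>m\<le>N k. w k m * norm (u (r m) z - U z)) ----> 0"
	using elim by (intro tail_weights_tendsto_0[OF weights]) (simp add: LIM_zero tendsto_norm_zero)
  ultimately have "(\<lambda>k. p k z - U z) ----> 0" by (rule Lim_null_comparison[OF always_eventually, OF allI])
  thus ?case by (rule LIM_zero_cancel)
qed

lemma p_norm: "norm (p k z) \<le> 1"
proof -
  have "norm (p k z) \<le> (\<Sum>m\<le>N k. w k m * 1)"
	unfolding p_def using weights'(1) u_norm by (intro order_trans[OF norm_sum] sum_mono) (simp add: mult_left_le)
  thus ?thesis using weights'(2) by simp
qed

lemma dominated_on_S:
  fixes f :: "nat => real \<times> 'a => real"
  assumes [measurable]: "\<And>m. f m \<in> borel_measurable borel" "F \<in> borel_measurable borel"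
	and conv: "AE z in lborel. (\<lambda>m. f m z) ----> F z" and bd: "\<And>m z. z \<in> S ==> norm (f m z) \<le> C" and out: "\<And>m z. z \<notin> S ==> f m z = 0"
  shows "(\<lambda>m. (LBINT z. f m z)) ----> (LBINT z. F z)" "integrable lborel (f m)" "integrable lborel F"
proof -
  have b: "AE z in lborel. norm (f m z) \<le> C * indicator S z" for m
  proof (rule AE_I2)
	fix z show "norm (f m z) \<le> C * indicator S z"
	proof (cases "z \<in> S")
	  case True
	  thus ?thesis using bd[OF True, of m] by (simp only: indicator_simps mult_1_right)
	next
	  case False
	  thus ?thesis using out[OF False, of m] False by simp
	qed
  qed
  have i: "integrable lborel (\<lambda>z. C * indicator S z)" using S_integrable by simp
  show "(\<lambda>m. (LBINT z. f m z)) ----> (LBINT z. F z)" by (rule integral_dominated_convergence[OF _ _ i conv b]) auto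
  show "integrable lborel (f m)" by (rule integrable_dominated_convergence2[OF _ _ i conv b]) auto
  show "integrable lborel F" by (rule integrable_dominated_convergence[OF _ _ i conv b]) auto
qed

lemma diff_bound: "norm a \<le> 1 ==> norm b \<le> 1 ==> norm (a - b :: real ^ 'n) \<le> 2" using norm_triangle_ineq4[of a b] by simp

lemma p_L1: "(\<lambda>k. (LBINT z. norm (p k z - U z))) ----> 0" "integrable lborel (\<lambda>z. norm (p k z - U z))"
proof -
  have c: "AE z in lborel. (\<lambda>k. norm (p k z - U z)) ----> 0" using p_conv by eventually_elim (simp add: LIM_zero tendsto_norm_zero)
  have meas: "(\<lambda>z. norm (p k z - U z)) \<in> borel_measurable borel" "(\<lambda>z :: real \<times> 'a. 0 :: real) \<in> borel_measurable borel" for k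
	by measurable
  have b: "norm (norm (p k z - U z)) \<le> 2" for k z using diff_bound[OF p_norm U_norm] by simp
  have out: "z \<notin> S ==> norm (p k z - U z) = 0" for k z by (simp add: p_out U_out')
  show "(\<lambda>k. (LBINT z. norm (p k z - U z))) ----> 0" using dominated_on_S(1)[OF meas c b out] by simp
  show "integrable lborel (\<lambda>z. norm (p k z - U z))" by (rule dominated_on_S(2)[OF meas c b out])
qed

lemma u_sq:
  "sq_integrable (\<lambda>z. u m z - U z)" "(\<lambda>m. sq_norm (\<lambda>z. u (r m) z - U z)) ----> 0"
proof -
  have c: "AE z in lborel. (\<lambda>m. (norm (u (r m) z - U z))^2) ----> 0"
	using U_conv by eventually_elim (auto intro!: tendsto_eq_intros simp: LIM_zero)
  have b: "(norm (u m z - U z))^2 \<le> 4" for m z using power_mono[OF diff_bound[OF u_norm U_norm], of m z z 2] by simp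
  have meas: "(\<lambda>z. (norm (u m z - U z))^2) \<in> borel_measurable borel" "(\<lambda>z :: real \<times> 'a. 0 :: real) \<in> borel_measurable borel" for m
	by measurable
  have b': "norm ((norm (u m z - U z))^2) \<le> 4" for m z using b by simp
  have out: "z \<notin> S ==> (norm (u m z - U z))^2 = 0" for m z by (simp add: u_out U_out')
  show "(\<lambda>m. sq_norm (\<lambda>z. u (r m) z - U z)) ----> 0" unfolding sq_norm_def using dominated_on_S(1)[OF meas c b' out] by simp
  have "integrable lborel (\<lambda>z. (norm (u m z - U z))^2)"
  proof (rule integrable_bound)
	show "integrable lborel (\<lambda>z. 4 * indicator S z :: real)" using S_integrable by simp
	show "AE z in lborel. norm ((norm (u m z - U z))^2) \<le> norm (4 * indicator S z :: real)"
	proof (rule AE_I2)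
	  fix z show "norm ((norm (u m z - U z))^2) \<le> norm (4 * indicator S z :: real)"
	  proof (cases "z \<in> S")
		case True
		hence "indicator S z = (1 :: real)" by (rule indicator_simps)
		thus ?thesis using b[of m z] by simp
	  next
		case False
		show ?thesis by (simp only: u_out[OF False] U_out'[OF False]) simp
	  qed
	qed
  qed measurable
  thus "sq_integrable (\<lambda>z. u m z - U z)" by (simp add: sq_integrable_def)
qed

lemma Gd_sq: "sq_integrable (Gd m)" "sq_norm (Gd m) \<le> DIM('a) * (2 * CARD('n) * vol \<Omega> / c)" using fv_solution.Gr_sq[OF sol] by auto

lemma P_sq: "sq_integrable (P k)" unfolding P_def[abs_def] by (intro sq_integrable_sum sq_integrable_scaleR Gd_sq)

lemma P_L1: "(\<lambda>k. LBINT z. norm (P k z - g z)) ----> 0" "integrable lborel (\<lambda>z. norm (P k z - g z))"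
proof -
  note d = sq_integrable_imp_integrable[OF S_bounded sq_integrable_diff[OF P_sq g_sq]]
  let ?C = "sqrt (sq_norm (indicator S :: real \<times> 'a => real))"
  show "integrable lborel (\<lambda>z. norm (P k z - g z))" by (rule integrable_norm[OF d(1)]) (simp add: P_out g_out')
  have lim: "(\<lambda>k. ?C * sqrt (sq_norm (\<lambda>z. P k z - g z))) ----> 0"
	using tendsto_mult_left[OF tendsto_real_sqrt[OF g_conv], of ?C] unfolding P_def by simp
  have le: "norm (LBINT z. norm (P k z - g z)) \<le> ?C * sqrt (sq_norm (\<lambda>z. P k z - g z))" for k
	using d(2)[of k] by (simp add: P_out g_out')
  show "(\<lambda>k. LBINT z. norm (P k z - g z)) ----> 0" by (rule Lim_null_comparison[OF always_eventually[OF allI] lim]) (rule le)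
qed

lemma g_integrable: "integrable lborel g" by (rule sq_integrable_imp_integrable(1)[OF S_bounded g_sq g_out'])

lemma Gd_integrable: "integrable lborel (Gd m)" unfolding fv_solution.Gr_def[OF sol] by (rule fv_solution.integrable_pw[OF sol])

lemma P_integrable: "integrable lborel (P k)" unfolding P_def[abs_def] by (intro integrable_sum integrable_scaleR_right Gd_integrable)

text \<open>Only the gradient factor of the flux is averaged. Replacing u by U costs an L2 norm
  tending to 0 times the bounded L2 norm of the gradients. The resulting functional H is linear and
  tends to X + X0 along the gradients themselves, hence along their convex combinations, which
  converge to g.\<close>

lemma weak_equation:
  assumes "test_bounds T R B \<phi> \<phi>t \<gamma>" and R: "\<Omega> \<subseteq> cball 0 R" and final: "\<And>x. x \<in> \<Omega> ==> \<phi> (T, x) = 0"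
  shows "- (LBINT z. U z $ i * \<phi>t z) - (\<integral>x. U0 x $ i * \<phi> (0, x) \<partial>lebesgue_on \<Omega>)
	+ (LBINT z. cross_vec A (U z) (g z) i \<bullet> \<gamma> z) = 0"
proof -
  interpret test_bounds T R B \<phi> \<phi>t \<gamma> by fact
  note [measurable] = test_measurable
  have SZ: "z \<in> {0..T} \<times> cball 0 R" if "z \<in> S" for z using that R unfolding S_def by (cases z) auto
  have \<gamma>b: "norm (\<gamma> z) \<le> B" if "z \<in> S" for z using SZ[OF that] by (rule g_bound)
  have \<gamma>Gd: "norm (\<gamma> z) \<le> B" if "Gd m z \<noteq> 0" for m z using Gd_out[of z m] that \<gamma>b by blast
  let ?a = "SU j. abs (A $ i $ j)"
  let ?c = "fv_solution.residual_const \<Omega> T A astar c" and ?C = "DIM('a) * (2 * CARD('n) * vol \<Omega> / c)"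
  let ?h = "\<lambda>m. B * (mesh_size (M m) + time_step (NT m) (t m))" and ?s = "\<lambda>m. sqrt (sq_norm (\<lambda>z. u (r m) z - U z))"
  let ?G = "\<lambda>m. (LBINT z. norm (u (r m) z - U z) * norm (Gd (r m) z))"
  define X0 where "X0 = (\<integral>x. U0 x $ i * \<phi> (0, x) \<partial>lebesgue_on \<Omega>)"
  define X where "X = (LBINT z. U z $ i * \<phi>t z)"
  define F where "F m = (LBINT z. cross_vec A (u m z) (Gd m z) i \<bullet> \<gamma> z)" for m
  define H where "H b = (LBINT z. cross_vec A (U z) (b z) i \<bullet> \<gamma> z)" for b
  have Hint: "integrable lborel (\<lambda>z. cross_vec A (U z) (b z) i \<bullet> \<gamma> z)"
	and Hbound: "abs (H b) \<le> 2 * ?a * B * (LBINT z. norm (b z))" if b: "integrable lborel b" and out: "\<And>z. z \<notin> S ==> b z = 0" for b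
  proof -
	have [measurable]: "b \<in> borel_measurable borel" using b by auto
	have j: "integrable lborel (\<lambda>z. norm (U z) * norm (b z))" by (rule integrable_bounded_times[OF U_measurable U_norm b])
	have \<gamma>: "norm (\<gamma> z) \<le> B" if "b z \<noteq> 0" for z using out[of z] that \<gamma>b by blast
	show "integrable lborel (\<lambda>z. cross_vec A (U z) (b z) i \<bullet> \<gamma> z)"
	  by (rule cross_vec_integral(1)[OF _ _ _ j B \<gamma>]) measurable
	have "abs (H b) \<le> 2 * ?a * B * (LBINT z. norm (U z) * norm (b z))"
	  unfolding H_def by (rule cross_vec_integral(2)[OF _ _ _ j B \<gamma>]) measurable
	also have "... \<le> 2 * ?a * B * (LBINT z. norm (b z))"
	proof (intro mult_left_mono integral_mono j)
	  show "norm (U z) * norm (b z) \<le> norm (b z)" for z using U_norm[of z] by (simp add: mult_left_le_one_le)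
	qed (use b B in \<open>auto intro: sum_nonneg\<close>)
	finally show "abs (H b) \<le> 2 * ?a * B * (LBINT z. norm (b z))" .
  qed
  have Hdiff: "H b - H b' = H (\<lambda>z. b z - b' z)"
	if "integrable lborel b" "\<And>z. z \<notin> S ==> b z = 0" "integrable lborel b'" "\<And>z. z \<notin> S ==> b' z = 0" for b b'
	unfolding H_def cross_vec_diff inner_diff_left using that by (intro integral_diff[symmetric] Hint)
  have residual: "abs (- (LBINT z. u m z $ i * \<phi>t z) - X0 + F m) \<le> ?h m * ?c" for m
  proof -
	interpret fv_solution \<Omega> "M m" T "NT m" "t m" A astar U0 "V m" c by (rule sol)
	have "F m = (LBINT z. pw (\<lambda>n. Fv n i) z \<bullet> \<gamma> z)" unfolding F_def pw_Fv cross_vec_def ..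
	thus ?thesis using residual_bound[OF assms(1) R final, of i] unfolding X0_def by simp
  qed
  have res_lim: "(\<lambda>m. - (LBINT z. u (r m) z $ i * \<phi>t z) - X0 + F (r m)) ----> 0"
  proof (rule Lim_null_comparison[OF always_eventually[OF allI]])
	show "norm (- (LBINT z. u (r m) z $ i * \<phi>t z) - X0 + F (r m)) \<le> ?h (r m) * ?c" for m using residual[of "r m"] by simp
	have "(\<lambda>m. ?h m * ?c)
	  ----> B * (0 + 0) * ?c" by (intro tendsto_intros mesh_fine time_fine)
	from LIMSEQ_subseq_LIMSEQ[OF this r]
	show "(\<lambda>m. ?h (r m) * ?c) ----> 0" by (simp add: o_def)
  qed
  have ut_lim: "(\<lambda>m. (LBINT z. u (r m) z $ i * \<phi>t z)) ----> X"
  proof -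
	have "0 \<in> {0..T}" using domain(3) by simp
	\<comment> \<open>Only a Lipschitz bound for \<phi>t is at hand; together with its value at one
	  point z0 it bounds \<phi>t on the bounded set S.\<close>
	obtain z0 where z0: "S \<noteq> {} ==> z0 \<in> S" by blast
	obtain D where D: "\<And>z. z \<in> S ==> norm z \<le> D" using S_bounded(1) bounded_iff by blast
	have \<phi>tb: "abs (\<phi>t z) \<le> abs (\<phi>t z0) + B * (D + D)" if z: "z \<in> S" for z
	proof -
	  have z0': "z0 \<in> S" using z0 z by auto
	  have "abs (\<phi>t z - \<phi>t z0) \<le> B * dist z z0" using SZ[OF z] SZ[OF z0'] by (rule lip_t)
	  also have "... \<le> B * (D + D)" using D[OF z] D[OF z0'] norm_triangle_ineq4[of z z0] B by (intro mult_left_mono) (auto simp: dist_norm)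
	  finally show ?thesis by linarith
	qed
	have meas: "(\<lambda>z. u (r m) z $ i * \<phi>t z) \<in> borel_measurable borel" "(\<lambda>z. U z $ i * \<phi>t z) \<in> borel_measurable borel" for m
	  by measurable
	have c: "AE z in lborel. (\<lambda>m. u (r m) z $ i * \<phi>t z) ----> U z $ i * \<phi>t z"
	  using U_conv by eventually_elim (intro tendsto_intros)
	have b: "norm (u (r m) z $ i * \<phi>t z) \<le> 1 * (abs (\<phi>t z0) + B * (D + D))" if "z \<in> S" for m z unfolding real_norm_def abs_mult
	  using \<phi>tb[OF that] order_trans[OF component_le_norm_cart u_norm, of "r m" z i] by (intro mult_mono) auto
	have out: "z \<notin> S ==> u (r m) z $ i * \<phi>t z = 0" for m z by (simp add: u_out)
	show ?thesis unfolding X_def by (rule dominated_on_S(1)[OF meas c b out])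
  qed
  have F_lim: "(\<lambda>m. F (r m)) ----> X + X0" using tendsto_add[OF res_lim tendsto_add[OF ut_lim tendsto_const[of X0]]] by simp
  have FH: "(\<lambda>m. F (r m) - H (Gd (r m))) ----> 0"
  proof (rule Lim_null_comparison[OF always_eventually[OF allI]])
	fix m
	have iu: "integrable lborel (\<lambda>z. cross_vec A (u (r m) z) (Gd (r m) z) i \<bullet> \<gamma> z)"
	  by (rule cross_vec_integral(1)[OF _ _ _ integrable_bounded_times[OF u_measurable u_norm Gd_integrable] B \<gamma>Gd]) measurable
	have "F (r m) - H (Gd (r m)) = (LBINT z. cross_vec A (u (r m) z - U z) (Gd (r m) z) i \<bullet> \<gamma> z)"
	  unfolding F_def H_def cross_vec_diff inner_diff_left by (rule integral_diff[symmetric, OF iu Hint[OF Gd_integrable Gd_out]])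
	moreover have "abs (...) \<le> 2 * ?a * B * ?G m"
	  by (rule cross_vec_integral(2)[OF _ _ _ Cauchy_Schwarz_sq_norm(1)[OF u_sq(1) Gd_sq(1)] B \<gamma>Gd]) measurable
	moreover have "... \<le> 2 * ?a * B * (?s m * sqrt ?C)"
	proof (rule mult_left_mono)
	  have "?G m \<le> ?s m * sqrt (sq_norm (Gd (r m)))" by (rule Cauchy_Schwarz_sq_norm(2)[OF u_sq(1) Gd_sq(1)])
	  also have "... \<le> ?s m * sqrt ?C" using Gd_sq(2) by (intro mult_left_mono) (auto simp: sq_norm_nonneg)
	  finally show "?G m \<le> ?s m * sqrt ?C" .
	qed (use B in \<open>auto intro: sum_nonneg\<close>)
	ultimately show "norm (F (r m) - H (Gd (r m))) \<le> 2 * ?a * B * (?s m * sqrt ?C)" unfolding real_norm_def by (simp only:)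
  next
	have "(\<lambda>m. 2 * ?a * B * (?s m * sqrt ?C))
	  ----> 2 * ?a * B * (sqrt 0 * sqrt ?C)" by (intro tendsto_intros u_sq(2))
	thus "(\<lambda>m. 2 * ?a * B * (?s m * sqrt ?C)) ----> 0" by simp
  qed
  have H_lim: "(\<lambda>m. H (Gd (r m)) - (X + X0)) ----> 0" using tendsto_diff[OF tendsto_diff[OF F_lim FH] tendsto_const[of "X + X0"]] by simp
  \<comment> \<open>H is linear and the weights sum to 1, so the constant X + X0 passes through the
    combination unchanged.\<close>
  have HP: "(\<Sum>m\<le>N k. w k m * (H (Gd (r m)) - (X + X0))) = H (P k) - (X + X0)" for k
  proof -
	have "H (P k) = (LBINT z. (\<Sum>m\<le>N k. w k m * (cross_vec A (U z) (Gd (r m) z) i \<bullet> \<gamma> z)))"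
	  unfolding H_def P_def cross_vec_sum inner_sum_left by simp
	also have "... = (\<Sum>m\<le>N k. w k m * H (Gd (r m)))" unfolding H_def using Hint[OF Gd_integrable Gd_out] by (simp add: integral_sum)
	finally show ?thesis using weights'(2)[of k] by (simp add: right_diff_distrib sum_subtractf flip: sum_distrib_right)
  qed
  have "(\<lambda>k. H (P k) - (X + X0)) ----> 0" using tail_weights_tendsto_0[OF weights H_lim] unfolding HP .
  moreover have "(\<lambda>k. H (P k) - H g) ----> 0"
  proof (rule Lim_null_comparison[OF always_eventually[OF allI]])
	show "norm (H (P k) - H g) \<le> 2 * ?a * B * (LBINT z. norm (P k z - g z))" for k
	proof -
	  have eq: "H (P k) - H g = H (\<lambda>z. P k z - g z)" by (rule Hdiff[OF P_integrable P_out g_integrable g_out'])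
	  show ?thesis unfolding eq real_norm_def
	  proof (rule Hbound)
		show "integrable lborel (\<lambda>z. P k z - g z)" using P_integrable g_integrable by (rule integrable_diff)
		show "z \<notin> S ==> P k z - g z = 0" for z by (simp add: P_out g_out')
	  qed
	qed
	show "(\<lambda>k. 2 * ?a * B * (LBINT z. norm (P k z - g z))) ----> 0" using tendsto_mult_left[OF P_L1(1), of "2 * ?a * B"] by simp
  qed
  ultimately have "(\<lambda>k. H g - (X + X0)) ----> 0"
	using tendsto_diff[of "\<lambda>k. H (P k) - (X + X0)" 0 sequentially "\<lambda>k. H (P k) - H g" 0] by (simp add: algebra_simps)
  hence "H g = X + X0" by (simp add: tendsto_const_iff)
  thus ?thesis unfolding H_def X_def X0_def by simp
qed

end

section \<open>The weak gradient of the limit on time slices\<close>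

lemma integral_lebesgue_on_borel:
  fixes f :: "'b::euclidean_space => real"
  assumes [measurable]: "S \<in> sets borel" "f \<in> borel_measurable borel"
  shows "(\<integral>x. f x \<partial>lebesgue_on S) = (LBINT x. indicator S x * f x)"
proof -
  have "(\<integral>x. f x \<partial>lebesgue_on S) = (\<integral>x. indicator S x * f x \<partial>lebesgue)"
	using integral_restrict_space[of S lebesgue f] by simp
  also have "... = (LBINT x. indicator S x * f x)" by (rule integral_completion) measurable
  finally show ?thesis .
qed

lemma integrable_lebesgue_on_borel:
  fixes f :: "'b::euclidean_space => real"
  assumes "S \<in> sets borel" and f: "integrable lborel f"
  shows "integrable (lebesgue_on S) f"
proof -
  have [measurable]: "f \<in> borel_measurable borel" using f by auto
  have "integrable lebesgue f" using f by (subst integrable_completion) auto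
  hence "integrable lebesgue (\<lambda>x. indicator S x *R f x)" using assms(1) by (intro integrable_mult_indicator) auto
  thus ?thesis using assms(1) by (simp add: integrable_restrict_space)
qed

lemma in_L2_borel:
  fixes f :: "'b::euclidean_space => 'c::euclidean_space"
  assumes "S \<in> sets borel" "f \<in> borel_measurable borel" "integrable lborel (\<lambda>x. (norm (f x))^2)"
  shows "in_L2 S f" unfolding in_L2_def using assms integrable_lebesgue_on_borel
  by (auto intro!: measurable_restrict_space1 measurable_completion)

lemma integrable_vec_component:
  fixes f :: "'b => 'c::euclidean_space ^ 'n"
  shows "integrable N f ==> integrable N (\<lambda>x. f x $ i)" by (rule integrable_bounded_linear[OF bounded_linear_vec_nth])

lemma (in fv_solution) integrable_pw_slice:
  fixes W' :: "nat => 'a set => 'c::euclidean_space"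
  shows "integrable lborel (\<lambda>x. pw W' (s, x))"
proof (cases "0 < s \<and> s \<le> T")
  case True
  thus ?thesis by (simp add: pw_in integral_sstep)
next
  case False
  show ?thesis by (simp only: pw_out[OF False]) simp
qed

context fv_limit
begin

text \<open>The consistency error at time s of the k-th convex combination, up to a factor that
  depends on the test function.\<close>

definition E :: "nat => real => real" where
  "E k s = (\<Sum>m\<le>N k. w k m * (mesh_size (M (r m)) *
	 fv_solution.tstep (NT (r m)) (t (r m)) (fv_solution.jumps (M (r m)) (V (r m))) s))"

lemma mesh_size_nonneg': "0 \<le> mesh_size (M m)"
proof -
  interpret fv_solution \<Omega> "M m" T "NT m" "t m" A astar U0 "V m" c by (rule sol)
  show ?thesis by (rule mesh_size_nonneg)
qed

lemma E: "integrable lborel (E k)" "0 \<le> E k s" "(\<lambda>k. (LBINT s. E k s)) ----> 0"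
proof -
  let ?j = "\<lambda>m. fv_solution.tstep (NT m) (t m) (fv_solution.jumps (M m) (V m))"
  note j = fv_solution.integral_tstep_jumps[OF sol]
  show int: "integrable lborel (E k)" for k unfolding E_def[abs_def] using j(1) by (intro integrable_sum integrable_mult_right)
  show nn: "0 \<le> E k s" for k s unfolding E_def using j(3) mesh_size_nonneg' weights'(1) by (intro sum_nonneg mult_nonneg_nonneg)
  interpret s0: fv_solution \<Omega> "M 0" T "NT 0" "t 0" A astar U0 "V 0" c by (rule sol)
  have le: "(LBINT s. E k s) \<le> (\<Sum>m\<le>N k. w k m * (mesh_size (M (r m)) * s0.space_const))" for k
  proof -
	have "(LBINT s. E k s) = (\<Sum>m\<le>N k. w k m * (mesh_size (M (r m)) * (LBINT s. ?j (r m) s)))"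
	  unfolding E_def using j(1) by (simp add: integral_sum)
	also have "... \<le> (\<Sum>m\<le>N k. w k m * (mesh_size (M (r m)) * s0.space_const))"
	  using j(2) mesh_size_nonneg' weights'(1) by (intro sum_mono mult_left_mono) auto
	finally show ?thesis .
  qed
  have "(\<lambda>m. mesh_size (M (r m)) * s0.space_const) ----> 0"
	using tendsto_mult_right[OF LIMSEQ_subseq_LIMSEQ[OF mesh_fine r], of s0.space_const] by (simp add: o_def)
  from tail_weights_tendsto_0[OF weights this]
  show "(\<lambda>k. (LBINT s. E k s)) ----> 0"
  proof (rule Lim_null_comparison[OF always_eventually[OF allI], rotated])
	show "norm (LBINT s. E k s) \<le> (\<Sum>m\<le>N k. w k m * (mesh_size (M (r m)) * s0.space_const))" for k
	  using le[of k] nn integral_nonneg_AE[of "E k" lborel] by simp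
  qed
qed

abbreviation err :: "nat => real \<times> 'a => real" where
  "err k z \<equiv> norm (p k z - U z) + norm (P k z - g z)"

text \<open>Records what the weak gradient identity at time s requires, with errors measured in
  norms that involve no test function.\<close>

definition good_slice :: "(nat => nat) => real => bool" where
  "good_slice q s \<longleftrightarrow> (\<lambda>l. (LBINT x. err (q l) (s, x)) + E (q l) s) ----> 0
	\<and> (\<forall>k. integrable lborel (\<lambda>x. err k (s, x)))
	\<and> integrable lborel (\<lambda>x. g (s, x)) \<and> integrable lborel (\<lambda>x. (norm (g (s, x)))^2)"

text \<open>Errors that vanish in L1 over space and time vanish along a subsequence on almost every
  slice. As no test function enters, one null set of times is excluded for all of them.\<close>

lemma AE_good_slice: obtains q where "AE s in lborel. good_slice q s"
proof -
  have dint: "integrable (lborel \<Otimes>\<^sub>M lborel) (err k)" for k unfolding lborel_prod using p_L1(2) P_L1(2) by (rule integrable_add)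
  define D where "D k s = (LBINT x. err k (s, x)) + E k s" for k s
  have Dint: "integrable lborel (D k)" for k unfolding D_def[abs_def] using lborel_pair.integrable_fst'[OF dint] E(1) by (rule integrable_add)
  have Dnn: "norm (D k s) = D k s" for k s
  proof -
	have "0 \<le> (LBINT x. err k (s, x))" by (rule integral_nonneg) simp
	thus ?thesis unfolding D_def using E(2)[of k s] by simp
  qed
  have "(LBINT s. norm (D k s)) = ((LBINT z. norm (p k z - U z)) + (LBINT z. norm (P k z - g z))) + (LBINT s. E k s)" for k
  proof -
	have "(LBINT s. norm (D k s)) = (LBINT s. (LBINT x. err k (s, x))) + (LBINT s. E k s)"
	  unfolding Dnn unfolding D_def using lborel_pair.integrable_fst'[OF dint] E(1) by (rule integral_add)
	also have "(LBINT s. (LBINT x. err k (s, x))) = (LBINT z. err k z)" using lborel_pair.integral_fst'[OF dint] unfolding lborel_prod .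
	also have "... = (LBINT z. norm (p k z - U z)) + (LBINT z. norm (P k z - g z))" using p_L1(2) P_L1(2) by (rule integral_add)
	finally show ?thesis .
  qed
  hence "(\<lambda>k. (LBINT s. norm (D k s))) ----> 0" using tendsto_add[OF tendsto_add[OF p_L1(1) P_L1(1)] E(3)] by simp
  from tendsto_L1_AE_subseq[OF Dint this] obtain q where q: "AE s in lborel. (\<lambda>l. D (q l) s) ----> 0" by blast
  have a: "AE s in lborel. \<forall>k. integrable lborel (\<lambda>x. err k (s, x))"
	unfolding AE_all_countable using lborel_pair.AE_integrable_fst'[OF dint] by blast
  have b: "AE s in lborel. integrable lborel (\<lambda>x. g (s, x))"
	using g_integrable by (intro lborel_pair.AE_integrable_fst') (simp add: lborel_prod)
  have c: "AE s in lborel. integrable lborel (\<lambda>x. (norm (g (s, x)))^2)"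
	using g_sq by (intro lborel_pair.AE_integrable_fst'[of "\<lambda>z. (norm (g z))^2"]) (simp add: lborel_prod sq_integrable_def)
  show thesis
  proof (rule that)
	show "AE s in lborel. good_slice q s" using q a b c unfolding D_def by eventually_elim (simp only: good_slice_def simp_thms)
  qed
qed

lemma slice_measurable [measurable]:
  "(\<lambda>x. U (s, x)) \<in> borel_measurable borel" "(\<lambda>x. g (s, x)) \<in> borel_measurable borel"
  "(\<lambda>x. p k (s, x)) \<in> borel_measurable borel" "(\<lambda>x. P k (s, x)) \<in> borel_measurable borel"
  by (rule measurable_compose[of _ _ borel], intro borel_measurable_continuous_onI continuous_intros, measurable)+

text \<open>Convex combinations satisfy the linear discrete identity up to 4 B E. Passing from them
  to U and g costs B + P0 times the L1 distance on the slice; 5 B + P0 dominates both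
  factors.\<close>

lemma weak_gradient_slice:
  assumes s: "0 < s" "s \<le> T" and "good_slice q s" and "space_test \<Omega> \<psi> d\<psi> e B C"
  shows "(LBINT x. U (s, x) $ i * d\<psi> x) + (LBINT x. (g (s, x) $ i \<bullet> e) * \<psi> x) = 0"
proof -
  have q: "(\<lambda>l. (LBINT x. err (q l) (s, x)) + E (q l) s) ----> 0" and dint: "\<And>k. integrable lborel (\<lambda>x. err k (s, x))"
	and gint: "integrable lborel (\<lambda>x. g (s, x))" using assms(3) by (auto simp: good_slice_def)
  interpret space_test \<Omega> \<psi> d\<psi> e B C by fact
  obtain P0 where P0: "0 \<le> P0" "\<And>x. abs (\<psi> x) \<le> P0" using psi_bounded by blast
  have um: "integrable lborel (\<lambda>x. u m (s, x))" "integrable lborel (\<lambda>x. Gd m (s, x))" for m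
	unfolding fv_solution.Gr_def[OF sol] by (rule fv_solution.integrable_pw_slice[OF sol])+
  have iu: "integrable lborel (\<lambda>x. f x $ i * d\<psi> x)" if "integrable lborel f" for f :: "'a => real ^ 'n"
	using integrable_vec_component[OF that] by (rule integrable_times_bounded[OF _ _ dpsi_bound]) measurable
  have ig: "integrable lborel (\<lambda>x. (f x $ i \<bullet> e) * \<psi> x)" if "integrable lborel f" for f :: "'a => 'a ^ 'n"
	by (rule integrable_times_bounded[OF _ _ P0(2)]) (auto intro!: integrable_inner_left integrable_vec_component that)
  have pint: "integrable lborel (\<lambda>x. p k (s, x))" "integrable lborel (\<lambda>x. P k (s, x))" for k
	unfolding p_def P_def using um by (auto intro!: integrable_sum)
  have Uint: "integrable lborel (\<lambda>x. U (s, x))"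
  proof -
	have "integrable lborel (\<lambda>x. norm (p 0 (s, x) - U (s, x)))" by (rule integrable_bound[OF dint[of 0]]) auto
	hence "integrable lborel (\<lambda>x. p 0 (s, x) - U (s, x))" by (subst (asm) integrable_norm_iff) auto
	from integrable_diff[OF pint(1)[of 0] this] show ?thesis by simp
  qed
  let ?I = "\<lambda>a b. (LBINT x. a x $ i * d\<psi> x) + (LBINT x. (b x $ i \<bullet> e) * \<psi> x)"
  define X where "X = ?I (\<lambda>x. U (s, x)) (\<lambda>x. g (s, x))"
  let ?d = "\<lambda>k. LBINT x. err k (s, x)"
  have bound: "abs X \<le> (5 * B + P0) * (?d k + E k s)" for k
  proof -
	define Y where "Y = ?I (\<lambda>x. p k (s, x)) (\<lambda>x. P k (s, x))"
	let ?y = "\<lambda>m. ?I (\<lambda>x. u m (s, x)) (\<lambda>x. Gd m (s, x))"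
	let ?j = "\<lambda>m. mesh_size (M m) * fv_solution.tstep (NT m) (t m) (fv_solution.jumps (M m) (V m)) s"
	have "Y = (LBINT x. (\<Sum>m\<le>N k. w k m * (u (r m) (s, x) $ i * d\<psi> x))) + (LBINT x. (\<Sum>m\<le>N k. w k m * ((Gd (r m) (s, x) $ i \<bullet> e) * \<psi> x)))"
	  unfolding Y_def p_def P_def by (simp add: sum_component sum_distrib_right inner_sum_left mult.assoc)
	also have "... = (\<Sum>m\<le>N k. w k m * ?y (r m))" using iu[OF um(1)] ig[OF um(2)] by (simp add: integral_sum sum.distrib distrib_left)
	finally have Y: "Y = (\<Sum>m\<le>N k. w k m * ?y (r m))" .
	have "abs Y \<le> (\<Sum>m\<le>N k. w k m * (4 * B * ?j (r m)))" unfolding Y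
	proof (rule order_trans[OF sum_abs], rule sum_mono)
	  fix m
	  from fv_solution.slice_consistency[OF sol s assms(4), of "r m" i]
	  show "abs (w k m * ?y (r m)) \<le> w k m * (4 * B * ?j (r m))" unfolding abs_mult using weights'(1)[of k m] by (simp add: mult_left_mono)
	qed
	also have "... = 4 * B * E k s" unfolding E_def sum_distrib_left by (intro sum.cong) (simp_all add: mult_ac)
	finally have Yb: "abs Y \<le> 4 * B * E k s" .
	let ?v = "\<lambda>x. p k (s, x) - U (s, x)" and ?V = "\<lambda>x. P k (s, x) - g (s, x)"
	let ?z = "\<lambda>x. ?v x $ i * d\<psi> x + (?V x $ i \<bullet> e) * \<psi> x"
	have YX: "Y - X = (LBINT x. ?z x)" unfolding Y_def X_def using iu[OF pint(1)] iu[OF Uint] ig[OF pint(2)] ig[OF gint]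
	  by (simp add: left_diff_distrib inner_diff_left)
	have "norm (LBINT x. ?z x) \<le> (LBINT x. (B + P0) * err k (s, x))"
	proof (rule integral_norm_bound_integral)
	  show "integrable lborel (\<lambda>x. ?z x)" by (intro integrable_add iu ig integrable_diff pint Uint gint)
	  show "integrable lborel (\<lambda>x. (B + P0) * err k (s, x))" using dint by (rule integrable_mult_right)
	  fix x
	  have 1: "abs (?v x $ i * d\<psi> x) \<le> norm (?v x) * B"
		unfolding abs_mult using dpsi_bound by (intro mult_mono component_le_norm_cart) auto
	  have "abs (?V x $ i \<bullet> e) \<le> norm (?V x $ i) * norm e" by (rule Cauchy_Schwarz_ineq2)
	  also have "... \<le> norm (?V x) * 1" using e by (intro mult_mono norm_nth_le) auto
	  finally have 2: "abs ((?V x $ i \<bullet> e) * \<psi> x) \<le> norm (?V x) * P0" unfolding abs_mult using P0 by (intro mult_mono) auto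
	  have "norm (?z x) \<le> norm (?v x) * B + norm (?V x) * P0" using 1 2 unfolding real_norm_def by linarith
	  also have "... \<le> norm (?v x) * (B + P0) + norm (?V x) * (B + P0)" using B P0(1) by (intro add_mono mult_left_mono) auto
	  finally show "norm (?z x) \<le> (B + P0) * err k (s, x)" by (simp add: algebra_simps)
	qed
	hence "abs (Y - X) \<le> (B + P0) * ?d k" unfolding YX by simp
	hence "abs X \<le> (B + P0) * ?d k + 4 * B * E k s" using Yb by linarith
	also have "... \<le> (5 * B + P0) * ?d k + (5 * B + P0) * E k s" using B P0(1) E(2) by (intro add_mono mult_right_mono integral_nonneg) auto
	finally show ?thesis by (simp add: distrib_left)
  qed
  have "(\<lambda>l. (5 * B + P0) * (?d (q l) + E (q l) s)) ----> (5 * B + P0) * 0" using q by (rule tendsto_mult_left)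
  hence "abs X \<le> (5 * B + P0) * 0" by (rule LIMSEQ_le_const) (use bound in blast)
  thus ?thesis by (simp add: X_def)
qed

lemma H1_slices: "has_L2H1_gradient T \<Omega> (\<lambda>z. U z $ i) (\<lambda>z. g z $ i)"
proof -
  obtain q where q: "AE s in lborel. good_slice q s" by (rule AE_good_slice)
  have gi_sq: "(norm (v $ i))^2 \<le> (norm v)^2" for v :: "'a ^ 'n" by (intro power_mono norm_nth_le) simp
  have Ui_sq: "(norm (U z $ i))^2 \<le> 1" for z using power_mono[OF order_trans[OF component_le_norm_cart U_norm[of z]], of i 2] by simp
  have slice: "has_H1_gradient \<Omega> (\<lambda>x. U (s, x) $ i) (\<lambda>x. g (s, x) $ i)"
	if s: "0 < s" "s \<le> T" and good: "good_slice q s" for s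
  proof -
	note [measurable] = domain(4)
	show ?thesis unfolding has_H1_gradient_def
	proof (intro conjI allI impI ballI)
	  have iU: "integrable lborel (\<lambda>x. (norm (U (s, x) $ i))^2)"
	  proof (rule integrable_bound)
		show "integrable lborel (\<lambda>x. indicator \<Omega> x :: real)" using domain by (intro integrable_indicator_bounded)
		show "AE x in lborel. norm ((norm (U (s, x) $ i))^2) \<le> norm (indicator \<Omega> x :: real)"
		proof (rule AE_I2)
		  fix x show "norm ((norm (U (s, x) $ i))^2) \<le> norm (indicator \<Omega> x :: real)"
			using Ui_sq[of "(s, x)"] U_out[of "(s, x)"] by (cases "x \<in> \<Omega>") auto
		qed
	  qed measurable
	  show "in_L2 \<Omega> (\<lambda>x. U (s, x) $ i)" by (rule in_L2_borel[OF domain(4) _ iU]) measurable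
	  have "integrable lborel (\<lambda>x. (norm (g (s, x)))^2)" using good by (simp add: good_slice_def)
	  hence "integrable lborel (\<lambda>x. (norm (g (s, x) $ i))^2)" by (rule integrable_bound) (auto intro!: AE_I2 simp: gi_sq)
	  thus "in_L2 \<Omega> (\<lambda>x. g (s, x) $ i)" by (rule in_L2_borel[OF domain(4), rotated]) measurable
	  fix \<phi> :: "'a => real" and e :: 'a assume \<phi>: "test_function \<Omega> \<phi>" and e: "e \<in> Basis"
	  obtain C where sm: "smooth \<phi>" and C: "compact C" "C \<subseteq> \<Omega>" "\<And>x. x \<in> \<Omega> - C ==> \<phi> x = 0"
		using \<phi> unfolding test_function_def by blast
	  define \<psi> where "\<psi> x = (if x \<in> \<Omega> then \<phi> x else 0)" for x
	  let ?d = "\<lambda>x. if x \<in> \<Omega> then partial_deriv e \<phi> x else 0"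
	  let ?A = "\<integral>x. U (s, x) $ i * partial_deriv e \<phi> x \<partial>lebesgue_on \<Omega>" and ?B = "\<integral>x. (g (s, x) $ i \<bullet> e) * \<phi> x \<partial>lebesgue_on \<Omega>"
	  obtain B where B: "space_test \<Omega> \<psi> ?d e B C" using zero_extension[OF sm domain(1) C e] unfolding \<psi>_def by blast
	  note [measurable] = smooth_measurable[OF sm] smooth_measurable[OF smooth_partial_deriv[OF sm e]]
	  have "?A = (LBINT x. indicator \<Omega> x * (U (s, x) $ i * partial_deriv e \<phi> x))"
		by (rule integral_lebesgue_on_borel[OF domain(4)]) measurable
	  also have "... = (LBINT x. U (s, x) $ i * ?d x)" by (rule integral_cong) (auto simp: indicator_def)
	  finally have 1: "?A = ..." .
	  have "?B = (LBINT x. indicator \<Omega> x * ((g (s, x) $ i \<bullet> e) * \<phi> x))"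
		by (rule integral_lebesgue_on_borel[OF domain(4)]) measurable
	  also have "... = (LBINT x. (g (s, x) $ i \<bullet> e) * \<psi> x)" by (rule integral_cong) (auto simp: indicator_def \<psi>_def)
	  finally have 2: "?B = ..." .
	  from weak_gradient_slice[OF s good B, of i]
	  show "?A = - ?B" unfolding 1 2 by linarith
	qed
  qed
  show ?thesis unfolding has_L2H1_gradient_def
  proof (intro conjI)
	have "integrable lborel (\<lambda>z. (norm (U z $ i))^2)"
	proof (rule integrable_bound[OF S_integrable])
	  show "AE z in lborel. norm ((norm (U z $ i))^2) \<le> norm (indicator S z :: real)"
	  proof (rule AE_I2)
		fix z show "norm ((norm (U z $ i))^2) \<le> norm (indicator S z :: real)" using Ui_sq[of z] U_out'[of z] by (cases "z \<in> S") simp_all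
	  qed
	qed measurable
	thus "in_L2 Q (\<lambda>z. U z $ i)" by (rule in_L2_borel[OF domain(7), rotated]) measurable
	have "integrable lborel (\<lambda>z. (norm (g z))^2)" using g_sq by (simp add: sq_integrable_def)
	hence "integrable lborel (\<lambda>z. (norm (g z $ i))^2)" by (rule integrable_bound) (auto intro!: AE_I2 simp: gi_sq)
	thus "in_L2 Q (\<lambda>z. g z $ i)" by (rule in_L2_borel[OF domain(7), rotated]) measurable
	show "AE s in lebesgue_on {0<..<T}. has_H1_gradient \<Omega> (\<lambda>x. U (s, x) $ i) (\<lambda>x. g (s, x) $ i)"
	proof (rule AE_lebesgue_onI)
	  show "AE s in lborel. s \<in> {0<..<T} \<longrightarrow> has_H1_gradient \<Omega> (\<lambda>x. U (s, x) $ i) (\<lambda>x. g (s, x) $ i)"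
		using q
	  proof eventually_elim
		case (elim s)
		thus ?case by (intro impI slice) auto
	  qed
	qed simp
  qed
qed

end

theorem theorem2p3:
  fixes \<Omega> :: "'a::euclidean_space set"
    and T astar \<zeta>star :: real
    and A :: "real ^ 'n ^ 'n"
    and M :: "nat \<Rightarrow> 'a mesh"
    and NT :: "nat \<Rightarrow> nat"
    and t :: "nat \<Rightarrow> nat \<Rightarrow> real"
    and U0 :: "'a \<Rightarrow> real ^ 'n"
    and V :: "nat \<Rightarrow> nat \<Rightarrow> 'a set \<Rightarrow> real ^ 'n"
  assumes "open \<Omega>" and "connected \<Omega>" and "bounded \<Omega>" and "\<Omega> \<noteq> {}"
    and "T > 0"
    and "CARD('n) \<ge> 2"
    and "transpose A = A"
    and "\<And>i j. A $ i $ j \<ge> 0"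
    and "astar > 0"
    and "astar \<ge> Min {A $ i $ j | i j. True}"
    and "Min {A $ i $ j | i j. i \<noteq> j} > 0"
    and "\<And>m. admissible_mesh \<Omega> (M m)"
    and "\<And>m. time_discretization T (NT m) (t m)"
    and "(\<lambda>m. mesh_size (M m)) \<longlonglongrightarrow> 0"
    and "(\<lambda>m. time_step (NT m) (t m)) \<longlonglongrightarrow> 0"
    and "\<zeta>star > 0"
    and "\<And>m. mesh_regularity (M m) \<ge> \<zeta>star"
    and "in_Linf_simplex \<Omega> U0"
    and "\<And>i. (\<integral>x. U0 x $ i \<partial>lebesgue_on \<Omega>) > 0"
    and "\<And>m. scheme_solution (M m) (NT m) (t m) A astar U0 (V m)"
    and "\<And>m n K. n \<in> {1..NT m} \<Longrightarrow> K \<in> cells (M m) \<Longrightarrow> V m n K \<in> unit_simplex"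
  shows "\<exists>U :: real \<times> 'a \<Rightarrow> real ^ 'n.
           in_Linf_simplex ({0<..<T} \<times> \<Omega>) U \<and>
           (\<forall>i. in_L2H1 T \<Omega> (\<lambda>z. U z $ i)) \<and>
           (\<exists>r :: nat \<Rightarrow> nat. strict_mono r \<and>
              (\<forall>p\<ge>1. tendsto_Lp p ({0<..<T} \<times> \<Omega>)
                 (\<lambda>m. approximate_solution (M (r m)) (NT (r m)) (t (r m)) (V (r m))) U)) \<and>
           weak_solution T \<Omega> A U0 U"
proof -
  define c where "c = min astar (Min {A $ i $ j | i j. i \<noteq> j})"
  have fin: "finite {A $ i $ j | i j. i \<noteq> j}" by (rule finite_subset[of _ "(\<lambda>(i, j). A $ i $ j) ` UNIV"]) auto
  have c: "0 < c" "c \<le> astar" "\<And>i j. i \<noteq> j ==> c \<le> A $ i $ j"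
  proof -
	show "0 < c" "c \<le> astar" using assms(9,11) by (auto simp: c_def)
	fix i j :: 'n assume "i \<noteq> j"
	hence "Min {A $ i $ j | i j. i \<noteq> j} \<le> A $ i $ j" using fin by (intro Min_le) auto
	thus "c \<le> A $ i $ j" by (simp add: c_def)
  qed
  have sym: "A $ i $ j = A $ j $ i" for i j using assms(7) by (metis transpose_def vec_lambda_beta)
  have sol: "fv_solution \<Omega> (M m) T (NT m) (t m) A astar U0 (V m) c" for m by unfold_locales (use assms sym c in auto)
  interpret fv_sequence \<Omega> M T NT t A astar U0 V c by (rule fv_sequence.intro) (rule sol assms(14,15))+
  obtain r U where r: "strict_mono (r :: nat => nat)" and U: "U \<in> borel_measurable borel"
	"AE z in lborel. (\<lambda>m. u (r m) z) ----> U z" "\<And>z. norm (U z) \<le> 1" "\<And>z. z \<notin> Q ==> U z = 0"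
	"AE z in lborel. z \<in> Q \<longrightarrow> U z \<in> unit_simplex" by (rule compactness) blast
  let ?Gd = "\<lambda>m. fv_solution.Gr (M m) (NT m) (t m) (V m)"
  have S: "bounded ({0<..T} \<times> \<Omega>)" "{0<..T} \<times> \<Omega> \<in> sets borel"
	using domain by (auto intro!: bounded_Times borel_Times)
  obtain N w g where g: "\<And>k. tail_weights k (N k) (w k)" "sq_integrable g" "\<And>z. z \<notin> {0<..T} \<times> \<Omega> ==> g z = 0"
	"(\<lambda>k. sq_norm (\<lambda>z. (\<Sum>m\<le>N k. w k m *R ?Gd (r m) z) - g z)) ----> 0"
  \<comment> \<open>Applied along the subsequence r, so that the convex combinations mix late
    members of a sequence along which u already converges.\<close>
  proof (rule Mazur_L2[OF fv_solution.Gr_sq[OF sol] S fv_solution.Gr_out[OF sol], of r])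
	fix N w g
	assume "\<And>k. tail_weights k (N k) (w k)" "sq_integrable g" "\<And>z. z \<notin> {0<..T} \<times> \<Omega> ==> g z = 0"
	  "(\<lambda>k. sq_norm (\<lambda>z. (\<Sum>m\<le>N k. w k m *R ?Gd (r m) z) - g z)) ----> 0"
	thus thesis by (rule that)
  qed
  interpret fv_limit \<Omega> M T NT t A astar U0 V c r U N w g
	by (rule fv_limit.intro[OF fv_sequence_axioms], rule fv_limit_axioms.intro) (fact r U g)+
  have simplex: "in_Linf_simplex Q U" unfolding in_Linf_simplex_def using borel_lebesgue_on[OF U(1)] AE_lebesgue_onI[OF domain(7) U(5)] by blast
  have approx: "approximate_solution (M m) (NT m) (t m) (V m) = u m" for m by (rule ext) (rule fv_solution.approximate_solution_eq[OF sol])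
  let ?F = "\<lambda>g i \<phi>. \<integral>(t, x). (SU j. A $ i $ j *R
				  (U (t, x) $ j *R g (t, x) $ i - U (t, x) $ i *R g (t, x) $ j))
				\<bullet> gradient (\<lambda>y. \<phi> (t, y)) x \<partial>lebesgue_on Q"
  let ?D = "\<lambda>i \<phi>. \<integral>(t, x). U (t, x) $ i * deriv (\<lambda>s. \<phi> (s, x)) t \<partial>lebesgue_on Q"
  have weak: "- ?D i \<phi>
		   - (\<integral>x. U0 x $ i * \<phi> (0, x) \<partial>lebesgue_on \<Omega>) + ?F g i \<phi> = 0"
	if \<phi>: "test_function ({0..<T} \<times> closure \<Omega>) \<phi>" for i \<phi>
  proof -
	obtain C where sm: "smooth \<phi>" and C: "compact C" "C \<subseteq> {0..<T} \<times> closure \<Omega>"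
	  "\<And>z. z \<in> {0..<T} \<times> closure \<Omega> - C ==> \<phi> z = 0"
	proof -
	  have "smooth \<phi>" "\<exists>C. compact C \<and> C \<subseteq> {0..<T} \<times> closure \<Omega> \<and> (\<forall>z\<in>{0..<T} \<times> closure \<Omega> - C. \<phi> z = 0)"
		using \<phi> unfolding test_function_def by (simp_all only:)
	  thus thesis using that by (elim exE conjE) (simp only: Ball_def)
	qed
	obtain R where "\<forall>x\<in>\<Omega>. norm x \<le> R" using domain(2) unfolding bounded_iff by blast
	hence R: "\<Omega> \<subseteq> cball 0 R" by auto
	let ?\<phi>t = "partial_deriv (1, 0) \<phi>" and ?\<gamma> = "\<lambda>z. gradient (\<lambda>y. \<phi> (fst z, y)) (snd z)"
	obtain B where tb: "test_bounds T R B \<phi> ?\<phi>t ?\<gamma>" using smooth_test_bounds[OF sm] by blast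
	then interpret test_bounds T R B \<phi> ?\<phi>t ?\<gamma> .
	note [measurable] = test_measurable
	\<comment> \<open>The test condition speaks of times below T only. As (T, x) lies outside the
	  compact set C, \<phi> vanishes at points (s, x) with s just below T, and by continuity at (T,
	  x).\<close>
	have final: "\<phi> (T, x) = 0" if x: "x \<in> \<Omega>" for x
	proof -
	  let ?z = "\<lambda>n. (T - T / real (Suc n), x)"
	  have "(\<lambda>n. T - T / real (Suc n)) ----> T - 0" using tendsto_mult_left[OF LIMSEQ_inverse_real_of_nat, of T]
		by (intro tendsto_diff tendsto_const) (simp add: divide_inverse)
	  hence z: "?z ----> (T, x)" by (intro tendsto_Pair tendsto_const) simp
	  have "open (- C)" using C(1) compact_imp_closed by blast
	  moreover have "(T, x) \<in> - C" using C(2) by auto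
	  ultimately have "\<forall>\<^sub>F n in sequentially. ?z n \<in> - C" by (rule topological_tendstoD[OF z])
	  hence "\<forall>\<^sub>F n in sequentially. \<phi> (?z n) = 0"
	  proof eventually_elim
		case (elim n)
		have "T / real (Suc n) \<le> T / 1" using domain(3) by (intro divide_left_mono) auto
		moreover have "0 < T / real (Suc n)" using domain(3) by simp
		moreover have "x \<in> closure \<Omega>" using x closure_subset by blast
		ultimately have "?z n \<in> {0..<T} \<times> closure \<Omega>" by simp
		thus ?case using elim C(3) by blast
	  qed
	  hence "(\<lambda>n. \<phi> (?z n)) ----> 0" by (rule tendsto_eventually)
	  moreover have "isCont \<phi> (T, x)" using smooth_continuous[OF sm, of UNIV] by (simp add: continuous_on_eq_continuous_at)
	  hence "(\<lambda>n. \<phi> (?z n)) ----> \<phi> (T, x)" by (rule isCont_tendsto_compose[OF _ z])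
	  ultimately show ?thesis by (rule LIMSEQ_unique[symmetric])
	qed
	let ?c = "\<lambda>z. cross_vec A (U z) (g z) i \<bullet> ?\<gamma> z"
	have d: "deriv (\<lambda>s. \<phi> (s, x)) t = ?\<phi>t (t, x)" for t x by (rule DERIV_imp_deriv) (rule slice_derivatives(1)[OF sm])
	have "?D i \<phi> = (\<integral>z. U z $ i * ?\<phi>t z \<partial>lebesgue_on Q)" unfolding d by (simp add: split_beta')
	also have "... = (LBINT z. indicator Q z * (U z $ i * ?\<phi>t z))" by (rule integral_lebesgue_on_borel[OF domain(7)]) measurable
	also have "... = (LBINT z. U z $ i * ?\<phi>t z)"
	proof (rule integral_cong)
	  fix z show "indicator Q z * (U z $ i * ?\<phi>t z) = U z $ i * ?\<phi>t z" using U(4)[of z] by (cases "z \<in> Q") simp_all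
	qed simp
	finally have 1: "?D i \<phi> = ..." .
	have "?F g i \<phi> = (\<integral>z. ?c z \<partial>lebesgue_on Q)" unfolding cross_vec_def by (simp add: split_beta')
	also have "... = (LBINT z. indicator Q z * (?c z))" by (rule integral_lebesgue_on_borel[OF domain(7)]) measurable
	also have "... = (LBINT z. ?c z)"
	proof (rule integral_cong)
	  fix z show "indicator Q z * (?c z) = ?c z" using U(4)[of z] by (cases "z \<in> Q") (simp_all add: cross_vec_def)
	qed simp
	finally have 2: "?F g i \<phi> = ..." .
	show ?thesis unfolding 1 2 by (rule weak_equation[OF tb R final])
  qed
  show ?thesis
  proof (intro exI[of _ U] conjI allI)
	show "in_Linf_simplex Q U" by (rule simplex)
	show "in_L2H1 T \<Omega> (\<lambda>z. U z $ i)" for i unfolding in_L2H1_def using H1_slices by blast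
	show "\<exists>r :: nat => nat. strict_mono r \<and> (\<forall>p\<ge>1. tendsto_Lp p Q
				 (\<lambda>m. approximate_solution (M (r m)) (NT (r m)) (t (r m)) (V (r m))) U)"
	  unfolding approx using r limit_Lp[OF U(1,2,3)] by blast
	show "weak_solution T \<Omega> A U0 U" unfolding weak_solution_def
	  by (intro conjI simplex exI[of _ "\<lambda>i z. g z $ i"] allI impI H1_slices weak)
  qed
qed

end
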